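(* Let $\Omega\subset\mathbb{R}^N$ ($N\ge 2$) be a smooth bounded domain. Let $\{u_n\}\subset W_0^{1,N}(\Omega)$ be a sequence such that $\int_\Omega F^N(\nabla u_n)\,dx=1$ and $u_n\rightharpoonup u\not\equiv 0$ weakly in $W_0^{1,N}(\Omega)$. Then for any $$0<p<p_N(u):=\Big(1-\int_\Omega F^N(\nabla u)\,dx\Big)^{-\frac1{N-1}},$$ we have $$\int_\Omega\frac{e^{\lambda_N(1-\frac{\beta}{N})\,p\,|u_n|^{\frac{N}{N-1}}}}{F^o(x)^\beta}\,dx<+\infty,$$ where $0\le\beta<N$, $\lambda_N=N^{\frac{N}{N-1}}\kappa_N^{\frac1{N-1}}$ and $\kappa_N$ is the volume of a unit Wulff ball. Moreover, this conclusion fails if $p\ge p_N(u)$.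
   Context: $F:\mathbb{R}^N\to[0,+\infty)$ is a convex function of class $C^2(\mathbb{R}^N\setminus\{0\})$, even and positively homogeneous of degree 1 (so $F(t\xi)=|t|F(\xi)$ for all $t\in\mathbb{R}$, $\xi\in\mathbb{R}^N$), with $F(\xi)>0$ for $\xi\ne0$, and the Hessian of $F^2$ is positive definite on $\mathbb{R}^N\setminus\{0\}$. $F^N(\nabla u)$ denotes $(F(\nabla u))^N$. The polar (dual) function of $F$ is $F^o(x):=\sup\{\langle x,\xi\rangle: F(\xi)\le 1\}=\sup_{\xi\neq0}\frac{\langle x,\xi\rangle}{F(\xi)}$. The unit Wulff ball is $\{x\in\mathbb{R}^N:F^o(x)\le1\}$, and $\kappa_N$ is its Lebesgue measure.
   Formalization: The failure for p ≥ p_N(u) is shown when 0 ∈ Ω or β = 0 (for β > 0 and 0 ∉ Ω it is false at p = p_N(u)), and as sharpness: for each value in (0,1) of the energy of u, some u_n and u have integrals unbounded in n for all such p; the first claim is uniform in n. *)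

theory Defs
  imports "HOL-Analysis.Analysis"
begin

section \<open>Functions of class \<open>C\<^sup>k\<close> and smooth bounded domains\<close>

text \<open>Intended for open \<open>S\<close>, so that the derivatives are unrestricted ones.\<close>

primrec Ck_on :: "nat \<Rightarrow> (real^'n \<Rightarrow> real) \<Rightarrow> (real^'n) set \<Rightarrow> bool" where
  "Ck_on 0 f S \<longleftrightarrow> continuous_on S f"
| "Ck_on (Suc k) f S \<longleftrightarrow> (\<forall>x\<in>S. f differentiable (at x)) \<and>
     (\<forall>i. Ck_on k (\<lambda>x. frechet_derivative f (at x) (axis i 1)) S)"

definition smooth_on :: "(real^'n \<Rightarrow> real) \<Rightarrow> (real^'n) set \<Rightarrow> bool" where
  "smooth_on f S \<longleftrightarrow> (\<forall>k. Ck_on k f S)"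

text \<open>The boundary is described locally by smooth defining functions with nonvanishing
  differential; \<open>\<Omega>\<close> lies on one side of it.\<close>

definition smooth_bounded_domain :: "(real^'n) set \<Rightarrow> bool" where
  "smooth_bounded_domain \<Omega> \<longleftrightarrow>
     open \<Omega> \<and> connected \<Omega> \<and> \<Omega> \<noteq> {} \<and> bounded \<Omega> \<and>
     (\<forall>x\<in>frontier \<Omega>. \<exists>U \<rho>. open U \<and> x \<in> U \<and> smooth_on \<rho> U \<and>
        (\<forall>y\<in>U. frechet_derivative \<rho> (at y) \<noteq> (\<lambda>v. 0)) \<and>
        \<Omega> \<inter> U = {y\<in>U. \<rho> y < 0})"

section \<open>Sobolev spaces\<close>

definition test_functions :: "(real^'n) set \<Rightarrow> (real^'n \<Rightarrow> real) set" where
  "test_functions \<Omega> = {\<phi>. smooth_on \<phi> UNIV \<and>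
     compact (closure {x. \<phi> x \<noteq> 0}) \<and> closure {x. \<phi> x \<noteq> 0} \<subseteq> \<Omega>}"

definition locally_integrable ::
    "(real^'n) set \<Rightarrow> (real^'n \<Rightarrow> 'b::{banach, second_countable_topology}) \<Rightarrow> bool" where
  "locally_integrable \<Omega> f \<longleftrightarrow>
     (\<forall>K. compact K \<and> K \<subseteq> \<Omega> \<longrightarrow> integrable (lebesgue_on K) f)"

definition has_weak_gradient ::
    "(real^'n) set \<Rightarrow> (real^'n \<Rightarrow> real) \<Rightarrow> (real^'n \<Rightarrow> real^'n) \<Rightarrow> bool" where
  "has_weak_gradient \<Omega> u g \<longleftrightarrow>
     locally_integrable \<Omega> u \<and> locally_integrable \<Omega> g \<and>
     (\<forall>\<phi>\<in>test_functions \<Omega>. \<forall>i.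
        (LINT x|lebesgue_on \<Omega>. u x * frechet_derivative \<phi> (at x) (axis i 1)) =
        - (LINT x|lebesgue_on \<Omega>. g x $ i * \<phi> x))"

text \<open>A weak gradient is unique up to a null subset of \<open>\<Omega>\<close>, so the choice below does not
  affect integrals over \<open>\<Omega>\<close>.\<close>

definition weak_grad :: "(real^'n) set \<Rightarrow> (real^'n \<Rightarrow> real) \<Rightarrow> real^'n \<Rightarrow> real^'n" where
  "weak_grad \<Omega> u = (SOME g. has_weak_gradient \<Omega> u g)"

definition Lp :: "(real^'n) set \<Rightarrow> real \<Rightarrow> (real^'n \<Rightarrow> 'b::real_normed_vector) set" where
  "Lp \<Omega> p = {f. f \<in> borel_measurable (lebesgue_on \<Omega>) \<and>
     integrable (lebesgue_on \<Omega>) (\<lambda>x. norm (f x) powr p)}"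

text \<open>Elements of the Sobolev spaces are represented by functions rather than by classes
  modulo almost everywhere equality on \<open>\<Omega>\<close>; their values outside \<open>\<Omega>\<close> are irrelevant.\<close>

definition W1p :: "(real^'n) set \<Rightarrow> real \<Rightarrow> (real^'n \<Rightarrow> real) set" where
  "W1p \<Omega> p = {u \<in> Lp \<Omega> p. \<exists>g \<in> Lp \<Omega> p. has_weak_gradient \<Omega> u g}"

definition W1p_norm :: "(real^'n) set \<Rightarrow> real \<Rightarrow> (real^'n \<Rightarrow> real) \<Rightarrow> real" where
  "W1p_norm \<Omega> p u =
     ((LINT x|lebesgue_on \<Omega>. \<bar>u x\<bar> powr p) +
      (LINT x|lebesgue_on \<Omega>. norm (weak_grad \<Omega> u x) powr p)) powr (1 / p)"

definition W01p :: "(real^'n) set \<Rightarrow> real \<Rightarrow> (real^'n \<Rightarrow> real) set" where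
  "W01p \<Omega> p = {u \<in> W1p \<Omega> p. \<exists>\<phi>. (\<forall>k. \<phi> k \<in> test_functions \<Omega>) \<and>
     (\<lambda>k::nat. W1p_norm \<Omega> p (\<lambda>x. u x - \<phi> k x)) \<longlonglongrightarrow> 0}"

text \<open>Boundedness makes such a functional invariant under almost everywhere equality on
  \<open>\<Omega>\<close>.\<close>

definition W01p_dual :: "(real^'n) set \<Rightarrow> real \<Rightarrow> ((real^'n \<Rightarrow> real) \<Rightarrow> real) set" where
  "W01p_dual \<Omega> p = {l.
     (\<forall>u\<in>W01p \<Omega> p. \<forall>v\<in>W01p \<Omega> p. l (\<lambda>x. u x + v x) = l u + l v) \<and>
     (\<forall>c. \<forall>u\<in>W01p \<Omega> p. l (\<lambda>x. c * u x) = c * l u) \<and>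
     (\<exists>C. \<forall>u\<in>W01p \<Omega> p. \<bar>l u\<bar> \<le> C * W1p_norm \<Omega> p u)}"

definition weakly_converges_W01p ::
    "(real^'n) set \<Rightarrow> real \<Rightarrow> (nat \<Rightarrow> real^'n \<Rightarrow> real) \<Rightarrow> (real^'n \<Rightarrow> real) \<Rightarrow> bool" where
  "weakly_converges_W01p \<Omega> p us u \<longleftrightarrow>
     (\<forall>n. us n \<in> W01p \<Omega> p) \<and> u \<in> W01p \<Omega> p \<and>
     (\<forall>l\<in>W01p_dual \<Omega> p. (\<lambda>n. l (us n)) \<longlonglongrightarrow> l u)"

section \<open>The anisotropic setting\<close>

definition hessian_form :: "(real^'n \<Rightarrow> real) \<Rightarrow> real^'n \<Rightarrow> real^'n \<Rightarrow> real^'n \<Rightarrow> real" where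
  "hessian_form f x v w =
     frechet_derivative (\<lambda>y. frechet_derivative f (at y) v) (at x) w"

definition anisotropic_norm :: "(real^'n \<Rightarrow> real) \<Rightarrow> bool" where
  "anisotropic_norm F \<longleftrightarrow>
     (\<forall>\<xi>. 0 \<le> F \<xi>) \<and> convex_on UNIV F \<and> Ck_on 2 F (UNIV - {0}) \<and>
     (\<forall>t \<xi>. F (t *\<^sub>R \<xi>) = \<bar>t\<bar> * F \<xi>) \<and>
     (\<forall>\<xi>. \<xi> \<noteq> 0 \<longrightarrow> 0 < F \<xi>) \<and>
     (\<forall>\<xi> v. \<xi> \<noteq> 0 \<and> v \<noteq> 0 \<longrightarrow> 0 < hessian_form (\<lambda>\<eta>. (F \<eta>)\<^sup>2) \<xi> v v)"

definition polar :: "(real^'n \<Rightarrow> real) \<Rightarrow> real^'n \<Rightarrow> real" where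
  "polar F x = (SUP \<xi>\<in>{\<xi>. F \<xi> \<le> 1}. x \<bullet> \<xi>)"

definition wulff_volume :: "(real^'n \<Rightarrow> real) \<Rightarrow> real" where
  "wulff_volume F = measure lebesgue {x. polar F x \<le> 1}"

definition lambda_N :: "(real^'n \<Rightarrow> real) \<Rightarrow> real" where
  "lambda_N F = (let N = real CARD('n) in
     N powr (N / (N - 1)) * wulff_volume F powr (1 / (N - 1)))"

definition aniso_energy :: "(real^'n \<Rightarrow> real) \<Rightarrow> (real^'n) set \<Rightarrow> (real^'n \<Rightarrow> real) \<Rightarrow> real" where
  "aniso_energy F \<Omega> u = (LINT x|lebesgue_on \<Omega>. F (weak_grad \<Omega> u x) ^ CARD('n))"

text \<open>A weak limit of functions of energy 1 has energy at most 1; if it equals 1, the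
  negative power of 0 is read as \<open>\<infinity>\<close>.\<close>

definition p_crit :: "(real^'n \<Rightarrow> real) \<Rightarrow> (real^'n) set \<Rightarrow> (real^'n \<Rightarrow> real) \<Rightarrow> ereal" where
  "p_crit F \<Omega> u =
     (if aniso_energy F \<Omega> u < 1
      then ereal ((1 - aniso_energy F \<Omega> u) powr (- 1 / (real CARD('n) - 1)))
      else \<infinity>)"

text \<open>The integrand takes the value 0 at the origin if that lies in \<open>\<Omega>\<close>, a null set.\<close>

definition singular_TM_integral ::
    "(real^'n \<Rightarrow> real) \<Rightarrow> (real^'n) set \<Rightarrow> real \<Rightarrow> real \<Rightarrow> (real^'n \<Rightarrow> real) \<Rightarrow> ennreal" where
  "singular_TM_integral F \<Omega> \<beta> p u = (let N = real CARD('n) in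
     \<integral>\<^sup>+ x. ennreal (exp (lambda_N F * (1 - \<beta> / N) * p * \<bar>u x\<bar> powr (N / (N - 1)))
               / polar F x powr \<beta>) \<partial>lebesgue_on \<Omega>)"

definition admissible_sequence ::
    "(real^'n \<Rightarrow> real) \<Rightarrow> (real^'n) set \<Rightarrow> (nat \<Rightarrow> real^'n \<Rightarrow> real) \<Rightarrow> (real^'n \<Rightarrow> real) \<Rightarrow> bool" where
  "admissible_sequence F \<Omega> us u \<longleftrightarrow>
     (\<forall>n. aniso_energy F \<Omega> (us n) = 1) \<and>
     weakly_converges_W01p \<Omega> (real CARD('n)) us u \<and>
     \<not> (AE x in lebesgue_on \<Omega>. u x = 0)"

end

theory Submission
  imports Defs
begin

text \<open>
  Averaging \<open>\<phi> x = - \<integral> \<nabla>\<phi>(x + t z) \<bullet> z dt\<close> over rays with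
    \<open>z\<close> in the unit Wulff ball gives
  \<open>N \<kappa>\<^sub>N \<bar>u x\<bar> \<le> \<integral> F (\<nabla>u y) F\<^sup>o(x -
    y)\<^bsup>1-N\<^esup> dy\<close>, with the constant that is responsible for \<open>\<lambda>\<^sub>N\<close>;
  no rearrangement is needed. Split this integral at the distances \<open>\<delta> < \<rho>\<close>. The part
    near \<open>x\<close> is at most
  \<open>\<delta>\<^sup>s I x\<close> with \<open>I\<close> a potential of order below 1 that lies in
    \<open>L\<^sup>N\<close>; by Hoelder the middle part is at most
  \<open>(N \<kappa>\<^sub>N ln (\<rho> / \<delta>))\<^bsup>1-1/N\<^esup> E\<^bsup>1/N\<^esup>\<close>, where
    \<open>E\<close> is the energy in the Wulff ball of radius \<open>\<rho>\<close> about \<open>x\<close>;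
  the far part is bounded. Taking \<open>\<delta>\<close> as a power of \<open>1 + I x\<close> bounds the
    exponential by a power of
  \<open>1 + I x\<close> that is small enough as soon as \<open>p\<^bsup>N-1\<^esup> E < 1\<close>. Weak
    lower semicontinuity of the energy on the
  complements of finitely many small balls shows that \<open>E\<close> may be taken arbitrarily close to
  \<open>1 - \<integral> F\<^sup>N(\<nabla>u)\<close>, uniformly in \<open>x\<close> and in large \<open>n\<close>.

  For the failure at and above the critical exponent, add to a test function \<open>u\<close> of energy
    \<open>\<theta>\<close>, equal to a
  constant \<open>A > 0\<close> near the singular point, smoothed Moser functions of energy \<open>1 -
    \<theta>\<close> whose gradients live
  on disjoint annuli shrinking to that point.
\<close>

section \<open>Smooth functions\<close>

text \<open>The kernel of order \<open>1 - N\<close> is critical: its power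
  \<open>N / (N - 1)\<close> is \<open>P powr - N\<close>, whose integral over an annulus is
  \<open>N * unit_vol P * ln (R / r)\<close>. The exponential turns this logarithm into a power, and
  the logarithm is multiplied only by the energy in a small ball. The condition
  \<open>p * E powr (1 / (N - 1)) < 1\<close> leaves room for an exponent
  \<open>q < N - \<beta>\<close>, and then \<open>(1 + I) powr q\<close> times
  \<open>P powr - \<beta>\<close> is integrable for \<open>I\<close> in L^N. If the limit has energy
  at least 1, \<open>E\<close> may be any small positive number, in agreement with
  \<open>p_crit\<close> being infinite. The estimate holds for large \<open>n\<close> only, while
  the supremum runs over all \<open>n\<close>; the remaining terms need an argument of their own.

  For the failure, the place of concentration matters: at the origin the weight lowers the threshold
  by the factor \<open>1 - \<beta> / N\<close>, whereas near any other point the weight is bounded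
  and the threshold would be larger when \<open>\<beta> > 0\<close>. Hence concentration takes place
  at a point \<open>x0\<close> with \<open>x0 = 0\<close> or \<open>\<beta> = 0\<close>.\<close>

definition gradient :: "(real^'n \<Rightarrow> real) \<Rightarrow> real^'n \<Rightarrow> real^'n" where
  "gradient f x = (\<chi> i. frechet_derivative f (at x) (axis i 1))"

lemma gradient_eqI:
  assumes "(f has_derivative (\<lambda>h. g \<bullet> h)) (at x)"
  shows "gradient f x = g"
proof -
  have "frechet_derivative f (at x) = (\<lambda>h. g \<bullet> h)"
    using frechet_derivative_at[OF assms] by simp
  then show ?thesis
    by (simp add: gradient_def vec_eq_iff inner_axis)
qed

lemma has_derivative_gradient:
  assumes "f differentiable (at x)"
  shows "(f has_derivative (\<lambda>h. gradient f x \<bullet> h)) (at x)"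
proof -
  let ?D = "frechet_derivative f (at x)"
  have D: "(f has_derivative ?D) (at x)"
    using assms frechet_derivative_works by blast
  then have lin: "linear ?D"
    using has_derivative_linear by blast
  have "?D h = gradient f x \<bullet> h" for h
  proof -
    have "h = (\<Sum>i\<in>UNIV. h $ i *\<^sub>R axis i 1)"
      using basis_expansion[of h] by (simp add: scalar_mult_eq_scaleR)
    then have "?D h = ?D (\<Sum>i\<in>UNIV. h $ i *\<^sub>R axis i 1)" by simp
    also have "\<dots> = (\<Sum>i\<in>UNIV. h $ i *\<^sub>R ?D (axis i 1))"
      by (simp add: linear_sum[OF lin] linear_scale[OF lin])
    finally have "?D h = (\<Sum>i\<in>UNIV. h $ i *\<^sub>R ?D (axis i 1))" .
    then show ?thesis
      by (simp only: gradient_def inner_vec_def vec_lambda_beta real_scaleR_def inner_real_def mult.commute)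
  qed
  then show ?thesis using D by presburger
qed

lemma frechet_axis_eq_gradient:
  "frechet_derivative f (at x) (axis i 1) = gradient f x $ i"
  by (simp add: gradient_def)

lemma Ck_on_Suc_iff:
  "Ck_on (Suc k) f S \<longleftrightarrow> (\<forall>x\<in>S. f differentiable (at x)) \<and> (\<forall>i.
    Ck_on k (\<lambda>x. gradient f x $ i) S)"
  by (simp add: gradient_def)

declare Ck_on.simps(2)[simp del]

lemma gradient_cong:
  assumes "open S" "\<And>x. x \<in> S \<Longrightarrow> f x = g x" "x \<in> S"
  shows "gradient f x = gradient g x"
proof -
  have "(f has_derivative D) (at x) \<longleftrightarrow> (g has_derivative D) (at x)" for D
    using assms has_derivative_transform_within_open[of f D x UNIV S g]
      has_derivative_transform_within_open[of g D x UNIV S f]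
    by (metis)
  then show ?thesis
    by (simp add: gradient_def frechet_derivative_def)
qed

text \<open>On an open set derivatives depend only on nearby values, so the two gradients agree as
  well and the induction passes to their components.\<close>

lemma Ck_on_cong:
  assumes "open S" "\<And>x. x \<in> S \<Longrightarrow> f x = g x" "Ck_on k f S"
  shows "Ck_on k g S"
  using assms(2,3)
proof (induction k arbitrary: f g)
  case 0 then show ?case by (simp cong: continuous_on_cong)
next
  case (Suc k)
  have "g differentiable (at x)" if "x \<in> S" for x
  proof -
    have "f differentiable (at x)" using Suc.prems that by (auto simp: Ck_on_Suc_iff)
    then obtain D where "(f has_derivative D) (at x)" by (auto simp: differentiable_def)
    then have "(g has_derivative D) (at x)"
      using has_derivative_transform_within_open[of f D x UNIV S g] assms(1) that Suc.prems by auto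
    then show ?thesis by (auto simp: differentiable_def)
  qed
  moreover have "Ck_on k (\<lambda>x. gradient g x $ i) S" for i
    by (rule Suc.IH[of "\<lambda>x. gradient f x $ i"])
      (use Suc.prems gradient_cong[OF assms(1), of f g] in \<open>auto simp: Ck_on_Suc_iff\<close>)
  ultimately show ?case by (simp add: Ck_on_Suc_iff)
qed

text \<open>Reduces regularity to an explicitly exhibited gradient field, so that the Frechet
  derivative, a choice term, never has to be computed.\<close>

lemma Ck_on_SucI:
  assumes "open S" "\<And>x. x \<in> S \<Longrightarrow> (f has_derivative (\<lambda>h. g x \<bullet> h)) (at x)"
    "\<And>i. Ck_on k (\<lambda>x. g x $ i) S"
  shows "Ck_on (Suc k) f S"
  unfolding Ck_on_Suc_iff
proof (intro conjI ballI allI)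
  fix x assume "x \<in> S" then show "f differentiable (at x)"
    using assms(2) differentiableI by blast
next
  fix i show "Ck_on k (\<lambda>x. gradient f x $ i) S"
    by (rule Ck_on_cong[OF assms(1) _ assms(3)[of i]]) (simp add: gradient_eqI[OF assms(2)])
qed

lemma Ck_on_SucD: "Ck_on (Suc k) f S \<Longrightarrow> Ck_on k f S"
proof (induction k arbitrary: f)
  case 0 then show ?case
    by (auto simp: Ck_on_Suc_iff intro!: continuous_at_imp_continuous_on differentiable_imp_continuous_within)
next
  case (Suc k) then show ?case by (auto simp: Ck_on_Suc_iff)
qed

text \<open>Every level of the recursion is a pointwise condition. This serves the Moser function,
  whose smoothness is checked separately near its centre and away from it.\<close>

lemma Ck_on_locally:
  assumes "\<And>x. x \<in> S \<Longrightarrow> \<exists>U. open U \<and> x \<in> U \<and> Ck_on k f U"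
  shows "Ck_on k f S"
  using assms
proof (induction k arbitrary: f)
  case 0
  then show ?case
    by (metis Ck_on.simps(1) continuous_at_imp_continuous_on continuous_on_eq_continuous_at)
next
  case (Suc k)
  have "f differentiable (at x)" if "x \<in> S" for x
    using Suc.prems[OF that] by (auto simp: Ck_on_Suc_iff)
  moreover have "Ck_on k (\<lambda>x. gradient f x $ i) S" for i
  proof (rule Suc.IH)
    fix x assume "x \<in> S"
    then obtain U where "open U" "x \<in> U" "Ck_on (Suc k) f U" using Suc.prems by blast
    then show "\<exists>U. open U \<and> x \<in> U \<and> Ck_on k (\<lambda>x. gradient f x $ i) U"
      unfolding Ck_on_Suc_iff by blast
  qed
  ultimately show ?case by (simp add: Ck_on_Suc_iff)
qed

section \<open>Closure of \<open>Ck_on\<close> under algebraic operations and composition\<close>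

lemma Ck_on_const: "open S \<Longrightarrow> Ck_on k (\<lambda>x. c) S"
proof (induction k arbitrary: c)
  case (Suc k)
  show ?case by (rule Ck_on_SucI[where g="\<lambda>_. 0"]) (use Suc in auto)
qed simp

lemma Ck_on_inner: "open S \<Longrightarrow> Ck_on k (\<lambda>x. x \<bullet> v) S"
proof (cases k)
  case (Suc j)
  assume "open S"
  then show ?thesis unfolding Suc
    by (intro Ck_on_SucI[where g="\<lambda>_. v"])
      (auto intro!: derivative_eq_intros Ck_on_const simp: inner_commute)
qed (auto intro!: continuous_intros)

lemma Ck_on_add:
  "open S \<Longrightarrow> Ck_on k f S \<Longrightarrow> Ck_on k g S \<Longrightarrow> Ck_on k (\<lambda>x.
    f x + g x) S"
proof (induction k arbitrary: f g)
  case (Suc k)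
  show ?case
    by (rule Ck_on_SucI[where g="\<lambda>x. gradient f x + gradient g x"])
     (use Suc in \<open>auto simp: Ck_on_Suc_iff inner_add_left intro!: has_derivative_add
       has_derivative_gradient\<close>)
qed (auto intro: continuous_intros)

lemma Ck_on_mult:
  "open S \<Longrightarrow> Ck_on k f S \<Longrightarrow> Ck_on k g S \<Longrightarrow> Ck_on k (\<lambda>x.
    f x * g x) S"
proof (induction k arbitrary: f g)
  case (Suc k)
  show ?case
  proof (rule Ck_on_SucI[where g="\<lambda>x. f x *\<^sub>R gradient g x + g x *\<^sub>R gradient f x"])
    fix x assume "x \<in> S"
    then have "f differentiable (at x)" "g differentiable (at x)"
      using Suc.prems by (auto simp: Ck_on_Suc_iff)
    from has_derivative_mult[OF this[THEN has_derivative_gradient]]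
    show "((\<lambda>x. f x * g x) has_derivative (\<lambda>h. (f x *\<^sub>R gradient g x + g x *\<^sub>R
      gradient f x) \<bullet> h)) (at x)"
      by (simp add: inner_add_left algebra_simps)
  next
    fix i
    have "Ck_on k f S" "Ck_on k g S" using Suc.prems Ck_on_SucD by blast+
    moreover have "Ck_on k (\<lambda>x. gradient f x $ i) S" "Ck_on k (\<lambda>x. gradient g x $ i) S"
      using Suc.prems by (auto simp: Ck_on_Suc_iff)
    ultimately show "Ck_on k (\<lambda>x. (f x *\<^sub>R gradient g x + g x *\<^sub>R gradient f x) $ i) S"
      using Suc.IH Suc.prems(1) by (simp add: Ck_on_add)
  qed (use Suc in auto)
qed (auto intro: continuous_intros)

lemma Ck_on_sum:
  assumes "open S" "\<And>i. i \<in> I \<Longrightarrow> Ck_on k (f i) S"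
  shows "Ck_on k (\<lambda>x. \<Sum>i\<in>I. f i x) S"
  using assms(2) by (induction I rule: infinite_finite_induct) (auto intro!: Ck_on_add Ck_on_const assms(1))

lemma Ck_on_prod:
  assumes "open S" "\<And>i. i \<in> I \<Longrightarrow> Ck_on k (f i) S"
  shows "Ck_on k (\<lambda>x. \<Prod>i\<in>I. f i x) S"
  using assms(2) by (induction I rule: infinite_finite_induct) (auto intro!: Ck_on_mult Ck_on_const assms(1))

lemma Ck_on_power:
  assumes "open S" "Ck_on k f S"
  shows "Ck_on k (\<lambda>x. f x ^ m) S"
  by (induction m) (auto intro!: Ck_on_mult Ck_on_const assms)

lemma has_derivative_gradient_compose:
  assumes "f differentiable (at x)" "(g has_real_derivative d) (at (f x))"
  shows "((\<lambda>x. g (f x)) has_derivative (\<lambda>h. (d *\<^sub>R gradient f x) \<bullet> h)) (at x)"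
proof -
  have "(g has_derivative (\<lambda>h. d * h)) (at (f x))"
    using assms(2) by (simp add: has_field_derivative_def)
  from has_derivative_compose[OF has_derivative_gradient[OF assms(1)] this]
  show ?thesis by simp
qed

text \<open>The outer function comes with its whole chain of derivatives \<open>G j\<close>;
  generalising over \<open>j\<close> closes the induction, because the gradient involves
  \<open>G (Suc j)\<close> at the same argument.\<close>

lemma Ck_on_compose:
  assumes S: "open S" and G: "\<And>j x. x \<in> S \<Longrightarrow> (G j has_real_derivative G (Suc j) (f
    x)) (at (f x))"
    and f: "Ck_on k f S"
  shows "Ck_on k (\<lambda>x. G j (f x)) S"
  using f
proof (induction k arbitrary: j)
  case 0
  then show ?case
    using G[THEN DERIV_isCont] by (auto intro!: continuous_at_imp_continuous_on continuous_at_compose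
      simp: continuous_on_eq_continuous_at[OF S] isCont_o2)
next
  case (Suc k)
  show ?case
  proof (rule Ck_on_SucI[where g="\<lambda>x. G (Suc j) (f x) *\<^sub>R gradient f x"])
    fix x assume "x \<in> S"
    then show "((\<lambda>x. G j (f x)) has_derivative (\<lambda>h. (G (Suc j) (f x) *\<^sub>R gradient f x)
      \<bullet> h)) (at x)"
      using G Suc.prems by (intro has_derivative_gradient_compose) (auto simp: Ck_on_Suc_iff)
  next
    fix i show "Ck_on k (\<lambda>x. (G (Suc j) (f x) *\<^sub>R gradient f x) $ i) S"
      using Suc.prems Suc.IH[OF Ck_on_SucD[OF Suc.prems], of "Suc j"]
      by (auto intro!: Ck_on_mult S simp: Ck_on_Suc_iff)
  qed (rule S)
qed

text \<open>The derivative of the reciprocal is a polynomial in the reciprocal itself, so products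
  and the induction hypothesis suffice.\<close>

lemma Ck_on_inverse:
  assumes S: "open S" and nz: "\<And>x. x \<in> S \<Longrightarrow> f x \<noteq> 0" and f: "Ck_on k f S"
  shows "Ck_on k (\<lambda>x. inverse (f x)) S"
  using f
proof (induction k)
  case 0 then show ?case using nz by (auto intro!: continuous_intros)
next
  case (Suc k)
  have IH: "Ck_on k (\<lambda>x. inverse (f x)) S" using Suc Ck_on_SucD by blast
  show ?case
  proof (rule Ck_on_SucI[where g="\<lambda>x. (- (inverse (f x) * inverse (f x))) *\<^sub>R gradient f x"])
    fix x assume x: "x \<in> S"
    show "((\<lambda>x. inverse (f x)) has_derivative (\<lambda>h. ((- (inverse (f x) * inverse (f x)))
      *\<^sub>R gradient f x) \<bullet> h)) (at x)"
      by (rule has_derivative_gradient_compose)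
       (use x nz Suc.prems in \<open>auto simp: Ck_on_Suc_iff power2_eq_square intro!: derivative_eq_intros\<close>)
  next
    fix i
    have "Ck_on k (\<lambda>x. (-1) * (inverse (f x) * inverse (f x) * gradient f x $ i)) S"
      by (intro Ck_on_mult S Ck_on_const IH) (use Suc.prems in \<open>auto simp: Ck_on_Suc_iff\<close>)
    then show "Ck_on k (\<lambda>x. ((- (inverse (f x) * inverse (f x))) *\<^sub>R gradient f x) $ i) S"
      by (simp add: mult.assoc)
  qed (rule S)
qed

lemma Ck_on_ln:
  assumes S: "open S" and nz: "\<And>x. x \<in> S \<Longrightarrow> f x > 0" and f: "Ck_on k f S"
  shows "Ck_on k (\<lambda>x. ln (f x)) S"
proof (cases k)
  case 0
  then show ?thesis using nz f by (auto intro!: continuous_intros simp: less_imp_neq[THEN not_sym])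
next
  case (Suc j)
  show ?thesis unfolding Suc
  proof (rule Ck_on_SucI[where g="\<lambda>x. inverse (f x) *\<^sub>R gradient f x"])
    fix x assume x: "x \<in> S"
    show "((\<lambda>x. ln (f x)) has_derivative (\<lambda>h. (inverse (f x) *\<^sub>R gradient f x)
      \<bullet> h)) (at x)"
      by (rule has_derivative_gradient_compose)
       (use x nz f Suc in \<open>auto simp: Ck_on_Suc_iff inverse_eq_divide intro!: derivative_eq_intros\<close>)
  next
    fix i
    have "Ck_on j f S" using f Suc Ck_on_SucD by blast
    then show "Ck_on j (\<lambda>x. (inverse (f x) *\<^sub>R gradient f x) $ i) S"
      using f Suc nz by (auto intro!: Ck_on_mult S Ck_on_inverse simp: Ck_on_Suc_iff less_imp_neq[THEN not_sym])
  qed (rule S)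
qed

section \<open>The flat function and bump functions\<close>

text \<open>For a polynomial \<open>P\<close>, the derivative of \<open>P(1/t) exp(-1/t)\<close> is
  \<open>(1/t)^2 (P - P')(1/t) exp(-1/t)\<close>; the recursion iterates this map, with
  \<open>[:0,0,1:]\<close> the square of the indeterminate.\<close>

definition flat_poly :: "nat \<Rightarrow> real poly" where
  "flat_poly j = ((\<lambda>P. [:0,0,1:] * (P - pderiv P)) ^^ j) 1"

definition flat_deriv :: "nat \<Rightarrow> real \<Rightarrow> real" where
  "flat_deriv j t = (if t \<le> 0 then 0 else poly (flat_poly j) (1/t) * exp (- (1/t)))"

abbreviation "flat \<equiv> flat_deriv 0"

lemma flat_def: "flat t = (if t \<le> 0 then 0 else exp (- (1/t)))"
  by (simp add: flat_deriv_def flat_poly_def)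

lemma poly_times_exp_neg_tendsto_0:
  "((\<lambda>x. poly P x * exp (- x)) \<longlongrightarrow> 0) (at_top :: real filter)"
proof -
  have "((\<lambda>x. \<Sum>i\<le>degree P. coeff P i * (x ^ i / exp x)) \<longlongrightarrow>
    (\<Sum>i\<le>degree P. coeff P i * 0)) at_top"
    by (intro tendsto_intros tendsto_power_div_exp_0)
  moreover have "poly P x * exp (- x) = (\<Sum>i\<le>degree P. coeff P i * (x ^ i / exp x))" for x
    by (simp add: poly_altdef sum_distrib_right exp_minus divide_inverse mult.assoc)
  ultimately show ?thesis by simp
qed

text \<open>Only the point 0 needs an argument: with \<open>x = 1 / t\<close>, the difference
  quotient from the right becomes a polynomial times \<open>exp (- x)\<close> at infinity.\<close>

lemma flat_deriv_has_derivative: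
  "(flat_deriv j has_real_derivative flat_deriv (Suc j) t) (at t)"
proof -
  consider "t < 0" | "t > 0" | "t = 0" by linarith
  then show ?thesis
  proof cases
    case 1
    have "((\<lambda>_. 0) has_real_derivative 0) (at t)" by simp
    then have "(flat_deriv j has_real_derivative 0) (at t)"
      by (rule has_field_derivative_transform_within_open[where S="{..<0}"])
        (use 1 in \<open>auto simp: flat_deriv_def\<close>)
    then show ?thesis using 1 by (simp add: flat_deriv_def)
  next
    case 2
    have "((\<lambda>t. poly (flat_poly j) (1/t) * exp (- (1/t))) has_real_derivative
       poly (flat_poly (Suc j)) (1/t) * exp (- (1/t))) (at t)"
      using 2 by (auto intro!: derivative_eq_intros simp: flat_poly_def field_simps power2_eq_square)
    then have "(flat_deriv j has_real_derivative poly (flat_poly (Suc j)) (1/t) * exp (- (1/t))) (at t)"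
      by (rule has_field_derivative_transform_within_open[where S="{0<..}"])
        (use 2 in \<open>auto simp: flat_deriv_def\<close>)
    then show ?thesis using 2 by (simp add: flat_deriv_def)
  next
    case 3
    have "((\<lambda>h. flat_deriv j h / h) \<longlongrightarrow> 0) (at 0)"
    proof (rule filterlim_split_at)
      have "\<forall>\<^sub>F h in at_left 0. 0 = flat_deriv j h / h"
        by (auto simp: flat_deriv_def eventually_at_filter)
      then show "((\<lambda>h. flat_deriv j h / h) \<longlongrightarrow> 0) (at_left 0)"
        by (rule Lim_transform_eventually[OF tendsto_const])
      \<comment> \<open>The extra factor \<open>[:0,1:]\<close> is the \<open>1 / h\<close> of the
        difference quotient.\<close>
      have "((\<lambda>h. poly ([:0,1:] * flat_poly j) (inverse h) * exp (- inverse h)) \<longlongrightarrow>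
        0) (at_right 0)"
        by (rule filterlim_compose[OF poly_times_exp_neg_tendsto_0 filterlim_inverse_at_top_right])
      then show "((\<lambda>h. flat_deriv j h / h) \<longlongrightarrow> 0) (at_right 0)"
        by (rule Lim_transform_eventually)
          (auto simp: flat_deriv_def eventually_at_filter field_simps)
    qed
    then show ?thesis using 3 by (simp add: has_field_derivative_iff flat_deriv_def)
  qed
qed

lemma Ck_on_flat: "open S \<Longrightarrow> Ck_on k f S \<Longrightarrow> Ck_on k (\<lambda>x. flat (f x)) S"
  by (rule Ck_on_compose[where G=flat_deriv]) (auto intro: flat_deriv_has_derivative)

lemma flat_nonneg: "0 \<le> flat t" and flat_le_1: "flat t \<le> 1"
  by (auto simp: flat_def)

lemma flat_eq_0_iff: "flat t = 0 \<longleftrightarrow> t \<le> 0"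
  by (auto simp: flat_def)

lemma continuous_on_flat: "continuous_on S flat"
  using flat_deriv_has_derivative[THEN DERIV_isCont] by (auto intro: continuous_at_imp_continuous_on)

text \<open>The argument \<open>k * t\<close> tends to infinity for \<open>t > 0\<close> and stays
  nonpositive otherwise. In this way indicators of boxes become limits of test functions.\<close>

lemma flat_tendsto_indicator: "(\<lambda>k. flat (real k * t)) \<longlonglongrightarrow> indicator {0<..} t"
proof (cases "t > 0")
  case True
  have "(\<lambda>k. exp (- (1 / t * inverse (real k)))) \<longlonglongrightarrow> exp (- (1 / t * 0))"
    by (intro tendsto_intros lim_inverse_n)
  then have "(\<lambda>k. exp (- (1 / (real k * t)))) \<longlonglongrightarrow> 1"
    by (simp add: field_simps)
  then have "(\<lambda>k. flat (real k * t)) \<longlonglongrightarrow> 1"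
    by (rule Lim_transform_eventually)
      (use True in \<open>auto intro!: eventually_sequentiallyI[of 1] simp: flat_def mult_le_0_iff\<close>)
  then show ?thesis using True by simp
next
  case False
  then have "flat (real k * t) = 0" for k
    by (simp add: flat_eq_0_iff mult_nonneg_nonpos)
  then show ?thesis using False by simp
qed

definition box_bump :: "real^'n \<Rightarrow> real^'n \<Rightarrow> nat \<Rightarrow> real^'n \<Rightarrow>
  real" where
  "box_bump a b k x = (\<Prod>i\<in>UNIV. flat (real k * (x $ i - a $ i)) * flat (real k * (b $ i - x $ i)))"

lemma smooth_on_box_bump:
  fixes a b :: "real^'a"
  shows "smooth_on (box_bump a b k) UNIV"
proof -
  have comp: "Ck_on m (\<lambda>x::real^'a. x $ i) UNIV" for m i
    using Ck_on_inner[of UNIV m "axis i 1"] by (simp add: inner_axis)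
  have "Ck_on m (\<lambda>x. flat (real k * (x $ i + (- a $ i)))) UNIV"
    "Ck_on m (\<lambda>x. flat (real k * (b $ i + (-1) * x $ i))) UNIV" for m i
    by (intro Ck_on_flat Ck_on_mult Ck_on_const Ck_on_add comp open_UNIV)+
  then show ?thesis
    unfolding smooth_on_def box_bump_def
    by (intro allI Ck_on_prod Ck_on_mult) auto
qed

lemma box_bump_nonneg: "0 \<le> box_bump a b k x"
  unfolding box_bump_def by (intro prod_nonneg ballI mult_nonneg_nonneg flat_nonneg)

lemma box_bump_le_1: "box_bump a b k x \<le> 1"
  unfolding box_bump_def
  by (intro prod_le_1) (auto intro!: mult_le_one simp: flat_nonneg flat_le_1)

lemma box_bump_eq_0: "x \<notin> box a b \<Longrightarrow> box_bump a b k x = 0"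
  by (auto simp: box_bump_def mem_box_cart flat_eq_0_iff not_less intro!: mult_nonneg_nonpos)

lemma box_bump_tendsto: "(\<lambda>k. box_bump a b k x) \<longlonglongrightarrow> indicator (box a b) x"
proof -
  have "(\<lambda>k. box_bump a b k x) \<longlonglongrightarrow>
     (\<Prod>i\<in>UNIV. indicator {0<..} (x $ i - a $ i) * indicator {0<..} (b $ i - x $ i))"
    unfolding box_bump_def by (intro tendsto_intros flat_tendsto_indicator)
  also have "(\<Prod>i\<in>UNIV. indicator {0<..} (x $ i - a $ i) * indicator {0<..} (b $ i - x $ i)) =
     (indicator (box a b) x :: real)"
    by (cases "x \<in> box a b") (auto simp: mem_box_cart indicator_def)
  finally show ?thesis .
qed

lemma box_bump_test:
  assumes "cbox a b \<subseteq> \<Omega>"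
  shows "box_bump a b k \<in> test_functions \<Omega>"
proof -
  have "closure {x. box_bump a b k x \<noteq> 0} \<subseteq> cbox a b"
    by (rule closure_minimal) (use box_bump_eq_0 box_subset_cbox in blast)+
  then show ?thesis
    using assms smooth_on_box_bump bounded_subset[OF bounded_cbox]
    by (auto simp: test_functions_def compact_eq_bounded_closed)
qed

section \<open>Test functions and weak gradients\<close>

lemma continuous_compact_support:
  fixes f :: "'a::euclidean_space \<Rightarrow> 'b::euclidean_space"
  assumes "continuous_on UNIV f" "compact K" "\<And>x. x \<notin> K \<Longrightarrow> f x = 0"
  shows "integrable lborel f" "\<exists>B>0. \<forall>x. norm (f x) \<le> B"
proof -
  have "(\<lambda>x. indicator K x *\<^sub>R f x) = f"
    using assms(3) by (auto simp: fun_eq_iff indicator_def)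
  moreover have "integrable lborel (\<lambda>x. indicator K x *\<^sub>R f x)"
    using assms continuous_on_subset[OF assms(1), of K] by (intro borel_integrable_compact) auto
  ultimately show "integrable lborel f" by simp
  have "bounded (f ` K)"
    using assms by (intro compact_imp_bounded compact_continuous_image) (auto intro: continuous_on_subset)
  then obtain B where "B > 0" "\<And>x. x \<in> K \<Longrightarrow> norm (f x) \<le> B"
    unfolding bounded_pos by auto
  then show "\<exists>B>0. \<forall>x. norm (f x) \<le> B"
    using assms(3) by (metis less_imp_le norm_zero)
qed

lemma smooth_onD:
  assumes "smooth_on f UNIV"
  shows "f differentiable (at x)" "continuous_on UNIV f" "continuous_on UNIV (gradient f)"
    "smooth_on (\<lambda>x. gradient f x $ i) UNIV"
proof -
  have s: "Ck_on (Suc k) f UNIV" for k using assms by (auto simp: smooth_on_def)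
  show "f differentiable (at x)" using s[of 0] by (auto simp: Ck_on_Suc_iff)
  show "continuous_on UNIV f" using assms by (metis smooth_on_def Ck_on.simps(1))
  have "continuous_on UNIV (\<lambda>x. gradient f x $ i)" for i
    using s[of 0] by (auto simp: Ck_on_Suc_iff)
  then show "continuous_on UNIV (gradient f)"
    using continuous_on_vec_lambda[of UNIV "\<lambda>i x. gradient f x $ i"] by simp
  show "smooth_on (\<lambda>x. gradient f x $ i) UNIV" using s by (auto simp: smooth_on_def Ck_on_Suc_iff)
qed

lemma gradient_eq_0_outside:
  assumes "compact K" "\<And>x. x \<notin> K \<Longrightarrow> f x = 0" "x \<notin> K"
  shows "gradient f x = 0"
proof -
  have "gradient f x = gradient (\<lambda>_. 0) x"
    by (rule gradient_cong[of "-K"]) (use assms compact_imp_closed in auto)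
  then show ?thesis by (simp add: gradient_eqI[where g=0])
qed

section \<open>Calculus of test functions\<close>

lemma test_functionE:
  assumes "\<phi> \<in> test_functions \<Omega>"
  obtains K where "compact K" "K \<subseteq> \<Omega>" "\<And>x. x \<notin> K \<Longrightarrow> \<phi> x = 0"
    "\<And>x. x \<notin> K \<Longrightarrow> gradient \<phi> x = 0"
    "smooth_on \<phi> UNIV"
proof
  let ?K = "closure {x. \<phi> x \<noteq> 0}"
  show K: "compact ?K" "?K \<subseteq> \<Omega>" "smooth_on \<phi> UNIV" using assms by (auto simp:
    test_functions_def)
  show o: "\<phi> x = 0" if "x \<notin> ?K" for x
    using that closure_subset[of "{x. \<phi> x \<noteq> 0}"] by auto
  show "gradient \<phi> x = 0" if "x \<notin> ?K" for x
    using gradient_eq_0_outside[OF K(1) o that] .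
qed

lemma test_functionI:
  assumes "smooth_on \<phi> UNIV" "compact K" "K \<subseteq> \<Omega>" "\<And>x. x \<notin> K
    \<Longrightarrow> \<phi> x = 0"
  shows "\<phi> \<in> test_functions \<Omega>"
proof -
  have "closure {x. \<phi> x \<noteq> 0} \<subseteq> K"
    by (rule closure_minimal) (use assms compact_imp_closed in auto)
  then show ?thesis
    using assms(1,3) bounded_subset[OF compact_imp_bounded[OF assms(2)]]
    by (auto simp: test_functions_def compact_eq_bounded_closed)
qed

lemma test_function_partial:
  assumes "\<phi> \<in> test_functions \<Omega>"
  shows "(\<lambda>x. gradient \<phi> x $ i) \<in> test_functions \<Omega>"
proof -
  obtain K where "compact K" "K \<subseteq> \<Omega>" "\<And>x. x \<notin> K \<Longrightarrow> gradient
    \<phi> x = 0" "smooth_on \<phi> UNIV"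
    using test_functionE[OF assms] by metis
  then show ?thesis by (intro test_functionI[of _ K] smooth_onD(4)) auto
qed

lemma test_function_scale_add:
  assumes "\<phi> \<in> test_functions \<Omega>" "\<psi> \<in> test_functions \<Omega>"
  shows "(\<lambda>x. \<phi> x + c * \<psi> x) \<in> test_functions \<Omega>"
    "gradient (\<lambda>x. \<phi> x + c * \<psi> x) x = gradient \<phi> x + c *\<^sub>R gradient \<psi> x"
proof -
  obtain K L where K: "compact K" "K \<subseteq> \<Omega>" "\<And>x. x \<notin> K \<Longrightarrow> \<phi> x
    = 0" "smooth_on \<phi> UNIV"
    and L: "compact L" "L \<subseteq> \<Omega>" "\<And>x. x \<notin> L \<Longrightarrow> \<psi> x = 0"
      "smooth_on \<psi> UNIV"
    using test_functionE[OF assms(1)] test_functionE[OF assms(2)] by metis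
  have "smooth_on (\<lambda>x. \<phi> x + c * \<psi> x) UNIV"
    using K(4) L(4) by (auto simp: smooth_on_def intro!: Ck_on_add Ck_on_mult Ck_on_const)
  then show "(\<lambda>x. \<phi> x + c * \<psi> x) \<in> test_functions \<Omega>"
    by (rule test_functionI[of _ "K \<union> L"]) (use K L in auto)
  have "((\<lambda>x. \<phi> x + c * \<psi> x) has_derivative (\<lambda>h. gradient \<phi> x \<bullet> h + c
    * (gradient \<psi> x \<bullet> h))) (at x)"
    by (intro has_derivative_add has_derivative_mult_right has_derivative_gradient smooth_onD K L)
  then show "gradient (\<lambda>x. \<phi> x + c * \<psi> x) x = gradient \<phi> x + c *\<^sub>R gradient \<psi> x"
    by (intro gradient_eqI) (simp add: inner_add_left)
qed

section \<open>Integration by parts for test functions\<close>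

lemma lint_translation:
  fixes f :: "'a::euclidean_space \<Rightarrow> real"
  assumes [measurable]: "f \<in> borel_measurable borel"
  shows "(LINT x|lborel. f (c + x)) = (LINT x|lborel. f x)"
proof -
  have "(LINT x|lborel. f x) = (LINT x|distr lborel borel ((+) c). f x)"
    by (simp add: lborel_distr_plus)
  also have "\<dots> = (LINT x|lborel. f (c + x))"
    by (subst integral_distr) auto
  finally show ?thesis by simp
qed

lemma lipschitz_of_gradient_bound:
  assumes "\<And>x. f differentiable (at x)" "\<And>x. norm (gradient f x) \<le> B"
  shows "\<bar>f y - f x\<bar> \<le> B * norm (y - x)"
proof -
  have "norm (f y - f x) \<le> B * norm (y - x)"
  proof (rule differentiable_bound[of UNIV f "\<lambda>x h. gradient f x \<bullet> h"])
    show "\<And>x. (f has_derivative (\<bullet>) (gradient f x)) (at x within UNIV)"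
      using has_derivative_gradient[OF assms(1)] by simp
    show "onorm ((\<bullet>) (gradient f x)) \<le> B" for x
    proof (rule onorm_le)
      fix h
      have "\<bar>gradient f x \<bullet> h\<bar> \<le> norm (gradient f x) * norm h" by (rule Cauchy_Schwarz_ineq2)
      also have "\<dots> \<le> B * norm h" by (intro mult_right_mono assms) auto
      finally show "norm (gradient f x \<bullet> h) \<le> B * norm h" by simp
    qed
  qed auto
  then show ?thesis by simp
qed

text \<open>The difference quotients in direction \<open>i\<close> have integral 0 by translation
  invariance, and they converge dominatedly to the partial derivative.\<close>

lemma integral_partial_eq_0:
  fixes f :: "real^'n \<Rightarrow> real"
  assumes diff: "\<And>x. f differentiable (at x)" and cont: "continuous_on UNIV (gradient f)"
    and K: "compact K" and f0: "\<And>x. x \<notin> K \<Longrightarrow> f x = 0"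
  shows "(LINT x|lborel. gradient f x $ i) = 0"
proof -
  have g0: "gradient f x = 0" if "x \<notin> K" for x by (rule gradient_eq_0_outside[OF K f0 that])
  have contf: "continuous_on UNIV f"
    by (intro continuous_at_imp_continuous_on ballI differentiable_imp_continuous_within diff)
  then have [measurable]: "f \<in> borel_measurable borel"
    by (rule borel_measurable_continuous_onI)
  have [measurable]: "gradient f \<in> borel_measurable borel"
    by (rule borel_measurable_continuous_onI[OF cont])
  obtain B where B: "B > 0" "\<And>x. norm (gradient f x) \<le> B"
    using continuous_compact_support(2)[OF cont K g0] by blast
  obtain R where R: "\<And>x. x \<in> K \<Longrightarrow> norm x \<le> R"
    using compact_imp_bounded[OF K] by (auto simp: bounded_iff)
  let ?e = "axis i 1 :: real^'n"
  let ?D = "\<lambda>n x. real (Suc n) * (f ((1 / real (Suc n)) *\<^sub>R ?e + x) - f x)"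
  have "(\<lambda>n. LINT x|lborel. ?D n x) \<longlonglongrightarrow> (LINT x|lborel. gradient f x $ i)"
  proof (rule integral_dominated_convergence[where w="\<lambda>x. B * indicator (cball 0 (R + 1)) x"])
    show "(\<lambda>x. gradient f x $ i) \<in> borel_measurable lborel"
      using borel_measurable_continuous_onI[OF continuous_on_component[OF cont, of i]] by simp
    \<comment> \<open>The increments have length at most 1, so each quotient vanishes outside the
      ball of radius \<open>R + 1\<close>; inside it the Lipschitz constant \<open>B\<close> is a
      bound.\<close>
    show "integrable lborel (\<lambda>x::real^'n. B * indicator (cball 0 (R + 1)) x)"
      using emeasure_bounded_finite[OF bounded_cball[of "0::real^'n" "R+1"]]
      by (intro integrable_mult_right integrable_real_indicator) auto
    show "AE x in lborel. (\<lambda>n. ?D n x) \<longlonglongrightarrow> gradient f x $ i"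
    proof (rule AE_I2)
      fix x
      have 1: "((\<lambda>t::real. t *\<^sub>R ?e + x) has_derivative (\<lambda>t. t *\<^sub>R ?e)) (at 0)"
        by (auto intro!: derivative_eq_intros)
      have "(f has_derivative (\<bullet>) (gradient f x)) (at ((0::real) *\<^sub>R ?e + x))"
        using has_derivative_gradient[OF diff] by simp
      from has_derivative_compose[OF 1 this]
      have "((\<lambda>t. f (t *\<^sub>R ?e + x)) has_real_derivative gradient f x $ i) (at 0)"
        by (simp add: has_field_derivative_def inner_axis mult_commute_abs)
      then have "((\<lambda>h. (f (h *\<^sub>R ?e + x) - f x) / h) \<longlongrightarrow> gradient f x $ i) (at 0)"
        by (simp add: has_field_derivative_iff)
      moreover have "filterlim (\<lambda>n. 1 / real (Suc n)) (at 0) sequentially"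
        using LIMSEQ_Suc[OF lim_1_over_n[where ?'a=real]] by (simp add: filterlim_at del: of_nat_Suc)
      ultimately have "(\<lambda>n. (f ((1 / real (Suc n)) *\<^sub>R ?e + x) - f x) / (1 / real (Suc n)))
        \<longlonglongrightarrow> gradient f x $ i"
        by (rule filterlim_compose)
      then show "(\<lambda>n. ?D n x) \<longlonglongrightarrow> gradient f x $ i" by (simp add: mult.commute)
    qed
    fix n
    show "AE x in lborel. norm (?D n x) \<le> B * indicator (cball 0 (R + 1)) x"
    proof (rule AE_I2)
      fix x :: "real^'n"
      let ?y = "(1 / real (Suc n)) *\<^sub>R ?e + x"
      show "norm (?D n x) \<le> B * indicator (cball 0 (R + 1)) x"
      proof (cases "x \<in> cball 0 (R + 1)")
        case True
        have "\<bar>f ?y - f x\<bar> \<le> B * norm (?y - x)" by (rule lipschitz_of_gradient_bound[OF diff B(2)])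
        also have "\<dots> = B / real (Suc n)" by simp
        finally have "real (Suc n) * \<bar>f ?y - f x\<bar> \<le> B" by (simp add: field_simps del: of_nat_Suc)
        then show ?thesis using True by (simp add: abs_mult del: of_nat_Suc)
      next
        case False
        have "norm x \<le> norm ?y + norm ((1 / real (Suc n)) *\<^sub>R ?e)"
          by (metis add.commute add_diff_cancel_left' norm_triangle_sub norm_minus_commute
              norm_triangle_ineq4 add_diff_cancel_right')
        also have "norm ((1 / real (Suc n)) *\<^sub>R ?e) \<le> 1" by (simp add: divide_simps)
        finally have "norm ?y > R" using False by simp
        then have "f ?y = 0" "f x = 0" using R f0 False by fastforce+
        then show ?thesis using B by (simp add: indicator_def)
      qed
    qed
  qed measurable
  moreover have "(LINT x|lborel. ?D n x) = 0" for n
  proof -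
    have int: "integrable lborel f" by (rule continuous_compact_support[OF contf K f0])
    have "integrable (distr lborel borel ((+) ((1 / real (Suc n)) *\<^sub>R ?e))) f"
      using int by (simp add: lborel_distr_plus)
    then have int': "integrable lborel (\<lambda>x. f ((1 / real (Suc n)) *\<^sub>R ?e + x))"
      by (subst (asm) integrable_distr_eq) auto
    show ?thesis
      using int int' lint_translation[of f "(1 / real (Suc n)) *\<^sub>R ?e"] by simp
  qed
  ultimately show ?thesis by (simp add: LIMSEQ_const_iff)
qed

lemma lint_lebesgue_on_eq_lborel:
  fixes f :: "real^'n \<Rightarrow> real"
  assumes "f \<in> borel_measurable borel" "open \<Omega>" "\<And>x. x \<notin> \<Omega> \<Longrightarrow> f x = 0"
  shows "(LINT x|lebesgue_on \<Omega>. f x) = (LINT x|lborel. f x)"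
proof -
  have "(LINT x|lebesgue_on \<Omega>. f x) = (LINT x|lebesgue. indicator \<Omega> x *\<^sub>R f x)"
    using assms(2) by (intro integral_restrict_space) auto
  also have "(\<lambda>x. indicator \<Omega> x *\<^sub>R f x) = f" using assms(3) by (auto simp:
    indicator_def fun_eq_iff)
  finally show ?thesis using assms(1) by (simp add: integral_completion)
qed

lemma integration_by_parts_test:
  fixes u :: "real^'n \<Rightarrow> real"
  assumes "open \<Omega>" "u \<in> test_functions \<Omega>" "\<phi> \<in> test_functions \<Omega>"
  shows "(LINT x|lebesgue_on \<Omega>. u x * gradient \<phi> x $ i) = - (LINT x|lebesgue_on \<Omega>.
    gradient u x $ i * \<phi> x)"
proof -
  obtain K where K: "compact K" "K \<subseteq> \<Omega>" "\<And>x. x \<notin> K \<Longrightarrow> \<phi> x =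
    0" "\<And>x. x \<notin> K \<Longrightarrow> gradient \<phi> x = 0" "smooth_on \<phi> UNIV"
    using test_functionE[OF assms(3)] by metis
  have u: "smooth_on u UNIV" using assms(2) by (simp add: test_functions_def)
  note S = smooth_onD[OF u] smooth_onD[OF K(5)]
  have D: "((\<lambda>x. u x * \<phi> x) has_derivative (\<lambda>h. (u x *\<^sub>R gradient \<phi> x +
    \<phi> x *\<^sub>R gradient u x) \<bullet> h)) (at x)" for x
    using has_derivative_mult[OF has_derivative_gradient[OF S(1)] has_derivative_gradient[OF S(5)], of x]
    by (simp add: inner_add_left algebra_simps)
  have g: "gradient (\<lambda>x. u x * \<phi> x) = (\<lambda>x. u x *\<^sub>R gradient \<phi> x + \<phi> x
    *\<^sub>R gradient u x)"
    using gradient_eqI[OF D] by blast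
  have "(LINT x|lborel. gradient (\<lambda>x. u x * \<phi> x) x $ i) = 0"
  proof (rule integral_partial_eq_0)
    show "continuous_on UNIV (gradient (\<lambda>x. u x * \<phi> x))"
      unfolding g by (intro continuous_intros S)
  qed (use D K in \<open>auto simp: differentiable_def\<close>)
  then have "(LINT x|lborel. u x * gradient \<phi> x $ i + gradient u x $ i * \<phi> x) = 0"
    unfolding g by (simp add: mult.commute[of "\<phi> _"])
  moreover have c1: "continuous_on UNIV (\<lambda>x. u x * gradient \<phi> x $ i)" and c2: "continuous_on
    UNIV (\<lambda>x. gradient u x $ i * \<phi> x)"
    by (intro continuous_intros S)+
  moreover have "integrable lborel (\<lambda>x. u x * gradient \<phi> x $ i)" "integrable lborel (\<lambda>x.
    gradient u x $ i * \<phi> x)"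
    using K by (auto intro!: continuous_compact_support(1)[OF _ K(1)] c1 c2)
  ultimately have "(LINT x|lborel. u x * gradient \<phi> x $ i) = - (LINT x|lborel. gradient u x $ i * \<phi> x)"
    by simp
  moreover have "\<phi> x = 0" "gradient \<phi> x = 0" if "x \<notin> \<Omega>" for x using K that by auto
  ultimately show ?thesis
    using assms(1) c1 c2
    by (subst (1 2) lint_lebesgue_on_eq_lborel) (auto intro!: borel_measurable_continuous_onI)
qed

section \<open>The fundamental lemma of the calculus of variations\<close>

lemma integrable_test_mult:
  fixes f :: "real^'n \<Rightarrow> real"
  assumes "open \<Omega>" "locally_integrable \<Omega> f" "\<phi> \<in> test_functions \<Omega>"
  shows "integrable (lebesgue_on \<Omega>) (\<lambda>x. f x * \<phi> x)"
proof -
  obtain K where K: "compact K" "K \<subseteq> \<Omega>" "\<And>x. x \<notin> K \<Longrightarrow> \<phi> x =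
    0" "smooth_on \<phi> UNIV"
    using test_functionE[OF assms(3)] by metis
  note S = smooth_onD[OF K(4)]
  have [measurable]: "\<phi> \<in> borel_measurable lborel"
    using borel_measurable_continuous_onI[OF S(2)] by simp
  obtain B where B: "\<And>x. \<bar>\<phi> x\<bar> \<le> B"
    using continuous_compact_support(2)[OF S(2) K(1,3)] by auto
  have "integrable (lebesgue_on K) f" using assms(2) K by (auto simp: locally_integrable_def)
  then have i: "integrable lebesgue (\<lambda>x. indicator K x *\<^sub>R f x)"
    using K(1) by (subst (asm) integrable_restrict_space) (auto simp: compact_imp_closed lmeasurable_compact
      fmeasurableD)
  have "integrable lebesgue (\<lambda>x. \<phi> x * (indicator K x *\<^sub>R f x))"
  proof (rule integrableI_bounded)
    show "(\<lambda>x. \<phi> x * (indicator K x *\<^sub>R f x)) \<in> borel_measurable lebesgue"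
      using borel_measurable_times[OF measurable_completion[of \<phi> lborel borel]
        borel_measurable_integrable[OF i]] by auto
    have "(\<integral>\<^sup>+ x. ennreal (norm (\<phi> x * (indicator K x *\<^sub>R f x))) \<partial>lebesgue)
      \<le> (\<integral>\<^sup>+ x. ennreal (norm (B * (indicator K x *\<^sub>R f x))) \<partial>lebesgue)"
      using B by (intro nn_integral_mono ennreal_leI) (auto simp: abs_mult intro!: mult_right_mono intro:
        order_trans[OF _ abs_ge_self])
    also have "\<dots> < \<infinity>"
      using integrable_mult_right[OF i, of B] unfolding integrable_iff_bounded by blast
    finally show "(\<integral>\<^sup>+ x. ennreal (norm (\<phi> x * (indicator K x *\<^sub>R f x)))
      \<partial>lebesgue) < \<infinity>" .
  qed
  moreover have "(\<lambda>x. \<phi> x * (indicator K x *\<^sub>R f x)) = (\<lambda>x. indicator \<Omega> x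
    *\<^sub>R (f x * \<phi> x))"
    using K by (auto simp: fun_eq_iff indicator_def)
  ultimately show ?thesis
    using assms(1) by (subst integrable_restrict_space) auto
qed

text \<open>A Dynkin argument: open boxes form an intersection-stable generator of the Borel sets,
  so the integral over every Borel set vanishes.\<close>

lemma AE_eq_0_if_box_integrals_0:
  fixes f :: "real^'n \<Rightarrow> real"
  assumes f: "integrable lborel f" and box: "\<And>a b. (LINT x|lborel. indicator (box a b) x * f x) = 0"
  shows "AE x in lborel. f x = 0"
proof (rule density_unique_real[OF f])
  have [measurable]: "f \<in> borel_measurable borel" using f by auto
  fix A :: "(real^'n) set" assume "A \<in> sets lborel"
  then have A: "A \<in> sigma_sets UNIV (range (\<lambda>(a, b). box a b))"
    by (simp add: borel_eq_box)
  have "Int_stable (range (\<lambda>(a, b). box a b :: (real^'n) set))"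
    "range (\<lambda>(a, b). box a b :: (real^'n) set) \<subseteq> Pow UNIV"
    by (auto simp: Int_stable_def box_Int_box)
  from this A have "(LINT x:A|lborel. f x) = 0"
  proof (induction rule: sigma_sets_induct_disjoint)
    case (basic A) then show ?case using box by (auto simp: set_lebesgue_integral_def)
  next
    case empty then show ?case by (simp add: set_lebesgue_integral_def)
  next
    case (compl A)
    have A: "A \<in> sets lborel" using compl by (simp add: borel_eq_box)
    have bc: "box (- (\<chi> i. real n)) (\<chi> i. real n) \<subseteq> (UNIV :: (real^'n) set)" for n by simp
    \<comment> \<open>Complements require the integral over the whole space, which is not a box but
      a limit of growing ones.\<close>
    have "(\<lambda>n. LINT x|lborel. indicator (box (- (\<chi> i. real n)) (\<chi> i. real n)) x * f x)
      \<longlonglongrightarrow> (LINT x|lborel. f x)"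
    proof (rule integral_dominated_convergence[where w="\<lambda>x. \<bar>f x\<bar>"])
      show "AE x in lborel. (\<lambda>n. indicator (box (- (\<chi> i. real n)) (\<chi> i. real n)) x * f x)
        \<longlonglongrightarrow> f x"
      proof (rule AE_I2, rule tendsto_eventually)
        fix x :: "real^'n"
        obtain m :: nat where "norm x < real m" using reals_Archimedean2 by blast
        then have "x \<in> box (- (\<chi> i. real n)) (\<chi> i. real n)" if "n \<ge> m" for n
          using that component_le_norm_cart[of x] by (auto simp: mem_box_cart abs_less_iff less_le_trans
            le_less_trans)
            (smt (verit) of_nat_le_iff)+
        then show "\<forall>\<^sub>F n in sequentially. indicator (box (- (\<chi> i. real n)) (\<chi> i. real
          n)) x * f x = f x"
          by (auto intro!: eventually_sequentiallyI[of m])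
      qed
    qed (use f in \<open>auto simp: indicator_def\<close>)
    then have "(LINT x|lborel. f x) = 0" by (simp add: box LIMSEQ_const_iff)
    moreover have "(LINT x:UNIV - A|lborel. f x) = (LINT x|lborel. f x) - (LINT x:A|lborel. f x)"
    proof -
      have "set_integrable lborel A f" "set_integrable lborel (UNIV - A) f"
        using integrable_mult_indicator[OF _ f] A unfolding set_integrable_def by (auto simp:
          Compl_eq_Diff_UNIV[symmetric])
      from set_integral_Un[OF _ this] show ?thesis
        by (simp add: set_lebesgue_integral_def[of _ UNIV])
    qed
    ultimately show ?case using compl by simp
  next
    case (union A)
    have A: "A i \<in> sets lborel" for i using union by (auto simp: borel_eq_box)
    have "(LINT x:(\<Union>i. A i)|lborel. f x) = (\<Sum>i. (LINT x:(A i)|lborel. f x))"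
    proof (rule lebesgue_integral_countable_add[OF A])
      show "set_integrable lborel (\<Union>(range A)) f"
        using integrable_mult_indicator[OF _ f, of "\<Union>(range A)"] A unfolding set_integrable_def by blast
    qed (use union in \<open>auto simp: disjoint_family_on_def\<close>)
    then show ?case using union by simp
  qed
  then show "(LINT x:A|lborel. f x) = (LINT x:A|lborel. 0)" by (simp add: set_lebesgue_integral_def)
qed simp

lemma box_bump_measurable: "box_bump p q k \<in> borel_measurable lebesgue"
proof (rule measurable_completion)
  have "box_bump p q k \<in> borel_measurable borel"
    by (rule borel_measurable_continuous_onI, rule smooth_onD(2), rule smooth_on_box_bump)
  then show "box_bump p q k \<in> borel_measurable lborel" by simp
qed

text \<open>Localised to closed boxes inside \<open>\<Omega>\<close>: box bumps converge boundedly
  to indicators of open boxes, so all box integrals of the localised function vanish. Countably many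
  closed boxes exhaust \<open>\<Omega>\<close>.\<close>

lemma fundamental_lemma:
  fixes g :: "real^'n \<Rightarrow> real"
  assumes \<Omega>: "open \<Omega>" and g: "locally_integrable \<Omega> g"
    and 0: "\<And>\<phi>. \<phi> \<in> test_functions \<Omega> \<Longrightarrow> (LINT x|lebesgue_on
      \<Omega>. g x * \<phi> x) = 0"
  shows "AE x in lborel. x \<in> \<Omega> \<longrightarrow> g x = 0"
proof -
  have loc: "AE x in lborel. x \<in> cbox a b \<longrightarrow> g x = 0" if ab: "cbox a b \<subseteq>
    \<Omega>" for a b
  proof -
    let ?h = "\<lambda>x. indicator (cbox a b) x *\<^sub>R g x"
    have "integrable (lebesgue_on (cbox a b)) g"
      using g ab by (auto simp: locally_integrable_def compact_cbox)
    then have h: "integrable lebesgue ?h"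
      by (subst (asm) integrable_restrict_space) auto
    then obtain h where h'[measurable]: "h \<in> borel_measurable borel" and ae: "AE x in lborel. ?h x = h x"
      using completion_ex_borel_measurable_real[OF borel_measurable_integrable[OF h]] by auto
    have ae': "AE x in lebesgue. ?h x = h x" using ae by (rule AE_completion)
    have hi: "integrable lborel h"
      using h integrable_cong_AE[OF _ _ ae'] by (auto simp: integrable_completion measurable_completion)
    have "AE x in lborel. h x = 0"
    proof (rule AE_eq_0_if_box_integrals_0[OF hi])
      fix c d :: "real^'n"
      obtain p q where pq: "box c d \<inter> box a b = box p q" using box_Int_box[of c d a b] by blast
      have sub: "box p q \<subseteq> box a b" using pq by auto
      have sub': "cbox p q \<subseteq> \<Omega>" if "box p q \<noteq> {}"
        using closure_mono[OF sub] that closure_box[OF that] closure_mono[OF box_subset_cbox[of a b]] ab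
        by auto
      \<comment> \<open>The bumps see open boxes only, while \<open>g\<close> is cut off to a closed
        one; the faces in between are null.\<close>
      have aebox: "AE x in lborel. x \<in> cbox a b \<longrightarrow> x \<in> box a b"
      proof (rule AE_I'[of "cbox a b - box a b"])
        show "cbox a b - box a b \<in> null_sets lborel"
          by (auto simp: null_sets_def emeasure_Diff emeasure_lborel_cbox_eq emeasure_lborel_box_eq box_subset_cbox)
      qed auto
      have "(LINT x|lborel. indicator (box c d) x * h x) = (LINT x|lebesgue. indicator (box c d) x * h x)"
        by (rule integral_completion[symmetric]) simp
      also have "\<dots> = (LINT x|lebesgue. indicator (box p q) x * ?h x)"
      proof (rule integral_cong_AE)
        show "(\<lambda>x. indicator (box c d) x * h x) \<in> borel_measurable lebesgue"
          by (rule measurable_completion) simp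
        show "(\<lambda>x. indicator (box p q) x * ?h x) \<in> borel_measurable lebesgue"
          by (intro borel_measurable_times borel_measurable_integrable[OF h] borel_measurable_indicator) simp
        show "AE x in lebesgue. indicator (box c d) x * h x = indicator (box p q) x * ?h x"
          using ae' AE_completion[OF aebox]
        proof eventually_elim
          case (elim x)
          then show ?case using pq by (cases "x \<in> cbox a b") (auto simp: indicator_def set_eq_iff)
        qed
      qed
      also have "\<dots> = 0"
      proof (cases "box p q = {}")
        case False
        have "(\<lambda>k. LINT x|lebesgue. box_bump p q k x * ?h x) \<longlonglongrightarrow> (LINT
          x|lebesgue. indicator (box p q) x * ?h x)"
        proof (rule integral_dominated_convergence[where w="\<lambda>x. \<bar>?h x\<bar>"])
          show "(\<lambda>x. indicator (box p q) x * ?h x) \<in> borel_measurable lebesgue"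
            by (intro borel_measurable_times borel_measurable_integrable[OF h] borel_measurable_indicator) simp
          show "(\<lambda>x. box_bump p q k x * ?h x) \<in> borel_measurable lebesgue" for k
            by (rule borel_measurable_times[OF box_bump_measurable borel_measurable_integrable[OF h]])
          show "integrable lebesgue (\<lambda>x. \<bar>?h x\<bar>)" using h by (rule integrable_abs)
          show "AE x in lebesgue. (\<lambda>k. box_bump p q k x * ?h x) \<longlonglongrightarrow> indicator
            (box p q) x * ?h x"
            by (intro AE_I2 tendsto_intros box_bump_tendsto)
          show "AE x in lebesgue. norm (box_bump p q k x * ?h x) \<le> \<bar>?h x\<bar>" for k
            by (rule AE_I2) (auto simp: abs_mult box_bump_nonneg box_bump_le_1 intro: mult_left_le_one_le)
        qed
        moreover have "(LINT x|lebesgue. box_bump p q k x * ?h x) = 0" for k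
        proof -
          have "box_bump p q k x * ?h x = indicator \<Omega> x *\<^sub>R (g x * box_bump p q k x)" for x
          proof (cases "x \<in> box p q")
            case True
            then have "x \<in> cbox a b" "x \<in> \<Omega>" using sub box_subset_cbox[of a b] ab by auto
            then show ?thesis by simp
          qed (simp add: box_bump_eq_0)
          then have "(LINT x|lebesgue. box_bump p q k x * ?h x) = (LINT x|lebesgue. indicator \<Omega> x
            *\<^sub>R (g x * box_bump p q k x))"
            by (rule Bochner_Integration.integral_cong[OF refl])
          also have "\<dots> = (LINT x|lebesgue_on \<Omega>. g x * box_bump p q k x)"
            using \<Omega> by (subst integral_restrict_space) auto
          also have "\<dots> = 0" by (rule 0[OF box_bump_test[OF sub'[OF False]]])
          finally show ?thesis .
        qed
        ultimately show ?thesis by (simp add: LIMSEQ_const_iff)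
      qed simp
      finally show "(LINT x|lborel. indicator (box c d) x * h x) = 0" .
    qed
    with ae show ?thesis by eventually_elim (auto simp: indicator_def)
  qed
  have "\<exists>D. countable D \<and> D \<subseteq> Pow \<Omega> \<and> (\<forall>X\<in>D. \<exists>a b. X =
    cbox a b) \<and> \<Union>D = \<Omega>"
  proof (rule open_countable_Union_open_cbox[OF \<Omega>])
    fix D :: "(real^'n) set set"
    assume "countable D" "D \<subseteq> Pow \<Omega>" "\<And>X. X \<in> D \<Longrightarrow> \<exists>a b. X =
      cbox a b" "\<Union>D = \<Omega>"
    then show ?thesis by (intro exI[of _ D] conjI ballI)
  qed
  then obtain D where D: "countable D" "D \<subseteq> Pow \<Omega>" "\<forall>X\<in>D. \<exists>a b. X = cbox
    a b" "\<Union>D = \<Omega>"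
    by (elim exE conjE)
  have "AE x in lborel. \<forall>X\<in>D. x \<in> X \<longrightarrow> g x = 0"
  proof (subst AE_ball_countable[OF D(1)], rule ballI)
    fix X assume X: "X \<in> D"
    then obtain a b where "X = cbox a b" using D(3) by blast
    then show "AE x in lborel. x \<in> X \<longrightarrow> g x = 0" using loc[of a b] D(2) X by auto
  qed
  then show ?thesis by eventually_elim (use D in auto)
qed

text \<open>The Borel function \<open>f'\<close> carries the measurability: by completeness of
  Lebesgue measure \<open>f\<close> inherits it from almost everywhere equality, and the integral
  moves to \<open>lborel\<close>.\<close>

lemma lint_lebesgue_on_AE:
  fixes f f' :: "real^'n \<Rightarrow> real"
  assumes \<Omega>: "open \<Omega>" and f'[measurable]: "f' \<in> borel_measurable borel"
    and ae: "AE x in lborel. x \<in> \<Omega> \<longrightarrow> f x = f' x"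
  shows "(LINT x|lebesgue_on \<Omega>. f x) = (LINT x|lborel. indicator \<Omega> x * f' x)"
    "integrable (lebesgue_on \<Omega>) f \<longleftrightarrow> integrable lborel (\<lambda>x. indicator
      \<Omega> x * f' x)"
proof -
  have [measurable]: "\<Omega> \<in> sets borel" using \<Omega> by simp
  have m: "(\<lambda>x. indicator \<Omega> x * f' x) \<in> borel_measurable lborel" by measurable
  have ae': "AE x in lebesgue. indicator \<Omega> x * f' x = indicator \<Omega> x *\<^sub>R f x"
    using AE_completion[OF ae] by eventually_elim (auto simp: indicator_def)
  have mL: "(\<lambda>x. indicator \<Omega> x * f' x) \<in> borel_measurable lebesgue" by (rule
    measurable_completion[OF m])
  have mR: "(\<lambda>x. indicator \<Omega> x *\<^sub>R f x) \<in> borel_measurable lebesgue"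
    by (rule borel_measurable_AE[OF mL ae'])
  show "(LINT x|lebesgue_on \<Omega>. f x) = (LINT x|lborel. indicator \<Omega> x * f' x)"
    using integral_cong_AE[OF mL mR ae'] \<Omega> by (simp add: integral_restrict_space integral_completion[OF m])
  show "integrable (lebesgue_on \<Omega>) f \<longleftrightarrow> integrable lborel (\<lambda>x. indicator
    \<Omega> x * f' x)"
    using integrable_cong_AE[OF mL mR ae'] \<Omega> by (simp add: integrable_restrict_space
      integrable_completion[OF m])
qed

lemma nn_integral_lebesgue_on_open:
  assumes "open \<Omega>"
  shows "(\<integral>\<^sup>+x. f x \<partial>lebesgue_on \<Omega>) = (\<integral>\<^sup>+x. f x * indicator
    \<Omega> x \<partial>lborel)"
  using assms by (simp add: nn_integral_restrict_space nn_integral_completion)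

section \<open>Borel representatives of measurable functions and fields\<close>

lemma ex_borel_rep_real:
  fixes f :: "real^'n \<Rightarrow> real"
  assumes \<Omega>: "open \<Omega>" and f: "f \<in> borel_measurable (lebesgue_on \<Omega>)"
  shows "\<exists>f'. f' \<in> borel_measurable borel \<and> (\<forall>x. x \<notin> \<Omega>
    \<longrightarrow> f' x = 0) \<and>
    (AE x in lborel. x \<in> \<Omega> \<longrightarrow> f x = f' x)"
proof -
  have "(\<lambda>x. indicator \<Omega> x *\<^sub>R f x) \<in> borel_measurable lebesgue"
    using f \<Omega> by (subst (asm) borel_measurable_restrict_space_iff) auto
  then obtain g where g[measurable]: "g \<in> borel_measurable borel" and ae: "AE x in lborel. indicator
    \<Omega> x *\<^sub>R f x = g x"
    using completion_ex_borel_measurable_real by force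
  have [measurable]: "\<Omega> \<in> sets borel" using \<Omega> by simp
  show ?thesis
  proof (intro exI conjI)
    show "(\<lambda>x. indicator \<Omega> x * g x) \<in> borel_measurable borel" by measurable
    show "AE x in lborel. x \<in> \<Omega> \<longrightarrow> f x = indicator \<Omega> x * g x"
      using ae by eventually_elim (auto simp: indicator_def)
  qed auto
qed

lemma ex_borel_rep_vec:
  fixes f :: "real^'n \<Rightarrow> real^'n"
  assumes \<Omega>: "open \<Omega>" and f: "f \<in> borel_measurable (lebesgue_on \<Omega>)"
  shows "\<exists>f'. f' \<in> borel_measurable borel \<and> (\<forall>x. x \<notin> \<Omega>
    \<longrightarrow> f' x = 0) \<and>
    (AE x in lborel. x \<in> \<Omega> \<longrightarrow> f x = f' x)"
proof -
  have "\<exists>g. g \<in> borel_measurable borel \<and> (\<forall>x. x \<notin> \<Omega> \<longrightarrow>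
    g x = 0) \<and>
    (AE x in lborel. x \<in> \<Omega> \<longrightarrow> f x $ i = g x)" for i
  proof -
    have "(\<lambda>x. f x \<bullet> axis i 1) \<in> borel_measurable (lebesgue_on \<Omega>)"
      using f by simp
    then have "(\<lambda>x. f x $ i) \<in> borel_measurable (lebesgue_on \<Omega>)"
      by (simp add: inner_axis)
    from ex_borel_rep_real[OF \<Omega> this] show ?thesis .
  qed
  then have "\<forall>i. \<exists>g. g \<in> borel_measurable borel \<and> (\<forall>x. x \<notin> \<Omega>
    \<longrightarrow> g x = 0) \<and>
    (AE x in lborel. x \<in> \<Omega> \<longrightarrow> f x $ i = g x)" by (rule allI)
  from choice[OF this] obtain g where g: "\<And>i. g i \<in> borel_measurable borel" "\<And>i x. x \<notin>
    \<Omega> \<Longrightarrow> g i x = 0"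
    "\<And>i. AE x in lborel. x \<in> \<Omega> \<longrightarrow> f x $ i = g i x" by blast
  show ?thesis
  proof (intro exI conjI)
    show "(\<lambda>x. \<chi> i. g i x) \<in> borel_measurable borel"
    proof (subst borel_measurable_euclidean_space, safe)
      fix b :: "real^'n" assume "b \<in> Basis"
      then obtain i where "b = axis i 1" by (auto simp: Basis_vec_def)
      then show "(\<lambda>x. (\<chi> i. g i x) \<bullet> b) \<in> borel_measurable borel" using g(1)[of i]
        by (simp add: inner_axis)
    qed
    have "AE x in lborel. \<forall>i. x \<in> \<Omega> \<longrightarrow> f x $ i = g i x"
      using g(3) by (subst AE_all_countable) auto
    then show "AE x in lborel. x \<in> \<Omega> \<longrightarrow> f x = (\<chi> i. g i x)"
      by eventually_elim (auto simp: vec_eq_iff)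
  qed (use g in \<open>auto simp: vec_eq_iff\<close>)
qed

section \<open>Uniqueness and linearity of weak gradients\<close>

lemma locally_integrable_component:
  fixes g :: "real^'n \<Rightarrow> real^'n"
  shows "locally_integrable \<Omega> g \<Longrightarrow> locally_integrable \<Omega> (\<lambda>x. g x $ i)"
  unfolding locally_integrable_def
  using integrable_inner_left[where c="axis i 1 :: real^'n"] by (fastforce simp: inner_axis)

lemma locally_integrable_lincomb:
  assumes "locally_integrable \<Omega> f" "locally_integrable \<Omega> g"
  shows "locally_integrable \<Omega> (\<lambda>x. f x + c *\<^sub>R g x)"
  using assms unfolding locally_integrable_def by auto

text \<open>Each component of the difference integrates to 0 against every test function, so the
  fundamental lemma applies.\<close>

lemma weak_gradient_unique:
  fixes g h :: "real^'n \<Rightarrow> real^'n"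
  assumes \<Omega>: "open \<Omega>" and g: "has_weak_gradient \<Omega> u g" and h: "has_weak_gradient \<Omega> u h"
  shows "AE x in lborel. x \<in> \<Omega> \<longrightarrow> g x = h x"
proof -
  have "AE x in lborel. x \<in> \<Omega> \<longrightarrow> g x $ i + (-1) *\<^sub>R h x $ i = 0" for i
  proof (rule fundamental_lemma[OF \<Omega>])
    have li: "locally_integrable \<Omega> (\<lambda>x. g x $ i)" "locally_integrable \<Omega> (\<lambda>x. h x $ i)"
      using g h by (auto simp: has_weak_gradient_def locally_integrable_component)
    then show "locally_integrable \<Omega> (\<lambda>x. g x $ i + (-1) *\<^sub>R h x $ i)"
      by (rule locally_integrable_lincomb)
    fix \<phi> assume \<phi>: "\<phi> \<in> test_functions \<Omega>"
    have "(LINT x|lebesgue_on \<Omega>. u x * frechet_derivative \<phi> (at x) (axis i 1)) = - (LINT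
      x|lebesgue_on \<Omega>. g x $ i * \<phi> x)"
      "(LINT x|lebesgue_on \<Omega>. u x * frechet_derivative \<phi> (at x) (axis i 1)) = - (LINT
        x|lebesgue_on \<Omega>. h x $ i * \<phi> x)"
      using g h \<phi> unfolding has_weak_gradient_def by blast+
    then have "(LINT x|lebesgue_on \<Omega>. g x $ i * \<phi> x) = (LINT x|lebesgue_on \<Omega>. h x $ i * \<phi> x)"
      by simp
    then show "(LINT x|lebesgue_on \<Omega>. (g x $ i + (-1) *\<^sub>R h x $ i) * \<phi> x) = 0"
      using integrable_test_mult[OF \<Omega> li(1) \<phi>] integrable_test_mult[OF \<Omega> li(2) \<phi>]
      by (simp add: algebra_simps)
  qed
  then have "AE x in lborel. \<forall>i. x \<in> \<Omega> \<longrightarrow> g x $ i + (-1) *\<^sub>R h x $ i = 0"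
    by (subst AE_all_countable) auto
  then show ?thesis by eventually_elim (auto simp: vec_eq_iff)
qed

lemma has_weak_gradient_weak_grad: "has_weak_gradient \<Omega> u g \<Longrightarrow> has_weak_gradient
  \<Omega> u (weak_grad \<Omega> u)"
  unfolding weak_grad_def by (rule someI[of "has_weak_gradient \<Omega> u"])

lemma weak_grad_AE:
  assumes "open \<Omega>" "has_weak_gradient \<Omega> u g"
  shows "AE x in lborel. x \<in> \<Omega> \<longrightarrow> weak_grad \<Omega> u x = g x"
proof -
  show ?thesis by (rule weak_gradient_unique[OF assms(1) has_weak_gradient_weak_grad[OF assms(2)] assms(2)])
qed

text \<open>Linearity is stated for exhibited fields. For \<open>weak_grad\<close>, a choice term,
  it holds only almost everywhere and goes through uniqueness.\<close>

lemma has_weak_gradient_lincomb: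
  assumes \<Omega>: "open \<Omega>" and g: "has_weak_gradient \<Omega> u g" and h: "has_weak_gradient \<Omega> v h"
  shows "has_weak_gradient \<Omega> (\<lambda>x. u x + c * v x) (\<lambda>x. g x + c *\<^sub>R h x)"
  unfolding has_weak_gradient_def
proof (intro conjI ballI allI)
  have li: "locally_integrable \<Omega> u" "locally_integrable \<Omega> v" "locally_integrable \<Omega> g"
    "locally_integrable \<Omega> h"
    using g h by (auto simp: has_weak_gradient_def)
  show "locally_integrable \<Omega> (\<lambda>x. u x + c * v x)" "locally_integrable \<Omega> (\<lambda>x. g
    x + c *\<^sub>R h x)"
    using locally_integrable_lincomb[OF li(1,2), of c] locally_integrable_lincomb[OF li(3,4)] by auto
  fix \<phi> i assume \<phi>: "\<phi> \<in> test_functions \<Omega>"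
  have "integrable (lebesgue_on \<Omega>) (\<lambda>x. w x * gradient \<phi> x $ i)" if "locally_integrable
    \<Omega> w" for w
    by (rule integrable_test_mult[OF \<Omega> that test_function_partial[OF \<phi>]])
  note I1 = this[OF li(1)] this[OF li(2)]
  have I2: "integrable (lebesgue_on \<Omega>) (\<lambda>x. g x $ i * \<phi> x)" "integrable (lebesgue_on
    \<Omega>) (\<lambda>x. h x $ i * \<phi> x)"
    by (auto intro!: integrable_test_mult \<Omega> \<phi> locally_integrable_component li)
  have E: "(LINT x|lebesgue_on \<Omega>. u x * gradient \<phi> x $ i) = - (LINT x|lebesgue_on \<Omega>. g x $
    i * \<phi> x)"
    "(LINT x|lebesgue_on \<Omega>. v x * gradient \<phi> x $ i) = - (LINT x|lebesgue_on \<Omega>. h x $ i * \<phi> x)"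
    using g h \<phi> by (auto simp: has_weak_gradient_def frechet_axis_eq_gradient)
  have "(LINT x|lebesgue_on \<Omega>. (u x + c * v x) * gradient \<phi> x $ i) =
     (LINT x|lebesgue_on \<Omega>. u x * gradient \<phi> x $ i) + c * (LINT x|lebesgue_on \<Omega>. v x *
       gradient \<phi> x $ i)"
    using I1 by (simp add: distrib_right mult.assoc)
  also have "\<dots> = - (LINT x|lebesgue_on \<Omega>. (g x + c *\<^sub>R h x) $ i * \<phi> x)"
    using I2 by (simp add: E distrib_right mult.assoc)
  finally show "(LINT x|lebesgue_on \<Omega>. (u x + c * v x) * frechet_derivative \<phi> (at x) (axis i 1)) =
     - (LINT x|lebesgue_on \<Omega>. (g x + c *\<^sub>R h x) $ i * \<phi> x)"
    by (simp add: frechet_axis_eq_gradient)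
qed

lemma locally_integrable_continuous:
  fixes f :: "real^'n \<Rightarrow> 'b::euclidean_space"
  assumes "continuous_on UNIV f"
  shows "locally_integrable \<Omega> f"
  unfolding locally_integrable_def
proof safe
  fix K :: "(real^'n) set" assume K: "compact K"
  have "integrable lborel (\<lambda>x. indicator K x *\<^sub>R f x)"
    by (rule borel_integrable_compact[OF K continuous_on_subset[OF assms]]) auto
  moreover have "K \<in> sets lborel" using K by (simp add: borel_compact)
  ultimately show "integrable (lebesgue_on K) f"
    using K assms by (subst integrable_restrict_space)
      (auto simp: integrable_completion fmeasurableD lmeasurable_compact)
qed

lemma has_weak_gradient_test:
  assumes "open \<Omega>" "\<phi> \<in> test_functions \<Omega>"
  shows "has_weak_gradient \<Omega> \<phi> (gradient \<phi>)"
proof -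
  have "smooth_on \<phi> UNIV" using assms by (auto simp: test_functions_def)
  note S = smooth_onD[OF this]
  show ?thesis
    unfolding has_weak_gradient_def frechet_axis_eq_gradient
    using integration_by_parts_test[OF assms] locally_integrable_continuous[OF S(2)]
      locally_integrable_continuous[OF S(3)] by auto
qed

section \<open>Sobolev functions through their representatives\<close>

lemma powr_CARD:
  assumes "0 \<le> (x::real)"
  shows "x powr real CARD('n::finite) = x ^ CARD('n)"
  using assms by (intro powr_realpow') auto

text \<open>Passing to a Borel representative \<open>(u', g)\<close> of a Sobolev function and its weak gradient makes
  Tonelli's theorem on \<open>lborel\<close> applicable.\<close>

definition sobolev_rep :: "(real^'n) set \<Rightarrow> (real^'n \<Rightarrow> real) \<Rightarrow> (real^'n
  \<Rightarrow> real) \<Rightarrow> (real^'n \<Rightarrow> real^'n) \<Rightarrow> bool" where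
  "sobolev_rep \<Omega> u u' g \<longleftrightarrow> u' \<in> borel_measurable borel \<and> g \<in>
    borel_measurable borel \<and>
     (\<forall>x. x \<notin> \<Omega> \<longrightarrow> u' x = 0 \<and> g x = 0) \<and>
     (AE x in lborel. x \<in> \<Omega> \<longrightarrow> u x = u' x) \<and> (AE x in lborel. x \<in> \<Omega>
       \<longrightarrow> weak_grad \<Omega> u x = g x) \<and>
     integrable lborel (\<lambda>x. \<bar>u' x\<bar> ^ CARD('n)) \<and> integrable lborel (\<lambda>x. norm
       (g x) ^ CARD('n))"

lemma sobolev_rep_ex:
  fixes \<Omega> :: "(real^'n) set"
  assumes \<Omega>: "open \<Omega>" and u: "u \<in> W1p \<Omega> (real CARD('n))"
  obtains u' g where "sobolev_rep \<Omega> u u' g"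
proof -
  from u obtain g0 where g0: "g0 \<in> Lp \<Omega> (real CARD('n))" "has_weak_gradient \<Omega> u g0" and u0:
    "u \<in> Lp \<Omega> (real CARD('n))"
    by (auto simp: W1p_def)
  have m: "u \<in> borel_measurable (lebesgue_on \<Omega>)" "g0 \<in> borel_measurable (lebesgue_on \<Omega>)"
    using u0 g0 by (auto simp: Lp_def)
  obtain u' where u': "u' \<in> borel_measurable borel" "\<forall>x. x \<notin> \<Omega> \<longrightarrow> u' x = 0"
    "AE x in lborel. x \<in> \<Omega> \<longrightarrow> u x = u' x"
    using ex_borel_rep_real[OF \<Omega> m(1)] by blast
  obtain g where g: "g \<in> borel_measurable borel" "\<forall>x. x \<notin> \<Omega> \<longrightarrow> g x = 0"
    "AE x in lborel. x \<in> \<Omega> \<longrightarrow> g0 x = g x"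
    using ex_borel_rep_vec[OF \<Omega> m(2)] by blast
  have "AE x in lborel. x \<in> \<Omega> \<longrightarrow> weak_grad \<Omega> u x = g x"
    using weak_grad_AE[OF \<Omega> g0(2)] g(3) by eventually_elim auto
  moreover have "integrable lborel (\<lambda>x. \<bar>u' x\<bar> ^ CARD('n))"
  proof -
    have "integrable (lebesgue_on \<Omega>) (\<lambda>x. \<bar>u x\<bar> ^ CARD('n))" using u0 by (simp add:
      Lp_def powr_CARD)
    then have "integrable lborel (\<lambda>x. indicator \<Omega> x * \<bar>u' x\<bar> ^ CARD('n))"
      using u' by (subst (asm) lint_lebesgue_on_AE(2)[OF \<Omega>]) auto
    also have "(\<lambda>x. indicator \<Omega> x * \<bar>u' x\<bar> ^ CARD('n)) = (\<lambda>x. \<bar>u'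
      x\<bar> ^ CARD('n))"
      using u' by (auto simp: indicator_def fun_eq_iff)
    finally show ?thesis .
  qed
  moreover have "integrable lborel (\<lambda>x. norm (g x) ^ CARD('n))"
  proof -
    have "integrable (lebesgue_on \<Omega>) (\<lambda>x. norm (g0 x) ^ CARD('n))" using g0 by (simp add:
      Lp_def powr_CARD)
    then have "integrable lborel (\<lambda>x. indicator \<Omega> x * norm (g x) ^ CARD('n))"
      using g by (subst (asm) lint_lebesgue_on_AE(2)[OF \<Omega>]) auto
    also have "(\<lambda>x. indicator \<Omega> x * norm (g x) ^ CARD('n)) = (\<lambda>x. norm (g x) ^ CARD('n))"
      using g by (auto simp: indicator_def fun_eq_iff)
    finally show ?thesis .
  qed
  ultimately have "sobolev_rep \<Omega> u u' g" using u' g unfolding sobolev_rep_def by blast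
  then show ?thesis using that by blast
qed

text \<open>The field \<open>g\<close> vanishes outside \<open>\<Omega>\<close>, and
  \<open>h 0 = 0\<close> then lets the integral extend over the whole space.\<close>

lemma sobolev_rep_lint:
  fixes \<Omega> :: "(real^'n) set"
  assumes \<Omega>: "open \<Omega>" and r: "sobolev_rep \<Omega> u u' g" and [measurable]: "(h :: real^'n
    \<Rightarrow> real) \<in> borel_measurable borel" and h0: "h 0 = 0"
  shows "(LINT x|lebesgue_on \<Omega>. h (weak_grad \<Omega> u x)) = (LINT x|lborel. h (g x))"
proof -
  have [measurable]: "g \<in> borel_measurable borel" using r by (auto simp: sobolev_rep_def)
  have "AE x in lborel. x \<in> \<Omega> \<longrightarrow> weak_grad \<Omega> u x = g x" using r by (auto
    simp: sobolev_rep_def)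
  then have "AE x in lborel. x \<in> \<Omega> \<longrightarrow> h (weak_grad \<Omega> u x) = h (g x)" by
    eventually_elim auto
  then have "(LINT x|lebesgue_on \<Omega>. h (weak_grad \<Omega> u x)) = (LINT x|lborel. indicator \<Omega> x
    * h (g x))"
    by (intro lint_lebesgue_on_AE(1)[OF \<Omega>]) measurable
  also have "\<dots> = (LINT x|lborel. h (g x))"
    using r h0 by (intro Bochner_Integration.integral_cong) (auto simp: sobolev_rep_def indicator_def)
  finally show ?thesis .
qed

lemma W1p_norm_rep:
  fixes \<Omega> :: "(real^'n) set"
  assumes \<Omega>: "open \<Omega>" and r: "sobolev_rep \<Omega> u u' g"
  shows "W1p_norm \<Omega> (real CARD('n)) u =
    ((LINT x|lborel. \<bar>u' x\<bar> ^ CARD('n)) + (LINT x|lborel. norm (g x) ^ CARD('n))) powr (1 / real CARD('n))"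
proof -
  have [measurable]: "u' \<in> borel_measurable borel" using r by (auto simp: sobolev_rep_def)
  have "AE x in lborel. x \<in> \<Omega> \<longrightarrow> u x = u' x" using r by (auto simp: sobolev_rep_def)
  then have "AE x in lborel. x \<in> \<Omega> \<longrightarrow> \<bar>u x\<bar> ^ CARD('n) = \<bar>u' x\<bar>
    ^ CARD('n)" by eventually_elim auto
  then have "(LINT x|lebesgue_on \<Omega>. \<bar>u x\<bar> ^ CARD('n)) = (LINT x|lborel. indicator \<Omega> x
    * \<bar>u' x\<bar> ^ CARD('n))"
    by (intro lint_lebesgue_on_AE(1)[OF \<Omega>]) measurable
  also have "\<dots> = (LINT x|lborel. \<bar>u' x\<bar> ^ CARD('n))"
    using r by (intro Bochner_Integration.integral_cong) (auto simp: sobolev_rep_def indicator_def)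
  finally show ?thesis
    using sobolev_rep_lint[OF \<Omega> r, of "\<lambda>y. norm y ^ CARD('n)"]
    unfolding W1p_norm_def by (simp add: powr_CARD)
qed

lemma power_add_le:
  assumes "0 \<le> a" "0 \<le> (b::real)"
  shows "(a + b) ^ n \<le> 2 ^ n * (a ^ n + b ^ n)"
proof -
  have "a + b \<le> 2 * max a b" by auto
  then have "(a + b) ^ n \<le> (2 * max a b) ^ n" using assms by (intro power_mono) auto
  also have "\<dots> = 2 ^ n * max a b ^ n" by (simp add: power_mult_distrib)
  also have "max a b ^ n \<le> a ^ n + b ^ n" using assms by (auto simp: max_def)
  finally show ?thesis by simp
qed

lemma sobolev_rep_lincomb:
  fixes \<Omega> :: "(real^'n) set"
  assumes \<Omega>: "open \<Omega>" and r: "sobolev_rep \<Omega> u u' g" and r2: "sobolev_rep \<Omega> v v' h"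
    and w: "has_weak_gradient \<Omega> u g0" "has_weak_gradient \<Omega> v h0"
  shows "sobolev_rep \<Omega> (\<lambda>x. u x + c * v x) (\<lambda>x. u' x + c * v' x) (\<lambda>x. g x + c
    *\<^sub>R h x)"
proof -
  note [measurable] = r[unfolded sobolev_rep_def, THEN conjunct1] r2[unfolded sobolev_rep_def, THEN conjunct1]
    r[unfolded sobolev_rep_def, THEN conjunct2, THEN conjunct1] r2[unfolded sobolev_rep_def, THEN conjunct2,
      THEN conjunct1]
  have ug: "has_weak_gradient \<Omega> u (weak_grad \<Omega> u)" "has_weak_gradient \<Omega> v (weak_grad \<Omega> v)"
    using w by (auto intro: has_weak_gradient_weak_grad)
  have "AE x in lborel. x \<in> \<Omega> \<longrightarrow> weak_grad \<Omega> (\<lambda>x. u x + c * v x) x =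
    weak_grad \<Omega> u x + c *\<^sub>R weak_grad \<Omega> v x"
    by (rule weak_grad_AE[OF \<Omega> has_weak_gradient_lincomb[OF \<Omega> ug]])
  moreover have "AE x in lborel. x \<in> \<Omega> \<longrightarrow> weak_grad \<Omega> u x = g x" "AE x in
    lborel. x \<in> \<Omega> \<longrightarrow> weak_grad \<Omega> v x = h x"
    using r r2 by (auto simp: sobolev_rep_def)
  ultimately have 1: "AE x in lborel. x \<in> \<Omega> \<longrightarrow> weak_grad \<Omega> (\<lambda>x. u x
    + c * v x) x = g x + c *\<^sub>R h x"
    by eventually_elim auto
  have "AE x in lborel. x \<in> \<Omega> \<longrightarrow> u x = u' x" "AE x in lborel. x \<in> \<Omega>
    \<longrightarrow> v x = v' x"
    using r r2 by (auto simp: sobolev_rep_def)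
  then have 2: "AE x in lborel. x \<in> \<Omega> \<longrightarrow> u x + c * v x = u' x + c * v' x"
    by eventually_elim auto
  have 3: "integrable lborel (\<lambda>x. \<bar>u' x + c * v' x\<bar> ^ CARD('n))"
  proof (rule Bochner_Integration.integrable_bound)
    show "integrable lborel (\<lambda>x. 2 ^ CARD('n) * (\<bar>u' x\<bar> ^ CARD('n) + \<bar>c\<bar> ^
      CARD('n) * \<bar>v' x\<bar> ^ CARD('n)))"
      using r r2 by (auto simp: sobolev_rep_def)
    show "AE x in lborel. norm (\<bar>u' x + c * v' x\<bar> ^ CARD('n)) \<le> norm (2 ^ CARD('n) * (\<bar>u'
      x\<bar> ^ CARD('n) + \<bar>c\<bar> ^ CARD('n) * \<bar>v' x\<bar> ^ CARD('n)))"
    proof (rule AE_I2)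
      fix x
      have "\<bar>u' x + c * v' x\<bar> ^ CARD('n) \<le> (\<bar>u' x\<bar> + \<bar>c\<bar> * \<bar>v'
        x\<bar>) ^ CARD('n)"
        by (intro power_mono) (auto intro: order_trans[OF abs_triangle_ineq] simp: abs_mult)
      also have "\<dots> \<le> 2 ^ CARD('n) * (\<bar>u' x\<bar> ^ CARD('n) + (\<bar>c\<bar> * \<bar>v'
        x\<bar>) ^ CARD('n))"
        by (rule power_add_le) auto
      finally show "norm (\<bar>u' x + c * v' x\<bar> ^ CARD('n)) \<le> norm (2 ^ CARD('n) * (\<bar>u'
        x\<bar> ^ CARD('n) + \<bar>c\<bar> ^ CARD('n) * \<bar>v' x\<bar> ^ CARD('n)))"
        by (simp add: power_mult_distrib)
    qed
  qed measurable
  have 4: "integrable lborel (\<lambda>x. norm (g x + c *\<^sub>R h x) ^ CARD('n))"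
  proof (rule Bochner_Integration.integrable_bound)
    show "integrable lborel (\<lambda>x. 2 ^ CARD('n) * (norm (g x) ^ CARD('n) + \<bar>c\<bar> ^ CARD('n) *
      norm (h x) ^ CARD('n)))"
      using r r2 by (auto simp: sobolev_rep_def)
    show "AE x in lborel. norm (norm (g x + c *\<^sub>R h x) ^ CARD('n)) \<le> norm (2 ^ CARD('n) * (norm (g
      x) ^ CARD('n) + \<bar>c\<bar> ^ CARD('n) * norm (h x) ^ CARD('n)))"
    proof (rule AE_I2)
      fix x
      have "norm (g x + c *\<^sub>R h x) ^ CARD('n) \<le> (norm (g x) + \<bar>c\<bar> * norm (h x)) ^ CARD('n)"
        by (intro power_mono) (auto intro: order_trans[OF norm_triangle_ineq])
      also have "\<dots> \<le> 2 ^ CARD('n) * (norm (g x) ^ CARD('n) + (\<bar>c\<bar> * norm (h x)) ^ CARD('n))"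
        by (rule power_add_le) auto
      finally show "norm (norm (g x + c *\<^sub>R h x) ^ CARD('n)) \<le> norm (2 ^ CARD('n) * (norm (g x) ^
        CARD('n) + \<bar>c\<bar> ^ CARD('n) * norm (h x) ^ CARD('n)))"
        by (simp add: power_mult_distrib)
    qed
  qed measurable
  show ?thesis
    unfolding sobolev_rep_def using 1 2 3 4 r r2 by (auto simp: sobolev_rep_def)
qed

lemma sobolev_rep_test:
  fixes \<Omega> :: "(real^'n) set"
  assumes \<Omega>: "open \<Omega>" and \<phi>: "\<phi> \<in> test_functions \<Omega>"
  shows "sobolev_rep \<Omega> \<phi> \<phi> (gradient \<phi>)"
proof -
  obtain K where K: "compact K" "K \<subseteq> \<Omega>" "\<And>x. x \<notin> K \<Longrightarrow> \<phi> x =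
    0" "\<And>x. x \<notin> K \<Longrightarrow> gradient \<phi> x = 0" "smooth_on \<phi> UNIV"
    using test_functionE[OF \<phi>] by metis
  note S = smooth_onD[OF K(5)]
  have "integrable lborel (\<lambda>x. \<bar>\<phi> x\<bar> ^ CARD('n))" "integrable lborel (\<lambda>x. norm
    (gradient \<phi> x) ^ CARD('n))"
    using K by (auto intro!: continuous_compact_support(1)[OF _ K(1)] continuous_intros S)
  moreover have "\<phi> x = 0 \<and> gradient \<phi> x = 0" if "x \<notin> \<Omega>" for x using K that by auto
  ultimately show ?thesis
    unfolding sobolev_rep_def using S weak_grad_AE[OF \<Omega> has_weak_gradient_test[OF \<Omega> \<phi>]]
    by (auto intro: borel_measurable_continuous_onI)
qed

lemma test_in_W01p:
  fixes \<Omega> :: "(real^'n) set"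
  assumes \<Omega>: "open \<Omega>" and \<phi>: "\<phi> \<in> test_functions \<Omega>"
  shows "\<phi> \<in> W01p \<Omega> (real CARD('n))"
proof -
  note r = sobolev_rep_test[OF \<Omega> \<phi>]
  have [measurable]: "\<phi> \<in> borel_measurable borel" "gradient \<phi> \<in> borel_measurable borel"
    "\<Omega> \<in> sets borel"
    using r \<Omega> by (auto simp: sobolev_rep_def)
  have "integrable lborel (\<lambda>x. indicator \<Omega> x *\<^sub>R \<bar>\<phi> x\<bar> ^ CARD('n))"
    "integrable lborel (\<lambda>x. indicator \<Omega> x *\<^sub>R norm (gradient \<phi> x) ^ CARD('n))"
    using r by (auto intro!: integrable_mult_indicator simp: sobolev_rep_def simp del: real_scaleR_def)
  then have i: "integrable (lebesgue_on \<Omega>) (\<lambda>x. norm (\<phi> x) powr real CARD('n))"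
    "integrable (lebesgue_on \<Omega>) (\<lambda>x. norm (gradient \<phi> x) powr real CARD('n))"
    using lint_lebesgue_on_AE(2)[OF \<Omega>, of "\<lambda>x. \<bar>\<phi> x\<bar> ^ CARD('n)" "\<lambda>x.
      \<bar>\<phi> x\<bar> ^ CARD('n)"]
      lint_lebesgue_on_AE(2)[OF \<Omega>, of "\<lambda>x. norm (gradient \<phi> x) ^ CARD('n)" "\<lambda>x.
        norm (gradient \<phi> x) ^ CARD('n)"]
    by (simp_all add: powr_CARD)
  have m: "\<phi> \<in> borel_measurable (lebesgue_on \<Omega>)" "gradient \<phi> \<in> borel_measurable
    (lebesgue_on \<Omega>)"
    using r by (auto simp: sobolev_rep_def intro!: measurable_restrict_space1 measurable_completion)
  have W: "\<phi> \<in> W1p \<Omega> (real CARD('n))"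
    unfolding W1p_def Lp_def using i m has_weak_gradient_test[OF \<Omega> \<phi>] by auto
  \<comment> \<open>A test function is approximated by the constant sequence; the difference is
    represented by 0.\<close>
  have "W1p_norm \<Omega> (real CARD('n)) (\<lambda>x. \<phi> x - \<phi> x) = 0"
    using W1p_norm_rep[OF \<Omega> sobolev_rep_lincomb[OF \<Omega> r r has_weak_gradient_test[OF \<Omega>
      \<phi>] has_weak_gradient_test[OF \<Omega> \<phi>], of "-1"]]
    by simp
  then show ?thesis
    unfolding W01p_def using W \<phi> by (auto intro!: exI[of _ "\<lambda>_. \<phi>"])
qed

section \<open>Norm-like functions and radial integration\<close>

text \<open>A common interface for \<open>F\<close> and its polar that asks for no smoothness. The
  lower bound makes sublevel sets bounded; continuity follows from convexity.\<close>

definition norm_like :: "(real^'n \<Rightarrow> real) \<Rightarrow> bool" where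
  "norm_like \<rho> \<longleftrightarrow> (\<forall>x y. \<rho> (x + y) \<le> \<rho> x + \<rho> y) \<and>
    (\<forall>t x. \<rho> (t *\<^sub>R x) = \<bar>t\<bar> * \<rho> x) \<and>
     (\<exists>c>0. \<forall>x. c * norm x \<le> \<rho> x)"

lemma norm_likeD:
  assumes "norm_like \<rho>"
  shows norm_like_triangle: "\<rho> (x + y) \<le> \<rho> x + \<rho> y"
    and norm_like_scale: "\<rho> (t *\<^sub>R x) = \<bar>t\<bar> * \<rho> x"
    and norm_like_0: "\<rho> 0 = 0"
    and norm_like_minus: "\<rho> (- x) = \<rho> x"
    and norm_like_nonneg: "0 \<le> \<rho> x"
    and norm_like_pos: "x \<noteq> 0 \<Longrightarrow> 0 < \<rho> x"
    and norm_like_lower: "\<exists>c>0. \<forall>x. c * norm x \<le> \<rho> x"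
proof -
  show "\<rho> (x + y) \<le> \<rho> x + \<rho> y" "\<rho> (t *\<^sub>R x) = \<bar>t\<bar> * \<rho> x" and c:
    "\<exists>c>0. \<forall>x. c * norm x \<le> \<rho> x"
    using assms by (auto simp: norm_like_def)
  show "\<rho> 0 = 0" "\<rho> (- x) = \<rho> x"
    using assms[unfolded norm_like_def, THEN conjunct2, THEN conjunct1, rule_format, of 0 0]
      assms[unfolded norm_like_def, THEN conjunct2, THEN conjunct1, rule_format, of "-1" x] by auto
  obtain c where c: "c > 0" "\<And>x. c * norm x \<le> \<rho> x" using c by blast
  show "0 \<le> \<rho> x" using c(2)[of x] c(1) by (meson mult_nonneg_nonneg norm_ge_zero less_imp_le order_trans)
  show "0 < \<rho> x" if "x \<noteq> 0" using c(2)[of x] c(1) that by (meson mult_pos_pos zero_less_norm_iff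
    less_le_trans)
qed

lemma norm_like_convex: "norm_like \<rho> \<Longrightarrow> convex_on UNIV \<rho>"
proof (rule convex_onI)
  fix t x y assume n: "norm_like \<rho>" and t: "0 < t" "t < (1::real)"
  have "\<rho> ((1 - t) *\<^sub>R x + t *\<^sub>R y) \<le> \<rho> ((1 - t) *\<^sub>R x) + \<rho> (t *\<^sub>R y)"
    by (rule norm_like_triangle[OF n])
  then show "\<rho> ((1 - t) *\<^sub>R x + t *\<^sub>R y) \<le> (1 - t) * \<rho> x + t * \<rho> y"
    using t by (simp add: norm_like_scale[OF n])
qed simp

lemma norm_like_continuous: "norm_like \<rho> \<Longrightarrow> continuous_on UNIV \<rho>"
  using norm_like_convex convex_on_continuous[OF open_UNIV] by blast

lemma norm_like_measurable: "norm_like \<rho> \<Longrightarrow> \<rho> \<in> borel_measurable borel"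
  using norm_like_continuous borel_measurable_continuous_onI by blast

lemma norm_like_upper:
  assumes "norm_like \<rho>"
  obtains C where "C > 0" "\<And>x. \<rho> x \<le> C * norm x"
proof -
  have "compact (\<rho> ` sphere 0 1)"
    using norm_like_continuous[OF assms] by (intro compact_continuous_image) (auto intro: continuous_on_subset)
  then have "bounded (\<rho> ` sphere 0 1)" by (rule compact_imp_bounded)
  then obtain B where B: "B > 0" "\<And>x. x \<in> sphere 0 1 \<Longrightarrow> norm (\<rho> x) \<le> B"
    by (auto simp: bounded_pos)
  have "\<rho> x \<le> B * norm x" for x
  proof (cases "x = 0")
    case False
    have "\<rho> x = norm x * \<rho> (x /\<^sub>R norm x)" using False by (simp add: norm_like_scale[OF assms])
    moreover have "\<rho> (x /\<^sub>R norm x) \<le> B" using B(2)[of "x /\<^sub>R norm x"] False by simp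
    ultimately show ?thesis by (metis mult.commute mult_left_mono norm_ge_zero)
  qed (simp add: norm_like_0[OF assms])
  then show ?thesis using B(1) that by blast
qed

lemma norm_like_sublevel_bounded:
  assumes "norm_like \<rho>"
  shows "bounded {x. \<rho> x \<le> t}"
proof -
  obtain c where c: "c > 0" "\<And>x. c * norm x \<le> \<rho> x" using norm_like_lower[OF assms] by blast
  have "norm x \<le> t / c" if "\<rho> x \<le> t" for x
    using order_trans[OF c(2) that] c(1) by (simp add: field_simps)
  then show ?thesis by (auto simp: bounded_iff)
qed

section \<open>Affine substitution, volumes of balls and radial integrals\<close>

lemma nn_integral_affine:
  fixes f :: "real^'n \<Rightarrow> ennreal"
  assumes [measurable]: "f \<in> borel_measurable borel" and c: "c \<noteq> 0"
  shows "(\<integral>\<^sup>+x. f x \<partial>lborel) = ennreal (\<bar>c\<bar> ^ CARD('n)) *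
    (\<integral>\<^sup>+x. f (t + c *\<^sub>R x) \<partial>lborel)"
proof -
  have "(\<integral>\<^sup>+x. f x \<partial>lborel) = (\<integral>\<^sup>+x. f x \<partial>density (distr
    lborel borel (\<lambda>x. t + c *\<^sub>R x)) (\<lambda>_. ennreal (\<bar>c\<bar> ^ CARD('n))))"
    by (subst lborel_affine[OF c, of t]) simp
  also have "\<dots> = (\<integral>\<^sup>+x. ennreal (\<bar>c\<bar> ^ CARD('n)) * f x \<partial>distr lborel
    borel (\<lambda>x. t + c *\<^sub>R x))"
    by (rule nn_integral_density) auto
  also have "\<dots> = (\<integral>\<^sup>+x. ennreal (\<bar>c\<bar> ^ CARD('n)) * f (t + c *\<^sub>R x)
    \<partial>lborel)"
    by (rule nn_integral_distr) auto
  also have "\<dots> = ennreal (\<bar>c\<bar> ^ CARD('n)) * (\<integral>\<^sup>+x. f (t + c *\<^sub>R x)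
    \<partial>lborel)"
    by (rule nn_integral_cmult) simp
  finally show ?thesis .
qed

lemma nn_integral_reflect_translate:
  fixes f :: "real^'n \<Rightarrow> ennreal"
  assumes "f \<in> borel_measurable borel"
  shows "(\<integral>\<^sup>+y. f (x - y) \<partial>lborel) = (\<integral>\<^sup>+y. f y \<partial>lborel)"
  using nn_integral_affine[OF assms, of "-1" x] by simp

definition unit_vol :: "(real^'n \<Rightarrow> real) \<Rightarrow> real" where
  "unit_vol \<rho> = measure lborel {x. \<rho> x \<le> 1}"

lemma unit_vol_emeasure:
  assumes n: "norm_like \<rho>"
  shows "emeasure lborel {x. \<rho> x \<le> 1} = ennreal (unit_vol \<rho>)"
  unfolding unit_vol_def
  using emeasure_bounded_finite[OF norm_like_sublevel_bounded[OF n, of 1]]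
  by (intro emeasure_eq_ennreal_measure) auto

lemma emeasure_norm_like_ball:
  fixes \<rho> :: "real^'n \<Rightarrow> real"
  assumes n: "norm_like \<rho>" and t: "0 \<le> t"
  shows "emeasure lborel {x. \<rho> x \<le> t} = ennreal (unit_vol \<rho> * t ^ CARD('n))"
proof (cases "t = 0")
  case True
  have "{x. \<rho> x \<le> 0} = {0}" using norm_like_pos[OF n] norm_like_0[OF n] by (auto simp: not_less[symmetric])
  then show ?thesis using True by (simp add: zero_power)
next
  case False
  then have t: "t > 0" using t by simp
  note [measurable] = norm_like_measurable[OF n]
  have "emeasure lborel {x. \<rho> x \<le> t} = (\<integral>\<^sup>+x. indicator {x. \<rho> x \<le> t} x
    \<partial>lborel)"
    by (rule nn_integral_indicator[symmetric]) measurable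
  also have "\<dots> = ennreal (\<bar>t\<bar> ^ CARD('n)) * (\<integral>\<^sup>+x. indicator {x. \<rho> x
    \<le> t} (0 + t *\<^sub>R x) \<partial>lborel)"
    using t by (intro nn_integral_affine) auto
  also have "(\<lambda>x. indicator {x. \<rho> x \<le> t} (0 + t *\<^sub>R x) :: ennreal) = indicator {x.
    \<rho> x \<le> 1}"
    using t by (auto simp: fun_eq_iff indicator_def norm_like_scale[OF n])
  also have "(\<integral>\<^sup>+x. indicator {x. \<rho> x \<le> 1} x \<partial>lborel) = emeasure lborel {x.
    \<rho> x \<le> 1}"
    by (rule nn_integral_indicator) measurable
  finally show ?thesis
    using t by (simp add: unit_vol_emeasure[OF n] ennreal_mult'' mult.commute)
qed

lemma unit_vol_pos:
  assumes n: "norm_like \<rho>"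
  shows "unit_vol \<rho> > 0"
proof -
  obtain C where C: "C > 0" "\<And>x. \<rho> x \<le> C * norm x" using norm_like_upper[OF n] by blast
  have "ball 0 (1 / C) \<subseteq> {x. \<rho> x \<le> 1}"
  proof
    fix x :: "real^'a" assume "x \<in> ball 0 (1 / C)"
    then have "C * norm x \<le> 1" using C(1) by (simp add: field_simps)
    then show "x \<in> {x. \<rho> x \<le> 1}" using C(2)[of x] by simp
  qed
  then have "emeasure lborel (ball (0::real^'a) (1 / C)) \<le> emeasure lborel {x. \<rho> x \<le> 1}"
    using norm_like_measurable[OF n] by (intro emeasure_mono) auto
  moreover have "emeasure lborel (ball (0::real^'a) (1 / C)) = ennreal (measure lborel (ball (0::real^'a) (1 / C)))"
    using emeasure_bounded_finite[OF bounded_ball[of "0::real^'a" "1 / C"]]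
    by (intro emeasure_eq_ennreal_measure) auto
  moreover have "measure lborel (ball (0::real^'a) (1 / C)) > 0"
    using C(1) by (intro content_ball_pos) simp
  ultimately show ?thesis 
    by (metis unit_vol_emeasure[OF n] ennreal_less_zero_iff less_le_trans)
qed

text \<open>Polar coordinates without a surface measure: the image of Lebesgue measure under
  \<open>\<rho>\<close> gives the half-line up to \<open>a \<ge> 0\<close> the mass
  \<open>unit_vol \<rho> * a ^ N\<close>, and this determines its density.\<close>

lemma nn_integral_radial:
  fixes \<rho> :: "real^'n \<Rightarrow> real"
  assumes n: "norm_like \<rho>" and h[measurable]: "h \<in> borel_measurable borel"
  shows "(\<integral>\<^sup>+x. h (\<rho> x) \<partial>lborel) =
    (\<integral>\<^sup>+t. ennreal (real CARD('n) * unit_vol \<rho> * t ^ (CARD('n) - 1)) * indicator {0..} t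
      * h t \<partial>lborel)"
proof -
  let ?D = "\<lambda>t::real. ennreal (real CARD('n) * unit_vol \<rho> * t ^ (CARD('n) - 1)) * indicator {0..} t"
  note [measurable] = norm_like_measurable[OF n]
  have v: "\<rho> -` {..a} = {x. \<rho> x \<le> a}" for a by auto
  have em: "emeasure (distr lborel borel \<rho>) {..a} = emeasure (density lborel ?D) {..a}" for a
  proof (cases "a \<ge> 0")
    case True
    have "emeasure (density lborel ?D) {..a} = (\<integral>\<^sup>+t. ?D t * indicator {..a} t \<partial>lborel)"
      by (rule emeasure_density) auto
    also have "\<dots> = (\<integral>\<^sup>+t. ennreal (real CARD('n) * unit_vol \<rho> * t ^ (CARD('n) -
      1)) * indicator {0..a} t \<partial>lborel)"
      by (intro nn_integral_cong) (auto simp: indicator_def)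
    also have "\<dots> = unit_vol \<rho> * a ^ CARD('n) - unit_vol \<rho> * 0 ^ CARD('n)"
      using True unit_vol_pos[OF n] by (intro nn_integral_FTC_Icc) (auto intro!: derivative_eq_intros)
    also have "\<dots> = emeasure (distr lborel borel \<rho>) {..a}"
      using True by (subst emeasure_distr) (auto simp: v emeasure_norm_like_ball[OF n] zero_power)
    finally show ?thesis by simp
  next
    case False
    have "{x. \<rho> x \<le> a} = {}" using norm_like_nonneg[OF n] False by (auto simp: not_le intro: less_le_trans)
    then have "emeasure (distr lborel borel \<rho>) {..a} = 0" by (subst emeasure_distr) (auto simp: v)
    moreover have "emeasure (density lborel ?D) {..a} = 0"
      using False by (subst emeasure_density) (auto simp: nn_integral_0_iff_AE indicator_def)
    ultimately show ?thesis by simp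
  qed
  have eq: "distr lborel borel \<rho> = density lborel ?D"
  proof (rule measure_eqI_generator_eq[where E="range (\<lambda>a::real. {..a})" and \<Omega>=UNIV and
    A="\<lambda>i. {..real i}"])
    show "Int_stable (range (\<lambda>a::real. {..a}))"
      by (auto simp: Int_stable_def)
    show "sets (distr lborel borel \<rho>) = sigma_sets UNIV (range (\<lambda>a::real. {..a}))"
      by (simp add: borel_eq_atMost)
    show "sets (density lborel ?D) = sigma_sets UNIV (range (\<lambda>a::real. {..a}))"
      by (simp add: borel_eq_atMost)
    show "(\<Union>i. {..real i}) = UNIV" by (auto intro: real_arch_simple)
    show "emeasure (distr lborel borel \<rho>) {..real i} \<noteq> \<infinity>" for i
      by (subst emeasure_distr) (auto simp: v emeasure_norm_like_ball[OF n])
  qed (use em in auto)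
  have "(\<integral>\<^sup>+x. h (\<rho> x) \<partial>lborel) = (\<integral>\<^sup>+t. h t \<partial>distr
    lborel borel \<rho>)"
    by (rule nn_integral_distr[symmetric]) auto
  also have "\<dots> = (\<integral>\<^sup>+t. ?D t * h t \<partial>lborel)"
    unfolding eq by (rule nn_integral_density) auto
  finally show ?thesis .
qed

text \<open>The radial density of order \<open>N - 1\<close> against the power \<open>-N\<close>
  leaves \<open>1 / t\<close>, the source of the logarithm in the exponential estimate.\<close>

lemma nn_integral_annulus:
  fixes \<rho> :: "real^'n \<Rightarrow> real"
  assumes n: "norm_like \<rho>" and ab: "0 < a" "a \<le> b"
  shows "(\<integral>\<^sup>+x. ennreal (\<rho> x powr - real CARD('n)) * indicator {a..b} (\<rho> x)
    \<partial>lborel) =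
    ennreal (real CARD('n) * unit_vol \<rho> * ln (b / a))"
proof -
  note v = unit_vol_pos[OF n]
  have "(\<integral>\<^sup>+x. ennreal (\<rho> x powr - real CARD('n)) * indicator {a..b} (\<rho> x)
    \<partial>lborel) =
    (\<integral>\<^sup>+t. ennreal (real CARD('n) * unit_vol \<rho> * t ^ (CARD('n) - 1)) * indicator {0..} t *
       (ennreal (t powr - real CARD('n)) * indicator {a..b} t) \<partial>lborel)"
    by (rule nn_integral_radial[OF n]) measurable
  also have "\<dots> = (\<integral>\<^sup>+t. ennreal (real CARD('n) * unit_vol \<rho> * (1 / t)) * indicator
    {a..b} t \<partial>lborel)"
  proof (rule nn_integral_cong)
    fix t :: real
    have "t ^ (CARD('n) - 1) * t powr - real CARD('n) = 1 / t" if "t > 0"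
    proof -
      have "t * (t ^ (CARD('n) - 1) * t powr - real CARD('n)) = t ^ CARD('n) * t powr - real CARD('n)"
        by (metis mult.assoc power_eq_if zero_less_card_finite less_not_refl)
      also have "\<dots> = 1" using that by (simp add: powr_realpow[symmetric] powr_add[symmetric])
      finally show ?thesis using that by (simp add: field_simps)
    qed
    then show "ennreal (real CARD('n) * unit_vol \<rho> * t ^ (CARD('n) - 1)) * indicator {0..} t *
       (ennreal (t powr - real CARD('n)) * indicator {a..b} t) =
       ennreal (real CARD('n) * unit_vol \<rho> * (1 / t)) * indicator {a..b} t"
      using ab v by (auto simp: indicator_def ennreal_mult'[symmetric] mult.assoc)
  qed
  also have "\<dots> = real CARD('n) * unit_vol \<rho> * ln b - real CARD('n) * unit_vol \<rho> * ln a"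
    using ab v by (intro nn_integral_FTC_Icc) (auto intro!: derivative_eq_intros)
  also have "\<dots> = real CARD('n) * unit_vol \<rho> * ln (b / a)"
    using ab by (simp add: ln_div algebra_simps)
  finally show ?thesis .
qed

text \<open>The radial integrand is \<open>t powr (N - 1 - a)\<close>, integrable at 0 because its
  exponent exceeds -1.\<close>

lemma nn_integral_kernel_finite:
  fixes \<rho> :: "real^'n \<Rightarrow> real"
  assumes n: "norm_like \<rho>" and r: "0 \<le> r" and a: "a < real CARD('n)"
  shows "(\<integral>\<^sup>+x. ennreal (\<rho> x powr - a) * indicator {x. \<rho> x \<le> r} x
    \<partial>lborel) < \<infinity>"
proof -
  note v = unit_vol_pos[OF n]
  let ?b = "real CARD('n) - 1 - a"
  have "(\<integral>\<^sup>+x. ennreal (\<rho> x powr - a) * indicator {..r} (\<rho> x) \<partial>lborel) =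
    (\<integral>\<^sup>+t. ennreal (real CARD('n) * unit_vol \<rho> * t ^ (CARD('n) - 1)) * indicator {0..} t *
       (ennreal (t powr - a) * indicator {..r} t) \<partial>lborel)"
    by (rule nn_integral_radial[OF n]) measurable
  also have "\<dots> = (\<integral>\<^sup>+t. ennreal (real CARD('n) * unit_vol \<rho> * (if t \<in> {0..r}
    then t powr ?b else 0)) \<partial>lborel)"
  proof (rule nn_integral_cong)
    fix t :: real
    have "t ^ (CARD('n) - 1) * t powr - a = t powr ?b" if "t > 0"
    proof -
      have "t ^ (CARD('n) - 1) = t powr (real CARD('n) - 1)"
        using powr_realpow[OF that, of "CARD('n) - 1"] by (simp add: of_nat_diff Suc_leI)
      then show ?thesis using that by (simp add: powr_add[symmetric])
    qed
    then show "ennreal (real CARD('n) * unit_vol \<rho> * t ^ (CARD('n) - 1)) * indicator {0..} t *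
       (ennreal (t powr - a) * indicator {..r} t) =
       ennreal (real CARD('n) * unit_vol \<rho> * (if t \<in> {0..r} then t powr ?b else 0))"
      using v by (cases "t = 0") (auto simp: indicator_def ennreal_mult'[symmetric] mult.assoc)
  qed
  also have "\<dots> = ennreal (real CARD('n) * unit_vol \<rho> * (r powr (?b + 1) / (?b + 1)))"
  proof (rule nn_integral_has_integral_lborel)
    have "((\<lambda>t. if t \<in> {0..r} then t powr ?b else 0) has_integral r powr (?b + 1) / (?b + 1)) UNIV"
      using has_integral_powr_from_0[of ?b r] a r has_integral_restrict_UNIV by fastforce
    then show "((\<lambda>t. real CARD('n) * unit_vol \<rho> * (if t \<in> {0..r} then t powr ?b else 0)) has_integral
       real CARD('n) * unit_vol \<rho> * (r powr (?b + 1) / (?b + 1))) UNIV"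
      by (rule has_integral_mult_right)
  qed (use v in auto)
  also have "\<dots> < \<infinity>" by simp
  finally show ?thesis by (simp add: indicator_def cong: if_cong)
qed

section \<open>The norm and its polar\<close>

locale anisotropic =
  fixes F :: "real^'n \<Rightarrow> real"
  assumes F: "anisotropic_norm F"
begin

abbreviation "P \<equiv> polar F"

text \<open>Midpoint convexity and homogeneity give the triangle inequality; the lower constant is
  the minimum of \<open>F\<close> on the unit sphere, positive by compactness.\<close>

lemma F_norm_like: "norm_like F"
proof -
  have cv: "convex_on UNIV F" and sc: "\<And>t x. F (t *\<^sub>R x) = \<bar>t\<bar> * F x" and pos: "\<And>x.
    x \<noteq> 0 \<Longrightarrow> 0 < F x"
    using F by (auto simp: anisotropic_norm_def)
  have "F (x + y) \<le> F x + F y" for x y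
  proof -
    have "F ((1 - 1/2) *\<^sub>R x + (1/2::real) *\<^sub>R y) \<le> (1 - 1/2) * F x + 1/2 * F y"
      by (rule convex_onD[OF cv]) auto
    moreover have "(1 - 1/2) *\<^sub>R x + (1/2::real) *\<^sub>R y = (1/2::real) *\<^sub>R (x + y)"
      by (simp add: scaleR_add_right)
    ultimately show ?thesis by (simp add: sc)
  qed
  moreover have "\<exists>c>0. \<forall>x. c * norm x \<le> F x"
  proof -
    have cont: "continuous_on UNIV F" by (rule convex_on_continuous[OF open_UNIV cv])
    have "\<exists>m\<in>sphere (0::real^'n) 1. \<forall>x\<in>sphere 0 1. F m \<le> F x"
      by (rule continuous_attains_inf) (auto intro: continuous_on_subset[OF cont])
    then obtain m where m: "m \<in> sphere 0 1" "\<And>x. x \<in> sphere 0 1 \<Longrightarrow> F m \<le> F x" by blast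
    have "F m * norm x \<le> F x" for x
    proof (cases "x = 0")
      case True then show ?thesis using sc[of 0 0] by simp
    next
      case False
      have "F x = norm x * F (x /\<^sub>R norm x)" using False by (simp add: sc)
      moreover have "F m \<le> F (x /\<^sub>R norm x)" using False by (intro m) auto
      ultimately show ?thesis by (metis mult.commute mult_left_mono norm_ge_zero)
    qed
    moreover have "F m > 0" using m by (intro pos) auto
    ultimately show ?thesis by blast
  qed
  ultimately show ?thesis using sc by (auto simp: norm_like_def)
qed

lemma polar_bdd: "bdd_above ((\<lambda>\<xi>. x \<bullet> \<xi>) ` {\<xi>. F \<xi> \<le> 1})"
proof -
  obtain B where B: "\<And>\<xi>. F \<xi> \<le> 1 \<Longrightarrow> norm \<xi> \<le> B"
    using norm_like_sublevel_bounded[OF F_norm_like, of 1] by (auto simp: bounded_iff)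
  show ?thesis
  proof (rule bdd_aboveI2)
    fix \<xi> assume "\<xi> \<in> {\<xi>. F \<xi> \<le> 1}"
    then have "norm \<xi> \<le> B" using B by simp
    then show "x \<bullet> \<xi> \<le> norm x * B"
      by (meson mult_left_mono norm_cauchy_schwarz norm_ge_zero order_trans)
  qed
qed

lemma polar_upper: "F \<xi> \<le> 1 \<Longrightarrow> x \<bullet> \<xi> \<le> polar F x"
  unfolding polar_def by (rule cSUP_upper[OF _ polar_bdd]) simp

lemma polar_least: "(\<And>\<xi>. F \<xi> \<le> 1 \<Longrightarrow> x \<bullet> \<xi> \<le> B)
  \<Longrightarrow> polar F x \<le> B"
  unfolding polar_def using norm_like_0[OF F_norm_like] by (intro cSUP_least) (auto intro!: exI[of _ 0])

text \<open>The Cauchy-Schwarz inequality of the dual pair; evenness of \<open>F\<close> supplies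
  the absolute value.\<close>

lemma polar_inner: "\<bar>x \<bullet> \<xi>\<bar> \<le> polar F x * F \<xi>"
proof (cases "\<xi> = 0")
  case True then show ?thesis by (simp add: norm_like_0[OF F_norm_like])
next
  case False
  then have p: "F \<xi> > 0" by (rule norm_like_pos[OF F_norm_like])
  then have "F ((1 / F \<xi>) *\<^sub>R \<xi>) \<le> 1" "F ((- 1 / F \<xi>) *\<^sub>R \<xi>) \<le> 1"
    by (simp_all only: norm_like_scale[OF F_norm_like]) auto
  then have "x \<bullet> ((1 / F \<xi>) *\<^sub>R \<xi>) \<le> polar F x" "x \<bullet> ((- 1 / F \<xi>)
    *\<^sub>R \<xi>) \<le> polar F x"
    using polar_upper by blast+
  then show ?thesis using p by (auto simp: field_simps abs_le_iff)
qed

lemma polar_norm_like: "norm_like (polar F)"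
  unfolding norm_like_def
proof (intro conjI allI)
  show "polar F (x + y) \<le> polar F x + polar F y" for x y
    by (rule polar_least) (simp add: inner_add_left add_mono polar_upper)
  have le: "polar F (t *\<^sub>R x) \<le> \<bar>t\<bar> * polar F x" for t x
  proof (rule polar_least)
    fix \<xi> assume 1: "F \<xi> \<le> 1"
    then have 2: "F (- \<xi>) \<le> 1" by (simp add: norm_like_minus[OF F_norm_like])
    have "t *\<^sub>R x \<bullet> \<xi> = \<bar>t\<bar> * (x \<bullet> (if t \<ge> 0 then \<xi> else -
      \<xi>))" by auto
    also have "\<dots> \<le> \<bar>t\<bar> * polar F x"
      using polar_upper[OF 1] polar_upper[OF 2] by (intro mult_left_mono) auto
    finally show "t *\<^sub>R x \<bullet> \<xi> \<le> \<bar>t\<bar> * polar F x" .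
  qed
  show "polar F (t *\<^sub>R x) = \<bar>t\<bar> * polar F x" for t x
  proof (cases "t = 0")
    case True
    have "polar F 0 = 0"
      using le[of 0 x] polar_upper[of 0 0] norm_like_0[OF F_norm_like] by simp
    then show ?thesis using True by simp
  next
    case False
    have "polar F x = polar F ((1/t) *\<^sub>R (t *\<^sub>R x))" using False by simp
    also have "\<dots> \<le> \<bar>1/t\<bar> * polar F (t *\<^sub>R x)" by (rule le)
    finally have "\<bar>t\<bar> * polar F x \<le> polar F (t *\<^sub>R x)" using False by (simp add: field_simps)
    then show ?thesis using le[of t x] by simp
  qed
  obtain C where C: "C > 0" "\<And>x. F x \<le> C * norm x" using norm_like_upper[OF F_norm_like] by blast
  have "1 / C * norm x \<le> polar F x" for x
  proof (cases "x = 0")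
    case True
    then show ?thesis using polar_upper[of 0 x] norm_like_0[OF F_norm_like] by simp
  next
    case False
    then have p: "F x > 0" by (rule norm_like_pos[OF F_norm_like])
    have n: "norm x > 0" using False by simp
    \<comment> \<open>Pairing \<open>x\<close> with itself and bounding \<open>F x\<close> by
      \<open>C * norm x\<close> yields the lower bound for the polar.\<close>
    have "norm x * norm x \<le> polar F x * F x" using polar_inner[of x x] by (simp add: dot_square_norm
      power2_eq_square)
    also have "\<dots> \<le> polar F x * (C * norm x)"
      using polar_upper[of 0 x] norm_like_0[OF F_norm_like] by (intro mult_left_mono C) auto
    finally have "norm x \<le> polar F x * C" using n by (simp add: field_simps)
    then show ?thesis using C by (simp add: field_simps)
  qed
  then show "\<exists>c>0. \<forall>x. c * norm x \<le> polar F x" using C(1) by (intro exI[of _ "1 / C"]) auto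
qed

lemma wulff_volume_eq: "wulff_volume F = unit_vol (polar F)"
  unfolding wulff_volume_def unit_vol_def
  using norm_like_measurable[OF polar_norm_like] by (subst measure_completion) auto

end

section \<open>A potential estimate for Sobolev functions\<close>

lemma nn_integral_powr_tail:
  assumes "0 < (a::real)" "0 < n"
  shows "(\<integral>\<^sup>+t. ennreal (t powr - (real n + 1)) * indicator {a..} t \<partial>lborel) =
    ennreal (a powr - real n / real n)"
proof -
  have "(\<integral>\<^sup>+t. ennreal (t powr - (real n + 1)) * indicator {a..} t \<partial>lborel) = 0 - (-
    (a powr - real n / real n))"
  proof (rule nn_integral_FTC_atLeast)
    fix t assume "a \<le> t"
    then have "t > 0" using assms by simp
    then show "((\<lambda>t. - (t powr - real n / real n)) has_real_derivative t powr - (real n + 1)) (at t)"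
      using assms by (auto intro!: derivative_eq_intros simp: field_simps)
        (simp add: powr_diff powr_minus field_simps powr_add)
  next
    have "((\<lambda>t. - (t powr - real n / real n)) \<longlongrightarrow> - (0 / real n)) at_top"
      using assms by (intro tendsto_intros tendsto_neg_powr filterlim_ident) auto
    then show "((\<lambda>t. - (t powr - real n / real n)) \<longlongrightarrow> 0) at_top" by simp
  qed auto
  then show ?thesis by simp
qed

text \<open>Values above \<open>\<epsilon>\<close> are paid for with powers of
  \<open>t / \<epsilon>\<close>. On sets of finite measure this deduces L^1 smallness from L^N
  smallness without taking roots.\<close>

lemma le_eps_power:
  assumes "0 \<le> (t::real)" "0 < \<epsilon>" "0 < n"
  shows "t \<le> \<epsilon> + t ^ n / \<epsilon> ^ (n - 1)"
proof (cases "t \<le> \<epsilon>")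
  case True then show ?thesis using assms by (simp add: add_increasing2)
next
  case False
  have "t * 1 \<le> t * (t / \<epsilon>) ^ (n - 1)"
    using False assms by (intro mult_left_mono one_le_power) auto
  also have "\<dots> = t ^ n / \<epsilon> ^ (n - 1)"
    using assms by (cases n) (auto simp: power_divide)
  finally show ?thesis using assms by simp
qed

lemma nn_integral_le_eps:
  fixes f :: "real^'n \<Rightarrow> real"
  assumes [measurable]: "f \<in> borel_measurable borel" "\<Omega> \<in> sets borel" and f: "\<And>x. 0 \<le>
    f x" and f0: "\<And>x. x \<notin> \<Omega> \<Longrightarrow> f x = 0"
    and \<epsilon>: "0 < \<epsilon>"
  shows "(\<integral>\<^sup>+x. ennreal (f x) \<partial>lborel) \<le> ennreal \<epsilon> * emeasure lborel
    \<Omega> + ennreal (1 / \<epsilon> ^ (CARD('n) - 1)) * (\<integral>\<^sup>+x. ennreal (f x ^ CARD('n))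
    \<partial>lborel)"
proof -
  have "(\<integral>\<^sup>+x. ennreal (f x) \<partial>lborel) \<le> (\<integral>\<^sup>+x. (ennreal
    \<epsilon> * indicator \<Omega> x + ennreal (1 / \<epsilon> ^ (CARD('n) - 1)) * ennreal (f x ^ CARD('n)))
    \<partial>lborel)"
  proof (rule nn_integral_mono)
    fix x
    show "ennreal (f x) \<le> ennreal \<epsilon> * indicator \<Omega> x + ennreal (1 / \<epsilon> ^ (CARD('n)
      - 1)) * ennreal (f x ^ CARD('n))"
    proof (cases "x \<in> \<Omega>")
      case True
      have "ennreal (f x) \<le> ennreal (\<epsilon> + 1 / \<epsilon> ^ (CARD('n) - 1) * f x ^ CARD('n))"
        using le_eps_power[OF f \<epsilon>, of "CARD('n)" x] by (intro ennreal_leI) simp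
      also have "\<dots> = ennreal \<epsilon> + ennreal (1 / \<epsilon> ^ (CARD('n) - 1)) * ennreal (f x ^ CARD('n))"
        using \<epsilon> f[of x] by (simp add: ennreal_plus[symmetric] ennreal_mult[symmetric] del: ennreal_plus)
      finally show ?thesis using True by simp
    qed (simp add: f0)
  qed
  also have "\<dots> = ennreal \<epsilon> * emeasure lborel \<Omega> + ennreal (1 / \<epsilon> ^ (CARD('n) -
    1)) * (\<integral>\<^sup>+x. ennreal (f x ^ CARD('n)) \<partial>lborel)"
    by (subst nn_integral_add) (auto simp: nn_integral_cmult)
  finally show ?thesis .
qed

context anisotropic
begin

lemma F_measurable[measurable]: "F \<in> borel_measurable borel"
  and polar_measurable[measurable]: "P \<in> borel_measurable borel"
  using norm_like_measurable F_norm_like polar_norm_like by auto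

text \<open>The derivative along the ray is integrated up to a point outside the support; the
  duality inequality bounds it by \<open>F\<close> of the gradient times \<open>P z\<close>.\<close>

lemma ray_bound:
  assumes \<phi>: "\<phi> \<in> test_functions \<Omega>" and z: "z \<noteq> 0"
  shows "ennreal \<bar>\<phi> x\<bar> \<le> (\<integral>\<^sup>+t. ennreal (F (gradient \<phi> (x + t
    *\<^sub>R z)) * P z) * indicator {0<..} t \<partial>lborel)"
proof -
  obtain K where K: "compact K" "K \<subseteq> \<Omega>" "\<And>y. y \<notin> K \<Longrightarrow> \<phi> y =
    0" "\<And>y. y \<notin> K \<Longrightarrow> gradient \<phi> y = 0" "smooth_on \<phi> UNIV"
    using test_functionE[OF \<phi>] by metis
  note S = smooth_onD[OF K(5)]
  obtain B where B: "B > 0" "\<And>y. y \<in> K \<Longrightarrow> norm y \<le> B"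
    using compact_imp_bounded[OF K(1)] by (auto simp: bounded_pos)
  \<comment> \<open>At this parameter \<open>x + T z\<close> has norm at least \<open>B + 1\<close>,
    hence lies outside \<open>K\<close>.\<close>
  define T where "T = (norm x + B + 1) / norm z"
  have T: "T > 0" unfolding T_def using B z by (intro divide_pos_pos) (auto intro: add_nonneg_pos)
  have "norm (T *\<^sub>R z) \<le> norm (x + T *\<^sub>R z) + norm x"
    by (metis add_diff_cancel_left' norm_triangle_ineq4)
  moreover have "norm (T *\<^sub>R z) = norm x + B + 1" using z T B(1) unfolding norm_scaleR by (simp add: T_def)
  ultimately have "x + T *\<^sub>R z \<notin> K" using B(2)[of "x + T *\<^sub>R z"] by auto
  then have 0: "\<phi> (x + T *\<^sub>R z) = 0" by (rule K)
  let ?h' = "\<lambda>t. gradient \<phi> (x + t *\<^sub>R z) \<bullet> z"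
  have cont: "continuous_on UNIV ?h'"
    by (intro continuous_intros continuous_on_compose2[OF S(3)]) auto
  have D: "((\<lambda>t. \<phi> (x + t *\<^sub>R z)) has_real_derivative ?h' t) (at t)" for t
  proof -
    have "((\<lambda>t. x + t *\<^sub>R z) has_derivative (\<lambda>t. t *\<^sub>R z)) (at t)" by (auto
      intro!: derivative_eq_intros)
    from has_derivative_compose[OF this has_derivative_gradient[OF S(1)]]
    show ?thesis by (simp add: has_field_derivative_def mult_commute_abs)
  qed
  have "(LINT t|lborel. indicator {0..T} t *\<^sub>R ?h' t) = \<phi> (x + T *\<^sub>R z) - \<phi> (x + 0 *\<^sub>R z)"
    using T D by (intro integral_FTC_Icc)
      (auto simp: has_real_derivative_iff_has_vector_derivative[symmetric] intro:
        has_field_derivative_at_within continuous_on_subset[OF cont])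
  then have eq: "\<bar>\<phi> x\<bar> = norm (LINT t|lborel. indicator {0..T} t *\<^sub>R ?h' t)" using 0 by simp
  have "ennreal (norm (LINT t|lborel. indicator {0..T} t *\<^sub>R ?h' t)) \<le> (\<integral>\<^sup>+t. norm
    (indicator {0..T} t *\<^sub>R ?h' t) \<partial>lborel)"
    by (intro integral_norm_bound_ennreal borel_integrable_compact) (auto intro: continuous_on_subset[OF cont])
  also have "\<dots> \<le> (\<integral>\<^sup>+t. ennreal (F (gradient \<phi> (x + t *\<^sub>R z)) * P z) *
    indicator {0<..} t \<partial>lborel)"
  proof (rule nn_integral_mono_AE)
    show "AE t in lborel. ennreal (norm (indicator {0..T} t *\<^sub>R ?h' t)) \<le> ennreal (F (gradient
      \<phi> (x + t *\<^sub>R z)) * P z) * indicator {0<..} t"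
      using AE_lborel_singleton[of 0]
    proof eventually_elim
      case (elim t)
      have "\<bar>?h' t\<bar> \<le> F (gradient \<phi> (x + t *\<^sub>R z)) * P z"
        using polar_inner[of z "gradient \<phi> (x + t *\<^sub>R z)"] by (simp add: inner_commute mult.commute)
      then show ?case using elim by (auto simp: indicator_def intro: ennreal_leI)
    qed
  qed
  finally show ?thesis by (simp add: eq)
qed

text \<open>The ray bound is integrated over \<open>P z \<le> 1\<close>. With \<open>y = t z\<close>
  the condition becomes \<open>P y \<le> t\<close>, and the integral of
  \<open>t powr - (N + 1)\<close> from \<open>P y\<close> on is \<open>P y powr - N / N\<close>;
  multiplied by \<open>P y\<close> this is the kernel, and the \<open>1 / N\<close> moves to the
  left-hand side.\<close>

lemma potential_test:
  assumes \<phi>: "\<phi> \<in> test_functions \<Omega>"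
  shows "ennreal (real CARD('n) * unit_vol P * \<bar>\<phi> x\<bar>) \<le>
    (\<integral>\<^sup>+y. ennreal (F (gradient \<phi> y) * P (x - y) powr - (real CARD('n) - 1)) \<partial>lborel)"
proof -
  let ?N = "CARD('n)"
  have N: "0 < ?N" by simp
  obtain K where K: "smooth_on \<phi> UNIV" using test_functionE[OF \<phi>] by metis
  have [measurable]: "gradient \<phi> \<in> borel_measurable borel"
    by (rule borel_measurable_continuous_onI[OF smooth_onD(3)[OF K]])
  let ?G = "\<lambda>z t. ennreal (F (gradient \<phi> (x + t *\<^sub>R z)) * P z) * indicator {0<..} t *
    indicator {z. P z \<le> 1} z"
  let ?H = "\<lambda>y. ennreal (F (gradient \<phi> (x + y)) * P y)"
  have "ennreal (unit_vol P * \<bar>\<phi> x\<bar>) = (\<integral>\<^sup>+z. ennreal \<bar>\<phi> x\<bar> *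
    indicator {z. P z \<le> 1} z \<partial>lborel)"
    using unit_vol_emeasure[OF polar_norm_like] unit_vol_pos[OF polar_norm_like]
    by (subst nn_integral_cmult_indicator) (auto simp: ennreal_mult' mult.commute)
  also have "\<dots> \<le> (\<integral>\<^sup>+z. (\<integral>\<^sup>+t. ?G z t \<partial>lborel) \<partial>lborel)"
  proof (rule nn_integral_mono_AE)
    show "AE z in lborel. ennreal \<bar>\<phi> x\<bar> * indicator {z. P z \<le> 1} z \<le>
      (\<integral>\<^sup>+t. ?G z t \<partial>lborel)"
      using AE_lborel_singleton[of 0]
    proof eventually_elim
      case (elim z)
      then show ?case using ray_bound[OF \<phi>, of z x] by (cases "P z \<le> 1") auto
    qed
  qed
  also have "\<dots> = (\<integral>\<^sup>+t. (\<integral>\<^sup>+z. ?G z t \<partial>lborel) \<partial>lborel)"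
    by (rule lborel_pair.Fubini'[symmetric]) measurable
  also have "\<dots> = (\<integral>\<^sup>+t. (\<integral>\<^sup>+y. ennreal (t powr - (real ?N + 1)) *
    indicator {0<..} t * (?H y * indicator {y. P y \<le> t} y) \<partial>lborel) \<partial>lborel)"
  proof (rule nn_integral_cong)
    fix t :: real
    show "(\<integral>\<^sup>+z. ?G z t \<partial>lborel) = (\<integral>\<^sup>+y. ennreal (t powr - (real ?N
      + 1)) * indicator {0<..} t * (?H y * indicator {y. P y \<le> t} y) \<partial>lborel)"
    proof (cases "t > 0")
      case True
      \<comment> \<open>The Jacobian \<open>t ^ N\<close> and the factor \<open>t\<close> in
        \<open>P (t z) = t * P z\<close> compensate the weight exactly.\<close>
      have p: "t ^ ?N * t powr - (real ?N + 1) * t = 1"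
        using True by (simp add: powr_realpow[symmetric] powr_add[symmetric] powr_mult_base mult.commute)
      have "(\<integral>\<^sup>+y. ennreal (t powr - (real ?N + 1)) * indicator {0<..} t * (?H y * indicator
        {y. P y \<le> t} y) \<partial>lborel)
        = ennreal (\<bar>t\<bar> ^ ?N) * (\<integral>\<^sup>+y. ennreal (t powr - (real ?N + 1)) * indicator
          {0<..} t * (?H (0 + t *\<^sub>R y) * indicator {y. P y \<le> t} (0 + t *\<^sub>R y)) \<partial>lborel)"
        using True by (intro nn_integral_affine) auto
      also have "\<dots> = (\<integral>\<^sup>+y. ennreal (\<bar>t\<bar> ^ ?N) * (ennreal (t powr - (real ?N
        + 1)) * indicator {0<..} t * (?H (0 + t *\<^sub>R y) * indicator {y. P y \<le> t} (0 + t *\<^sub>R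
        y))) \<partial>lborel)"
        by (rule nn_integral_cmult[symmetric]) measurable
      also have "\<dots> = (\<integral>\<^sup>+z. ?G z t \<partial>lborel)"
      proof (rule nn_integral_cong)
        fix z
        have i: "indicator {y. P y \<le> t} (t *\<^sub>R z) = (indicator {z. P z \<le> 1} z :: ennreal)"
          using True by (auto simp: indicator_def norm_like_scale[OF polar_norm_like])
        have nn: "0 \<le> F (gradient \<phi> (x + t *\<^sub>R z))" "0 \<le> P z" by (rule norm_like_nonneg[OF
          F_norm_like] norm_like_nonneg[OF polar_norm_like])+
        have "ennreal (\<bar>t\<bar> ^ ?N) * (ennreal (t powr - (real ?N + 1)) * ennreal (F (gradient \<phi>
          (x + t *\<^sub>R z)) * (t * P z)))
          = ennreal ((t ^ ?N * t powr - (real ?N + 1) * t) * (F (gradient \<phi> (x + t *\<^sub>R z)) * P z))"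
          using True nn by (simp add: ennreal_mult[symmetric] mult_ac)
        also have "\<dots> = ennreal (F (gradient \<phi> (x + t *\<^sub>R z)) * P z)" by (simp only: p mult_1)
        finally show "ennreal (\<bar>t\<bar> ^ ?N) * (ennreal (t powr - (real ?N + 1)) * indicator {0<..} t *
          (?H (0 + t *\<^sub>R z) * indicator {y. P y \<le> t} (0 + t *\<^sub>R z))) = ?G z t"
          using True by (simp add: norm_like_scale[OF polar_norm_like] mult.assoc[symmetric] i)
      qed
      finally show ?thesis by simp
    qed simp
  qed
  also have "\<dots> = (\<integral>\<^sup>+y. (\<integral>\<^sup>+t. ennreal (t powr - (real ?N + 1)) *
    indicator {0<..} t * (?H y * indicator {y. P y \<le> t} y) \<partial>lborel) \<partial>lborel)"
    by (rule lborel_pair.Fubini'[symmetric]) measurable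
  also have "\<dots> = (\<integral>\<^sup>+y. ennreal (1 / real ?N) * ennreal (F (gradient \<phi> (x + y)) *
    P (x - (x + y)) powr - (real ?N - 1)) \<partial>lborel)"
  proof (rule nn_integral_cong_AE)
    show "AE y in lborel. (\<integral>\<^sup>+t. ennreal (t powr - (real ?N + 1)) * indicator {0<..} t * (?H
      y * indicator {y. P y \<le> t} y) \<partial>lborel)
      = ennreal (1 / real ?N) * ennreal (F (gradient \<phi> (x + y)) * P (x - (x + y)) powr - (real ?N - 1))"
      using AE_lborel_singleton[of 0]
    proof eventually_elim
      case (elim y)
      then have y: "P y > 0" by (rule norm_like_pos[OF polar_norm_like])
      have nn: "0 \<le> F (gradient \<phi> (x + y))" by (rule norm_like_nonneg[OF F_norm_like])
      have "(\<integral>\<^sup>+t. ennreal (t powr - (real ?N + 1)) * indicator {0<..} t * (?H y * indicator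
        {y. P y \<le> t} y) \<partial>lborel)
        = (\<integral>\<^sup>+t. ?H y * (ennreal (t powr - (real ?N + 1)) * indicator {P y..} t) \<partial>lborel)"
        using y by (intro nn_integral_cong) (auto simp: indicator_def mult.commute)
      also have "\<dots> = ?H y * (\<integral>\<^sup>+t. ennreal (t powr - (real ?N + 1)) * indicator {P y..}
        t \<partial>lborel)"
        by (rule nn_integral_cmult) measurable
      also have "\<dots> = ?H y * ennreal (P y powr - real ?N / real ?N)"
        by (simp only: nn_integral_powr_tail[OF y N])
      also have "\<dots> = ennreal (1 / real ?N * (F (gradient \<phi> (x + y)) * (P y * P y powr - real ?N)))"
        using y nn by (simp add: ennreal_mult[symmetric])
      also have "P y * P y powr - real ?N = P y powr - (real ?N - 1)"
        using y by (simp add: powr_mult_base)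
      finally show ?case using nn norm_like_minus[OF polar_norm_like, of y] by (simp add: ennreal_mult[symmetric])
    qed
  qed
  also have "\<dots> = ennreal (1 / real ?N) * (\<integral>\<^sup>+y. ennreal (F (gradient \<phi> (x + y)) *
    P (x - (x + y)) powr - (real ?N - 1)) \<partial>lborel)"
    by (rule nn_integral_cmult) measurable
  also have "(\<integral>\<^sup>+y. ennreal (F (gradient \<phi> (x + y)) * P (x - (x + y)) powr - (real ?N -
    1)) \<partial>lborel)
    = (\<integral>\<^sup>+y. ennreal (F (gradient \<phi> y) * P (x - y) powr - (real ?N - 1)) \<partial>lborel)"
    using nn_integral_affine[of "\<lambda>y. ennreal (F (gradient \<phi> y) * P (x - y) powr - (real ?N -
      1))" 1 x] by simp
  finally have "ennreal (real ?N) * ennreal (unit_vol P * \<bar>\<phi> x\<bar>) \<le> ennreal (real ?N) *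
    (ennreal (1 / real ?N) *
     (\<integral>\<^sup>+y. ennreal (F (gradient \<phi> y) * P (x - y) powr - (real ?N - 1)) \<partial>lborel))"
    by (intro mult_left_mono) auto
  then show ?thesis
    using unit_vol_pos[OF polar_norm_like] by (simp add: mult.assoc[symmetric] ennreal_mult[symmetric])
qed

text \<open>Tonelli and translation invariance, as in Young's inequality for L^1. Points of
  \<open>\<Omega>\<close> are at polar distance at most \<open>R\<close>, so only that part of the
  kernel enters.\<close>

lemma convolution_bound:
  fixes f k :: "real^'n \<Rightarrow> ennreal"
  assumes [measurable]: "f \<in> borel_measurable borel" "k \<in> borel_measurable borel" "\<Omega> \<in> sets borel"
    and f0: "\<And>y. y \<notin> \<Omega> \<Longrightarrow> f y = 0" and R: "\<And>x y. x \<in> \<Omega>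
      \<Longrightarrow> y \<in> \<Omega> \<Longrightarrow> P (x - y) \<le> R"
  shows "(\<integral>\<^sup>+x. (\<integral>\<^sup>+y. f y * k (x - y) \<partial>lborel) * indicator \<Omega>
    x \<partial>lborel) \<le>
    (\<integral>\<^sup>+z. k z * indicator {z. P z \<le> R} z \<partial>lborel) * (\<integral>\<^sup>+y. f y
      \<partial>lborel)"
proof -
  have "(\<integral>\<^sup>+x. (\<integral>\<^sup>+y. f y * k (x - y) \<partial>lborel) * indicator \<Omega>
    x \<partial>lborel) = (\<integral>\<^sup>+x. (\<integral>\<^sup>+y. f y * k (x - y) * indicator \<Omega>
    x \<partial>lborel) \<partial>lborel)"
    by (intro nn_integral_cong nn_integral_multc[symmetric]) measurable
  also have "\<dots> \<le> (\<integral>\<^sup>+x. (\<integral>\<^sup>+y. f y * (k (x - y) * indicator {z. P z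
    \<le> R} (x - y)) \<partial>lborel) \<partial>lborel)"
    using R f0 by (intro nn_integral_mono) (auto simp: indicator_def)
  also have "\<dots> = (\<integral>\<^sup>+y. (\<integral>\<^sup>+x. f y * (k (x - y) * indicator {z. P z
    \<le> R} (x - y)) \<partial>lborel) \<partial>lborel)"
    by (rule lborel_pair.Fubini'[symmetric]) measurable
  also have "\<dots> = (\<integral>\<^sup>+y. f y * (\<integral>\<^sup>+z. k z * indicator {z. P z \<le> R} z
    \<partial>lborel) \<partial>lborel)"
  proof (rule nn_integral_cong)
    fix y
    have "(\<integral>\<^sup>+x. f y * (k (x - y) * indicator {z. P z \<le> R} (x - y)) \<partial>lborel) = f
      y * (\<integral>\<^sup>+x. k (x - y) * indicator {z. P z \<le> R} (x - y) \<partial>lborel)"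
      by (rule nn_integral_cmult) measurable
    also have "(\<integral>\<^sup>+x. k (x - y) * indicator {z. P z \<le> R} (x - y) \<partial>lborel) =
      (\<integral>\<^sup>+z. k z * indicator {z. P z \<le> R} z \<partial>lborel)"
      using nn_integral_affine[of "\<lambda>z. k z * indicator {z. P z \<le> R} z" 1 "- y"] by simp
    finally show "(\<integral>\<^sup>+x. f y * (k (x - y) * indicator {z. P z \<le> R} (x - y))
      \<partial>lborel) = f y * (\<integral>\<^sup>+z. k z * indicator {z. P z \<le> R} z \<partial>lborel)" .
  qed
  also have "\<dots> = (\<integral>\<^sup>+z. k z * indicator {z. P z \<le> R} z \<partial>lborel) *
    (\<integral>\<^sup>+y. f y \<partial>lborel)"
    by (subst nn_integral_multc) (auto simp: mult.commute)
  finally show ?thesis .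
qed

section \<open>From test functions to the Sobolev space\<close>

lemma bounded_polar_diam:
  assumes "bounded (\<Omega> :: (real^'n) set)"
  shows "\<exists>R>0. (\<forall>x\<in>\<Omega>. \<forall>y\<in>\<Omega>. P (x - y) \<le> R) \<and>
    (\<forall>x\<in>\<Omega>. P x \<le> R)"
proof -
  obtain B where B: "B > 0" "\<And>x. x \<in> \<Omega> \<Longrightarrow> norm x \<le> B" using assms by (auto
    simp: bounded_pos)
  obtain C where C: "C > 0" "\<And>x. P x \<le> C * norm x" using norm_like_upper[OF polar_norm_like] by blast
  show ?thesis
  proof (intro exI conjI ballI)
    show "C * (2 * B) > 0" using B C by simp
    show "P (x - y) \<le> C * (2 * B)" if "x \<in> \<Omega>" "y \<in> \<Omega>" for x y
    proof -
      have "norm (x - y) \<le> 2 * B" using norm_triangle_ineq4[of x y] B(2)[OF that(1)] B(2)[OF that(2)] by simp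
      then have "C * norm (x - y) \<le> C * (2 * B)" using C(1) by simp
      then show ?thesis using C(2)[of "x - y"] by simp
    qed
    show "P x \<le> C * (2 * B)" if "x \<in> \<Omega>" for x
    proof -
      have "C * norm x \<le> C * (2 * B)" using C(1) B(1) B(2)[OF that] by simp
      then show ?thesis using C(2)[of x] by simp
    qed
  qed
qed

lemma W01p_approx:
  fixes \<Omega> :: "(real^'n) set"
  assumes \<Omega>: "open \<Omega>" and u: "u \<in> W01p \<Omega> (real CARD('n))" and r: "sobolev_rep
    \<Omega> u u' g"
  shows "\<exists>\<phi>. (\<forall>k. \<phi> k \<in> test_functions \<Omega>) \<and> (\<forall>k.
    sobolev_rep \<Omega> (\<lambda>x. u x - \<phi> k x) (\<lambda>x. u' x - \<phi> k x) (\<lambda>x. g x -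
    gradient (\<phi> k) x)) \<and>
    (\<lambda>k::nat. (LINT x|lborel. \<bar>u' x - \<phi> k x\<bar> ^ CARD('n)) + (LINT x|lborel. norm (g x -
      gradient (\<phi> k) x) ^ CARD('n))) \<longlonglongrightarrow> 0"
proof -
  obtain \<phi> where \<phi>: "\<And>k. \<phi> k \<in> test_functions \<Omega>" and lim: "(\<lambda>k::nat.
    W1p_norm \<Omega> (real CARD('n)) (\<lambda>x. u x - \<phi> k x)) \<longlonglongrightarrow> 0"
    using u by (auto simp: W01p_def)
  obtain g0 where g0: "has_weak_gradient \<Omega> u g0" using u by (auto simp: W01p_def W1p_def)
  have rep: "sobolev_rep \<Omega> (\<lambda>x. u x - \<phi> k x) (\<lambda>x. u' x - \<phi> k x) (\<lambda>x.
    g x - gradient (\<phi> k) x)" for k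
    using sobolev_rep_lincomb[OF \<Omega> r sobolev_rep_test[OF \<Omega> \<phi>[of k]] g0
      has_weak_gradient_test[OF \<Omega> \<phi>[of k]], of "-1"] by simp
  let ?d = "\<lambda>k. (LINT x|lborel. \<bar>u' x - \<phi> k x\<bar> ^ CARD('n)) + (LINT x|lborel. norm (g x
    - gradient (\<phi> k) x) ^ CARD('n))"
  have d0: "?d k \<ge> 0" for k by simp
  have "(\<lambda>k. ?d k powr (1 / real CARD('n))) \<longlonglongrightarrow> 0"
    using lim unfolding W1p_norm_rep[OF \<Omega> rep] .
  then have "(\<lambda>k. (?d k powr (1 / real CARD('n))) ^ CARD('n)) \<longlonglongrightarrow> 0 ^ CARD('n)"
    by (rule tendsto_power)
  moreover have "(?d k powr (1 / real CARD('n))) ^ CARD('n) = ?d k" for k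
    using d0[of k] by (simp add: powr_CARD[symmetric] powr_powr)
  ultimately have "?d \<longlonglongrightarrow> 0" by (simp add: zero_power)
  then show ?thesis using \<phi> rep by (intro exI[of _ \<phi>]) simp
qed

text \<open>No pointwise limit is taken: the integral of the positive part of left minus right side
  is bounded by L^1 distances to approximating test functions. These tend to 0, so the positive part
  vanishes almost everywhere.\<close>

lemma potential_W01p:
  fixes \<Omega> :: "(real^'n) set"
  assumes \<Omega>: "open \<Omega>" "bounded \<Omega>" and u: "u \<in> W01p \<Omega> (real CARD('n))" and r:
    "sobolev_rep \<Omega> u u' g"
  shows "AE x in lborel. x \<in> \<Omega> \<longrightarrow> ennreal (real CARD('n) * unit_vol P * \<bar>u'
    x\<bar>) \<le>
    (\<integral>\<^sup>+y. ennreal (F (g y)) * ennreal (P (x - y) powr - (real CARD('n) - 1)) \<partial>lborel)"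
proof -
  let ?N = "CARD('n)"
  let ?c = "real ?N * unit_vol P"
  let ?k = "\<lambda>z. ennreal (P z powr - (real ?N - 1))"
  have c: "?c > 0" using unit_vol_pos[OF polar_norm_like] by simp
  have [measurable]: "\<Omega> \<in> sets borel" using \<Omega> by simp
  have [measurable]: "u' \<in> borel_measurable borel" "g \<in> borel_measurable borel" using r by (auto
    simp: sobolev_rep_def)
  obtain \<phi> where all: "\<forall>k. \<phi> k \<in> test_functions \<Omega>"
    "\<forall>k. sobolev_rep \<Omega> (\<lambda>x. u x - \<phi> k x) (\<lambda>x. u' x - \<phi> k x)
      (\<lambda>x. g x - gradient (\<phi> k) x)"
    and lim: "(\<lambda>k::nat. (LINT x|lborel. \<bar>u' x - \<phi> k x\<bar> ^ ?N) + (LINT x|lborel. norm (g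
      x - gradient (\<phi> k) x) ^ ?N)) \<longlonglongrightarrow> 0"
    using W01p_approx[OF \<Omega>(1) u r] by (elim exE conjE) (rule that)
  note \<phi> = all(1)[rule_format] and rep = all(2)[rule_format]
  let ?d = "\<lambda>k. (LINT x|lborel. \<bar>u' x - \<phi> k x\<bar> ^ ?N) + (LINT x|lborel. norm (g x -
    gradient (\<phi> k) x) ^ ?N)"
  have [measurable]: "\<phi> k \<in> borel_measurable borel" "gradient (\<phi> k) \<in> borel_measurable borel" for k
    using sobolev_rep_test[OF \<Omega>(1) \<phi>[of k]] by (auto simp: sobolev_rep_def)
  obtain R where R: "R > 0" "\<forall>x\<in>\<Omega>. \<forall>y\<in>\<Omega>. P (x - y) \<le> R" using
    bounded_polar_diam[OF \<Omega>(2)] by auto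
  obtain C where C: "C > 0" "\<And>x. F x \<le> C * norm x" using norm_like_upper[OF F_norm_like] by blast
  define J where "J x = (\<integral>\<^sup>+y. ennreal (F (g y)) * ?k (x - y) \<partial>lborel)" for x
  have [measurable]: "J \<in> borel_measurable borel" unfolding J_def by measurable
  define M where "M = (\<integral>\<^sup>+z. ?k z * indicator {z. P z \<le> R} z \<partial>lborel)"
  have "M < \<infinity>" unfolding M_def using R by (intro nn_integral_kernel_finite[OF polar_norm_like]) auto
  then obtain m where m: "M = ennreal m" "m \<ge> 0" by (cases M) auto
  have "emeasure lborel \<Omega> < \<infinity>" using emeasure_bounded_finite[OF \<Omega>(2)] by simp
  then obtain w where w: "emeasure lborel \<Omega> = ennreal w" "w \<ge> 0" by (cases "emeasure lborel \<Omega>") auto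
  \<comment> \<open>Subtraction in \<open>ennreal\<close> is truncated at 0, so the integrand is the
    positive part of the possible defect.\<close>
  let ?X = "\<integral>\<^sup>+x. (ennreal (?c * \<bar>u' x\<bar>) - J x) * indicator \<Omega> x \<partial>lborel"
  have est: "?X \<le> ennreal ((?c + m * C) * (\<epsilon> * w + 1 / \<epsilon> ^ (?N - 1) * ?d k))" if
    \<epsilon>: "\<epsilon> > 0" for \<epsilon> k
  proof -
    have N1: "(\<integral>\<^sup>+x. ennreal (f x) \<partial>lborel) \<le> ennreal (\<epsilon> * w + 1 /
      \<epsilon> ^ (?N - 1) * ?d k)"
      if f: "f \<in> borel_measurable borel" "\<And>x. 0 \<le> f x" "\<And>x. x \<notin> \<Omega>
        \<Longrightarrow> f x = 0"
        and fi: "integrable lborel (\<lambda>x. f x ^ ?N)" and le: "(LINT x|lborel. f x ^ ?N) \<le> ?d k" for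
          f :: "real^'n \<Rightarrow> real"
    proof -
      have "(\<integral>\<^sup>+x. ennreal (f x) \<partial>lborel) \<le> ennreal \<epsilon> * emeasure lborel
        \<Omega> + ennreal (1 / \<epsilon> ^ (?N - 1)) * (\<integral>\<^sup>+x. ennreal (f x ^ ?N) \<partial>lborel)"
        by (rule nn_integral_le_eps[OF f(1) _ f(2,3) \<epsilon>]) simp
      also have "(\<integral>\<^sup>+x. ennreal (f x ^ ?N) \<partial>lborel) = ennreal (LINT x|lborel. f x ^ ?N)"
        using f fi by (intro nn_integral_eq_integral) auto
      also have "ennreal \<epsilon> * emeasure lborel \<Omega> + ennreal (1 / \<epsilon> ^ (?N - 1)) *
        ennreal (LINT x|lborel. f x ^ ?N) = ennreal (\<epsilon> * w + 1 / \<epsilon> ^ (?N - 1) * (LINT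
        x|lborel. f x ^ ?N))"
      proof -
        have "0 \<le> (LINT x|lborel. f x ^ ?N)" using f(2) by simp
        then show ?thesis
          using \<epsilon> w by (simp add: ennreal_mult[symmetric] ennreal_plus[symmetric] del: ennreal_plus)
      qed
      also have "\<dots> \<le> ennreal (\<epsilon> * w + 1 / \<epsilon> ^ (?N - 1) * ?d k)"
        using le \<epsilon> by (intro ennreal_leI add_left_mono mult_left_mono) auto
      finally show ?thesis .
    qed
    let ?b = "\<epsilon> * w + 1 / \<epsilon> ^ (?N - 1) * ?d k"
    have d0: "0 \<le> (LINT x|lborel. \<bar>u' x - \<phi> k x\<bar> ^ ?N)" "0 \<le> (LINT x|lborel. norm (g x
      - gradient (\<phi> k) x) ^ ?N)"
      by simp_all
    have b0: "?b \<ge> 0" using \<epsilon> w d0 by simp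
    have rk: "\<And>x. x \<notin> \<Omega> \<Longrightarrow> u' x - \<phi> k x = 0" "\<And>x. x \<notin>
      \<Omega> \<Longrightarrow> g x - gradient (\<phi> k) x = 0"
      "integrable lborel (\<lambda>x. \<bar>u' x - \<phi> k x\<bar> ^ ?N)" "integrable lborel (\<lambda>x.
        norm (g x - gradient (\<phi> k) x) ^ ?N)"
      using rep[of k] unfolding sobolev_rep_def by blast+
    have A: "(\<integral>\<^sup>+x. ennreal \<bar>u' x - \<phi> k x\<bar> \<partial>lborel) \<le> ennreal ?b"
      using rk d0 by (intro N1) auto
    have B: "(\<integral>\<^sup>+x. ennreal (norm (g x - gradient (\<phi> k) x)) \<partial>lborel) \<le> ennreal ?b"
      using rk d0 by (intro N1) auto
    let ?e = "\<lambda>x. \<integral>\<^sup>+y. ennreal (F (g y - gradient (\<phi> k) y)) * ?k (x - y)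
      \<partial>lborel"
    have pt: "(ennreal (?c * \<bar>u' x\<bar>) - J x) * indicator \<Omega> x \<le> ennreal ?c * ennreal
      \<bar>u' x - \<phi> k x\<bar> + ?e x * indicator \<Omega> x" for x
    proof (cases "x \<in> \<Omega>")
      case True
      have "ennreal (?c * \<bar>\<phi> k x\<bar>) \<le> (\<integral>\<^sup>+y. ennreal (F (gradient (\<phi>
        k) y) * P (x - y) powr - (real ?N - 1)) \<partial>lborel)"
        by (rule potential_test[OF \<phi>])
      also have "\<dots> \<le> (\<integral>\<^sup>+y. (ennreal (F (g y)) * ?k (x - y) + ennreal (F (g y -
        gradient (\<phi> k) y)) * ?k (x - y)) \<partial>lborel)"
      proof (rule nn_integral_mono)
        fix y
        have "F (gradient (\<phi> k) y) \<le> F (g y) + F (g y - gradient (\<phi> k) y)"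
          using norm_like_triangle[OF F_norm_like, of "g y" "- (g y - gradient (\<phi> k) y)"]
            norm_like_minus[OF F_norm_like, of "g y - gradient (\<phi> k) y"] by simp
        then have "F (gradient (\<phi> k) y) * P (x - y) powr - (real ?N - 1) \<le> F (g y) * P (x - y) powr
          - (real ?N - 1) + F (g y - gradient (\<phi> k) y) * P (x - y) powr - (real ?N - 1)"
          by (metis distrib_right mult_right_mono powr_ge_zero)
        then show "ennreal (F (gradient (\<phi> k) y) * P (x - y) powr - (real ?N - 1)) \<le> ennreal (F (g
          y)) * ?k (x - y) + ennreal (F (g y - gradient (\<phi> k) y)) * ?k (x - y)"
          using norm_like_nonneg[OF F_norm_like]
          by (simp add: ennreal_mult[symmetric] ennreal_plus[symmetric] ennreal_leI del: ennreal_plus)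
      qed
      also have "\<dots> = J x + ?e x"
        unfolding J_def by (rule nn_integral_add) measurable
      finally have 1: "ennreal (?c * \<bar>\<phi> k x\<bar>) \<le> J x + ?e x" .
      have "\<bar>u' x\<bar> \<le> \<bar>u' x - \<phi> k x\<bar> + \<bar>\<phi> k x\<bar>" by simp
      then have "?c * \<bar>u' x\<bar> \<le> ?c * \<bar>u' x - \<phi> k x\<bar> + ?c * \<bar>\<phi> k x\<bar>"
        using c by (metis distrib_left mult_left_mono less_imp_le)
      then have "ennreal (?c * \<bar>u' x\<bar>) \<le> ennreal ?c * ennreal \<bar>u' x - \<phi> k x\<bar> +
        ennreal (?c * \<bar>\<phi> k x\<bar>)"
        using c by (simp add: ennreal_mult[symmetric] ennreal_plus[symmetric] ennreal_leI del: ennreal_plus)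
      also have "\<dots> \<le> ennreal ?c * ennreal \<bar>u' x - \<phi> k x\<bar> + (J x + ?e x)"
        by (intro add_left_mono 1)
      finally have "ennreal (?c * \<bar>u' x\<bar>) \<le> J x + (ennreal ?c * ennreal \<bar>u' x - \<phi> k
        x\<bar> + ?e x)"
        by (simp add: ac_simps)
      then have "ennreal (?c * \<bar>u' x\<bar>) - J x \<le> ennreal ?c * ennreal \<bar>u' x - \<phi> k
        x\<bar> + ?e x"
        by (simp add: ennreal_minus_le_iff)
      then show ?thesis using True by simp
    qed simp
    have "?X \<le> (\<integral>\<^sup>+x. (ennreal ?c * ennreal \<bar>u' x - \<phi> k x\<bar> + ?e x *
      indicator \<Omega> x) \<partial>lborel)"
      by (rule nn_integral_mono[OF pt])
    also have "\<dots> = ennreal ?c * (\<integral>\<^sup>+x. ennreal \<bar>u' x - \<phi> k x\<bar>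
      \<partial>lborel) + (\<integral>\<^sup>+x. ?e x * indicator \<Omega> x \<partial>lborel)"
      by (subst nn_integral_add) (auto simp: nn_integral_cmult)
    also have "(\<integral>\<^sup>+x. ?e x * indicator \<Omega> x \<partial>lborel) \<le> M *
      (\<integral>\<^sup>+y. ennreal (F (g y - gradient (\<phi> k) y)) \<partial>lborel)"
      unfolding M_def using rk R norm_like_0[OF F_norm_like] by (intro convolution_bound) auto
    also have "(\<integral>\<^sup>+y. ennreal (F (g y - gradient (\<phi> k) y)) \<partial>lborel) \<le>
      (\<integral>\<^sup>+y. ennreal C * ennreal (norm (g y - gradient (\<phi> k) y)) \<partial>lborel)"
      using C by (intro nn_integral_mono) (auto simp: ennreal_mult[symmetric] intro: ennreal_leI)
    also have "\<dots> = ennreal C * (\<integral>\<^sup>+y. ennreal (norm (g y - gradient (\<phi> k) y))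
      \<partial>lborel)"
      by (rule nn_integral_cmult) measurable
    also note B
    also note A
    finally have "?X \<le> ennreal ?c * ennreal ?b + M * (ennreal C * ennreal ?b)"
      by (simp add: add_mono mult_left_mono)
    also have "\<dots> = ennreal ((?c + m * C) * ?b)"
    proof -
      have "ennreal c * ennreal b + ennreal m * (ennreal C * ennreal b) = ennreal ((c + m * C) * b)"
        if "0 \<le> c" "0 \<le> m" "0 \<le> C" "0 \<le> b" for c m C b :: real
        using that by (simp add: ennreal_mult[symmetric] ennreal_plus[symmetric] distrib_right mult.assoc
          del: ennreal_plus)
      from this[OF less_imp_le[OF c] m(2) less_imp_le[OF C(1)] b0] show ?thesis unfolding m(1) .
    qed
    finally show ?thesis .
  qed
  \<comment> \<open>First \<open>k\<close> tends to infinity for fixed \<open>\<epsilon>\<close>,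
    which removes the term with \<open>1 / \<epsilon> ^ (N - 1)\<close>; only then is
    \<open>\<epsilon>\<close> sent to 0.\<close>
  have lim0: "?X \<le> ennreal ((?c + m * C) * (\<epsilon> * w))" if \<epsilon>: "\<epsilon> > 0" for \<epsilon>
  proof -
    have "(\<lambda>k. ennreal ((?c + m * C) * (\<epsilon> * w + 1 / \<epsilon> ^ (?N - 1) * ?d k)))
      \<longlonglongrightarrow> ennreal ((?c + m * C) * (\<epsilon> * w + 1 / \<epsilon> ^ (?N - 1) * 0))"
      by (intro tendsto_ennrealI tendsto_mult tendsto_add tendsto_const lim)
    then have "?X \<le> ennreal ((?c + m * C) * (\<epsilon> * w + 1 / \<epsilon> ^ (?N - 1) * 0))"
      using est[OF \<epsilon>] by (intro LIMSEQ_le_const) auto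
    then show ?thesis by simp
  qed
  have *: "?X \<le> ennreal ((?c + m * C) * (1 / real (Suc j) * w))" for j by (rule lim0) simp
  have "(\<lambda>j. ennreal ((?c + m * C) * (1 / real (Suc j) * w))) \<longlonglongrightarrow> ennreal ((?c
    + m * C) * (0 * w))"
    by (intro tendsto_ennrealI tendsto_mult tendsto_const LIMSEQ_Suc[OF lim_1_over_n])
  then have "?X \<le> ennreal ((?c + m * C) * (0 * w))"
    using * by (intro LIMSEQ_le_const) blast+
  then have "?X = 0" by simp
  then have "AE x in lborel. (ennreal (?c * \<bar>u' x\<bar>) - J x) * indicator \<Omega> x = 0"
    by (subst (asm) nn_integral_0_iff_AE) auto
  then show ?thesis
  proof eventually_elim
    case (elim x)
    then show ?case unfolding J_def[symmetric]
      by (auto simp: indicator_def diff_eq_0_iff_ennreal split: if_splits)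
  qed
qed

end

section \<open>Exponential integrability\<close>

text \<open>Positive upper bounds \<open>A\<close> and \<open>B\<close> take the place of the two
  integrals, so that the normalisation before Young's inequality is possible even when an integral
  is 0.\<close>

lemma nn_integral_Holder:
  fixes f g :: "'a \<Rightarrow> real"
  assumes [measurable]: "f \<in> borel_measurable M" "g \<in> borel_measurable M"
    and nn: "\<And>x. 0 \<le> f x" "\<And>x. 0 \<le> g x" and p: "1 < p" "1 / p + 1 / q = 1"
    and A: "(\<integral>\<^sup>+x. ennreal (f x powr p) \<partial>M) \<le> ennreal A" "0 < A"
    and B: "(\<integral>\<^sup>+x. ennreal (g x powr q) \<partial>M) \<le> ennreal B" "0 < B"
  shows "(\<integral>\<^sup>+x. ennreal (f x * g x) \<partial>M) \<le> ennreal (A powr (1 / p) * B powr (1 / q))"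
proof -
  have q: "1 < q"
  proof -
    have "1 / q = 1 - 1 / p" "0 < 1 / p" "1 / p < 1" using p by auto
    then have "0 < 1 / q" "1 / q < 1" by auto
    then show ?thesis by (simp add: divide_less_eq split: if_splits)
  qed
  let ?a = "A powr (1 / p)" and ?b = "B powr (1 / q)"
  have ab: "0 < ?a" "0 < ?b" using A B by auto
  have "(\<integral>\<^sup>+x. ennreal (f x * g x) \<partial>M) \<le> (\<integral>\<^sup>+x. (ennreal (?a *
    ?b / (p * A)) * ennreal (f x powr p) + ennreal (?a * ?b / (q * B)) * ennreal (g x powr q)) \<partial>M)"
  proof (rule nn_integral_mono)
    fix x
    have "f x / ?a * (g x / ?b) \<le> (f x / ?a) powr p / p + (g x / ?b) powr q / q"
      using p q nn ab by (intro Youngs_inequality) auto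
    also have "(f x / ?a) powr p = f x powr p / A" using A p ab nn by (simp add: powr_divide powr_powr)
    also have "(g x / ?b) powr q = g x powr q / B" using B q ab nn by (simp add: powr_divide powr_powr)
    finally have "(?a * ?b) * (f x / ?a * (g x / ?b)) \<le> (?a * ?b) * (f x powr p / A / p + g x powr q / B / q)"
      using ab by (intro mult_left_mono) auto
    then have "f x * g x \<le> ?a * ?b / (p * A) * f x powr p + ?a * ?b / (q * B) * g x powr q"
      using ab by (simp add: distrib_left mult_ac)
    then show "ennreal (f x * g x) \<le> ennreal (?a * ?b / (p * A)) * ennreal (f x powr p) + ennreal (?a *
      ?b / (q * B)) * ennreal (g x powr q)"
      using ab A B p q by (simp add: ennreal_mult[symmetric] ennreal_plus[symmetric] ennreal_leI del: ennreal_plus)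
  qed
  also have "\<dots> = ennreal (?a * ?b / (p * A)) * (\<integral>\<^sup>+x. ennreal (f x powr p) \<partial>M)
    + ennreal (?a * ?b / (q * B)) * (\<integral>\<^sup>+x. ennreal (g x powr q) \<partial>M)"
    by (subst nn_integral_add) (auto simp: nn_integral_cmult)
  also have "\<dots> \<le> ennreal (?a * ?b / (p * A)) * ennreal A + ennreal (?a * ?b / (q * B)) * ennreal B"
    by (intro add_mono mult_left_mono A B) auto
  also have "\<dots> = ennreal (?a * ?b / (p * A) * A + ?a * ?b / (q * B) * B)"
    using ab A(2) B(2) p q by (simp add: ennreal_mult[symmetric] ennreal_plus[symmetric] del: ennreal_plus)
  also have "?a * ?b / (p * A) * A + ?a * ?b / (q * B) * B = ?a * ?b * (1 / p + 1 / q)"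
    using A(2) B(2) p(1) q by (simp add: distrib_left)
  finally show ?thesis using p by simp
qed

text \<open>Splitting at \<open>a = \<eta> * b\<close> keeps the coefficient of the main term
  \<open>b\<close> as close to 1 as desired and charges the rest to \<open>a\<close>, which is
  bounded in the application.\<close>

lemma powr_add_le_eta:
  assumes "0 \<le> a" "0 \<le> (b::real)" "0 < \<eta>" "0 < p"
  shows "(a + b) powr p \<le> (1 + \<eta>) powr p * b powr p + (1 + 1 / \<eta>) powr p * a powr p"
proof (cases "a \<le> \<eta> * b")
  case True
  have "(a + b) powr p \<le> ((1 + \<eta>) * b) powr p" using True assms by (intro powr_mono2) (auto simp:
    algebra_simps)
  then show ?thesis using assms by (simp add: powr_mult add_increasing2)
next
  case False
  have "b \<le> a / \<eta>" using False assms by (simp add: field_simps)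
  then have "(a + b) powr p \<le> ((1 + 1 / \<eta>) * a) powr p" using assms by (intro powr_mono2) (auto
    simp: algebra_simps)
  then show ?thesis using assms by (simp add: powr_mult add_increasing)
qed

text \<open>A form of Young's inequality, by comparing \<open>b\<close> with
  \<open>a powr (N - q)\<close>. It separates the potential from the weight: for
  \<open>b = P x powr - \<beta>\<close> the resulting singularity has order
  \<open>\<beta> * N / (N - q)\<close>, which is below \<open>N\<close> when
  \<open>q < N - \<beta>\<close>.\<close>

lemma weighted_power_bound:
  fixes a b q N :: real
  assumes a: "1 \<le> a" and b: "0 < b" and q: "0 \<le> q" "q < N"
  shows "a powr q * b \<le> a powr N + b powr (N / (N - q))"
proof (cases "b \<le> a powr (N - q)")
  case True
  have "a powr q * b \<le> a powr q * a powr (N - q)" using True by (intro mult_left_mono) auto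
  also have "\<dots> = a powr N" using a by (simp add: powr_add[symmetric])
  finally show ?thesis by (simp add: add_increasing2)
next
  case False
  have "a = (a powr (N - q)) powr (1 / (N - q))" using a q by (simp add: powr_powr)
  also have "\<dots> \<le> b powr (1 / (N - q))" using False q by (intro powr_mono2) auto
  finally have "a powr q \<le> (b powr (1 / (N - q))) powr q" using a q by (intro powr_mono2) auto
  then have "a powr q * b \<le> (b powr (1 / (N - q))) powr q * b" using b by (intro mult_right_mono) auto
  also have "\<dots> = b powr (q / (N - q) + 1)" using b by (simp add: powr_powr powr_add)
  also have "q / (N - q) + 1 = N / (N - q)" using q by (simp add: field_simps)
  finally show ?thesis by (simp add: add_increasing)
qed

lemma ennreal_power_add_le: "(1 + (x::ennreal)) ^ n \<le> 2 ^ n * (1 + x ^ n)"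
proof -
  have "1 + x \<le> 2 * max 1 x" by (cases "x \<le> 1") (auto simp: max_def mult_2 add_mono not_le less_imp_le)
  then have "(1 + x) ^ n \<le> (2 * max 1 x) ^ n" by (rule power_mono) simp
  also have "\<dots> = 2 ^ n * max 1 x ^ n" by (simp add: power_mult_distrib)
  also have "\<dots> \<le> 2 ^ n * (1 + x ^ n)" by (intro mult_left_mono) (auto simp: max_def add_increasing
    add_increasing2)
  finally show ?thesis .
qed

locale anisotropic_ge2 = anisotropic F for F :: "real^'n \<Rightarrow> real" +
  assumes N2: "2 \<le> CARD('n)"
begin

lemma conjugate_exponents: "1 < real CARD('n)" "1 / real CARD('n) + 1 / (real CARD('n) / (real CARD('n) - 1))
  = 1" "1 / (real CARD('n) / (real CARD('n) - 1)) = (real CARD('n) - 1) / real CARD('n)"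
  using N2 by (auto simp: field_simps)

text \<open>Exhibits \<open>N * unit_vol P\<close>, the constant of the potential estimate; this is
  where the sharp constant and that estimate meet.\<close>

lemma lambda_eq: "lambda_N F = real CARD('n) * (real CARD('n) * unit_vol P) powr (1 / (real CARD('n) - 1))"
proof -
  have "real CARD('n) powr (real CARD('n) / (real CARD('n) - 1)) = real CARD('n) powr (1 + 1 / (real CARD('n)
    - 1))" using conjugate_exponents(1) by (simp add: field_simps)
  also have "\<dots> = real CARD('n) * real CARD('n) powr (1 / (real CARD('n) - 1))" using
    conjugate_exponents(1) by (simp add: powr_add)
  finally show ?thesis
    using conjugate_exponents(1) unit_vol_pos[OF polar_norm_like] by (simp add: lambda_N_def Let_def
      wulff_volume_eq powr_mult)
qed

text \<open>Here \<open>i\<close> is the truncated potential at \<open>x\<close> with the more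
  singular kernel of exponent \<open>N - 1 + s\<close>. The local energy enters only through the
  middle region, and the inner radius trades its logarithm against \<open>i\<close>.\<close>

lemma potential_pointwise:
  fixes f :: "real^'n \<Rightarrow> real"
  assumes f[measurable]: "f \<in> borel_measurable borel" and f0: "\<And>y. 0 \<le> f y" "\<And>y. y \<notin>
    \<Omega> \<Longrightarrow> f y = 0"
    and \<Omega>[measurable]: "\<Omega> \<in> sets borel" and w: "emeasure lborel \<Omega> \<le> ennreal w"
      "0 \<le> w"
    and f1: "(\<integral>\<^sup>+y. ennreal (f y ^ CARD('n)) \<partial>lborel) \<le> 1"
    and r: "0 < r" and s: "0 < s" "s < 1" and E: "0 < E"
    and fE: "(\<integral>\<^sup>+y. ennreal (f y ^ CARD('n)) * indicator {y. P (x - y) \<le> r} y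
      \<partial>lborel) \<le> ennreal E"
    and i: "(\<integral>\<^sup>+y. ennreal (f y * (P (x - y) powr - (real CARD('n) - 1 + s) * indicator {z. P
      z \<le> r} (x - y))) \<partial>lborel) = ennreal i" "0 \<le> i"
  shows "(\<integral>\<^sup>+y. ennreal (f y) * ennreal (P (x - y) powr - (real CARD('n) - 1)) \<partial>lborel) \<le>
    ennreal (r powr s + r powr - (real CARD('n) - 1) * (w + 1) +
      E powr (1 / real CARD('n)) * (real CARD('n) * unit_vol P * (ln (1 + i) / s + 1)) powr ((real CARD('n) -
        1) / real CARD('n)))"
proof -
  \<comment> \<open>With this choice \<open>\<delta> powr s * i\<close> is at most
    \<open>r powr s\<close>, while \<open>ln (r / \<delta>)\<close> equals
    \<open>ln (1 + i) / s\<close>.\<close>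
  define \<delta> where "\<delta> = r * (1 + i) powr - (1 / s)"
  have "(1 + i) powr - (1 / s) \<le> (1 + i) powr 0" using i s by (intro powr_mono) auto
  then have \<delta>: "0 < \<delta>" "\<delta> \<le> r"
    using r i s unfolding \<delta>_def by (auto intro!: mult_left_le)
  have Pnn: "0 \<le> P z" for z by (rule norm_like_nonneg[OF polar_norm_like])
  let ?A = "\<lambda>y. ennreal (\<delta> powr s) * ennreal (f y * (P (x - y) powr - (real CARD('n) - 1 + s)
    * indicator {z. P z \<le> r} (x - y)))"
  let ?B = "\<lambda>y. ennreal ((f y * indicator {y. P (x - y) \<le> r} y) * (P (x - y) powr - (real
    CARD('n) - 1) * indicator {\<delta>..r} (P (x - y))))"
  let ?C = "\<lambda>y. ennreal (r powr - (real CARD('n) - 1)) * ennreal (f y)"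
  have "(\<integral>\<^sup>+y. ennreal (f y) * ennreal (P (x - y) powr - (real CARD('n) - 1))
    \<partial>lborel) \<le> (\<integral>\<^sup>+y. (?A y + (?B y + ?C y)) \<partial>lborel)"
  proof (rule nn_integral_mono)
    fix y
    consider "P (x - y) < \<delta>" | "\<delta> \<le> P (x - y)" "P (x - y) \<le> r" | "r < P (x - y)" by linarith
    then show "ennreal (f y) * ennreal (P (x - y) powr - (real CARD('n) - 1)) \<le> ?A y + (?B y + ?C y)"
    proof cases
      case 1
      have "P (x - y) powr - (real CARD('n) - 1) \<le> \<delta> powr s * P (x - y) powr - (real CARD('n) - 1 + s)"
      proof (cases "P (x - y) = 0")
        case False
        have "P (x - y) powr - (real CARD('n) - 1) = P (x - y) powr s * P (x - y) powr - (real CARD('n) - 1 + s)"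
          by (simp add: powr_add[symmetric])
        also have "\<dots> \<le> \<delta> powr s * P (x - y) powr - (real CARD('n) - 1 + s)"
          using 1 s Pnn by (intro mult_right_mono powr_mono2) auto
        finally show ?thesis .
      qed simp
      then have "f y * P (x - y) powr - (real CARD('n) - 1) \<le> f y * (\<delta> powr s * P (x - y) powr -
        (real CARD('n) - 1 + s))"
        using f0 by (intro mult_left_mono) auto
      then have "ennreal (f y) * ennreal (P (x - y) powr - (real CARD('n) - 1)) \<le> ?A y"
        using 1 \<delta> f0 by (simp add: ennreal_mult[symmetric] ennreal_leI mult_ac)
      then show ?thesis by (rule order_trans) simp
    next
      case 2
      have "ennreal (f y) * ennreal (P (x - y) powr - (real CARD('n) - 1)) = ?B y"
        using 2 f0 by (simp add: ennreal_mult[symmetric])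
      then show ?thesis by (simp add: add_increasing)
    next
      case 3
      have "P (x - y) powr - (real CARD('n) - 1) \<le> r powr - (real CARD('n) - 1)"
        using 3 r conjugate_exponents(1) by (intro powr_mono2') auto
      then have "ennreal (f y) * ennreal (P (x - y) powr - (real CARD('n) - 1)) \<le> ?C y"
        using f0 by (simp add: ennreal_mult[symmetric] mult.commute ennreal_leI mult_left_mono)
      then show ?thesis by (meson add_increasing order_trans zero_le)
    qed
  qed
  also have "\<dots> = (\<integral>\<^sup>+y. ?A y \<partial>lborel) + ((\<integral>\<^sup>+y. ?B y
    \<partial>lborel) + (\<integral>\<^sup>+y. ?C y \<partial>lborel))"
    by (subst nn_integral_add, measurable, subst nn_integral_add, measurable)
  also have "(\<integral>\<^sup>+y. ?A y \<partial>lborel) \<le> ennreal (r powr s)"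
  proof -
    have "(\<integral>\<^sup>+y. ?A y \<partial>lborel) = ennreal (\<delta> powr s) * ennreal i"
      by (subst nn_integral_cmult) (auto simp: i(1)[symmetric])
    also have "\<dots> = ennreal (\<delta> powr s * i)" using i by (simp add: ennreal_mult)
    also have "\<delta> powr s * i \<le> r powr s"
    proof -
      have "\<delta> powr s = r powr s * (1 + i) powr - 1"
        unfolding \<delta>_def using r i s by (simp add: powr_mult powr_powr)
      also have "\<dots> = r powr s / (1 + i)" using i by (simp add: powr_minus_divide)
      finally have "\<delta> powr s * i = r powr s * (i / (1 + i))" by simp
      also have "\<dots> \<le> r powr s * 1" using i by (intro mult_left_mono) (auto simp: field_simps)
      finally show ?thesis by simp
    qed
    finally show ?thesis by (simp add: ennreal_leI)
  qed
  also have "(\<integral>\<^sup>+y. ?B y \<partial>lborel) \<le> ennreal (E powr (1 / real CARD('n)) * (real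
    CARD('n) * unit_vol P * (ln (1 + i) / s + 1)) powr (1 / (real CARD('n) / (real CARD('n) - 1))))"
  proof (rule nn_integral_Holder)
    show "(\<integral>\<^sup>+y. ennreal ((f y * indicator {y. P (x - y) \<le> r} y) powr real CARD('n))
      \<partial>lborel) \<le> ennreal E"
    proof -
      have "(\<integral>\<^sup>+y. ennreal ((f y * indicator {y. P (x - y) \<le> r} y) powr real CARD('n))
        \<partial>lborel) = (\<integral>\<^sup>+y. ennreal (f y ^ CARD('n)) * indicator {y. P (x - y) \<le>
        r} y \<partial>lborel)"
        using f0 by (intro nn_integral_cong) (auto simp: powr_CARD indicator_def)
      then show ?thesis using fE by simp
    qed
    show "(\<integral>\<^sup>+y. ennreal ((P (x - y) powr - (real CARD('n) - 1) * indicator {\<delta>..r} (P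
      (x - y))) powr (real CARD('n) / (real CARD('n) - 1))) \<partial>lborel) \<le> ennreal (real CARD('n) *
      unit_vol P * (ln (1 + i) / s + 1))"
    proof -
      have "(\<integral>\<^sup>+y. ennreal ((P (x - y) powr - (real CARD('n) - 1) * indicator {\<delta>..r}
        (P (x - y))) powr (real CARD('n) / (real CARD('n) - 1))) \<partial>lborel)
        = (\<integral>\<^sup>+y. ennreal (P (x - y) powr - real CARD('n)) * indicator {\<delta>..r} (P (x -
          y)) \<partial>lborel)"
      proof -
        have "(1 - real CARD('n)) * real CARD('n) / (real CARD('n) - 1) = - real CARD('n)" using
          conjugate_exponents(1) by (simp add: field_simps)
        then show ?thesis by (intro nn_integral_cong) (auto simp: indicator_def powr_powr)
      qed
      also have "\<dots> = (\<integral>\<^sup>+z. ennreal (P z powr - real CARD('n)) * indicator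
        {\<delta>..r} (P z) \<partial>lborel)"
        by (rule nn_integral_reflect_translate[of "\<lambda>z. ennreal (P z powr - real CARD('n)) * indicator
          {\<delta>..r} (P z)"]) measurable
      also have "\<dots> = ennreal (real CARD('n) * unit_vol P * ln (r / \<delta>))"
        by (rule nn_integral_annulus[OF polar_norm_like \<delta>])
      also have "r / \<delta> = (1 + i) powr (1 / s)"
        using r i by (simp add: \<delta>_def powr_minus_divide)
      also have "ln ((1 + i) powr (1 / s)) = ln (1 + i) / s" using i by (simp add: ln_powr)
      \<comment> \<open>The added 1 keeps the bound positive when \<open>i = 0\<close>, as the form
        of Hoelder's inequality used here demands.\<close>
      also have "ennreal (real CARD('n) * unit_vol P * (ln (1 + i) / s)) \<le> ennreal (real CARD('n) *
        unit_vol P * (ln (1 + i) / s + 1))"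
        using unit_vol_pos[OF polar_norm_like] by (intro ennreal_leI mult_left_mono) auto
      finally show ?thesis .
    qed
    show "0 < real CARD('n) * unit_vol P * (ln (1 + i) / s + 1)"
      using unit_vol_pos[OF polar_norm_like] conjugate_exponents(1) i s by (intro mult_pos_pos) (auto intro!:
        add_nonneg_pos divide_nonneg_nonneg)
  qed (use f0 E conjugate_exponents in \<open>auto\<close>)
  also have "(\<integral>\<^sup>+y. ?C y \<partial>lborel) \<le> ennreal (r powr - (real CARD('n) - 1) * (w + 1))"
  proof -
    have "(\<integral>\<^sup>+y. ennreal (f y) \<partial>lborel) \<le> ennreal 1 * emeasure lborel \<Omega> +
      ennreal (1 / 1 ^ (CARD('n) - 1)) * (\<integral>\<^sup>+x. ennreal (f x ^ CARD('n)) \<partial>lborel)"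
      using f0 by (intro nn_integral_le_eps) auto
    also have "\<dots> \<le> ennreal w + 1" using w f1 by (simp add: add_mono)
    also have "\<dots> = ennreal (w + 1)" using w by simp
    finally have "ennreal (r powr - (real CARD('n) - 1)) * (\<integral>\<^sup>+y. ennreal (f y)
      \<partial>lborel) \<le> ennreal (r powr - (real CARD('n) - 1)) * ennreal (w + 1)"
      by (rule mult_left_mono) simp
    then show ?thesis using w by (simp add: nn_integral_cmult ennreal_mult)
  qed
  finally have "(\<integral>\<^sup>+y. ennreal (f y) * ennreal (P (x - y) powr - (real CARD('n) - 1))
    \<partial>lborel) \<le> ennreal (r powr s) +
      (ennreal (E powr (1 / real CARD('n)) * (real CARD('n) * unit_vol P * (ln (1 + i) / s + 1)) powr (1 /
        (real CARD('n) / (real CARD('n) - 1)))) + ennreal (r powr - (real CARD('n) - 1) * (w + 1)))"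
    by (simp add: add_mono)
  also have "\<dots> = ennreal (r powr s + r powr - (real CARD('n) - 1) * (w + 1) + E powr (1 / real
    CARD('n)) * (real CARD('n) * unit_vol P * (ln (1 + i) / s + 1)) powr ((real CARD('n) - 1) / real CARD('n)))"
    using w by (simp add: ennreal_plus[symmetric] conjugate_exponents(3) del: ennreal_plus)
  finally show ?thesis .
qed

text \<open>Hoelder after factoring \<open>k\<close> as \<open>k powr (1 / N)\<close> times
  \<open>k powr ((N - 1) / N)\<close>. It puts \<open>f ^ N\<close> under a single kernel, ready for
  the convolution bound.\<close>

lemma riesz_power_bound:
  fixes f k :: "real^'n \<Rightarrow> real"
  assumes f[measurable]: "f \<in> borel_measurable borel" and k[measurable]: "k \<in> borel_measurable borel"
    and nn: "\<And>y. 0 \<le> f y" "\<And>y. 0 \<le> k y" and M: "(\<integral>\<^sup>+z. ennreal (k z)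
      \<partial>lborel) \<le> ennreal M" "0 < M"
  shows "(\<integral>\<^sup>+y. ennreal (f y * k (x - y)) \<partial>lborel) ^ CARD('n) \<le>
    ennreal (M ^ (CARD('n) - 1)) * (\<integral>\<^sup>+y. ennreal (f y ^ CARD('n)) * ennreal (k (x - y))
      \<partial>lborel)"
    (is "?I ^ _ \<le> _ * ?J")
proof (cases "?J = \<infinity>")
  case True
  then show ?thesis using M(2) by (simp add: ennreal_mult_top)
next
  case False
  then obtain j where j: "?J = ennreal j" "0 \<le> j" by (cases ?J) auto
  \<comment> \<open>Since \<open>j\<close> may be 0, the positive bound \<open>j + e\<close> is used
    and \<open>e\<close> sent to 0 afterwards.\<close>
  have "?I ^ CARD('n) \<le> ennreal ((j + e) * M ^ (CARD('n) - 1))" if e: "0 < e" for e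
  proof -
    have "(\<integral>\<^sup>+y. ennreal ((f y * k (x - y) powr (1 / real CARD('n))) * k (x - y) powr ((real
      CARD('n) - 1) / real CARD('n))) \<partial>lborel) \<le> ennreal ((j + e) powr (1 / real CARD('n)) * M
      powr (1 / (real CARD('n) / (real CARD('n) - 1))))"
    proof (rule nn_integral_Holder)
      have "(\<integral>\<^sup>+y. ennreal ((f y * k (x - y) powr (1 / real CARD('n))) powr real CARD('n))
        \<partial>lborel) = ?J"
        using nn by (intro nn_integral_cong) (auto simp: powr_mult powr_powr powr_CARD ennreal_mult)
      also have "\<dots> \<le> ennreal (j + e)" using j e by (simp add: ennreal_leI)
      finally show "(\<integral>\<^sup>+y. ennreal ((f y * k (x - y) powr (1 / real CARD('n))) powr real
        CARD('n)) \<partial>lborel) \<le> ennreal (j + e)" .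
      have "(\<integral>\<^sup>+y. ennreal ((k (x - y) powr ((real CARD('n) - 1) / real CARD('n))) powr (real
        CARD('n) / (real CARD('n) - 1))) \<partial>lborel) = (\<integral>\<^sup>+y. ennreal (k (x - y))
        \<partial>lborel)"
        using nn conjugate_exponents(1) by (intro nn_integral_cong) (auto simp: powr_powr)
      also have "\<dots> = (\<integral>\<^sup>+y. ennreal (k y) \<partial>lborel)"
        by (rule nn_integral_reflect_translate[of "\<lambda>z. ennreal (k z)"]) measurable
      finally show "(\<integral>\<^sup>+y. ennreal ((k (x - y) powr ((real CARD('n) - 1) / real CARD('n)))
        powr (real CARD('n) / (real CARD('n) - 1))) \<partial>lborel) \<le> ennreal M" using M by simp
    qed (use nn M conjugate_exponents j e in auto)
    also have "(\<integral>\<^sup>+y. ennreal ((f y * k (x - y) powr (1 / real CARD('n))) * k (x - y) powr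
      ((real CARD('n) - 1) / real CARD('n))) \<partial>lborel) = ?I"
    proof (rule nn_integral_cong)
      fix y
      have "k (x - y) powr (1 / real CARD('n)) * k (x - y) powr ((real CARD('n) - 1) / real CARD('n)) = k (x - y)"
        using nn(2)[of "x - y"] conjugate_exponents(1) by (simp add: powr_add[symmetric]
          add_divide_distrib[symmetric])
      then show "ennreal ((f y * k (x - y) powr (1 / real CARD('n))) * k (x - y) powr ((real CARD('n) - 1) /
        real CARD('n))) = ennreal (f y * k (x - y))"
        by (simp add: mult.assoc)
    qed
    finally have "?I ^ CARD('n) \<le> ennreal ((j + e) powr (1 / real CARD('n)) * M powr (1 / (real CARD('n)
      / (real CARD('n) - 1)))) ^ CARD('n)"
      by (rule power_mono) simp
    also have "\<dots> = ennreal (((j + e) powr (1 / real CARD('n)) * M powr ((real CARD('n) - 1) / real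
      CARD('n))) ^ CARD('n))"
      by (simp add: ennreal_power conjugate_exponents(3))
    also have "((j + e) powr (1 / real CARD('n)) * M powr ((real CARD('n) - 1) / real CARD('n))) ^ CARD('n) =
      (j + e) * M powr (real CARD('n) - 1)"
      using j e M conjugate_exponents(1) by (simp add: powr_CARD[symmetric] powr_mult powr_powr)
    also have "M powr (real CARD('n) - 1) = M ^ (CARD('n) - 1)"
      using powr_realpow[OF M(2), of "CARD('n) - 1"] N2 by (simp add: of_nat_diff)
    finally show ?thesis .
  qed
  then have *: "?I ^ CARD('n) \<le> ennreal ((j + 1 / real (Suc m)) * M ^ (CARD('n) - 1))" for m by simp
  have "(\<lambda>m. ennreal ((j + 1 / real (Suc m)) * M ^ (CARD('n) - 1))) \<longlonglongrightarrow> ennreal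
    ((j + 0) * M ^ (CARD('n) - 1))"
    by (intro tendsto_ennrealI tendsto_intros LIMSEQ_Suc[OF lim_1_over_n])
  then have "?I ^ CARD('n) \<le> ennreal ((j + 0) * M ^ (CARD('n) - 1))"
    using * by (intro LIMSEQ_le_const) blast+
  then show ?thesis using j M by (simp add: ennreal_mult mult.commute)
qed

text \<open>The additive constant depends on \<open>s\<close>, which is chosen here, and is
  therefore passed as a function \<open>ca\<close>; it disappears into \<open>C\<close>. What
  decides is the coefficient of \<open>ln (1 + i)\<close>: the losses from \<open>1 / s\<close> and
  from \<open>\<eta>\<close> must still leave \<open>q < N - \<beta>\<close>.\<close>

lemma exp_pointwise:
  assumes \<beta>: "0 \<le> \<beta>" "\<beta> < real CARD('n)" and p: "0 < p" and E: "0 < E" "p * E powr (1 /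
    (real CARD('n) - 1)) < 1"
    and ca: "\<And>s :: real. 0 \<le> (ca s :: real)"
  shows "\<exists>s C q. 0 < s \<and> s < 1 \<and> 0 < C \<and> 0 \<le> q \<and> q < real CARD('n) - \<beta> \<and>
    (\<forall>v i. 0 \<le> v \<longrightarrow> 0 \<le> i \<longrightarrow> real CARD('n) * unit_vol P * v
      \<le> ca s + E powr (1 / real CARD('n)) * (real CARD('n) * unit_vol P * (ln (1 + i) / s + 1)) powr
      ((real CARD('n) - 1) / real CARD('n)) \<longrightarrow>
      exp (lambda_N F * (1 - \<beta> / real CARD('n)) * p * v powr (real CARD('n) / (real CARD('n) - 1)))
        \<le> C * (1 + i) powr q)"
proof -
  let ?N = "real CARD('n)"
  let ?p = "?N / (?N - 1)"
  define K where "K = ?N * unit_vol P"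
  have K: "K > 0" using unit_vol_pos[OF polar_norm_like] by (simp add: K_def)
  define \<tau> where "\<tau> = p * E powr (1 / (?N - 1))"
  have \<tau>: "0 < \<tau>" "\<tau> < 1" using p E by (auto simp: \<tau>_def)
  \<comment> \<open>The midpoint of \<open>sqrt \<tau>\<close> and 1, so that \<open>\<tau>\<close>
    divided by the square of \<open>s\<close> is still below 1.\<close>
  define s where "s = (1 + sqrt \<tau>) / 2"
  have s: "0 < s" "s < 1" "\<tau> < s\<^sup>2"
  proof -
    have q: "0 < sqrt \<tau>" "sqrt \<tau> < 1" using \<tau> by auto
    then show "0 < s" "s < 1" by (simp_all add: s_def add_pos_pos)
    have "(sqrt \<tau>)\<^sup>2 < s\<^sup>2" using q by (intro power_strict_mono) (auto simp: s_def)
    then show "\<tau> < s\<^sup>2" using \<tau> by simp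
  qed
  \<comment> \<open>Makes \<open>(1 + \<eta>) powr (N / (N - 1))\<close> equal to
    \<open>1 / s\<close>; with the \<open>1 / s\<close> of the logarithm this gives the square in
    the denominator of \<open>q\<close>.\<close>
  define \<eta> where "\<eta> = (1 / s) powr ((?N - 1) / ?N) - 1"
  have "1 < (1 / s) powr ((?N - 1) / ?N)" using s conjugate_exponents(1) by (intro gr_one_powr) auto
  then have \<eta>: "0 < \<eta>" by (simp add: \<eta>_def)
  have \<eta>p: "(1 + \<eta>) powr ?p = 1 / s" using s conjugate_exponents(1) by (simp add: \<eta>_def powr_powr)
  define q where "q = (?N - \<beta>) * \<tau> / s\<^sup>2"
  have q: "0 \<le> q" "q < ?N - \<beta>"
  proof -
    show "0 \<le> q" using \<beta> \<tau> by (simp add: q_def)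
    have "(?N - \<beta>) * \<tau> < (?N - \<beta>) * s\<^sup>2" using \<beta> s by (intro mult_strict_left_mono) auto
    then show "q < ?N - \<beta>" using s by (simp add: q_def divide_less_eq)
  qed
  define D where "D = lambda_N F * (1 - \<beta> / ?N) * p"
  have D_eq: "D = (?N - \<beta>) * p * K powr (1 / (?N - 1))"
    unfolding D_def lambda_eq K_def[symmetric] using conjugate_exponents(1) by (simp add: field_simps)
  have D: "0 \<le> D" unfolding D_eq using \<beta> p by simp
  define C2 where "C2 = D * ((1 + 1 / \<eta>) powr ?p * (ca s / K) powr ?p)"
  have main: "exp (D * v powr ?p) \<le> exp (q * s + C2) * (1 + i) powr q"
    if v: "0 \<le> v" and i: "0 \<le> i" and le: "K * v \<le> ca s + E powr (1 / ?N) * (K * (ln (1 + i) / s +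
      1)) powr ((?N - 1) / ?N)" for v i
  proof -
    let ?l = "ln (1 + i) / s + 1"
    have l: "?l > 0" using i s by (auto intro!: add_nonneg_pos divide_nonneg_nonneg)
    let ?b = "E powr (1 / ?N) * (K * ?l) powr ((?N - 1) / ?N) / K"
    have b0: "0 \<le> ?b" using K by simp
    have "v \<le> ca s / K + ?b" using le K by (simp add: field_simps)
    then have "v powr ?p \<le> (ca s / K + ?b) powr ?p" using v conjugate_exponents(1) by (intro powr_mono2) auto
    also have "\<dots> \<le> (1 + \<eta>) powr ?p * ?b powr ?p + (1 + 1 / \<eta>) powr ?p * (ca s / K) powr ?p"
      using ca[of s] K \<eta> b0 conjugate_exponents(1) by (intro powr_add_le_eta) auto
    finally have "D * v powr ?p \<le> D * ((1 / s) * ?b powr ?p + (1 + 1 / \<eta>) powr ?p * (ca s / K) powr ?p)"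
      using D unfolding \<eta>p by (rule mult_left_mono)
    also have "\<dots> = (1 / s) * (D * ?b powr ?p) + C2" by (simp add: C2_def algebra_simps)
    also have "D * ?b powr ?p = (?N - \<beta>) * \<tau> * ?l"
    proof -
      have "?b powr ?p = E powr (1 / (?N - 1)) * (K * ?l) / K powr ?p"
        using E K l conjugate_exponents(1) by (simp add: powr_divide powr_mult powr_powr)
      moreover have "K powr ?p = K * K powr (1 / (?N - 1))"
      proof -
        have "?p = 1 + 1 / (?N - 1)" using conjugate_exponents(1) by (simp add: field_simps)
        then show ?thesis using K by (simp add: powr_add)
      qed
      ultimately show ?thesis unfolding D_eq \<tau>_def using K by simp
    qed
    also have "(1 / s) * ((?N - \<beta>) * \<tau> * ?l) + C2 = q * ln (1 + i) + (q * s + C2)"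
      using s by (simp add: q_def field_simps power2_eq_square)
    finally have "exp (D * v powr ?p) \<le> exp (q * ln (1 + i) + (q * s + C2))" by simp
    also have "\<dots> = exp (q * s + C2) * (1 + i) powr q"
      using i by (simp add: powr_def exp_add[symmetric] ac_simps)
    finally show ?thesis .
  qed
  show ?thesis
    by (rule exI[of _ s], rule exI[of _ "exp (q * s + C2)"], rule exI[of _ q])
      (use s q main in \<open>auto simp: D_def K_def\<close>)
qed

text \<open>The constant is fixed before \<open>f\<close> and \<open>u'\<close>, hence uniform along
  a sequence: only the bound 1 on the total energy and the bound \<open>E\<close> at scale
  \<open>r\<close> enter.\<close>

lemma exp_integral_bound:
  fixes \<Omega> :: "(real^'n) set"
  assumes \<Omega>: "open \<Omega>" "bounded \<Omega>" and \<beta>: "0 \<le> \<beta>" "\<beta> < real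
    CARD('n)" and p: "0 < p"
    and E: "0 < E" "p * E powr (1 / (real CARD('n) - 1)) < 1" and r: "0 < r"
  shows "\<exists>C<\<infinity>. \<forall>f u'. f \<in> borel_measurable borel \<longrightarrow> (\<forall>y.
    0 \<le> f y) \<longrightarrow> (\<forall>y. y \<notin> \<Omega> \<longrightarrow> f y = 0) \<longrightarrow>
    (\<integral>\<^sup>+y. ennreal (f y ^ CARD('n)) \<partial>lborel) \<le> 1 \<longrightarrow>
    (\<forall>x\<in>\<Omega>. (\<integral>\<^sup>+y. ennreal (f y ^ CARD('n)) * indicator {y. P (x - y) \<le>
      r} y \<partial>lborel) \<le> ennreal E) \<longrightarrow>
    (AE x in lborel. x \<in> \<Omega> \<longrightarrow> ennreal (real CARD('n) * unit_vol P * \<bar>u' x\<bar>) \<le>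
       (\<integral>\<^sup>+y. ennreal (f y) * ennreal (P (x - y) powr - (real CARD('n) - 1))
         \<partial>lborel)) \<longrightarrow>
    (\<integral>\<^sup>+x. ennreal (exp (lambda_N F * (1 - \<beta> / real CARD('n)) * p * \<bar>u' x\<bar>
      powr (real CARD('n) / (real CARD('n) - 1))) / P x powr \<beta>) * indicator \<Omega> x
      \<partial>lborel) \<le> C"
proof -
  let ?N = "real CARD('n)"
  have [measurable]: "\<Omega> \<in> sets borel" using \<Omega> by simp
  have "emeasure lborel \<Omega> < \<infinity>" using emeasure_bounded_finite[OF \<Omega>(2)] by simp
  then obtain w where w: "emeasure lborel \<Omega> = ennreal w" "w \<ge> 0" by (cases "emeasure lborel \<Omega>") auto
  obtain R where R: "R > 0" "\<forall>x\<in>\<Omega>. \<forall>y\<in>\<Omega>. P (x - y) \<le> R"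
    "\<forall>x\<in>\<Omega>. P x \<le> R" using bounded_polar_diam[OF \<Omega>(2)] by auto
  have "\<exists>s C q. 0 < s \<and> s < 1 \<and> 0 < C \<and> 0 \<le> q \<and> q < ?N - \<beta> \<and>
    (\<forall>v i. 0 \<le> v \<longrightarrow> 0 \<le> i \<longrightarrow> ?N * unit_vol P * v \<le> (r powr
      s + r powr - (?N - 1) * (w + 1)) + E powr (1 / ?N) * (?N * unit_vol P * (ln (1 + i) / s + 1)) powr ((?N
      - 1) / ?N) \<longrightarrow>
      exp (lambda_N F * (1 - \<beta> / ?N) * p * v powr (?N / (?N - 1))) \<le> C * (1 + i) powr q)"
    using w(2) by (intro exp_pointwise[OF \<beta> p E, where ca="\<lambda>s. r powr s + r powr - (?N - 1) *
      (w + 1)"]) auto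
  then obtain s C1 q where s: "0 < s" "s < 1" and C1: "0 < C1" and q: "0 \<le> q" "q < ?N - \<beta>"
    and pw: "\<forall>v i. 0 \<le> v \<longrightarrow> 0 \<le> i \<longrightarrow> ?N * unit_vol P * v \<le>
      (r powr s + r powr - (?N - 1) * (w + 1)) + E powr (1 / ?N) * (?N * unit_vol P * (ln (1 + i) / s + 1))
      powr ((?N - 1) / ?N) \<longrightarrow>
      exp (lambda_N F * (1 - \<beta> / ?N) * p * v powr (?N / (?N - 1))) \<le> C1 * (1 + i) powr q"
    by (elim exE conjE) (rule that)
  let ?k = "\<lambda>z. P z powr - (?N - 1 + s) * indicator {z. P z \<le> r} z"
  have "(\<integral>\<^sup>+z. ennreal (P z powr - (?N - 1 + s)) * indicator {z. P z \<le> r} z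
    \<partial>lborel) < \<infinity>"
    using r s by (intro nn_integral_kernel_finite[OF polar_norm_like]) auto
  also have "(\<integral>\<^sup>+z. ennreal (P z powr - (?N - 1 + s)) * indicator {z. P z \<le> r} z
    \<partial>lborel) = (\<integral>\<^sup>+z. ennreal (?k z) \<partial>lborel)"
    by (intro nn_integral_cong) (auto simp: indicator_def)
  finally obtain M0 where M0: "(\<integral>\<^sup>+z. ennreal (?k z) \<partial>lborel) = ennreal M0" "0 \<le> M0"
    by (cases "\<integral>\<^sup>+z. ennreal (?k z) \<partial>lborel") auto
  define M where "M = M0 + 1"
  have M: "(\<integral>\<^sup>+z. ennreal (?k z) \<partial>lborel) \<le> ennreal M" "0 < M" using M0 by (auto
    simp: M_def ennreal_leI)
  \<comment> \<open>The order of the singularity produced by \<open>weighted_power_bound\<close>; it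
    stays below \<open>N\<close> because \<open>q < N - \<beta>\<close>.\<close>
  let ?\<gamma> = "\<beta> * (?N / (?N - q))"
  have \<gamma>: "?\<gamma> < ?N"
  proof -
    have "\<beta> * ?N < (?N - q) * ?N" using q conjugate_exponents(1) by (intro mult_strict_right_mono) auto
    then show ?thesis using q \<beta> by (simp add: divide_less_eq mult.commute)
  qed
  define T where "T = (\<integral>\<^sup>+x. ennreal (P x powr - ?\<gamma>) * indicator {z. P z \<le> R} x
    \<partial>lborel)"
  have T: "T < \<infinity>" unfolding T_def using R \<gamma> by (intro nn_integral_kernel_finite[OF
    polar_norm_like]) auto
  define C where "C = ennreal C1 * (2 ^ CARD('n) * (ennreal w + ennreal (M ^ (CARD('n) - 1)) * ennreal M) + T)"
  have "T \<noteq> top" using T by auto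
  then have "C \<noteq> top" unfolding C_def by (simp add: ennreal_mult_eq_top_iff power_eq_top_ennreal)
  then have C: "C < \<infinity>" by (simp add: less_top)
  show ?thesis
  proof (intro exI conjI allI impI)
    show "C < \<infinity>" by (rule C)
  next
    fix f :: "real^'n \<Rightarrow> real" and u' :: "real^'n \<Rightarrow> real"
    assume f[measurable]: "f \<in> borel_measurable borel" and f0: "\<forall>y. 0 \<le> f y" "\<forall>y. y
      \<notin> \<Omega> \<longrightarrow> f y = 0"
      and f1: "(\<integral>\<^sup>+y. ennreal (f y ^ CARD('n)) \<partial>lborel) \<le> 1"
      and fE: "\<forall>x\<in>\<Omega>. (\<integral>\<^sup>+y. ennreal (f y ^ CARD('n)) * indicator {y. P (x
        - y) \<le> r} y \<partial>lborel) \<le> ennreal E"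
      and u': "AE x in lborel. x \<in> \<Omega> \<longrightarrow> ennreal (?N * unit_vol P * \<bar>u' x\<bar>) \<le>
       (\<integral>\<^sup>+y. ennreal (f y) * ennreal (P (x - y) powr - (?N - 1)) \<partial>lborel)"
    define I where "I x = (\<integral>\<^sup>+y. ennreal (f y * ?k (x - y)) \<partial>lborel)" for x
    have [measurable]: "I \<in> borel_measurable borel" unfolding I_def by measurable
    let ?L = "\<lambda>x. ennreal (exp (lambda_N F * (1 - \<beta> / ?N) * p * \<bar>u' x\<bar> powr (?N / (?N
      - 1))) / P x powr \<beta>)"
    have "(\<integral>\<^sup>+x. ?L x * indicator \<Omega> x \<partial>lborel) \<le> (\<integral>\<^sup>+x.
      ennreal C1 * ((1 + I x) ^ CARD('n) * indicator \<Omega> x + ennreal (P x powr - ?\<gamma>) * indicator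
      {z. P z \<le> R} x) \<partial>lborel)"
    proof (rule nn_integral_mono_AE)
      show "AE x in lborel. ?L x * indicator \<Omega> x \<le> ennreal C1 * ((1 + I x) ^ CARD('n) * indicator
        \<Omega> x + ennreal (P x powr - ?\<gamma>) * indicator {z. P z \<le> R} x)"
        using u' AE_lborel_singleton[of 0]
      proof eventually_elim
        case (elim x)
        show ?case
        proof (cases "x \<in> \<Omega>")
          case x: True
          then have PR: "P x \<le> R" using R by auto
          have P0: "P x > 0" using elim(2) by (rule norm_like_pos[OF polar_norm_like])
          show ?thesis
          \<comment> \<open>Where the potential is infinite, so is the right-hand side; elsewhere
            the pointwise estimate needs a real value of the potential.\<close>
          proof (cases "I x = \<infinity>")
            case True
            then show ?thesis using x C1 by (simp add: ennreal_mult_top)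
          next
            case False
            then obtain i where i: "I x = ennreal i" "0 \<le> i" by (cases "I x") auto
            have "ennreal (?N * unit_vol P * \<bar>u' x\<bar>) \<le> (\<integral>\<^sup>+y. ennreal (f y) *
              ennreal (P (x - y) powr - (?N - 1)) \<partial>lborel)"
              using elim(1) x by simp
            also have "\<dots> \<le> ennreal (r powr s + r powr - (?N - 1) * (w + 1) + E powr (1 / ?N) * (?N
              * unit_vol P * (ln (1 + i) / s + 1)) powr ((?N - 1) / ?N))"
              using f0 w f1 fE x i(1) unfolding I_def by (intro potential_pointwise[OF f _ _ _ _ w(2) f1 r s
                E(1) _ _ i(2), where \<Omega>=\<Omega>]) auto
            finally have "?N * unit_vol P * \<bar>u' x\<bar> \<le> r powr s + r powr - (?N - 1) * (w + 1) + E
              powr (1 / ?N) * (?N * unit_vol P * (ln (1 + i) / s + 1)) powr ((?N - 1) / ?N)"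
              using w by (subst (asm) ennreal_le_iff) (auto intro!: add_nonneg_nonneg)
            then have "exp (lambda_N F * (1 - \<beta> / ?N) * p * \<bar>u' x\<bar> powr (?N / (?N - 1)))
              \<le> C1 * (1 + i) powr q"
              using pw i(2) by simp
            then have "exp (lambda_N F * (1 - \<beta> / ?N) * p * \<bar>u' x\<bar> powr (?N / (?N - 1))) / P
              x powr \<beta> \<le> C1 * (1 + i) powr q * P x powr - \<beta>"
              by (simp add: powr_minus_divide divide_right_mono)
            also have "\<dots> = C1 * ((1 + i) powr q * P x powr - \<beta>)" by simp
            also have "\<dots> \<le> C1 * ((1 + i) powr ?N + (P x powr - \<beta>) powr (?N / (?N - q)))"
              using C1 i q \<beta> P0 by (intro mult_left_mono weighted_power_bound) auto
            also have "(1 + i) powr ?N = (1 + i) ^ CARD('n)" using i by (simp add: powr_CARD)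
            also have "(P x powr - \<beta>) powr (?N / (?N - q)) = P x powr - ?\<gamma>" by (simp add: powr_powr)
            finally have "?L x \<le> ennreal (C1 * ((1 + i) ^ CARD('n) + P x powr - ?\<gamma>))" by (rule ennreal_leI)
            also have "\<dots> = ennreal C1 * ((1 + I x) ^ CARD('n) + ennreal (P x powr - ?\<gamma>))"
            proof -
              have "(1 + I x) ^ CARD('n) = ennreal ((1 + i) ^ CARD('n))"
                using i by (simp add: ennreal_power[symmetric])
              then show ?thesis using C1 i by (simp add: ennreal_mult ennreal_plus)
            qed
            finally show ?thesis using x PR by simp
          qed
        qed simp
      qed
    qed
    also have "\<dots> = ennreal C1 * (\<integral>\<^sup>+x. ((1 + I x) ^ CARD('n) * indicator \<Omega> x +
      ennreal (P x powr - ?\<gamma>) * indicator {z. P z \<le> R} x) \<partial>lborel)"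
      by (rule nn_integral_cmult) measurable
    also have "(\<integral>\<^sup>+x. ((1 + I x) ^ CARD('n) * indicator \<Omega> x + ennreal (P x powr -
      ?\<gamma>) * indicator {z. P z \<le> R} x) \<partial>lborel) = (\<integral>\<^sup>+x. (1 + I x) ^
      CARD('n) * indicator \<Omega> x \<partial>lborel) + T"
      unfolding T_def by (rule nn_integral_add) measurable
    also have "ennreal C1 * ((\<integral>\<^sup>+x. (1 + I x) ^ CARD('n) * indicator \<Omega> x
      \<partial>lborel) + T) \<le> C"
      unfolding C_def
    proof (intro mult_left_mono add_right_mono)
      have "(\<integral>\<^sup>+x. (1 + I x) ^ CARD('n) * indicator \<Omega> x \<partial>lborel) \<le>
        (\<integral>\<^sup>+x. 2 ^ CARD('n) * (indicator \<Omega> x + I x ^ CARD('n) * indicator \<Omega> x)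
        \<partial>lborel)"
        using ennreal_power_add_le by (intro nn_integral_mono) (auto simp: indicator_def)
      also have "\<dots> = 2 ^ CARD('n) * (\<integral>\<^sup>+x. (indicator \<Omega> x + I x ^ CARD('n) *
        indicator \<Omega> x) \<partial>lborel)"
        by (rule nn_integral_cmult) measurable
      also have "(\<integral>\<^sup>+x. (indicator \<Omega> x + I x ^ CARD('n) * indicator \<Omega> x)
        \<partial>lborel) =
        (\<integral>\<^sup>+x. indicator \<Omega> x \<partial>lborel) + (\<integral>\<^sup>+x. I x ^ CARD('n)
          * indicator \<Omega> x \<partial>lborel)"
        by (rule nn_integral_add) measurable
      also have "(\<integral>\<^sup>+x. indicator \<Omega> x \<partial>lborel) = emeasure lborel \<Omega>" by
        (rule nn_integral_indicator) measurable
      also have "(\<integral>\<^sup>+x. I x ^ CARD('n) * indicator \<Omega> x \<partial>lborel) \<le>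
        (\<integral>\<^sup>+x. ennreal (M ^ (CARD('n) - 1)) * ((\<integral>\<^sup>+y. ennreal (f y ^
        CARD('n)) * ennreal (?k (x - y)) \<partial>lborel) * indicator \<Omega> x) \<partial>lborel)"
      proof (rule nn_integral_mono)
        fix x
        have "I x ^ CARD('n) \<le> ennreal (M ^ (CARD('n) - 1)) * (\<integral>\<^sup>+y. ennreal (f y ^
          CARD('n)) * ennreal (?k (x - y)) \<partial>lborel)"
          unfolding I_def using f0 M by (intro riesz_power_bound) auto
        then show "I x ^ CARD('n) * indicator \<Omega> x \<le> ennreal (M ^ (CARD('n) - 1)) *
          ((\<integral>\<^sup>+y. ennreal (f y ^ CARD('n)) * ennreal (?k (x - y)) \<partial>lborel) *
          indicator \<Omega> x)"
          by (auto simp: indicator_def)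
      qed
      also have "\<dots> = ennreal (M ^ (CARD('n) - 1)) * (\<integral>\<^sup>+x. (\<integral>\<^sup>+y.
        ennreal (f y ^ CARD('n)) * ennreal (?k (x - y)) \<partial>lborel) * indicator \<Omega> x \<partial>lborel)"
        by (rule nn_integral_cmult) measurable
      also have "(\<integral>\<^sup>+x. (\<integral>\<^sup>+y. ennreal (f y ^ CARD('n)) * ennreal (?k (x -
        y)) \<partial>lborel) * indicator \<Omega> x \<partial>lborel)
        \<le> (\<integral>\<^sup>+z. ennreal (?k z) * indicator {z. P z \<le> R} z \<partial>lborel) *
          (\<integral>\<^sup>+y. ennreal (f y ^ CARD('n)) \<partial>lborel)"
        using f0 R by (intro convolution_bound) (auto simp: zero_power)
      also have "\<dots> \<le> ennreal M * 1"
      proof (intro mult_mono f1)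
        have "(\<integral>\<^sup>+z. ennreal (?k z) * indicator {z. P z \<le> R} z \<partial>lborel) \<le>
          (\<integral>\<^sup>+z. ennreal (?k z) \<partial>lborel)"
          by (intro nn_integral_mono) (auto simp: indicator_def)
        then show "(\<integral>\<^sup>+z. ennreal (?k z) * indicator {z. P z \<le> R} z \<partial>lborel)
          \<le> ennreal M" using M(1) by (rule order_trans)
      qed auto
      finally show "(\<integral>\<^sup>+x. (1 + I x) ^ CARD('n) * indicator \<Omega> x \<partial>lborel)
        \<le> 2 ^ CARD('n) * (ennreal w + ennreal (M ^ (CARD('n) - 1)) * ennreal M)"
        by (simp add: w(1) mult_left_mono add_left_mono)
    qed auto
    finally show "(\<integral>\<^sup>+x. ?L x * indicator \<Omega> x \<partial>lborel) \<le> C" .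
  qed
qed

end

section \<open>Weak lower semicontinuity\<close>

text \<open>Bernoulli's inequality at \<open>a / b\<close>, scaled by \<open>b ^ n\<close>.\<close>

lemma power_tangent:
  assumes "0 \<le> a" "0 < (b::real)" "0 < n"
  shows "b ^ n + real n * b ^ (n - 1) * (a - b) \<le> a ^ n"
proof -
  have "1 + real n * (a / b - 1) \<le> (1 + (a / b - 1)) ^ n"
    using assms by (intro Bernoulli_inequality) auto
  then have "b ^ n * (1 + real n * (a / b - 1)) \<le> b ^ n * (a / b) ^ n"
    using assms by (intro mult_left_mono) auto
  also have "b ^ n * (a / b) ^ n = a ^ n" using assms by (simp add: power_divide)
  also have "b ^ n * (1 + real n * (a / b - 1)) = b ^ n + real n * b ^ (n - 1) * (a - b)"
    using assms by (cases n) (auto simp: field_simps)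
  finally show ?thesis .
qed

text \<open>By convexity the difference quotients towards \<open>y\<close> are at most
  \<open>f y - f x\<close>; their limit from the right at 0 is the directional derivative.\<close>

lemma convex_gradient_inequality:
  fixes f :: "real^'n \<Rightarrow> real"
  assumes cv: "convex_on UNIV f" and d: "f differentiable (at x)"
  shows "f x + gradient f x \<bullet> (y - x) \<le> f y"
proof -
  let ?h = "\<lambda>t. f (x + t *\<^sub>R (y - x))"
  have "((\<lambda>t::real. x + t *\<^sub>R (y - x)) has_derivative (\<lambda>t. t *\<^sub>R (y - x))) (at 0)"
    by (auto intro!: derivative_eq_intros)
  moreover have "(f has_derivative (\<bullet>) (gradient f x)) (at (x + (0::real) *\<^sub>R (y - x)))"
    using has_derivative_gradient[OF d] by simp
  ultimately have "((\<lambda>t. ?h t) has_derivative (\<lambda>t. gradient f x \<bullet> (t *\<^sub>R (y -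
    x)))) (at 0)"
    by (rule has_derivative_compose)
  then have "(?h has_real_derivative gradient f x \<bullet> (y - x)) (at 0)"
    by (simp add: has_field_derivative_def mult_commute_abs)
  then have "((\<lambda>t. (?h t - f x) / t) \<longlongrightarrow> gradient f x \<bullet> (y - x)) (at_right 0)"
    by (simp add: has_field_derivative_iff filterlim_at_split)
  moreover have "\<forall>\<^sub>F t in at_right 0. (?h t - f x) / t \<le> f y - f x"
    using eventually_at_right_less[of 0] eventually_at_right[of 0 1, THEN iffD2]
  proof (rule eventually_elim2)
    show "\<exists>b>0. \<forall>t>0. t < b \<longrightarrow> t < (1::real)" by (rule exI[of _ 1]) auto
    fix t :: real assume t: "0 < t" "t < 1"
    have "f ((1 - t) *\<^sub>R x + t *\<^sub>R y) \<le> (1 - t) * f x + t * f y"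
      using t by (intro convex_onD[OF cv]) auto
    moreover have "(1 - t) *\<^sub>R x + t *\<^sub>R y = x + t *\<^sub>R (y - x)" by (simp add: algebra_simps)
    ultimately have "?h t - f x \<le> t * (f y - f x)" by (simp add: algebra_simps)
    then show "(?h t - f x) / t \<le> f y - f x" using t by (simp add: field_simps)
  qed simp
  ultimately have "gradient f x \<bullet> (y - x) \<le> f y - f x"
    by (intro tendsto_upperbound) auto
  then show ?thesis by simp
qed

section \<open>Dual functionals given by bounded vector fields\<close>

lemma sobolev_rep_of_W01p:
  fixes \<Omega> :: "(real^'n) set"
  assumes "open \<Omega>" "u \<in> W01p \<Omega> (real CARD('n))"
  shows "\<exists>u' g. sobolev_rep \<Omega> u u' g"
  using sobolev_rep_ex[OF assms(1), of u] assms(2) unfolding W01p_def by blast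

text \<open>Serves estimates that divide by the norm: they are run with the norm plus
  \<open>e\<close>, which is positive even for the zero function.\<close>

lemma le_mult_epsilon:
  fixes K x y :: real
  assumes "\<And>e. 0 < e \<Longrightarrow> x \<le> K * (y + e)"
  shows "x \<le> K * y"
proof -
  have "(\<lambda>n. K * (y + 1 / real (Suc n))) \<longlonglongrightarrow> K * (y + 0)"
    by (intro tendsto_intros LIMSEQ_Suc[OF lim_1_over_n])
  then show ?thesis using assms by (intro LIMSEQ_le_const[of _ "K * y"]) auto
qed

text \<open>The pointwise bound of \<open>norm (g x) / t\<close> by 1 plus its \<open>N\<close>-th
  power replaces Hoelder on a set of finite measure; with \<open>t\<close> at least the L^N norm the
  second term integrates to at most 1.\<close>

lemma integrable_norm_grad:
  fixes g :: "real^'n \<Rightarrow> real^'n"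
  assumes \<Omega>: "open \<Omega>" "bounded \<Omega>" and g[measurable]: "g \<in> borel_measurable borel"
    and g0: "\<And>x. x \<notin> \<Omega> \<Longrightarrow> g x = 0"
    and gi: "integrable lborel (\<lambda>x. norm (g x) ^ CARD('n))" and t: "0 < t" "(LINT x|lborel. norm (g
      x) ^ CARD('n)) \<le> t ^ CARD('n)"
  shows "integrable lborel g" "(LINT x|lborel. norm (g x)) \<le> (measure lborel \<Omega> + 1) * t"
proof -
  have [measurable]: "\<Omega> \<in> sets borel" using \<Omega> by simp
  have "emeasure lborel \<Omega> < \<infinity>" using emeasure_bounded_finite[OF \<Omega>(2)] by simp
  then have i: "integrable lborel (\<lambda>x. t * (indicator \<Omega> x + norm (g x) ^ CARD('n) / t ^ CARD('n)))"
    using gi by (auto intro!: integrable_mult_right Bochner_Integration.integrable_add integrable_real_indicator)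
  have le: "norm (g x) \<le> t * (indicator \<Omega> x + norm (g x) ^ CARD('n) / t ^ CARD('n))" for x
  proof (cases "x \<in> \<Omega>")
    case True
    have "norm (g x) / t \<le> 1 + (norm (g x) / t) ^ CARD('n)"
      using le_eps_power[of "norm (g x) / t" 1 "CARD('n)"] t by simp
    then have "t * (norm (g x) / t) \<le> t * (1 + (norm (g x) / t) ^ CARD('n))"
      using t by (intro mult_left_mono) auto
    then show ?thesis using True t by (simp add: power_divide)
  qed (simp add: g0 zero_power)
  show ig: "integrable lborel g"
    by (rule Bochner_Integration.integrable_bound[OF i]) (use le in \<open>auto intro: order_trans[OF _
      abs_ge_self]\<close>)
  have "(LINT x|lborel. norm (g x)) \<le> (LINT x|lborel. t * (indicator \<Omega> x + norm (g x) ^ CARD('n) /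
    t ^ CARD('n)))"
    using i ig le by (intro integral_mono) auto
  also have "\<dots> = t * (measure lborel \<Omega> + (LINT x|lborel. norm (g x) ^ CARD('n)) / t ^ CARD('n))"
    using gi \<open>emeasure lborel \<Omega> < \<infinity>\<close> by (subst integral_mult_right_zero, subst
      Bochner_Integration.integral_add) auto
  also have "\<dots> \<le> t * (measure lborel \<Omega> + 1)"
    using t by (intro mult_left_mono add_left_mono) (auto simp: divide_le_eq)
  finally show "(LINT x|lborel. norm (g x)) \<le> (measure lborel \<Omega> + 1) * t" by (simp add: mult.commute)
qed

lemma integrable_inner_bounded:
  fixes G g :: "real^'n \<Rightarrow> real^'n"
  assumes [measurable]: "G \<in> borel_measurable borel" "g \<in> borel_measurable borel" and c: "\<And>x.
    norm (G x) \<le> c" and g: "integrable lborel g"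
  shows "integrable lborel (\<lambda>x. G x \<bullet> g x)" "\<bar>LINT x|lborel. G x \<bullet> g x\<bar>
    \<le> c * (LINT x|lborel. norm (g x))"
proof -
  have c0: "0 \<le> c" using norm_ge_zero[of "G 0"] c[of 0] by linarith
  have i: "integrable lborel (\<lambda>x. c * norm (g x))" using g by auto
  have le: "\<bar>G x \<bullet> g x\<bar> \<le> c * norm (g x)" for x
    using Cauchy_Schwarz_ineq2[of "G x" "g x"] mult_right_mono[OF c[of x] norm_ge_zero[of "g x"]] by linarith
  show ii: "integrable lborel (\<lambda>x. G x \<bullet> g x)"
    by (rule Bochner_Integration.integrable_bound[OF i]) (use le c0 in \<open>auto simp: abs_mult\<close>)
  have "\<bar>LINT x|lborel. G x \<bullet> g x\<bar> \<le> (LINT x|lborel. \<bar>G x \<bullet> g x\<bar>)" by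
    (rule integral_abs_bound)
  also have "\<dots> \<le> (LINT x|lborel. c * norm (g x))" using i ii le by (intro integral_mono) auto
  finally show "\<bar>LINT x|lborel. G x \<bullet> g x\<bar> \<le> c * (LINT x|lborel. norm (g x))" by simp
qed

lemma gradient_functional_rep:
  fixes \<Omega> :: "(real^'n) set"
  assumes \<Omega>: "open \<Omega>" and [measurable]: "G \<in> borel_measurable borel" and r: "sobolev_rep
    \<Omega> v v' g"
  shows "(LINT x|lebesgue_on \<Omega>. G x \<bullet> weak_grad \<Omega> v x) = (LINT x|lborel. G x \<bullet> g x)"
proof -
  have [measurable]: "g \<in> borel_measurable borel" using r by (auto simp: sobolev_rep_def)
  have "AE x in lborel. x \<in> \<Omega> \<longrightarrow> weak_grad \<Omega> v x = g x" using r by (auto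
    simp: sobolev_rep_def)
  then have "AE x in lborel. x \<in> \<Omega> \<longrightarrow> G x \<bullet> weak_grad \<Omega> v x = G x
    \<bullet> g x" by eventually_elim auto
  then have "(LINT x|lebesgue_on \<Omega>. G x \<bullet> weak_grad \<Omega> v x) = (LINT x|lborel. indicator
    \<Omega> x * (G x \<bullet> g x))"
    by (intro lint_lebesgue_on_AE(1)[OF \<Omega>]) measurable
  also have "\<dots> = (LINT x|lborel. G x \<bullet> g x)"
    using r by (intro Bochner_Integration.integral_cong) (auto simp: sobolev_rep_def indicator_def)
  finally show ?thesis .
qed

lemma sobolev_rep_integrable_grad:
  fixes \<Omega> :: "(real^'n) set"
  assumes \<Omega>: "open \<Omega>" "bounded \<Omega>" and r: "sobolev_rep \<Omega> v v' g"
  shows "integrable lborel g"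
proof (rule integrable_norm_grad[OF \<Omega>])
  let ?A = "LINT x|lborel. norm (g x) ^ CARD('n)"
  \<comment> \<open>Any positive \<open>t\<close> with large enough power serves; a base of at least
    1 is dominated by its power.\<close>
  show "?A \<le> (1 + ?A) ^ CARD('n)"
    using self_le_power[of "1 + ?A" "CARD('n)"] by simp
  have "0 \<le> ?A" by simp
  then show "0 < 1 + ?A" by linarith
qed (use r in \<open>auto simp: sobolev_rep_def\<close>)

text \<open>These are the functionals used against the weakly convergent sequence. Pairing with a
  bounded field is controlled by the L^1 norm of the gradient, hence, \<open>\<Omega>\<close> being
  bounded, by the Sobolev norm.\<close>

lemma gradient_functional_dual:
  fixes \<Omega> :: "(real^'n) set"
  assumes \<Omega>: "open \<Omega>" "bounded \<Omega>" and G[measurable]: "G \<in> borel_measurable borel"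
    and c: "\<And>x. norm (G x) \<le> c"
  shows "(\<lambda>v. LINT x|lebesgue_on \<Omega>. G x \<bullet> weak_grad \<Omega> v x) \<in> W01p_dual
    \<Omega> (real CARD('n))"
proof -
  let ?l = "\<lambda>v. LINT x|lebesgue_on \<Omega>. G x \<bullet> weak_grad \<Omega> v x"
  have lin: "?l (\<lambda>x. u x + a * v x) = ?l u + a * ?l v"
    if u: "u \<in> W01p \<Omega> (real CARD('n))" and v: "v \<in> W01p \<Omega> (real CARD('n))" for u v a
  proof -
    obtain u' g where r: "sobolev_rep \<Omega> u u' g" using sobolev_rep_of_W01p[OF \<Omega>(1) u] by blast
    obtain v' h where r2: "sobolev_rep \<Omega> v v' h" using sobolev_rep_of_W01p[OF \<Omega>(1) v] by blast
    obtain g0 h0 where w: "has_weak_gradient \<Omega> u g0" "has_weak_gradient \<Omega> v h0"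
      using u v by (auto simp: W01p_def W1p_def)
    have m: "g \<in> borel_measurable borel" "h \<in> borel_measurable borel" using r r2 by (auto simp:
      sobolev_rep_def)
    have "?l (\<lambda>x. u x + a * v x) = (LINT x|lborel. G x \<bullet> (g x + a *\<^sub>R h x))"
      by (rule gradient_functional_rep[OF \<Omega>(1) G sobolev_rep_lincomb[OF \<Omega>(1) r r2 w]])
    also have "\<dots> = (LINT x|lborel. G x \<bullet> g x) + a * (LINT x|lborel. G x \<bullet> h x)"
      using integrable_inner_bounded(1)[OF G m(1) c sobolev_rep_integrable_grad[OF \<Omega> r]]
        integrable_inner_bounded(1)[OF G m(2) c sobolev_rep_integrable_grad[OF \<Omega> r2]]
      by (simp add: inner_add_right)
    finally show ?thesis
      by (simp add: gradient_functional_rep[OF \<Omega>(1) G r] gradient_functional_rep[OF \<Omega>(1) G r2])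
  qed
  have z: "(\<lambda>x. 0) \<in> W01p \<Omega> (real CARD('n))"
  proof (rule test_in_W01p[OF \<Omega>(1)])
    show "(\<lambda>x::real^'n. 0) \<in> test_functions \<Omega>"
      by (rule test_functionI[of _ "{}"]) (auto simp: smooth_on_def intro: Ck_on_const)
  qed
  have l0: "?l (\<lambda>x. 0) = 0" using lin[OF z z, of 1] by simp
  have c0: "0 \<le> c" using norm_ge_zero[of "G 0"] c[of 0] by linarith
  have bd: "\<bar>?l u\<bar> \<le> (c * (measure lborel \<Omega> + 1)) * W1p_norm \<Omega> (real CARD('n)) u"
    if u: "u \<in> W01p \<Omega> (real CARD('n))" for u
  proof (rule le_mult_epsilon)
    fix e :: real assume e: "0 < e"
    obtain u' g where r: "sobolev_rep \<Omega> u u' g" using sobolev_rep_of_W01p[OF \<Omega>(1) u] by blast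
    let ?U = "LINT x|lborel. \<bar>u' x\<bar> ^ CARD('n)" and ?A = "LINT x|lborel. norm (g x) ^ CARD('n)"
    let ?n = "W1p_norm \<Omega> (real CARD('n)) u"
    have UA: "0 \<le> ?U" "0 \<le> ?A" by simp_all
    have n: "?n = (?U + ?A) powr (1 / real CARD('n))" by (rule W1p_norm_rep[OF \<Omega>(1) r])
    then have n0: "0 \<le> ?n" by simp
    have "?n ^ CARD('n) = ?U + ?A"
      unfolding n using UA by (simp add: powr_CARD[symmetric] powr_powr)
    moreover have "?n ^ CARD('n) \<le> (?n + e) ^ CARD('n)" using n0 e by (intro power_mono) auto
    ultimately have A: "?A \<le> (?n + e) ^ CARD('n)" using UA by linarith
    have m: "g \<in> borel_measurable borel" using r by (auto simp: sobolev_rep_def)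
    have "\<bar>?l u\<bar> \<le> c * (LINT x|lborel. norm (g x))"
      unfolding gradient_functional_rep[OF \<Omega>(1) G r]
      by (rule integrable_inner_bounded(2)[OF G m c sobolev_rep_integrable_grad[OF \<Omega> r]])
    also have "\<dots> \<le> c * ((measure lborel \<Omega> + 1) * (?n + e))"
      using r n0 e A by (intro mult_left_mono c0 integrable_norm_grad(2)[OF \<Omega>]) (auto simp: sobolev_rep_def)
    finally show "\<bar>?l u\<bar> \<le> (c * (measure lborel \<Omega> + 1)) * (?n + e)" by simp
  qed
  have "?l (\<lambda>x. u x + v x) = ?l u + ?l v"
    if "u \<in> W01p \<Omega> (real CARD('n))" "v \<in> W01p \<Omega> (real CARD('n))" for u v
    using lin[OF that, of 1] by simp
  moreover have "?l (\<lambda>x. a * u x) = a * ?l u" if "u \<in> W01p \<Omega> (real CARD('n))" for a u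
    using lin[OF z that, of a] l0 by simp
  ultimately show ?thesis unfolding W01p_dual_def using bd by blast
qed

section \<open>Lower semicontinuity of the energy on Borel sets\<close>

context anisotropic_ge2
begin

text \<open>For measurability of the gradient, continuity off the origin is enough: a single
  exceptional point is harmless.\<close>

lemma F_diff: "x \<noteq> 0 \<Longrightarrow> F differentiable (at x)"
  and gradF_measurable[measurable]: "gradient F \<in> borel_measurable borel"
proof -
  have C2: "Ck_on (Suc (Suc 0)) F (UNIV - {0})"
    using F unfolding anisotropic_norm_def numeral_2_eq_2 by blast
  then have C1: "Ck_on (Suc 0) F (UNIV - {0})" by (rule Ck_on_SucD)
  then show "x \<noteq> 0 \<Longrightarrow> F differentiable (at x)" by (simp add: Ck_on_Suc_iff)
  have "continuous_on (UNIV - {0}) (\<lambda>x. gradient F x $ i)" for i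
    using C1 by (simp add: Ck_on_Suc_iff)
  then have "continuous_on (UNIV - {0}) (\<lambda>x. \<chi> i. gradient F x $ i)" by (rule continuous_on_vec_lambda)
  then have "continuous_on (- {0}) (gradient F)" by (simp add: Compl_eq_Diff_UNIV)
  then show "gradient F \<in> borel_measurable borel"
    by (rule borel_measurable_continuous_countable_exceptions[rotated]) simp
qed

text \<open>Combines the tangent inequalities of \<open>F\<close> and of the power. At the origin,
  where \<open>F\<close> has no gradient, the coefficient \<open>F \<xi> ^ (N - 1)\<close> is 0
  because \<open>N \<ge> 2\<close>.\<close>

lemma F_power_tangent:
  "F \<xi> ^ CARD('n) + ((real CARD('n) * F \<xi> ^ (CARD('n) - 1)) *\<^sub>R gradient F \<xi>) \<bullet>
    (\<zeta> - \<xi>) \<le> F \<zeta> ^ CARD('n)"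
proof (cases "\<xi> = 0")
  case True
  have "CARD('n) - 1 > 0" using N2 by simp
  then show ?thesis using True norm_like_0[OF F_norm_like] norm_like_nonneg[OF F_norm_like, of \<zeta>] by
    (simp add: zero_power)
next
  case False
  then have p: "0 < F \<xi>" by (rule norm_like_pos[OF F_norm_like])
  have "gradient F \<xi> \<bullet> (\<zeta> - \<xi>) \<le> F \<zeta> - F \<xi>"
    using convex_gradient_inequality[OF norm_like_convex[OF F_norm_like] F_diff[OF False], of \<zeta>] by simp
  then have "real CARD('n) * F \<xi> ^ (CARD('n) - 1) * (gradient F \<xi> \<bullet> (\<zeta> - \<xi>)) \<le>
    real CARD('n) * F \<xi> ^ (CARD('n) - 1) * (F \<zeta> - F \<xi>)"
    using p by (intro mult_left_mono) auto
  then show ?thesis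
    using power_tangent[OF norm_like_nonneg[OF F_norm_like] p zero_less_card_finite[where ?'a='n], of
      \<zeta>] unfolding inner_scaleR_left by linarith
qed

text \<open>The gradient inequality is applied in the direction of the gradient itself;
  subadditivity then cancels \<open>F x\<close>.\<close>

lemma gradF_bound:
  assumes C: "0 < C" "\<And>x. F x \<le> C * norm x" and x: "x \<noteq> 0"
  shows "norm (gradient F x) \<le> C"
proof -
  let ?d = "gradient F x"
  have "F x + ?d \<bullet> ((x + ?d) - x) \<le> F (x + ?d)"
    by (rule convex_gradient_inequality[OF norm_like_convex[OF F_norm_like] F_diff[OF x]])
  also have "\<dots> \<le> F x + F ?d" by (rule norm_like_triangle[OF F_norm_like])
  also have "F ?d \<le> C * norm ?d" by (rule C)
  finally have "norm ?d * norm ?d \<le> C * norm ?d" by (simp add: dot_square_norm power2_eq_square)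
  then show ?thesis using C by (cases "?d = 0") auto
qed

lemma integrable_F_power:
  assumes r: "sobolev_rep \<Omega> u u' g"
  shows "integrable lborel (\<lambda>x. F (g x) ^ CARD('n))"
proof -
  obtain C where C: "C > 0" "\<And>x. F x \<le> C * norm x" using norm_like_upper[OF F_norm_like] by blast
  have [measurable]: "g \<in> borel_measurable borel" using r by (auto simp: sobolev_rep_def)
  have i: "integrable lborel (\<lambda>x. C ^ CARD('n) * norm (g x) ^ CARD('n))" using r by (auto simp:
    sobolev_rep_def)
  show ?thesis
  proof (rule Bochner_Integration.integrable_bound[OF i])
    show "AE x in lborel. norm (F (g x) ^ CARD('n)) \<le> norm (C ^ CARD('n) * norm (g x) ^ CARD('n))"
      using C norm_like_nonneg[OF F_norm_like] by (auto simp: power_mult_distrib[symmetric] intro!: power_mono)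
  qed measurable
qed

lemma aniso_energy_rep:
  assumes "open \<Omega>" "sobolev_rep \<Omega> u u' g"
  shows "aniso_energy F \<Omega> u = (LINT x|lborel. F (g x) ^ CARD('n))"
  unfolding aniso_energy_def
  by (rule sobolev_rep_lint[OF assms]) (auto simp: norm_like_0[OF F_norm_like] zero_power)

text \<open>The tangent inequality at \<open>g\<close> bounds the energy of \<open>gs n\<close> from
  below by an affine functional of \<open>gs n\<close>. Restricting to points where \<open>g\<close>
  is bounded makes its field bounded, so the functional lies in the dual. Truncation and weak
  convergence each cost \<open>\<eta> / 2\<close>.\<close>

lemma weak_lsc:
  assumes \<Omega>: "open \<Omega>" "bounded \<Omega>" and w: "weakly_converges_W01p \<Omega> (real CARD('n)) us u"
    and rs: "\<And>n. sobolev_rep \<Omega> (us n) (us' n) (gs n)" and r: "sobolev_rep \<Omega> u u' g"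
    and B[measurable]: "B \<in> sets borel" and \<eta>: "0 < \<eta>"
  shows "\<forall>\<^sub>F n in sequentially. (LINT x|lborel. indicator B x * F (g x) ^ CARD('n)) - \<eta>
    \<le> (LINT x|lborel. indicator B x * F (gs n x) ^ CARD('n))"
proof -
  let ?N = "CARD('n)"
  have [measurable]: "g \<in> borel_measurable borel" "gs n \<in> borel_measurable borel" for n
    using r rs[of n] by (auto simp: sobolev_rep_def)
  obtain C where C: "C > 0" "\<And>x. F x \<le> C * norm x" using norm_like_upper[OF F_norm_like] by blast
  have Fi: "integrable lborel (\<lambda>x. F (g x) ^ ?N)" "integrable lborel (\<lambda>x. F (gs n x) ^ ?N)" for n
    using integrable_F_power[OF r] integrable_F_power[OF rs] by auto
  let ?S = "\<lambda>m. {x \<in> B. norm (g x) \<le> real m}"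
  have "(\<lambda>m. LINT x|lborel. indicator (?S m) x * F (g x) ^ ?N) \<longlonglongrightarrow> (LINT
    x|lborel. indicator B x * F (g x) ^ ?N)"
  proof (rule integral_dominated_convergence[where w="\<lambda>x. F (g x) ^ ?N"])
    show "AE x in lborel. (\<lambda>m. indicator (?S m) x * F (g x) ^ ?N) \<longlonglongrightarrow> indicator
      B x * F (g x) ^ ?N"
    proof (rule AE_I2, rule tendsto_eventually)
      fix x
      obtain m0 where m0: "norm (g x) \<le> real m0" using real_arch_simple by blast
      show "\<forall>\<^sub>F m in sequentially. indicator (?S m) x * F (g x) ^ ?N = indicator B x * F (g x) ^ ?N"
        using m0 by (intro eventually_sequentiallyI[of m0]) (auto simp: indicator_def)
    qed
  qed (use Fi norm_like_nonneg[OF F_norm_like] in \<open>auto simp: indicator_def\<close>)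
  then have "\<forall>\<^sub>F m in sequentially. (LINT x|lborel. indicator B x * F (g x) ^ ?N) - \<eta> / 2
    < (LINT x|lborel. indicator (?S m) x * F (g x) ^ ?N)"
    using \<eta> by (intro order_tendstoD(1)) auto
  then obtain m where m: "(LINT x|lborel. indicator B x * F (g x) ^ ?N) - \<eta> / 2 < (LINT x|lborel.
    indicator (?S m) x * F (g x) ^ ?N)"
    by (auto simp: eventually_sequentially)
  define G where "G x = indicator (?S m) x *\<^sub>R ((real ?N * F (g x) ^ (?N - 1)) *\<^sub>R gradient F (g
    x))" for x
  have G[measurable]: "G \<in> borel_measurable borel" unfolding G_def by measurable
  have Gb: "norm (G x) \<le> real ?N * (C * real m) ^ (?N - 1) * C" for x
  proof (cases "x \<in> ?S m \<and> g x \<noteq> 0")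
    case True
    have "F (g x) \<le> C * real m"
      using C(2)[of "g x"] True C(1) by (smt (verit, best) mem_Collect_eq mult_left_mono)
    then have "F (g x) ^ (?N - 1) \<le> (C * real m) ^ (?N - 1)" using norm_like_nonneg[OF F_norm_like] by
      (intro power_mono) auto
    moreover have "norm (gradient F (g x)) \<le> C" by (rule gradF_bound[OF C]) (use True in auto)
    ultimately have "(real ?N * F (g x) ^ (?N - 1)) * norm (gradient F (g x)) \<le> real ?N * (C * real m) ^
      (?N - 1) * C"
      using C norm_like_nonneg[OF F_norm_like] by (intro mult_mono) auto
    then show ?thesis using True norm_like_nonneg[OF F_norm_like] by (simp add: G_def)
  next
    case False
    have "CARD('n) - 1 > 0" using N2 by simp
    then have "G x = 0" using False norm_like_0[OF F_norm_like] by (auto simp: G_def indicator_def zero_power)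
    then show ?thesis using C by simp
  qed
  let ?l = "\<lambda>v. LINT x|lebesgue_on \<Omega>. G x \<bullet> weak_grad \<Omega> v x"
  have "?l \<in> W01p_dual \<Omega> (real ?N)" by (rule gradient_functional_dual[OF \<Omega> G Gb])
  then have "(\<lambda>n. ?l (us n)) \<longlonglongrightarrow> ?l u" using w by (auto simp: weakly_converges_W01p_def)
  then have "\<forall>\<^sub>F n in sequentially. ?l u - \<eta> / 2 < ?l (us n)" using \<eta> by (intro
    order_tendstoD(1)) auto
  then show ?thesis
  proof eventually_elim
    case (elim n)
    have lG: "integrable lborel (\<lambda>x. G x \<bullet> g x)" "integrable lborel (\<lambda>x. G x
      \<bullet> gs n x)"
      using sobolev_rep_integrable_grad[OF \<Omega> r] sobolev_rep_integrable_grad[OF \<Omega> rs]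
      by (auto intro!: integrable_inner_bounded(1)[OF G _ Gb])
    have ii: "integrable lborel (\<lambda>x. indicator A x * F (g x) ^ ?N)" "integrable lborel (\<lambda>x.
      indicator A x * F (gs n x) ^ ?N)"
      if "A \<in> sets borel" for A
      using integrable_mult_indicator[of A lborel "\<lambda>x. F (g x) ^ ?N"] integrable_mult_indicator[of A
        lborel "\<lambda>x. F (gs n x) ^ ?N"] Fi that by auto
    have S: "?S m \<in> sets borel" by measurable
    have pt: "indicator (?S m) x * F (g x) ^ ?N + (G x \<bullet> gs n x - G x \<bullet> g x) \<le> indicator
      B x * F (gs n x) ^ ?N" for x
    proof (cases "x \<in> ?S m")
      case True
      then show ?thesis using F_power_tangent[of "g x" "gs n x"] by (simp add: G_def inner_diff_right)
    next
      case False
      then show ?thesis using norm_like_nonneg[OF F_norm_like] by (simp add: G_def)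
    qed
    have "(LINT x|lborel. indicator (?S m) x * F (g x) ^ ?N) + ((LINT x|lborel. G x \<bullet> gs n x) - (LINT
      x|lborel. G x \<bullet> g x))
      = (LINT x|lborel. indicator (?S m) x * F (g x) ^ ?N + (G x \<bullet> gs n x - G x \<bullet> g x))"
      using lG ii[OF S] by simp
    also have "\<dots> \<le> (LINT x|lborel. indicator B x * F (gs n x) ^ ?N)"
      using lG ii[OF S] ii[OF B] by (intro integral_mono pt) auto
    finally have "(LINT x|lborel. indicator (?S m) x * F (g x) ^ ?N) + (?l (us n) - ?l u) \<le> (LINT
      x|lborel. indicator B x * F (gs n x) ^ ?N)"
      by (simp add: gradient_functional_rep[OF \<Omega>(1) G r] gradient_functional_rep[OF \<Omega>(1) G rs])
    then show ?case using elim m by linarith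
  qed
qed

text \<open>Absolute continuity of the integral, uniform in the centre: \<open>h\<close> is split at
  a height \<open>m\<close>. The high part is small altogether, the low part is at most
  \<open>m\<close> times the volume of the ball.\<close>

lemma small_ball_mass:
  assumes i: "integrable lborel h" and h: "\<And>x::real^'n. 0 \<le> h x" and \<epsilon>: "0 < (\<epsilon>::real)"
  shows "\<exists>r>0. \<forall>z. (LINT x|lborel. indicator {y. P (z - y) \<le> r} x * h x) \<le> \<epsilon>"
proof -
  have [measurable]: "h \<in> borel_measurable borel" using i by auto
  have "(\<lambda>m. LINT x|lborel. indicator {x. h x > real m} x * h x) \<longlonglongrightarrow> (LINT
    x|(lborel::(real^'n) measure). 0)"
  proof (rule integral_dominated_convergence[where w=h])
    show "AE x in lborel. (\<lambda>m. indicator {x. h x > real m} x * h x) \<longlonglongrightarrow> 0"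
    proof (rule AE_I2, rule tendsto_eventually)
      fix x
      obtain m0 where m0: "h x \<le> real m0" using real_arch_simple by blast
      show "\<forall>\<^sub>F m in sequentially. indicator {x. h x > real m} x * h x = 0"
        using m0 by (intro eventually_sequentiallyI[of m0]) (auto simp: indicator_def)
    qed
  qed (use i h in \<open>auto simp: indicator_def\<close>)
  then have "\<forall>\<^sub>F m in sequentially. (LINT x|lborel. indicator {x. h x > real m} x * h x) <
    \<epsilon> / 2"
    using \<epsilon> by (intro order_tendstoD(2)) auto
  then obtain m where m: "(LINT x|lborel. indicator {x. h x > real m} x * h x) < \<epsilon> / 2"
    by (auto simp: eventually_sequentially)
  let ?c = "real m * unit_vol P"
  have c: "0 \<le> ?c" using unit_vol_pos[OF polar_norm_like] by simp
  \<comment> \<open>The cap 1 gives \<open>r ^ N \<le> r\<close>; the other bound keeps the low part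
    below \<open>\<epsilon> / 2\<close>, where adding 1 prevents a division by 0.\<close>
  define r where "r = min 1 (\<epsilon> / 2 / (?c + 1))"
  have r: "0 < r" "r \<le> 1" "?c * r \<le> \<epsilon> / 2"
  proof -
    show "0 < r" "r \<le> 1" using \<epsilon> c by (auto simp: r_def)
    have "?c * r \<le> ?c * (\<epsilon> / 2 / (?c + 1))" using c by (intro mult_left_mono) (auto simp: r_def)
    also have "\<dots> = (?c / (?c + 1)) * (\<epsilon> / 2)" by simp
    also have "\<dots> \<le> 1 * (\<epsilon> / 2)" using c \<epsilon> by (intro mult_right_mono) (auto simp:
      divide_le_eq)
    finally show "?c * r \<le> \<epsilon> / 2" by simp
  qed
  have "(LINT x|lborel. indicator {y. P (z - y) \<le> r} x * h x) \<le> \<epsilon>" for z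
  proof -
    let ?S = "{y. P (z - y) \<le> r}"
    have [measurable]: "?S \<in> sets borel" by measurable
    have e: "emeasure lborel ?S = ennreal (unit_vol P * r ^ CARD('n))"
    proof -
      have "emeasure lborel ?S = (\<integral>\<^sup>+y. indicator {y. P y \<le> r} (z - y) \<partial>lborel)"
      proof -
        have "(\<lambda>y. indicator {y. P y \<le> r} (z - y) :: ennreal) = indicator ?S" by (auto simp:
          indicator_def)
        then show ?thesis by simp
      qed
      also have "\<dots> = (\<integral>\<^sup>+y. indicator {y. P y \<le> r} y \<partial>lborel)"
        by (rule nn_integral_reflect_translate) measurable
      also have "\<dots> = emeasure lborel {y. P y \<le> r}" by (rule nn_integral_indicator) measurable
      finally show ?thesis using emeasure_norm_like_ball[OF polar_norm_like less_imp_le[OF r(1)]] by simp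
    qed
    then have me: "measure lborel ?S = unit_vol P * r ^ CARD('n)"
      using unit_vol_pos[OF polar_norm_like] r by (simp add: measure_def)
    have iS: "integrable lborel (indicator ?S :: real^'n \<Rightarrow> real)" using e by (intro
      integrable_real_indicator) auto
    have ih: "integrable lborel (\<lambda>x. indicator A x * h x)" if "A \<in> sets borel" for A
      using integrable_mult_indicator[of A lborel h] that i by simp
    have "(LINT x|lborel. indicator ?S x * h x) \<le> (LINT x|lborel. real m * indicator ?S x + indicator {x.
      h x > real m} x * h x)"
    proof (intro integral_mono ih Bochner_Integration.integrable_add integrable_mult_right iS)
      fix x
      show "indicator ?S x * h x \<le> real m * indicator ?S x + indicator {x. h x > real m} x * h x"
        using h[of x] by (auto simp: indicator_def not_less)
    qed measurable
    also have "\<dots> = real m * measure lborel ?S + (LINT x|lborel. indicator {x. h x > real m} x * h x)"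
      using iS by (subst Bochner_Integration.integral_add) (auto intro!: ih)
    also have "real m * measure lborel ?S \<le> \<epsilon> / 2"
    proof -
      have "r ^ CARD('n) \<le> r" using r by (intro power_le_one_iff[THEN iffD2] power_decreasing[of 1
        "CARD('n)" r, simplified]) auto
      then have "real m * (unit_vol P * r ^ CARD('n)) \<le> ?c * r"
        using unit_vol_pos[OF polar_norm_like] by (simp add: mult.assoc mult_left_mono)
      then show ?thesis using r(3) me by simp
    qed
    finally show ?thesis using m by simp
  qed
  then show ?thesis using r(1) by blast
qed

section \<open>Local energy bounds and finiteness of the supremum\<close>

lemma finite_polar_cover:
  assumes "bounded (\<Omega> :: (real^'n) set)" "0 < r"
  shows "\<exists>X. finite X \<and> (\<forall>x\<in>\<Omega>. \<exists>z\<in>X. P (x - z) \<le> r)"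
proof -
  obtain C where C: "C > 0" "\<And>x. P x \<le> C * norm x" using norm_like_upper[OF polar_norm_like] by blast
  have "compact (closure \<Omega>)" using assms(1) by (simp add: compact_closure)
  then have "\<exists>k. finite k \<and> closure \<Omega> \<subseteq> (\<Union>x\<in>k. ball x (r / C))"
    using assms(2) C(1) by (simp add: compact_eq_totally_bounded)
  then obtain k where k: "finite k" "closure \<Omega> \<subseteq> (\<Union>x\<in>k. ball x (r / C))" by blast
  have "\<exists>z\<in>k. P (x - z) \<le> r" if "x \<in> \<Omega>" for x
  proof -
    have "x \<in> closure \<Omega>" using that closure_subset by blast
    then obtain z where z: "z \<in> k" "dist z x < r / C" using k(2) by auto
    have "P (x - z) \<le> C * norm (x - z)" by (rule C)
    also have "\<dots> \<le> r" using z C(1) by (simp add: dist_norm norm_minus_commute field_simps)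
    finally show ?thesis using z by blast
  qed
  then show ?thesis using k by blast
qed

lemma nn_integral_indicator_eq_lint:
  assumes i: "integrable lborel (h :: real^'n \<Rightarrow> real)" and h: "\<And>x. 0 \<le> h x" and A: "A
    \<in> sets borel"
  shows "(\<integral>\<^sup>+x. ennreal (h x) * indicator A x \<partial>lborel) = ennreal (LINT x|lborel.
    indicator A x * h x)"
proof -
  have "integrable lborel (\<lambda>x. indicator A x * h x)" using integrable_mult_indicator[of A lborel h] i
    A by simp
  then have "ennreal (LINT x|lborel. indicator A x * h x) = (\<integral>\<^sup>+x. ennreal (indicator A x * h
    x) \<partial>lborel)"
    using h by (intro nn_integral_eq_integral[symmetric]) auto
  also have "\<dots> = (\<integral>\<^sup>+x. ennreal (h x) * indicator A x \<partial>lborel)"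
    by (intro nn_integral_cong) (auto simp: indicator_def)
  finally show ?thesis by simp
qed

text \<open>Each \<open>gs n\<close> has total energy 1, so a lower bound outside a ball is an upper
  bound inside. The limit itself has at most \<open>\<epsilon> / 2\<close> in such a ball and
  semicontinuity costs another \<open>\<epsilon> / 2\<close>, which adds up to
  \<open>E\<close>.\<close>

lemma eventually_local_energy:
  assumes \<Omega>: "open \<Omega>" "bounded \<Omega>" and w: "weakly_converges_W01p \<Omega> (real CARD('n)) us u"
    and rs: "\<And>n. sobolev_rep \<Omega> (us n) (us' n) (gs n)" and r: "sobolev_rep \<Omega> u u' g"
    and en: "\<And>n. (LINT x|lborel. F (gs n x) ^ CARD('n)) = 1"
    and E: "1 - (LINT x|lborel. F (g x) ^ CARD('n)) < E"
  shows "\<exists>\<rho>>0. \<forall>\<^sub>F n in sequentially. \<forall>x\<in>\<Omega>. (LINT y|lborel.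
    indicator {y. P (x - y) \<le> \<rho>} y * F (gs n y) ^ CARD('n)) \<le> E"
proof -
  let ?N = "CARD('n)"
  let ?\<theta> = "LINT x|lborel. F (g x) ^ ?N"
  define \<epsilon> where "\<epsilon> = E - (1 - ?\<theta>)"
  have \<epsilon>: "0 < \<epsilon>" using E by (simp add: \<epsilon>_def)
  have F_nonneg: "0 \<le> F z ^ ?N" for z using norm_like_nonneg[OF F_norm_like] by simp
  have Fi: "integrable lborel (\<lambda>x. F (g x) ^ ?N)" "integrable lborel (\<lambda>x. F (gs n x) ^ ?N)" for n
    using integrable_F_power[OF r] integrable_F_power[OF rs] by auto
  obtain \<rho> where \<rho>: "0 < \<rho>" "\<forall>z. (LINT x|lborel. indicator {y. P (z - y) \<le> \<rho>}
    x * F (g x) ^ ?N) \<le> \<epsilon> / 2"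
    using small_ball_mass[OF Fi(1) F_nonneg, of "\<epsilon> / 2"] \<epsilon> by auto
  \<comment> \<open>Half the radius: the ball of radius \<open>\<rho> / 2\<close> about any
    \<open>x\<close> in \<open>\<Omega>\<close> then lies in the ball of radius
    \<open>\<rho>\<close> about some net point.\<close>
  obtain X where X: "finite X" "\<forall>x\<in>\<Omega>. \<exists>z\<in>X. P (x - z) \<le> \<rho> / 2"
    using finite_polar_cover[OF \<Omega>(2), of "\<rho> / 2"] \<rho>(1) by auto
  let ?B = "\<lambda>z. {y. P (z - y) \<le> \<rho>}"
  have B[measurable]: "?B z \<in> sets borel" for z by measurable
  have split: "(LINT x|lborel. indicator (?B z) x * h x) + (LINT x|lborel. indicator (- ?B z) x * h x) =
    (LINT x|lborel. h x)"
    if "integrable lborel h" for h :: "real^'n \<Rightarrow> real" and z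
  proof -
    have 1: "integrable lborel (\<lambda>x. indicator (?B z) x * h x)" "integrable lborel (\<lambda>x.
      indicator (- ?B z) x * h x)"
      using integrable_mult_indicator[of "?B z" lborel h] integrable_mult_indicator[of "- ?B z" lborel h] that by auto
    show ?thesis
      unfolding Bochner_Integration.integral_add[OF 1, symmetric]
      by (intro Bochner_Integration.integral_cong) (auto simp: indicator_def)
  qed
  have "\<forall>\<^sub>F n in sequentially. (LINT x|lborel. indicator (- ?B z) x * F (g x) ^ ?N) -
    \<epsilon> / 2 \<le> (LINT x|lborel. indicator (- ?B z) x * F (gs n x) ^ ?N)" for z
    using \<epsilon> by (intro weak_lsc[OF \<Omega> w rs r]) auto
  then have "\<forall>\<^sub>F n in sequentially. \<forall>z\<in>X. (LINT x|lborel. indicator (- ?B z) x * F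
    (g x) ^ ?N) - \<epsilon> / 2 \<le> (LINT x|lborel. indicator (- ?B z) x * F (gs n x) ^ ?N)"
    using X(1) by (intro eventually_ball_finite) auto
  then have "\<forall>\<^sub>F n in sequentially. \<forall>x\<in>\<Omega>. (LINT y|lborel. indicator {y. P (x
    - y) \<le> \<rho> / 2} y * F (gs n y) ^ ?N) \<le> E"
  proof eventually_elim
    case (elim n)
    show ?case
    proof
      fix x assume "x \<in> \<Omega>"
      then obtain z where z: "z \<in> X" "P (x - z) \<le> \<rho> / 2" using X(2) by blast
      have sub: "P (z - y) \<le> \<rho>" if "P (x - y) \<le> \<rho> / 2" for y
        using norm_like_triangle[OF polar_norm_like, of "z - x" "x - y"] norm_like_minus[OF polar_norm_like,
          of "x - z"] that z(2) by simp
      have "(LINT y|lborel. indicator {y. P (x - y) \<le> \<rho> / 2} y * F (gs n y) ^ ?N) \<le> (LINT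
        y|lborel. indicator (?B z) y * F (gs n y) ^ ?N)"
      proof (rule integral_mono)
        show "integrable lborel (\<lambda>y. indicator {y. P (x - y) \<le> \<rho> / 2} y * F (gs n y) ^ ?N)"
          using integrable_mult_indicator[of "{y. P (x - y) \<le> \<rho> / 2}" lborel "\<lambda>y. F (gs n y)
            ^ ?N"] Fi(2) by simp
        show "integrable lborel (\<lambda>y. indicator (?B z) y * F (gs n y) ^ ?N)"
          using integrable_mult_indicator[of "?B z" lborel "\<lambda>y. F (gs n y) ^ ?N"] Fi(2) by simp
        show "indicator {y. P (x - y) \<le> \<rho> / 2} y * F (gs n y) ^ ?N \<le> indicator (?B z) y * F (gs
          n y) ^ ?N" for y
          using sub F_nonneg by (auto simp: indicator_def)
      qed
      also have "\<dots> \<le> E"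
        using bspec[OF elim z(1)] split[OF Fi(1), of z] split[OF Fi(2)[of n], of z] spec[OF \<rho>(2), of z]
          en[of n] \<epsilon>_def
        by linarith
      finally show "(LINT y|lborel. indicator {y. P (x - y) \<le> \<rho> / 2} y * F (gs n y) ^ ?N) \<le> E" .
    qed
  qed
  then show ?thesis using \<rho>(1) by (intro exI[of _ "\<rho> / 2"]) auto
qed

lemma eventually_TM_bounded:
  fixes \<Omega> :: "(real^'n) set"
  assumes \<Omega>: "open \<Omega>" "bounded \<Omega>" and \<beta>: "0 \<le> \<beta>" "\<beta> < real
    CARD('n)" and p: "0 < p" "ereal p < p_crit F \<Omega> u"
    and w: "weakly_converges_W01p \<Omega> (real CARD('n)) us u" and en: "\<And>n. aniso_energy F \<Omega> (us n) = 1"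
  shows "\<exists>C<\<infinity>. \<forall>\<^sub>F n in sequentially. singular_TM_integral F \<Omega> \<beta>
    p (us n) \<le> C"
proof -
  let ?N = "real CARD('n)"
  have N: "1 < ?N" using N2 by simp
  have uW: "u \<in> W01p \<Omega> ?N" "us n \<in> W01p \<Omega> ?N" for n using w by (auto simp:
    weakly_converges_W01p_def)
  obtain u' g where r: "sobolev_rep \<Omega> u u' g" using sobolev_rep_of_W01p[OF \<Omega>(1) uW(1)] by blast
  have "\<forall>n. \<exists>vg. sobolev_rep \<Omega> (us n) (fst vg) (snd vg)" using sobolev_rep_of_W01p[OF
    \<Omega>(1) uW(2)] by simp
  from choice[OF this] obtain vg where rs: "\<And>n. sobolev_rep \<Omega> (us n) (fst (vg n)) (snd (vg n))" by blast
  let ?\<theta> = "LINT x|lborel. F (g x) ^ CARD('n)"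
  have \<theta>: "aniso_energy F \<Omega> u = ?\<theta>" by (rule aniso_energy_rep[OF \<Omega>(1) r])
  have en': "(LINT x|lborel. F (snd (vg n) x) ^ CARD('n)) = 1" for n using aniso_energy_rep[OF \<Omega>(1)
    rs] en by simp
  \<comment> \<open>\<open>E\<close> is the power \<open>N - 1\<close> of a number strictly between
    \<open>1 / p\<close> and the \<open>(N - 1)\<close>-th root of the residual energy. The maximum
    with 0 covers limits of energy at least 1, where \<open>p_crit\<close> is infinite.\<close>
  obtain E where E: "0 < E" "1 - ?\<theta> < E" "p * E powr (1 / (?N - 1)) < 1"
  proof -
    define E0 where "E0 = max 0 (1 - ?\<theta>)"
    define t0 where "t0 = E0 powr (1 / (?N - 1))"
    have pt: "p * t0 < 1"
    proof (cases "?\<theta> < 1")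
      case True
      then have "p < (1 - ?\<theta>) powr (- 1 / (?N - 1))" using p(2) by (simp add: p_crit_def \<theta>)
      also have "\<dots> = 1 / (1 - ?\<theta>) powr (1 / (?N - 1))"
        by (simp add: powr_minus_divide[symmetric])
      finally show ?thesis using True by (simp add: t0_def E0_def field_simps)
    next
      case False
      then show ?thesis by (simp add: t0_def E0_def)
    qed
    define t where "t = (t0 + 1 / p) / 2"
    have t0: "0 \<le> t0" by (simp add: t0_def)
    have t: "t0 < t" "p * t < 1" using pt p(1) by (auto simp: t_def field_simps)
    have e: "(t powr (?N - 1)) powr (1 / (?N - 1)) = t" using t t0 N by (simp add: powr_powr)
    have "E0 = t0 powr (?N - 1)" using N by (simp add: t0_def powr_powr E0_def)
    also have "\<dots> < t powr (?N - 1)" using t t0 N by (intro powr_less_mono2) auto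
    finally have "E0 < t powr (?N - 1)" .
    then have "0 < t powr (?N - 1)" "1 - ?\<theta> < t powr (?N - 1)" by (auto simp: E0_def)
    then show ?thesis using t(2) e by (intro that[of "t powr (?N - 1)"]) auto
  qed
  obtain \<rho> where \<rho>: "0 < \<rho>" and ev: "\<forall>\<^sub>F n in sequentially.
    \<forall>x\<in>\<Omega>. (LINT y|lborel. indicator {y. P (x - y) \<le> \<rho>} y * F (snd (vg n) y) ^
    CARD('n)) \<le> E"
    using eventually_local_energy[OF \<Omega> w rs r en' E(2)] by blast
  obtain C where C: "C < \<infinity>" and bd: "\<forall>f u'. f \<in> borel_measurable borel
    \<longrightarrow> (\<forall>y. 0 \<le> f y) \<longrightarrow> (\<forall>y. y \<notin> \<Omega>
    \<longrightarrow> f y = 0) \<longrightarrow>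
    (\<integral>\<^sup>+y. ennreal (f y ^ CARD('n)) \<partial>lborel) \<le> 1 \<longrightarrow>
    (\<forall>x\<in>\<Omega>. (\<integral>\<^sup>+y. ennreal (f y ^ CARD('n)) * indicator {y. P (x - y) \<le>
      \<rho>} y \<partial>lborel) \<le> ennreal E) \<longrightarrow>
    (AE x in lborel. x \<in> \<Omega> \<longrightarrow> ennreal (?N * unit_vol P * \<bar>u' x\<bar>) \<le>
       (\<integral>\<^sup>+y. ennreal (f y) * ennreal (P (x - y) powr - (?N - 1)) \<partial>lborel)) \<longrightarrow>
    (\<integral>\<^sup>+x. ennreal (exp (lambda_N F * (1 - \<beta> / ?N) * p * \<bar>u' x\<bar> powr (?N /
      (?N - 1))) / P x powr \<beta>) * indicator \<Omega> x \<partial>lborel) \<le> C"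
    using exp_integral_bound[OF \<Omega> \<beta> p(1) E(1,3) \<rho>] by (elim exE conjE) (rule that)
  have "\<forall>\<^sub>F n in sequentially. singular_TM_integral F \<Omega> \<beta> p (us n) \<le> C"
    using ev
  proof eventually_elim
    case (elim n)
    let ?v = "fst (vg n)" and ?g = "snd (vg n)"
    have Fi: "integrable lborel (\<lambda>x. F (?g x) ^ CARD('n))" by (rule integrable_F_power[OF rs])
    have F_nonneg: "0 \<le> F z" for z by (rule norm_like_nonneg[OF F_norm_like])
    have [measurable]: "?g \<in> borel_measurable borel" using rs[of n] by (auto simp: sobolev_rep_def)
    have "(\<integral>\<^sup>+x. ennreal (exp (lambda_N F * (1 - \<beta> / ?N) * p * \<bar>?v x\<bar> powr
      (?N / (?N - 1))) / P x powr \<beta>) * indicator \<Omega> x \<partial>lborel) \<le> C"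
    proof (rule bd[rule_format])
      show "(\<lambda>y. F (?g y)) \<in> borel_measurable borel" by measurable
      show "F (?g y) = 0" if "y \<notin> \<Omega>" for y using rs[of n] that norm_like_0[OF F_norm_like] by
        (simp add: sobolev_rep_def)
      have "(\<integral>\<^sup>+y. ennreal (F (?g y) ^ CARD('n)) \<partial>lborel) = ennreal 1"
        using nn_integral_eq_integral[OF Fi] F_nonneg en'[of n] by simp
      then show "(\<integral>\<^sup>+y. ennreal (F (?g y) ^ CARD('n)) \<partial>lborel) \<le> 1" by simp
      show "(\<integral>\<^sup>+y. ennreal (F (?g y) ^ CARD('n)) * indicator {y. P (x - y) \<le> \<rho>} y
        \<partial>lborel) \<le> ennreal E" if "x \<in> \<Omega>" for x
        using elim that F_nonneg by (subst nn_integral_indicator_eq_lint[OF Fi]) (auto intro: ennreal_leI)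
      show "AE x in lborel. x \<in> \<Omega> \<longrightarrow> ennreal (?N * unit_vol P * \<bar>?v x\<bar>)
        \<le> (\<integral>\<^sup>+y. ennreal (F (?g y)) * ennreal (P (x - y) powr - (?N - 1)) \<partial>lborel)"
        by (rule potential_W01p[OF \<Omega> uW(2) rs])
    qed (rule F_nonneg)
    moreover have "singular_TM_integral F \<Omega> \<beta> p (us n) = (\<integral>\<^sup>+x. ennreal (exp
      (lambda_N F * (1 - \<beta> / ?N) * p * \<bar>?v x\<bar> powr (?N / (?N - 1))) / P x powr \<beta>) *
      indicator \<Omega> x \<partial>lborel)"
    proof -
      have "AE x in lborel. x \<in> \<Omega> \<longrightarrow> us n x = ?v x" using rs[of n] by (auto simp:
        sobolev_rep_def)
      then have "AE x in lborel. ennreal (exp (lambda_N F * (1 - \<beta> / ?N) * p * \<bar>us n x\<bar> powr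
        (?N / (?N - 1))) / P x powr \<beta>) * indicator \<Omega> x =
        ennreal (exp (lambda_N F * (1 - \<beta> / ?N) * p * \<bar>?v x\<bar> powr (?N / (?N - 1))) / P x powr
          \<beta>) * indicator \<Omega> x"
        by eventually_elim (auto simp: indicator_def)
      then show ?thesis
        unfolding singular_TM_integral_def Let_def nn_integral_lebesgue_on_open[OF \<Omega>(1)] by (rule
          nn_integral_cong_AE)
    qed
    ultimately show ?case by simp
  qed
  then show ?thesis using C by blast
qed

lemma TM_sup_finite:
  fixes \<Omega> :: "(real^'n) set"
  assumes \<Omega>: "open \<Omega>" "bounded \<Omega>" and \<beta>: "0 \<le> \<beta>" "\<beta> < real
    CARD('n)" and p: "0 < p" "ereal p < p_crit F \<Omega> u"
    and adm: "admissible_sequence F \<Omega> us u"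
  shows "(SUP n. singular_TM_integral F \<Omega> \<beta> p (us n)) < \<infinity>"
proof -
  have w: "weakly_converges_W01p \<Omega> (real CARD('n)) us u" and en: "\<And>n. aniso_energy F \<Omega> (us n) = 1"
    using adm by (auto simp: admissible_sequence_def)
  obtain C where C: "C < \<infinity>" "\<forall>\<^sub>F n in sequentially. singular_TM_integral F \<Omega>
    \<beta> p (us n) \<le> C"
    using eventually_TM_bounded[OF \<Omega> \<beta> p w en] by blast
  obtain n0 where n0: "\<And>n. n \<ge> n0 \<Longrightarrow> singular_TM_integral F \<Omega> \<beta> p (us n) \<le> C"
    using C(2) by (auto simp: eventually_sequentially)
  have fin: "singular_TM_integral F \<Omega> \<beta> p (us n) < \<infinity>" for n
  proof -
    \<comment> \<open>A single term is the weak limit of its constant sequence, and its energy 1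
      makes \<open>p_crit\<close> infinite. This settles the finitely many terms not reached by the
      eventual bound.\<close>
    have "weakly_converges_W01p \<Omega> (real CARD('n)) (\<lambda>_. us n) (us n)"
      using w by (auto simp: weakly_converges_W01p_def)
    moreover have "ereal p < p_crit F \<Omega> (us n)" by (simp add: p_crit_def en)
    ultimately obtain D where "D < \<infinity>" "\<forall>\<^sub>F m::nat in sequentially.
      singular_TM_integral F \<Omega> \<beta> p (us n) \<le> D"
      using eventually_TM_bounded[OF \<Omega> \<beta> p(1), of "us n" "\<lambda>_. us n"] en by auto
    then show ?thesis by (auto simp: eventually_sequentially)
  qed
  have "singular_TM_integral F \<Omega> \<beta> p (us n) \<le> C + (\<Sum>m<n0. singular_TM_integral F
    \<Omega> \<beta> p (us m))" for n
  proof (cases "n < n0")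
    case True
    then have "singular_TM_integral F \<Omega> \<beta> p (us n) \<le> (\<Sum>m<n0. singular_TM_integral F
      \<Omega> \<beta> p (us m))"
      by (intro member_le_sum) auto
    then show ?thesis by (rule add_increasing[rotated]) simp
  next
    case False
    then show ?thesis using n0[of n] by (simp add: add_increasing2)
  qed
  then have "(SUP n. singular_TM_integral F \<Omega> \<beta> p (us n)) \<le> C + (\<Sum>m<n0.
    singular_TM_integral F \<Omega> \<beta> p (us m))"
    by (rule SUP_least)
  also have "\<dots> < \<infinity>" using C(1) fin by simp
  finally show ?thesis .
qed

end

section \<open>Smooth approximations of the Moser functions\<close>

text \<open>A descent from 1 to 0 over length \<open>\<beta> - \<alpha>\<close> has maximal slope at
  least \<open>1 / (\<beta> - \<alpha>)\<close>; this is attained up to the factor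
  \<open>1 / (1 - \<delta>)\<close>, because the Moser energy must be asymptotically sharp.
  Smoothness is recorded for \<open>b\<close>, from which it passes to \<open>\<Phi>\<close> by the
  derivative relation.\<close>

lemma smooth_step:
  fixes \<alpha> \<beta> \<delta> :: real
  assumes ab: "\<alpha> < \<beta>" and \<delta>: "0 < \<delta>" "\<delta> < 1"
  shows "\<exists>\<Phi> b. (\<forall>t. (\<Phi> has_real_derivative - b t) (at t)) \<and> (\<forall>t. t
    \<le> \<alpha> \<longrightarrow> \<Phi> t = 1) \<and> (\<forall>t. \<beta> \<le> t \<longrightarrow>
    \<Phi> t = 0) \<and>
    (\<forall>t. 0 \<le> b t \<and> b t \<le> 1 / ((1 - \<delta>) * (\<beta> - \<alpha>))) \<and>
      (\<forall>t. t \<le> \<alpha> \<or> \<beta> \<le> t \<longrightarrow> b t = 0) \<and>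
    (\<forall>k S (f :: real^'n \<Rightarrow> real). open S \<longrightarrow> Ck_on k f S \<longrightarrow>
      Ck_on k (\<lambda>x. b (f x)) S)"
proof -
  define h where "h = \<delta> * (\<beta> - \<alpha>) / 4"
  have h: "0 < h" using ab \<delta> by (simp add: h_def)
  \<comment> \<open>For large \<open>k\<close> the profile \<open>c\<close> exceeds
    \<open>1 - \<delta> / 2\<close> at distance at least \<open>h\<close> from both ends, so its
    integral is nearly the length of the interval.\<close>
  have "(\<lambda>k. (flat (real k * h))\<^sup>2) \<longlonglongrightarrow> (indicator {0<..} h)\<^sup>2"
    by (intro tendsto_power flat_tendsto_indicator)
  then have "\<forall>\<^sub>F k in sequentially. 1 - \<delta> / 2 < (flat (real k * h))\<^sup>2"
    using h \<delta> by (intro order_tendstoD(1)) auto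
  then have "\<forall>\<^sub>F k in sequentially. 1 - \<delta> / 2 < (flat (real k * h))\<^sup>2 \<and> 1 \<le> k"
    using eventually_ge_at_top[of 1] by eventually_elim auto
  then obtain k where k: "1 - \<delta> / 2 < (flat (real k * h))\<^sup>2" "1 \<le> k"
    by (auto simp: eventually_sequentially)
  define c where "c t = flat (real k * (t - \<alpha>)) * flat (real k * (\<beta> - t))" for t
  have c0: "0 \<le> c t" "c t \<le> 1" for t
    by (auto simp: c_def flat_nonneg flat_le_1 intro!: mult_le_one)
  have cz: "c t = 0" if "t \<le> \<alpha> \<or> \<beta> \<le> t" for t
    using that by (auto simp: c_def flat_eq_0_iff mult_nonneg_nonpos)
  have cc: "continuous_on S c" for S
    unfolding c_def by (intro continuous_intros continuous_on_compose2[OF continuous_on_flat[of UNIV]]) auto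
  define \<Psi> where "\<Psi> t = integral {\<alpha> - 1..t} c" for t
  have \<Psi>0: "\<Psi> t = 0" if "t \<le> \<alpha>" for t
  proof -
    have "integral {\<alpha> - 1..t} c = integral {\<alpha> - 1..t} (\<lambda>_. 0)"
      using that by (intro integral_cong) (auto intro: cz)
    then show ?thesis by (simp add: \<Psi>_def)
  qed
  have D: "(\<Psi> has_real_derivative c t) (at t)" for t
  proof (cases "t < \<alpha>")
    case True
    have "((\<lambda>_. 0) has_real_derivative 0) (at t)" by simp
    then have "(\<Psi> has_real_derivative 0) (at t)"
      by (rule has_field_derivative_transform_within_open[where S="{..<\<alpha>}"]) (use True \<Psi>0 in auto)
    then show ?thesis using True cz by simp
  next
    case False
    have "((\<lambda>x. integral {\<alpha> - 1..x} c) has_real_derivative c t) (at t within {\<alpha> - 1..t + 1})"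
      by (rule integral_has_real_derivative[OF cc]) (use False in auto)
    then show ?thesis
      unfolding \<Psi>_def by (subst (asm) at_within_interior) (use False in \<open>auto simp:
        interior_atLeastAtMost_real\<close>)
  qed
  define B where "B = \<Psi> \<beta>"
  have \<Psi>B: "\<Psi> t = B" if "\<beta> \<le> t" for t
  proof -
    have "integral {\<alpha> - 1..\<beta>} c + integral {\<beta>..t} c = integral {\<alpha> - 1..t} c"
      using ab that by (intro Henstock_Kurzweil_Integration.integral_combine integrable_continuous_real cc) auto
    moreover have "integral {\<beta>..t} c = integral {\<beta>..t} (\<lambda>_. 0)"
      by (intro integral_cong) (auto intro: cz)
    ultimately show ?thesis by (simp add: B_def \<Psi>_def)
  qed
  have Bge: "(1 - \<delta>) * (\<beta> - \<alpha>) \<le> B"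
  proof -
    have "(1 - \<delta>) * (\<beta> - \<alpha>) \<le> (1 - \<delta> / 2) * ((1 - \<delta> / 2) * (\<beta> -
      \<alpha>))"
    proof -
      have "(1 - \<delta>) \<le> (1 - \<delta> / 2) * (1 - \<delta> / 2)" by (simp add: algebra_simps)
      then show ?thesis using ab by (simp add: mult.assoc[symmetric] mult_right_mono)
    qed
    also have "\<dots> \<le> (flat (real k * h))\<^sup>2 * ((1 - \<delta> / 2) * (\<beta> - \<alpha>))"
      using k \<delta> ab by (intro mult_right_mono) auto
    also have "(1 - \<delta> / 2) * (\<beta> - \<alpha>) = (\<beta> - h) - (\<alpha> + h)"
      by (simp add: h_def field_simps)
    also have "(flat (real k * h))\<^sup>2 * ((\<beta> - h) - (\<alpha> + h)) = integral {\<alpha> +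
      h..\<beta> - h} (\<lambda>_. (flat (real k * h))\<^sup>2)"
    proof -
      have "\<alpha> + h \<le> \<beta> - h"
      proof -
        have "4 * h = \<delta> * (\<beta> - \<alpha>)" by (simp add: h_def)
        also have "\<dots> \<le> 1 * (\<beta> - \<alpha>)" using \<delta> ab by (intro mult_right_mono) auto
        finally show ?thesis using h by simp
      qed
      then show ?thesis by simp
    qed
    also have "\<dots> \<le> integral {\<alpha> + h..\<beta> - h} c"
    proof (rule integral_le)
      fix t assume t: "t \<in> {\<alpha> + h..\<beta> - h}"
      have mono: "flat s \<le> flat s'" if "s \<le> s'" for s s'
        using that by (auto simp: flat_def frac_le)
      have "flat (real k * h) \<le> flat (real k * (t - \<alpha>))" "flat (real k * h) \<le> flat (real k *
        (\<beta> - t))"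
        using t by (auto intro!: mono mult_left_mono)
      then show "(flat (real k * h))\<^sup>2 \<le> c t"
        unfolding c_def power2_eq_square by (intro mult_mono flat_nonneg)
    qed (auto intro!: integrable_continuous_real cc)
    also have "\<dots> \<le> integral {\<alpha> - 1..\<beta>} c"
      using h c0 by (intro integral_subset_le integrable_continuous_real cc) auto
    finally show ?thesis by (simp add: B_def \<Psi>_def)
  qed
  have B: "0 < B" using Bge ab \<delta> by (smt (verit) mult_pos_pos)
  have Dg: "((\<lambda>t. 1 - \<Psi> t / B) has_real_derivative - (c t / B)) (at t)" for t
    using B by (auto intro!: derivative_eq_intros D)
  have bd: "c t / B \<le> 1 / ((1 - \<delta>) * (\<beta> - \<alpha>))" for t
    using c0(2)[of t] Bge B ab \<delta> by (intro frac_le) auto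
  have Ck: "Ck_on m (\<lambda>x. c (f x) / B) S" if S: "open S" and f: "Ck_on m f S" for m S and f ::
    "real^'n \<Rightarrow> real"
  proof -
    have "Ck_on m (\<lambda>x. flat (real k * (f x + (- \<alpha>))) * flat (real k * (\<beta> + (- 1) * f x))
      * (1 / B)) S"
      by (intro Ck_on_mult Ck_on_flat Ck_on_add Ck_on_const S f)
    then show ?thesis by (simp add: c_def)
  qed
  show ?thesis
    by (rule exI[of _ "\<lambda>t. 1 - \<Psi> t / B"], rule exI[of _ "\<lambda>t. c t / B"])
      (use Dg \<Psi>0 \<Psi>B bd c0 cz Ck B in \<open>auto simp: divide_nonneg_pos\<close>)
qed

lemma Ck_on_translate:
  fixes a :: "real^'n"
  assumes S: "open S" and f: "Ck_on k f S"
  shows "Ck_on k (\<lambda>x. f (x - a)) {x. x - a \<in> S}"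
  using f
proof (induction k arbitrary: f)
  case 0
  then show ?case by (auto intro!: continuous_on_compose2[of S f] continuous_intros)
next
  case (Suc k)
  have op: "open {x. x - a \<in> S}"
    using open_vimage[OF S, of "\<lambda>x. x - a"] by (simp add: vimage_def continuous_intros)
  show ?case
  proof (rule Ck_on_SucI[OF op, where g="\<lambda>x. gradient f (x - a)"])
    fix x assume "x \<in> {x. x - a \<in> S}"
    then have "(f has_derivative (\<bullet>) (gradient f (x - a))) (at (x - a))"
      using Suc.prems by (intro has_derivative_gradient) (auto simp: Ck_on_Suc_iff)
    moreover have "((\<lambda>x. x - a) has_derivative (\<lambda>h. h)) (at x)" by (auto intro!: derivative_eq_intros)
    ultimately show "((\<lambda>x. f (x - a)) has_derivative (\<bullet>) (gradient f (x - a))) (at x)"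
      by (rule has_derivative_compose[rotated])
  next
    fix i show "Ck_on k (\<lambda>x. gradient f (x - a) $ i) {x. x - a \<in> S}"
      using Suc.prems by (intro Suc.IH) (auto simp: Ck_on_Suc_iff)
  qed
qed

section \<open>Smoothed logarithms of the polar and the Moser functions\<close>

context anisotropic
begin

text \<open>The unit ball of \<open>F\<close> is compact; a net of mesh \<open>\<delta> * c\<close>,
  with \<open>c\<close> the lower constant of the polar, changes each pairing with \<open>x\<close>
  by at most \<open>\<delta> * P x\<close>.\<close>

lemma polar_net:
  assumes \<delta>: "0 < \<delta>"
  shows "\<exists>X. finite X \<and> X \<noteq> {} \<and> (\<forall>\<xi>\<in>X. F \<xi> \<le> 1) \<and>
    (\<forall>x. \<exists>\<xi>\<in>X. (1 - \<delta>) * P x \<le> x \<bullet> \<xi>)"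
proof -
  let ?W = "{\<xi>. F \<xi> \<le> 1}"
  obtain c where c: "c > 0" "\<And>x. c * norm x \<le> P x" using norm_like_lower[OF polar_norm_like] by blast
  have "closed ?W" using norm_like_continuous[OF F_norm_like] by (intro closed_Collect_le) auto
  then have "compact ?W" using norm_like_sublevel_bounded[OF F_norm_like] by (simp add: compact_eq_bounded_closed)
  then have "seq_compact ?W" by (rule compact_imp_seq_compact)
  from seq_compact_imp_totally_bounded[OF this] obtain X where X: "finite X" "X \<subseteq> ?W" "?W
    \<subseteq> (\<Union>x\<in>X. ball x (\<delta> * c))"
    using c \<delta> by (metis mult_pos_pos)
  have "0 \<in> ?W" by (simp add: norm_like_0[OF F_norm_like])
  then have ne: "X \<noteq> {}" using X(3) by blast
  have "\<exists>\<xi>\<in>X. (1 - \<delta>) * P x \<le> x \<bullet> \<xi>" for x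
  proof -
    let ?M = "Max ((\<lambda>\<xi>. x \<bullet> \<xi>) ` X)"
    have "P x \<le> ?M + \<delta> * P x"
    proof (rule polar_least)
      fix \<xi> assume "F \<xi> \<le> 1"
      then obtain \<eta> where \<eta>: "\<eta> \<in> X" "dist \<eta> \<xi> < \<delta> * c" using X(3) by auto
      have "x \<bullet> \<xi> = x \<bullet> \<eta> + x \<bullet> (\<xi> - \<eta>)" by (simp add: inner_diff_right)
      also have "x \<bullet> \<eta> \<le> ?M" using X(1) \<eta>(1) by (intro Max_ge) auto
      also have "x \<bullet> (\<xi> - \<eta>) \<le> norm x * norm (\<xi> - \<eta>)" by (rule norm_cauchy_schwarz)
      also have "\<dots> \<le> norm x * (\<delta> * c)" using \<eta>(2) by (intro mult_left_mono) (auto simp: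
        dist_norm norm_minus_commute)
      also have "\<dots> = \<delta> * (c * norm x)" by simp
      also have "\<dots> \<le> \<delta> * P x" using c(2) \<delta> by (intro mult_left_mono) auto
      finally show "x \<bullet> \<xi> \<le> ?M + \<delta> * P x" by simp
    qed
    moreover have "?M \<in> (\<lambda>\<xi>. x \<bullet> \<xi>) ` X" using X(1) ne by (intro Max_in) auto
    ultimately show ?thesis by (auto simp: algebra_simps)
  qed
  then show ?thesis using X ne by blast
qed

text \<open>\<open>L\<close> is the logarithm of an \<open>\<ell>\<^sup>2\<^sup>q\<close> norm over a finite
  net of linear functionals; it
  replaces \<open>ln (polar F x)\<close>, which need not be smooth.\<close>

lemma smooth_log_norm:
  assumes \<delta>: "0 < \<delta>" "\<delta> < 1"
  shows "\<exists>L. (\<forall>k. Ck_on k L (- {0})) \<and> (\<forall>x. x \<noteq> 0 \<longrightarrow> ln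
    ((1 - \<delta>) * P x) \<le> L x \<and> L x \<le> ln ((1 + \<delta>) * P x) \<and>
    F (gradient L x) \<le> (1 / (1 - \<delta>) + \<delta>) / (1 - \<delta>) / P x)"
proof -
  obtain X where X: "finite X" "X \<noteq> {}" "\<forall>\<xi>\<in>X. F \<xi> \<le> 1" "\<forall>x.
    \<exists>\<xi>\<in>X. (1 - \<delta>) * P x \<le> x \<bullet> \<xi>"
    using polar_net[OF \<delta>(1)] by blast
  let ?m = "real (card X)"
  have m: "1 \<le> ?m" using X by (simp add: Suc_le_eq card_gt_0_iff)
  define \<eta> where "\<eta> = 1 - \<delta>"
  have \<eta>: "0 < \<eta>" "\<eta> < 1" using \<delta> by (auto simp: \<eta>_def)
  have "(\<lambda>q. ?m * \<eta> ^ q) \<longlonglongrightarrow> ?m * 0" using \<eta> by (intro tendsto_intros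
    LIMSEQ_power_zero) auto
  then have "\<forall>\<^sub>F q in sequentially. ?m * \<eta> ^ q < \<delta>" using \<delta> by (intro
    order_tendstoD(2)) auto
  moreover have "(\<lambda>q. ln ?m * (1 / real q)) \<longlonglongrightarrow> ln ?m * 0" by (intro
    tendsto_intros lim_1_over_n)
  then have "\<forall>\<^sub>F q in sequentially. ln ?m * (1 / real q) < ln (1 + \<delta>)" using \<delta> by
    (intro order_tendstoD(2)) auto
  ultimately have "\<forall>\<^sub>F q in sequentially. ?m * \<eta> ^ q < \<delta> \<and> ln ?m * (1 / real
    q) < ln (1 + \<delta>) \<and> 1 \<le> q"
    using eventually_ge_at_top[of 1] by eventually_elim auto
  then obtain q where q: "?m * \<eta> ^ q < \<delta>" "ln ?m * (1 / real q) < ln (1 + \<delta>)" "1 \<le> q"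
    by (auto simp: eventually_sequentially)
  \<comment> \<open>An even exponent makes every summand of \<open>Q\<close> nonnegative, so that
    \<open>Q\<close> dominates the largest one.\<close>
  define n where "n = 2 * q"
  have n: "even n" "2 \<le> n" "odd (n - 1)" using q(3) by (auto simp: n_def)
  have mn: "?m * \<eta> ^ (n - 1) \<le> \<delta>" "ln ?m / real n \<le> ln (1 + \<delta>)"
  proof -
    have "\<eta> ^ (n - 1) \<le> \<eta> ^ q" using \<eta> q(3) by (intro power_decreasing) (auto simp: n_def)
    then have "?m * \<eta> ^ (n - 1) \<le> ?m * \<eta> ^ q" using m by (intro mult_left_mono) auto
    then show "?m * \<eta> ^ (n - 1) \<le> \<delta>" using q(1) by simp
    have "ln ?m / real n \<le> ln ?m * (1 / real q)"
      using m q(3) by (simp add: n_def frac_le)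
    then show "ln ?m / real n \<le> ln (1 + \<delta>)" using q(2) by simp
  qed
  define Q where "Q x = (\<Sum>\<xi>\<in>X. (x \<bullet> \<xi>) ^ n)" for x
  have Qge: "((1 - \<delta>) * P x) ^ n \<le> Q x" for x
  proof -
    obtain \<xi> where \<xi>: "\<xi> \<in> X" "(1 - \<delta>) * P x \<le> x \<bullet> \<xi>" using X(4) by blast
    have "((1 - \<delta>) * P x) ^ n \<le> (x \<bullet> \<xi>) ^ n"
      using \<xi> \<delta> norm_like_nonneg[OF polar_norm_like] by (intro power_mono) auto
    also have "\<dots> \<le> Q x" unfolding Q_def using X(1) \<xi>(1) n by (intro member_le_sum) auto
    finally show ?thesis .
  qed
  have Pp: "0 < P x" if "x \<noteq> 0" for x by (rule norm_like_pos[OF polar_norm_like that])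
  have Qpos: "0 < Q x" if "x \<noteq> 0" for x
    using Qge[of x] Pp[OF that] \<delta> by (smt (verit) mult_pos_pos zero_less_power)
  have xi: "\<bar>x \<bullet> \<xi>\<bar> \<le> P x" if "\<xi> \<in> X" for x \<xi>
  proof -
    have "\<bar>x \<bullet> \<xi>\<bar> \<le> P x * F \<xi>" by (rule polar_inner)
    also have "\<dots> \<le> P x * 1" using X(3) that norm_like_nonneg[OF polar_norm_like] by (intro
      mult_left_mono) auto
    finally show ?thesis by simp
  qed
  have Qle: "Q x \<le> ?m * P x ^ n" for x
  proof -
    have "Q x \<le> (\<Sum>\<xi>\<in>X. P x ^ n)"
      unfolding Q_def
    proof (rule sum_mono)
      fix \<xi> assume "\<xi> \<in> X"
      then have "\<bar>x \<bullet> \<xi>\<bar> ^ n \<le> P x ^ n" by (intro power_mono xi) auto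
      then show "(x \<bullet> \<xi>) ^ n \<le> P x ^ n" using n by (simp add: power_even_abs)
    qed
    then show ?thesis by simp
  qed
  define L where "L x = (1 / real n) * ln (Q x)" for x
  have QC: "Ck_on k Q S" if "open S" for k S
    unfolding Q_def by (intro Ck_on_sum Ck_on_power Ck_on_inner that)
  have LC: "Ck_on k L (- {0})" for k
    unfolding L_def using Qpos by (intro Ck_on_mult Ck_on_const Ck_on_ln QC) auto
  have bounds: "ln ((1 - \<delta>) * P x) \<le> L x \<and> L x \<le> ln ((1 + \<delta>) * P x)" if x: "x
    \<noteq> 0" for x
  proof
    note p = Pp[OF x]
    have np: "0 < real n" using n by simp
    have "real n * ln ((1 - \<delta>) * P x) = ln (((1 - \<delta>) * P x) ^ n)" using p \<delta> by (simp
      add: ln_realpow)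
    also have "\<dots> \<le> ln (Q x)" using Qge[of x] p \<delta> Qpos[OF x] by simp
    finally show "ln ((1 - \<delta>) * P x) \<le> L x" using np by (simp add: L_def field_simps)
    have "ln (Q x) \<le> ln (?m * P x ^ n)" using Qle[of x] Qpos[OF x] by simp
    also have "\<dots> = ln ?m + real n * ln (P x)" using p m by (simp add: ln_mult ln_realpow)
    finally have "L x \<le> ln ?m / real n + ln (P x)" using np by (simp add: L_def field_simps)
    also have "\<dots> \<le> ln (1 + \<delta>) + ln (P x)" using mn by simp
    also have "\<dots> = ln ((1 + \<delta>) * P x)" using p \<delta> by (simp add: ln_mult)
    finally show "L x \<le> ln ((1 + \<delta>) * P x)" .
  qed
  have grad: "F (gradient L x) \<le> (1 / (1 - \<delta>) + \<delta>) / (1 - \<delta>) / P x" if x: "x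
    \<noteq> 0" for x
  proof -
    let ?T = "(1 - \<delta>) * P x"
    have T: "0 < ?T" using Pp[OF x] \<delta> by simp
    have Qp: "0 < Q x" by (rule Qpos[OF x])
    have "(Q has_derivative (\<lambda>h. \<Sum>\<xi>\<in>X. real n * (x \<bullet> \<xi>) ^ (n - 1) * (h
      \<bullet> \<xi>))) (at x)"
      unfolding Q_def by (auto intro!: derivative_eq_intros sum.cong simp: mult_ac)
    then have dQ: "(Q has_derivative (\<lambda>h. (\<Sum>\<xi>\<in>X. (real n * (x \<bullet> \<xi>) ^ (n -
      1)) *\<^sub>R \<xi>) \<bullet> h)) (at x)"
      by (simp add: inner_sum_left inner_sum_right inner_commute)
    have gQ: "gradient Q x = (\<Sum>\<xi>\<in>X. (real n * (x \<bullet> \<xi>) ^ (n - 1)) *\<^sub>R \<xi>)"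
      by (rule gradient_eqI[OF dQ])
    have "((\<lambda>y. (1 / real n) * ln (Q y)) has_derivative (\<lambda>h. ((1 / real n * (1 / Q x))
      *\<^sub>R gradient Q x) \<bullet> h)) (at x)"
    proof (rule has_derivative_gradient_compose)
      show "Q differentiable (at x)" using dQ by (auto simp: differentiable_def)
      show "((\<lambda>y. (1 / real n) * ln y) has_real_derivative 1 / real n * (1 / Q x)) (at (Q x))"
        using Qp n(2) by (auto intro!: derivative_eq_intros)
    qed
    then have "gradient L x = (1 / real n * (1 / Q x)) *\<^sub>R gradient Q x"
      unfolding L_def by (rule gradient_eqI)
    also have "\<dots> = (1 / Q x) *\<^sub>R (\<Sum>\<xi>\<in>X. (x \<bullet> \<xi>) ^ (n - 1) *\<^sub>R \<xi>)"
      using n unfolding gQ scaleR_sum_right by (intro sum.cong) auto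
    finally have "F (gradient L x) = 1 / Q x * F (\<Sum>\<xi>\<in>X. (x \<bullet> \<xi>) ^ (n - 1) *\<^sub>R \<xi>)"
      using Qp by (simp add: norm_like_scale[OF F_norm_like])
    also have "F (\<Sum>\<xi>\<in>X. (x \<bullet> \<xi>) ^ (n - 1) *\<^sub>R \<xi>) \<le> (\<Sum>\<xi>\<in>X.
      \<bar>x \<bullet> \<xi>\<bar> ^ (n - 1))"
    proof -
      have "F (\<Sum>\<xi>\<in>Y. (x \<bullet> \<xi>) ^ (n - 1) *\<^sub>R \<xi>) \<le> (\<Sum>\<xi>\<in>Y.
        \<bar>x \<bullet> \<xi>\<bar> ^ (n - 1))" if "finite Y" "Y \<subseteq> X" for Y
        using that
      proof (induction Y rule: finite_induct)
        case empty then show ?case by (simp add: norm_like_0[OF F_norm_like])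
      next
        case (insert \<xi> Y)
        have "F ((x \<bullet> \<xi>) ^ (n - 1) *\<^sub>R \<xi>) \<le> \<bar>x \<bullet> \<xi>\<bar> ^ (n - 1) * 1"
          unfolding norm_like_scale[OF F_norm_like] power_abs using insert.prems X(3) by (intro mult_left_mono) auto
        then show ?case
          using insert norm_like_triangle[OF F_norm_like, of "(x \<bullet> \<xi>) ^ (n - 1) *\<^sub>R \<xi>"
            "\<Sum>\<xi>\<in>Y. (x \<bullet> \<xi>) ^ (n - 1) *\<^sub>R \<xi>"] by simp
      qed
      then show ?thesis using X(1) by blast
    qed
    \<comment> \<open>A large pairing gains one more factor at the price of
      \<open>1 / (\<eta> * ?T)\<close>, and these terms sum up to \<open>Q x\<close>. The small ones
      are negligible because \<open>?m * \<eta> ^ (n - 1) \<le> \<delta>\<close>.\<close>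
    also have "(\<Sum>\<xi>\<in>X. \<bar>x \<bullet> \<xi>\<bar> ^ (n - 1)) \<le> (\<Sum>\<xi>\<in>X. ((x
      \<bullet> \<xi>) ^ n / (\<eta> * ?T) + (\<eta> * ?T) ^ (n - 1)))"
    proof (rule sum_mono)
      fix \<xi>
      have t: "0 < \<eta> * ?T" using \<eta> T by simp
      show "\<bar>x \<bullet> \<xi>\<bar> ^ (n - 1) \<le> (x \<bullet> \<xi>) ^ n / (\<eta> * ?T) + (\<eta> *
        ?T) ^ (n - 1)"
      proof (cases "\<bar>x \<bullet> \<xi>\<bar> \<le> \<eta> * ?T")
        case True
        then have "\<bar>x \<bullet> \<xi>\<bar> ^ (n - 1) \<le> (\<eta> * ?T) ^ (n - 1)" by (intro power_mono) auto
        moreover have "0 \<le> (x \<bullet> \<xi>) ^ n / (\<eta> * ?T)" using n t by (intro divide_nonneg_pos) auto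
        ultimately show ?thesis by linarith
      next
        case False
        have "\<bar>x \<bullet> \<xi>\<bar> ^ (n - 1) * (\<eta> * ?T) \<le> \<bar>x \<bullet> \<xi>\<bar> ^
          (n - 1) * \<bar>x \<bullet> \<xi>\<bar>"
          using False by (intro mult_left_mono) auto
        also have "\<dots> = \<bar>x \<bullet> \<xi>\<bar> ^ n" using n by (metis power_minus_mult
          less_le_trans zero_less_numeral)
        also have "\<dots> = (x \<bullet> \<xi>) ^ n" using n by (simp add: power_even_abs)
        finally have "\<bar>x \<bullet> \<xi>\<bar> ^ (n - 1) \<le> (x \<bullet> \<xi>) ^ n / (\<eta> * ?T)"
          using t by (simp add: pos_le_divide_eq)
        moreover have "0 \<le> (\<eta> * ?T) ^ (n - 1)" using t by simp
        ultimately show ?thesis by linarith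
      qed
    qed
    also have "\<dots> = Q x / (\<eta> * ?T) + ?m * (\<eta> * ?T) ^ (n - 1)"
      by (simp add: Q_def sum.distrib sum_divide_distrib)
    also have "?m * (\<eta> * ?T) ^ (n - 1) \<le> \<delta> * (Q x / ?T)"
    proof -
      have "?m * (\<eta> * ?T) ^ (n - 1) = (?m * \<eta> ^ (n - 1)) * ?T ^ (n - 1)" by (simp add: power_mult_distrib)
      also have "\<dots> \<le> \<delta> * ?T ^ (n - 1)" using mn T by (intro mult_right_mono) auto
      also have "?T ^ (n - 1) = ?T ^ n / ?T" using T n(2) by (cases n) auto
      also have "\<delta> * (?T ^ n / ?T) \<le> \<delta> * (Q x / ?T)"
        using Qge[of x] T \<delta> by (intro mult_left_mono divide_right_mono) auto
      finally show ?thesis .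
    qed
    finally have "F (gradient L x) \<le> 1 / Q x * (Q x / (\<eta> * ?T) + \<delta> * (Q x / ?T))"
      using Qp by (simp add: mult_left_mono divide_right_mono)
    also have "\<dots> = (1 / \<eta> + \<delta>) / ?T"
    proof -
      have *: "1 / a * (a / (e * t) + d * (a / t)) = (1 / e + d) / t" if "a \<noteq> 0" "e \<noteq> 0" "t
        \<noteq> 0" for a e t d :: real
        using that by (simp add: field_simps)
      show ?thesis by (rule *) (use Qp T \<eta> in auto)
    qed
    finally show ?thesis by (simp add: \<eta>_def)
  qed
  show ?thesis using LC bounds grad by blast
qed

text \<open>The classical profile between the two balls is \<open>ln (R / P) / ln (R / r)\<close>.
  Replacing \<open>ln P\<close> by a smooth \<open>L\<close> and the linear profile by a smooth step
  costs factors that tend to 1 with \<open>\<delta>\<close>; they are absorbed in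
  \<open>1 + \<epsilon>\<close>.\<close>

lemma moser_function:
  fixes x0 :: "real^'n"
  assumes rR: "0 < r" "r < R" and \<epsilon>: "0 < \<epsilon>"
  shows "\<exists>w. smooth_on w UNIV \<and> (\<forall>x. P (x - x0) \<le> r \<longrightarrow> w x = 1)
    \<and> (\<forall>x. R \<le> P (x - x0) \<longrightarrow> w x = 0) \<and>
    (\<forall>x. P (x - x0) \<le> r \<or> R \<le> P (x - x0) \<longrightarrow> gradient w x = 0) \<and>
    (\<integral>\<^sup>+x. ennreal (F (gradient w x) ^ CARD('n)) \<partial>lborel) \<le> ennreal ((1 +
      \<epsilon>) * (real CARD('n) * unit_vol P / ln (R / r) ^ (CARD('n) - 1)))"
proof -
  let ?N = "CARD('n)"
  let ?l = "ln (R / r)"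
  have l: "0 < ?l" using rR by simp
  let ?g = "\<lambda>\<delta>. ln ((1 - \<delta>) * R) - ln ((1 + \<delta>) * r)"
  \<comment> \<open>The gradient bound of \<open>L\<close>, up to the factor \<open>1 / P\<close>,
    times the slope bound of the step; it tends to \<open>1 / ln (R / r)\<close> as
    \<open>\<delta>\<close> tends to 0.\<close>
  let ?c = "\<lambda>\<delta>. (1 / (1 - \<delta>) + \<delta>) / (1 - \<delta>) * (1 / ((1 - \<delta>) * ?g
    \<delta>))"
  have id: "((\<lambda>\<delta>::real. \<delta>) \<longlongrightarrow> 0) (at_right 0)" by (rule tendsto_ident_at)
  have g: "(?g \<longlongrightarrow> ln ((1 - 0) * R) - ln ((1 + 0) * r)) (at_right 0)"
    using rR by (intro tendsto_intros id) auto
  have lg: "ln ((1 - 0) * R) - ln ((1 + 0) * r) = ?l" using rR by (simp add: ln_div)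
  have "((\<lambda>\<delta>. ?c \<delta> ^ ?N) \<longlongrightarrow> ((1 / (1 - 0) + 0) / (1 - 0) * (1 / ((1
    - 0) * ?l))) ^ ?N) (at_right 0)"
    using l by (intro tendsto_intros id g[unfolded lg]) auto
  then have "((\<lambda>\<delta>. ?c \<delta> ^ ?N) \<longlongrightarrow> (1 / ?l) ^ ?N) (at_right 0)" by simp
  then have "\<forall>\<^sub>F \<delta> in at_right 0. ?c \<delta> ^ ?N < (1 + \<epsilon>) * (1 / ?l) ^ ?N"
    using \<epsilon> l by (intro order_tendstoD(2)) auto
  moreover have "\<forall>\<^sub>F \<delta> in at_right 0. 0 < ?g \<delta>"
    using l by (intro order_tendstoD(1)[OF g[unfolded lg]]) auto
  moreover have "\<forall>\<^sub>F \<delta> in at_right (0::real). 0 < \<delta> \<and> \<delta> < 1"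
    unfolding eventually_at_right_field by (rule exI[of _ 1]) auto
  ultimately have "\<forall>\<^sub>F \<delta> in at_right 0. ?c \<delta> ^ ?N < (1 + \<epsilon>) * (1 / ?l) ^
    ?N \<and> 0 < ?g \<delta> \<and> 0 < \<delta> \<and> \<delta> < 1"
    by eventually_elim auto
  then obtain \<delta> where \<delta>c: "?c \<delta> ^ ?N < (1 + \<epsilon>) * (1 / ?l) ^ ?N" and \<delta>g:
    "0 < ?g \<delta>" and \<delta>: "0 < \<delta>" "\<delta> < 1"
    using eventually_happens[of _ "at_right (0::real)"] by auto
  \<comment> \<open>The distortion of \<open>L\<close> is built into the endpoints:
    \<open>P \<le> r\<close> forces \<open>L \<le> \<alpha>\<close>, and \<open>R \<le> P\<close>
    forces \<open>\<beta> \<le> L\<close>.\<close>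
  define \<alpha> where "\<alpha> = ln ((1 + \<delta>) * r)"
  define \<beta> where "\<beta> = ln ((1 - \<delta>) * R)"
  have ab: "\<alpha> < \<beta>" using \<delta>g by (simp add: \<alpha>_def \<beta>_def)
  obtain L where LC: "\<forall>k. Ck_on k L (- {0})"
    and Lb: "\<forall>x. x \<noteq> 0 \<longrightarrow> ln ((1 - \<delta>) * P x) \<le> L x \<and> L x \<le>
      ln ((1 + \<delta>) * P x) \<and> F (gradient L x) \<le> (1 / (1 - \<delta>) + \<delta>) / (1 - \<delta>) / P x"
    using smooth_log_norm[OF \<delta>] by (elim exE conjE) (rule that)
  obtain \<Phi> b where \<Phi>: "\<forall>t. (\<Phi> has_real_derivative - b t) (at t)" "\<forall>t. t \<le>
    \<alpha> \<longrightarrow> \<Phi> t = 1" "\<forall>t. \<beta> \<le> t \<longrightarrow> \<Phi> t = 0"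
    and b: "\<forall>t. 0 \<le> b t \<and> b t \<le> 1 / ((1 - \<delta>) * (\<beta> - \<alpha>))"
      "\<forall>t. t \<le> \<alpha> \<or> \<beta> \<le> t \<longrightarrow> b t = 0"
    and bC: "\<forall>k S (f :: real^'n \<Rightarrow> real). open S \<longrightarrow> Ck_on k f S
      \<longrightarrow> Ck_on k (\<lambda>x. b (f x)) S"
    using smooth_step[OF ab \<delta>, where ?'n='n] by (elim exE conjE) (rule that)
  have Pp: "0 < P y" if "y \<noteq> 0" for y by (rule norm_like_pos[OF polar_norm_like that])
  have Lr: "L y \<le> \<alpha>" if "y \<noteq> 0" "P y \<le> r" for y
  proof -
    have "L y \<le> ln ((1 + \<delta>) * P y)" using Lb that by blast
    also have "\<dots> \<le> \<alpha>" unfolding \<alpha>_def using that Pp[OF that(1)] \<delta> rR by simp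
    finally show ?thesis .
  qed
  have LR: "\<beta> \<le> L y" if "y \<noteq> 0" "R \<le> P y" for y
  proof -
    have "\<beta> \<le> ln ((1 - \<delta>) * P y)" unfolding \<beta>_def using that Pp[OF that(1)] \<delta> rR by simp
    also have "\<dots> \<le> L y" using Lb that by blast
    finally show ?thesis .
  qed
  \<comment> \<open>The centre is treated by hand because nothing is known about \<open>L\<close> at
    0; the value 1 agrees with the constant value nearby.\<close>
  define w where "w x = (if x = x0 then 1 else \<Phi> (L (x - x0)))" for x
  have w1: "w x = 1" if "P (x - x0) \<le> r" for x using Lr[of "x - x0"] that \<Phi>(2) by (simp add: w_def)
  have w0: "w x = 0" if "R \<le> P (x - x0)" for x
    using LR[of "x - x0"] that \<Phi>(3) rR norm_like_0[OF polar_norm_like] by (auto simp: w_def)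
  have op: "open (- {x0})" by (intro open_Compl) simp
  have Dw: "(w has_derivative (\<lambda>h. ((- b (L (x - x0))) *\<^sub>R gradient L (x - x0)) \<bullet> h))
    (at x)" if x: "x \<noteq> x0" for x
  proof -
    have "L differentiable (at (x - x0))" using LC[rule_format, of "Suc 0"] x by (simp add: Ck_on_Suc_iff)
    from has_derivative_gradient[OF this]
    have dL: "((\<lambda>x. L (x - x0)) has_derivative (\<lambda>h. gradient L (x - x0) \<bullet> h)) (at x)"
    proof (rule has_derivative_compose[rotated])
      show "((\<lambda>x. x - x0) has_derivative (\<lambda>h. h)) (at x)" by (auto intro!: derivative_eq_intros)
    qed
    have "((\<lambda>x. \<Phi> (L (x - x0))) has_derivative (\<lambda>h. ((- b (L (x - x0))) *\<^sub>R
      gradient (\<lambda>x. L (x - x0)) x) \<bullet> h)) (at x)"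
      by (rule has_derivative_gradient_compose) (use dL \<Phi>(1) in \<open>auto simp: differentiable_def\<close>)
    then have "((\<lambda>x. \<Phi> (L (x - x0))) has_derivative (\<lambda>h. ((- b (L (x - x0))) *\<^sub>R
      gradient L (x - x0)) \<bullet> h)) (at x)"
      by (simp add: gradient_eqI[OF dL])
    then show ?thesis
      by (rule has_derivative_transform_within_open[OF _ op]) (use x in \<open>auto simp: w_def\<close>)
  qed
  have gw: "gradient w x = (- b (L (x - x0))) *\<^sub>R gradient L (x - x0)" if "x \<noteq> x0" for x
    by (rule gradient_eqI[OF Dw[OF that]])
  let ?U = "{x. P (x - x0) < r}"
  have opU: "open ?U"
    by (intro open_Collect_less continuous_intros continuous_on_compose2[OF norm_like_continuous[OF
      polar_norm_like]]) auto
  have x0U: "x0 \<in> ?U" using rR by (simp add: norm_like_0[OF polar_norm_like])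
  have gw0: "gradient w x0 = 0"
  proof -
    have "gradient w x0 = gradient (\<lambda>_. 1) x0" by (rule gradient_cong[OF opU _ x0U]) (auto intro: w1)
    then show ?thesis by (simp add: gradient_eqI[where g=0])
  qed
  have smooth: "smooth_on w UNIV"
    unfolding smooth_on_def
  proof (intro allI Ck_on_locally)
    fix k and x :: "real^'n"
    show "\<exists>U. open U \<and> x \<in> U \<and> Ck_on k w U"
    proof (cases "x = x0")
      case True
      have "Ck_on k w ?U" by (rule Ck_on_cong[OF opU _ Ck_on_const[OF opU, of k 1]]) (simp add: w1)
      then show ?thesis using opU x0U True by blast
    next
      case False
      have op0: "open (- {0::real^'n})" by (intro open_Compl) simp
      have set_eq: "{x. x - x0 \<in> - {0}} = - {x0}" by auto
      have "Ck_on (Suc k) w (- {x0})"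
      proof (rule Ck_on_SucI[OF op, where g="\<lambda>x. (- b (L (x - x0))) *\<^sub>R gradient L (x - x0)"])
        show "(w has_derivative (\<bullet>) ((- b (L (x - x0))) *\<^sub>R gradient L (x - x0))) (at x)" if "x
          \<in> - {x0}" for x
          by (rule Dw) (use that in auto)
        fix i
        have "Ck_on k (\<lambda>x. L (x - x0)) (- {x0})"
          using Ck_on_translate[OF op0, of k L x0] LC unfolding set_eq by simp
        then have "Ck_on k (\<lambda>x. b (L (x - x0))) (- {x0})"
          by (rule bC[rule_format, OF op])
        moreover have "Ck_on k (\<lambda>x. gradient L x $ i) (- {0})" using LC[rule_format, of "Suc k"] by
          (simp add: Ck_on_Suc_iff)
        then have "Ck_on k (\<lambda>x. gradient L (x - x0) $ i) (- {x0})"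
          using Ck_on_translate[OF op0, of k "\<lambda>x. gradient L x $ i" x0] unfolding set_eq by simp
        ultimately have "Ck_on k (\<lambda>x. (- 1) * b (L (x - x0)) * gradient L (x - x0) $ i) (- {x0})"
          by (intro Ck_on_mult Ck_on_const op)
        then show "Ck_on k (\<lambda>x. ((- b (L (x - x0))) *\<^sub>R gradient L (x - x0)) $ i) (- {x0})" by simp
      qed
      then have "Ck_on k w (- {x0})" by (rule Ck_on_SucD)
      then show ?thesis using False op by (intro exI[of _ "- {x0}"]) auto
    qed
  qed
  have gz: "gradient w x = 0" if "P (x - x0) \<le> r \<or> R \<le> P (x - x0)" for x
  proof (cases "x = x0")
    case False
    then have "L (x - x0) \<le> \<alpha> \<or> \<beta> \<le> L (x - x0)" using Lr[of "x - x0"] LR[of "x -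
      x0"] that by auto
    then have "b (L (x - x0)) = 0" using b(2) by blast
    then show ?thesis by (simp add: gw[OF False])
  qed (simp add: gw0)
  have "(\<integral>\<^sup>+x. ennreal (F (gradient w x) ^ ?N) \<partial>lborel) \<le>
    (\<integral>\<^sup>+x. ennreal (?c \<delta> ^ ?N) * (ennreal (P (- x0 + 1 *\<^sub>R x) powr - real ?N) *
      indicator {r..R} (P (- x0 + 1 *\<^sub>R x))) \<partial>lborel)"
  proof (rule nn_integral_mono)
    fix x
    show "ennreal (F (gradient w x) ^ ?N) \<le> ennreal (?c \<delta> ^ ?N) * (ennreal (P (- x0 + 1 *\<^sub>R
      x) powr - real ?N) * indicator {r..R} (P (- x0 + 1 *\<^sub>R x)))"
    proof (cases "P (x - x0) \<le> r \<or> R \<le> P (x - x0)")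
      case True
      then show ?thesis using gz[OF True] by (simp add: norm_like_0[OF F_norm_like] zero_power)
    next
      case False
      then have y: "r < P (x - x0)" "P (x - x0) < R" by auto
      then have x: "x \<noteq> x0" using rR norm_like_0[OF polar_norm_like] by auto
      have p: "0 < P (x - x0)" using y rR by simp
      have "F (gradient w x) = b (L (x - x0)) * F (gradient L (x - x0))"
        using b(1) by (simp add: gw[OF x] norm_like_minus[OF F_norm_like] norm_like_scale[OF F_norm_like])
      also have "\<dots> \<le> 1 / ((1 - \<delta>) * ?g \<delta>) * ((1 / (1 - \<delta>) + \<delta>) / (1 -
        \<delta>) / P (x - x0))"
        using b(1) Lb x norm_like_nonneg[OF F_norm_like] \<delta> \<delta>g unfolding \<alpha>_def
          \<beta>_def by (intro mult_mono) auto
      also have "\<dots> = ?c \<delta> * (1 / P (x - x0))" by simp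
      finally have "F (gradient w x) ^ ?N \<le> (?c \<delta> * (1 / P (x - x0))) ^ ?N"
        using norm_like_nonneg[OF F_norm_like] by (intro power_mono) auto
      also have "\<dots> = ?c \<delta> ^ ?N * P (x - x0) powr - real ?N"
      proof -
        have "(a * (1 / p)) ^ ?N = a ^ ?N * p powr - real ?N" if "0 < p" for a p :: real
          using that by (simp add: power_divide powr_minus_divide powr_realpow)
        from this[OF p] show ?thesis .
      qed
      finally have "ennreal (F (gradient w x) ^ ?N) \<le> ennreal (?c \<delta> ^ ?N * P (x - x0) powr - real
        ?N)" by (rule ennreal_leI)
      also have "\<dots> = ennreal (?c \<delta> ^ ?N) * ennreal (P (x - x0) powr - real ?N)" by (rule
        ennreal_mult'') simp
      finally show ?thesis using y by simp
    qed
  qed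
  also have "\<dots> = ennreal (?c \<delta> ^ ?N) * (\<integral>\<^sup>+x. ennreal (P (- x0 + 1 *\<^sub>R x)
    powr - real ?N) * indicator {r..R} (P (- x0 + 1 *\<^sub>R x)) \<partial>lborel)"
    by (rule nn_integral_cmult) measurable
  also have "(\<integral>\<^sup>+x. ennreal (P (- x0 + 1 *\<^sub>R x) powr - real ?N) * indicator {r..R} (P
    (- x0 + 1 *\<^sub>R x)) \<partial>lborel)
     = (\<integral>\<^sup>+x. ennreal (P x powr - real ?N) * indicator {r..R} (P x) \<partial>lborel)"
    using nn_integral_affine[of "\<lambda>x. ennreal (P x powr - real ?N) * indicator {r..R} (P x)" 1 "- x0"] by simp
  also have "\<dots> = ennreal (real ?N * unit_vol P * ?l)"
    using rR by (intro nn_integral_annulus[OF polar_norm_like]) auto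
  also have "ennreal (?c \<delta> ^ ?N) * ennreal (real ?N * unit_vol P * ?l) = ennreal (?c \<delta> ^ ?N *
    (real ?N * unit_vol P * ?l))"
    using unit_vol_pos[OF polar_norm_like] l by (intro ennreal_mult''[symmetric]) simp
  also have "\<dots> \<le> ennreal ((1 + \<epsilon>) * (real ?N * unit_vol P / ?l ^ (?N - 1)))"
  proof (rule ennreal_leI)
    have "?c \<delta> ^ ?N * (real ?N * unit_vol P * ?l) \<le> ((1 + \<epsilon>) * (1 / ?l) ^ ?N) * (real ?N
      * unit_vol P * ?l)"
      using \<delta>c unit_vol_pos[OF polar_norm_like] l by (intro mult_right_mono) auto
    also have "\<dots> = (1 + \<epsilon>) * (real ?N * unit_vol P * ((1 / ?l) ^ ?N * ?l))" by simp
    also have "(1 / ?l) ^ ?N * ?l = 1 / ?l ^ (?N - 1)"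
    proof -
      have "?l ^ ?N = ?l ^ (?N - 1) * ?l" by (rule power_minus_mult[symmetric]) simp
      then show ?thesis using l by (simp add: power_one_over divide_simps)
    qed
    finally show "?c \<delta> ^ ?N * (real ?N * unit_vol P * ?l) \<le> (1 + \<epsilon>) * (real ?N * unit_vol
      P / ?l ^ (?N - 1))" by simp
  qed
  finally show ?thesis using smooth w1 w0 gz by (intro exI[of _ w]) simp
qed

end

section \<open>Sharpness\<close>

context anisotropic_ge2
begin

section \<open>Energies of test functions\<close>

lemma F_nonneg: "0 \<le> F x"
  by (rule norm_like_nonneg[OF F_norm_like])

lemma energy_test:
  assumes "open \<Omega>" "\<phi> \<in> test_functions \<Omega>"
  shows "aniso_energy F \<Omega> \<phi> = (LINT x|lborel. F (gradient \<phi> x) ^ CARD('n))"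
    "(\<integral>\<^sup>+x. ennreal (F (gradient \<phi> x) ^ CARD('n)) \<partial>lborel) = ennreal
      (aniso_energy F \<Omega> \<phi>)"
    "integrable lborel (\<lambda>x. F (gradient \<phi> x) ^ CARD('n))"
proof -
  note r = sobolev_rep_test[OF assms]
  show 1: "aniso_energy F \<Omega> \<phi> = (LINT x|lborel. F (gradient \<phi> x) ^ CARD('n))"
    by (rule aniso_energy_rep[OF assms(1) r])
  show 2: "integrable lborel (\<lambda>x. F (gradient \<phi> x) ^ CARD('n))" by (rule integrable_F_power[OF r])
  show "(\<integral>\<^sup>+x. ennreal (F (gradient \<phi> x) ^ CARD('n)) \<partial>lborel) = ennreal
    (aniso_energy F \<Omega> \<phi>)"
    unfolding 1 using F_nonneg by (intro nn_integral_eq_integral[OF 2]) auto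
qed

text \<open>At each point at most one gradient is nonzero, so the \<open>N\<close>-th power produces
  no mixed terms.\<close>

lemma energy_disjoint:
  assumes \<Omega>: "open \<Omega>" and t: "\<phi> \<in> test_functions \<Omega>" "\<psi> \<in>
    test_functions \<Omega>"
    and d: "\<And>x. gradient \<phi> x = 0 \<or> gradient \<psi> x = 0"
  shows "aniso_energy F \<Omega> (\<lambda>x. \<phi> x + c * \<psi> x) = aniso_energy F \<Omega> \<phi> +
    \<bar>c\<bar> ^ CARD('n) * aniso_energy F \<Omega> \<psi>"
proof -
  have "F (gradient \<phi> x + c *\<^sub>R gradient \<psi> x) ^ CARD('n) = F (gradient \<phi> x) ^ CARD('n) +
    \<bar>c\<bar> ^ CARD('n) * F (gradient \<psi> x) ^ CARD('n)" for x
    using d[of x] by (auto simp: norm_like_0[OF F_norm_like] norm_like_scale[OF F_norm_like]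
      power_mult_distrib zero_power)
  then show ?thesis
    using energy_test(3)[OF \<Omega> t(1)] energy_test(3)[OF \<Omega> t(2)]
    by (simp add: energy_test(1)[OF \<Omega> test_function_scale_add(1)[OF t]] energy_test(1)[OF \<Omega>
      t(1)] energy_test(1)[OF \<Omega> t(2)]
        test_function_scale_add(2)[OF t])
qed

lemma zero_test: "(\<lambda>x::real^'n. 0) \<in> test_functions \<Omega>"
  by (rule test_functionI[of _ "{}"]) (auto simp: smooth_on_def intro: Ck_on_const)

lemma gradient_zero: "gradient (\<lambda>x::real^'n. 0) x = 0"
  by (rule gradient_eqI) simp

lemma energy_scale:
  assumes \<Omega>: "open \<Omega>" and t: "\<psi> \<in> test_functions \<Omega>"
  shows "(\<lambda>x. c * \<psi> x) \<in> test_functions \<Omega>" "gradient (\<lambda>x. c * \<psi> x) x = c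
    *\<^sub>R gradient \<psi> x"
    "aniso_energy F \<Omega> (\<lambda>x. c * \<psi> x) = \<bar>c\<bar> ^ CARD('n) * aniso_energy F \<Omega> \<psi>"
proof -
  have z: "aniso_energy F \<Omega> (\<lambda>x. 0) = 0"
    by (simp add: energy_test(1)[OF \<Omega> zero_test] gradient_zero norm_like_0[OF F_norm_like] zero_power)
  show "(\<lambda>x. c * \<psi> x) \<in> test_functions \<Omega>" "gradient (\<lambda>x. c * \<psi> x) x = c
    *\<^sub>R gradient \<psi> x"
    using test_function_scale_add[OF zero_test t, of c] by (auto simp: gradient_zero)
  show "aniso_energy F \<Omega> (\<lambda>x. c * \<psi> x) = \<bar>c\<bar> ^ CARD('n) * aniso_energy F
    \<Omega> \<psi>"
    using energy_disjoint[OF \<Omega> zero_test t, of c] by (simp add: gradient_zero z)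
qed

lemma emeasure_polar_ball_at:
  assumes "0 \<le> r"
  shows "emeasure lborel {x. P (x - x0) \<le> r} = ennreal (unit_vol P * r ^ CARD('n))"
proof -
  have "emeasure lborel {x. P (x - x0) \<le> r} = (\<integral>\<^sup>+x. indicator {x. P (x - x0) \<le> r} x
    \<partial>lborel)"
    by (rule nn_integral_indicator[symmetric]) measurable
  also have "\<dots> = (\<integral>\<^sup>+x. indicator {x. P x \<le> r} (- x0 + 1 *\<^sub>R x) \<partial>lborel)"
    by (intro nn_integral_cong) (auto simp: indicator_def)
  also have "\<dots> = (\<integral>\<^sup>+x. indicator {x. P x \<le> r} x \<partial>lborel)"
    using nn_integral_affine[of "indicator {x. P x \<le> r}" 1 "- x0"] by simp
  also have "\<dots> = emeasure lborel {x. P x \<le> r}" by (rule nn_integral_indicator) measurable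
  finally show ?thesis by (simp add: emeasure_norm_like_ball[OF polar_norm_like assms])
qed

text \<open>With vanishing energy the potential of the gradient would vanish too, and the potential
  estimate would force \<open>\<phi> x = 0\<close>. Positivity allows bumps to be normalised to a
  prescribed energy.\<close>

lemma test_energy_pos:
  assumes \<Omega>: "open \<Omega>" and t: "\<phi> \<in> test_functions \<Omega>" and x: "\<phi> x \<noteq> 0"
  shows "0 < aniso_energy F \<Omega> \<phi>"
proof (rule ccontr)
  assume "\<not> 0 < aniso_energy F \<Omega> \<phi>"
  then have "(\<integral>\<^sup>+x. ennreal (F (gradient \<phi> x) ^ CARD('n)) \<partial>lborel) = 0"
    by (simp add: energy_test(2)[OF \<Omega> t] ennreal_neg)
  moreover have [measurable]: "gradient \<phi> \<in> borel_measurable borel"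
    using sobolev_rep_test[OF \<Omega> t] by (auto simp: sobolev_rep_def)
  ultimately have "AE y in lborel. ennreal (F (gradient \<phi> y) ^ CARD('n)) = 0"
    by (subst (asm) nn_integral_0_iff_AE) auto
  then have "AE y in lborel. ennreal (F (gradient \<phi> y) * P (x - y) powr - (real CARD('n) - 1)) = 0"
  proof eventually_elim
    case (elim y)
    then have "F (gradient \<phi> y) ^ CARD('n) = 0" using F_nonneg[of "gradient \<phi> y"] by (metis
      ennreal_eq_0_iff zero_le_power antisym)
    then show ?case by simp
  qed
  then have "(\<integral>\<^sup>+y. ennreal (F (gradient \<phi> y) * P (x - y) powr - (real CARD('n) - 1))
    \<partial>lborel) = 0"
    by (subst nn_integral_0_iff_AE) auto
  then have "ennreal (real CARD('n) * unit_vol P * \<bar>\<phi> x\<bar>) \<le> 0"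
    using potential_test[OF t, of x] by simp
  then have "real CARD('n) * unit_vol P * \<bar>\<phi> x\<bar> \<le> 0" by (simp add: ennreal_eq_0_iff)
  moreover have "0 < real CARD('n) * unit_vol P * \<bar>\<phi> x\<bar>" using unit_vol_pos[OF
    polar_norm_like] x by simp
  ultimately show False by simp
qed

lemma moser_test:
  assumes \<Omega>: "open \<Omega>" and R0: "{x. P (x - x0) \<le> R0} \<subseteq> \<Omega>" and rR: "0 < r"
    "r < R" "R \<le> R0" and \<epsilon>: "0 < \<epsilon>"
  shows "\<exists>w. w \<in> test_functions \<Omega> \<and> (\<forall>x. P (x - x0) \<le> r \<longrightarrow>
    w x = 1) \<and>
    (\<forall>x. P (x - x0) \<le> r \<or> R \<le> P (x - x0) \<longrightarrow> gradient w x = 0) \<and> 0 <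
      aniso_energy F \<Omega> w \<and>
    aniso_energy F \<Omega> w \<le> (1 + \<epsilon>) * (real CARD('n) * unit_vol P / ln (R / r) ^ (CARD('n) - 1))"
proof -
  obtain w where w: "smooth_on w UNIV" "\<forall>x. P (x - x0) \<le> r \<longrightarrow> w x = 1"
    "\<forall>x. R \<le> P (x - x0) \<longrightarrow> w x = 0"
    "\<forall>x. P (x - x0) \<le> r \<or> R \<le> P (x - x0) \<longrightarrow> gradient w x = 0"
    "(\<integral>\<^sup>+x. ennreal (F (gradient w x) ^ CARD('n)) \<partial>lborel) \<le> ennreal ((1 +
      \<epsilon>) * (real CARD('n) * unit_vol P / ln (R / r) ^ (CARD('n) - 1)))"
    using moser_function[OF rR(1,2) \<epsilon>, of x0] by (elim exE conjE) (rule that)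
  let ?K = "{x. P (x - x0) \<le> R}"
  have t: "w \<in> test_functions \<Omega>"
  proof (rule test_functionI[OF w(1), of ?K])
    have "closed ?K"
      by (intro closed_Collect_le continuous_intros continuous_on_compose2[OF norm_like_continuous[OF
        polar_norm_like]]) auto
    moreover have "bounded ?K"
    proof -
      have "?K = (+) x0 ` {x. P x \<le> R}" by (auto simp: image_iff intro!: exI[of _ "_ - x0"])
      then show ?thesis using bounded_translation[OF norm_like_sublevel_bounded[OF polar_norm_like, of R]] by simp
    qed
    ultimately show "compact ?K" by (simp add: compact_eq_bounded_closed)
  qed (use w(3) R0 rR in auto)
  have "w x0 = 1" using w(2) rR by (simp add: norm_like_0[OF polar_norm_like])
  then have "0 < aniso_energy F \<Omega> w" by (intro test_energy_pos[OF \<Omega> t, of x0]) simp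
  moreover have "aniso_energy F \<Omega> w \<le> (1 + \<epsilon>) * (real CARD('n) * unit_vol P / ln (R / r)
    ^ (CARD('n) - 1))"
    using w(5) \<epsilon> unit_vol_pos[OF polar_norm_like] rR unfolding energy_test(2)[OF \<Omega> t] by
      (subst (asm) ennreal_le_iff) auto
  ultimately show ?thesis using t w by blast
qed

section \<open>Concentrating bumps and the critical exponent\<close>

lemma power_root: "0 \<le> (x::real) \<Longrightarrow> (x powr (1 / real CARD('n))) ^ CARD('n) = x"
  by (simp add: powr_CARD[symmetric] powr_powr)

text \<open>The additive constant \<open>A\<close> gains the factor \<open>exp (c
  L\<^bsup>1/N\<^esup>)\<close>, where \<open>L = ln (R / r)\<close>; it
  beats the bounded Moser integral even at the critical exponent.\<close>

lemma concentrating_step: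
  assumes \<Omega>: "open \<Omega>" and R0: "{x. P (x - x0) \<le> R0} \<subseteq> \<Omega>" and R: "0 < R" "R
    \<le> R0"
    and A: "0 < A" and \<theta>: "0 < \<theta>" "\<theta> < 1" and \<beta>: "0 \<le> \<beta>" "\<beta> < real
      CARD('n)"
  shows "\<exists>r v V. 0 < r \<and> r < R \<and> v \<in> test_functions \<Omega> \<and> (\<forall>x. P (x -
    x0) \<le> r \<longrightarrow> v x = V) \<and> 0 \<le> V \<and>
    (\<forall>x. P (x - x0) \<le> r \<or> R \<le> P (x - x0) \<longrightarrow> gradient v x = 0) \<and>
      aniso_energy F \<Omega> v = 1 - \<theta> \<and>
    real n \<le> exp (lambda_N F * (1 - \<beta> / real CARD('n)) * (1 - \<theta>) powr (- 1 / (real CARD('n)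
      - 1)) * (A + V) powr (real CARD('n) / (real CARD('n) - 1)))
      * unit_vol P * r powr (real CARD('n) - \<beta>)"
proof -
  let ?N = "real CARD('n)"
  let ?q = "?N / (?N - 1)"
  have N: "1 < ?N" "2 \<le> ?N" using N2 by auto
  define \<kappa> where "\<kappa> = unit_vol P"
  have \<kappa>: "0 < \<kappa>" using unit_vol_pos[OF polar_norm_like] by (simp add: \<kappa>_def)
  define \<mu> where "\<mu> = lambda_N F * (1 - \<theta>) powr (- 1 / (?N - 1))"
  have \<mu>_eq: "\<mu> = ?N * (?N * \<kappa>) powr (1 / (?N - 1)) * (1 - \<theta>) powr (- 1 / (?N - 1))"
    by (simp add: \<mu>_def lambda_eq \<kappa>_def)
  have \<mu>: "0 < \<mu>" unfolding \<mu>_eq using \<kappa> N \<theta> by simp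
  \<comment> \<open>The coefficient of the gain in the exponent: the cross term
    \<open>A * V powr (1 / (N - 1))\<close>, with \<open>V\<close> replaced by its lower bound,
    contributes \<open>c * (L - 1) powr (1 / N)\<close>.\<close>
  define c where "c = (1 - \<beta> / ?N) * \<mu> * A * (?N / \<mu>) powr (1 / ?N)"
  have c: "0 < c" unfolding c_def using \<beta> \<mu> A N by simp
  \<comment> \<open>What remains after \<open>exp ((N - \<beta>) * L)\<close> cancels against the
    small radius: the volume constant, the outer radius, and the unit lost in passing from
    \<open>L\<close> to \<open>L - 1\<close>.\<close>
  define K where "K = \<kappa> * R powr (?N - \<beta>) * exp (- (?N - \<beta>))"
  have K: "0 < K" unfolding K_def using \<kappa> R by simp
  \<comment> \<open>The gain to be reached in the exponent: \<open>K * exp y\<close> is at least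
    \<open>n\<close>.\<close>
  define y where "y = real n / K + 1"
  have y: "0 < y" unfolding y_def using K by (auto intro: add_nonneg_pos)
  \<comment> \<open>Solves \<open>c * (L - 1) powr (1 / N) = y\<close>, so that the gain is exactly
    \<open>y\<close>.\<close>
  define L where "L = 1 + (y / c) ^ CARD('n)"
  have L: "1 < L" unfolding L_def using y c by simp
  then have L1: "0 < 1 + 1 / L" "1 + 1 / L \<noteq> 0" using add_pos_pos[of 1 "1 / L"] by auto
  define r where "r = R * exp (- L)"
  have r: "0 < r" "r < R" unfolding r_def using R L by auto
  have "R / r = exp L" unfolding r_def using R by (simp add: exp_minus divide_inverse)
  then have lRr: "ln (R / r) = L" by simp
  have "0 < 1 / L" using L by simp
  \<comment> \<open>The relative error \<open>1 / L\<close> in the energy costs at most one unit of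
    \<open>L\<close>, since \<open>L / (1 + 1 / L) \<ge> L - 1\<close>.\<close>
  from moser_test[OF \<Omega> R0 r R(2) this] obtain w where w: "w \<in> test_functions \<Omega>"
    "\<forall>x. P (x - x0) \<le> r \<longrightarrow> w x = 1"
    "\<forall>x. P (x - x0) \<le> r \<or> R \<le> P (x - x0) \<longrightarrow> gradient w x = 0"
    and J0: "0 < aniso_energy F \<Omega> w" and J1: "aniso_energy F \<Omega> w \<le> (1 + 1 / L) * (?N *
      unit_vol P / ln (R / r) ^ (CARD('n) - 1))"
    by (elim exE conjE) (rule that)
  let ?J = "aniso_energy F \<Omega> w"
  define V where "V = ((1 - \<theta>) / ?J) powr (1 / ?N)"
  have V0: "0 < V" unfolding V_def using J0 \<theta> by simp
  have en: "aniso_energy F \<Omega> (\<lambda>x. V * w x) = 1 - \<theta>"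
    using J0 \<theta> V0 unfolding energy_scale(3)[OF \<Omega> w(1)] by (simp add: V_def power_root)
  have Vq: "?N * (L - 1) / \<mu> \<le> V powr ?q"
  proof -
    have "V powr ?q = ((1 - \<theta>) / ?J) powr (1 / (?N - 1))" using N by (simp add: V_def powr_powr)
    moreover have "((1 - \<theta>) / ((1 + 1 / L) * (?N * \<kappa> / L ^ (CARD('n) - 1)))) powr (1 / (?N -
      1)) \<le> ((1 - \<theta>) / ?J) powr (1 / (?N - 1))"
      using J0 J1 \<theta> N L \<kappa> L1 unfolding lRr \<kappa>_def[symmetric] by (intro powr_mono2
        divide_left_mono mult_pos_pos) auto
    moreover have "((1 - \<theta>) / ((1 + 1 / L) * (?N * \<kappa> / L ^ (CARD('n) - 1)))) powr (1 / (?N - 1)) =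
      (1 - \<theta>) powr (1 / (?N - 1)) * (L / (?N * \<kappa>) powr (1 / (?N - 1)) / (1 + 1 / L) powr (1 /
        (?N - 1)))"
    proof -
      have e: "(L ^ (CARD('n) - 1)) powr (1 / (?N - 1)) = L"
      proof -
        have "L ^ (CARD('n) - 1) = L powr (?N - 1)" using powr_realpow[of L "CARD('n) - 1"] L N2 by (simp
          add: of_nat_diff)
        then show ?thesis using L N by (simp add: powr_powr)
      qed
      have "(1 - \<theta>) / ((1 + 1 / L) * (?N * \<kappa> / L ^ (CARD('n) - 1))) = (1 - \<theta>) * (L ^
        (CARD('n) - 1) / (?N * \<kappa>) / (1 + 1 / L))"
        using L by (simp add: field_simps)
      then show ?thesis using L \<theta> \<kappa> e by (simp add: powr_mult powr_divide)
    qed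
    moreover have "L - 1 \<le> L / (1 + 1 / L) powr (1 / (?N - 1))"
    proof -
      have "(1 + 1 / L) powr (1 / (?N - 1)) \<le> (1 + 1 / L) powr 1" using L N by (intro powr_mono) (auto
        simp: field_simps)
      then have "L / (1 + 1 / L) \<le> L / (1 + 1 / L) powr (1 / (?N - 1))"
        using L L1 by (intro divide_left_mono mult_pos_pos) auto
      moreover have "L - 1 \<le> L / (1 + 1 / L)" using L by (simp add: field_simps)
      ultimately show ?thesis by linarith
    qed
    ultimately have le: "(1 - \<theta>) powr (1 / (?N - 1)) / (?N * \<kappa>) powr (1 / (?N - 1)) * (L - 1)
      \<le> V powr ?q"
    proof -
      assume a: "V powr ?q = ((1 - \<theta>) / ?J) powr (1 / (?N - 1))"
        "((1 - \<theta>) / ((1 + 1 / L) * (?N * \<kappa> / L ^ (CARD('n) - 1)))) powr (1 / (?N - 1)) \<le>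
          ((1 - \<theta>) / ?J) powr (1 / (?N - 1))"
        "((1 - \<theta>) / ((1 + 1 / L) * (?N * \<kappa> / L ^ (CARD('n) - 1)))) powr (1 / (?N - 1)) =
           (1 - \<theta>) powr (1 / (?N - 1)) * (L / (?N * \<kappa>) powr (1 / (?N - 1)) / (1 + 1 / L) powr
             (1 / (?N - 1)))"
        "L - 1 \<le> L / (1 + 1 / L) powr (1 / (?N - 1))"
      have "(1 - \<theta>) powr (1 / (?N - 1)) / (?N * \<kappa>) powr (1 / (?N - 1)) * (L - 1)
        \<le> (1 - \<theta>) powr (1 / (?N - 1)) / (?N * \<kappa>) powr (1 / (?N - 1)) * (L / (1 + 1 / L)
          powr (1 / (?N - 1)))"
        by (intro mult_left_mono a(4)) auto
      then show ?thesis using a(1,2,3) by (simp add: mult_ac)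
    qed
    have "?N / \<mu> = (1 - \<theta>) powr (1 / (?N - 1)) / (?N * \<kappa>) powr (1 / (?N - 1))"
    proof -
      have "(1 - \<theta>) powr (- 1 / (?N - 1)) = 1 / (1 - \<theta>) powr (1 / (?N - 1))"
        by (simp add: powr_minus_divide[symmetric])
      then show ?thesis unfolding \<mu>_eq using N \<theta> \<kappa> by (simp add: field_simps)
    qed
    then have "?N * (L - 1) / \<mu> = (1 - \<theta>) powr (1 / (?N - 1)) / (?N * \<kappa>) powr (1 / (?N -
      1)) * (L - 1)"
      by (metis times_divide_eq_left mult.commute)
    then show ?thesis using le by simp
  qed
  \<comment> \<open>The exponent is 1 plus \<open>1 / (N - 1)\<close>; splitting off one factor
    \<open>A + V\<close> leaves a gain linear in \<open>A\<close>.\<close>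
  have AV: "V powr ?q + A * V powr (1 / (?N - 1)) \<le> (A + V) powr ?q"
  proof -
    have q: "?q = 1 + 1 / (?N - 1)" using N by (simp add: field_simps)
    have "(A + V) * V powr (1 / (?N - 1)) \<le> (A + V) * (A + V) powr (1 / (?N - 1))"
      using A V0 N by (intro mult_left_mono powr_mono2) auto
    then show ?thesis using A V0 unfolding q by (simp add: powr_add algebra_simps)
  qed
  have V1: "(?N * (L - 1) / \<mu>) powr (1 / ?N) \<le> V powr (1 / (?N - 1))"
  proof -
    have "(?N * (L - 1) / \<mu>) powr (1 / ?N) \<le> (V powr ?q) powr (1 / ?N)"
      using Vq L \<mu> by (intro powr_mono2) auto
    also have "(V powr ?q) powr (1 / ?N) = V powr (1 / (?N - 1))" using N by (simp add: powr_powr)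
    finally show ?thesis .
  qed
  have b: "0 < 1 - \<beta> / ?N" using \<beta> N by simp
  have exp_ge: "(?N - \<beta>) * (L - 1) + y \<le> (1 - \<beta> / ?N) * \<mu> * (A + V) powr ?q"
  proof -
    have "(?N * (L - 1) / \<mu>) powr (1 / ?N) = (?N / \<mu>) powr (1 / ?N) * (L - 1) powr (1 / ?N)"
    proof -
      have "?N * (L - 1) / \<mu> = (?N / \<mu>) * (L - 1)" by simp
      then show ?thesis using N \<mu> L by (simp only: powr_mult)
    qed
    also have "(L - 1) powr (1 / ?N) = y / c"
    proof -
      have "L - 1 = (y / c) powr ?N" using y c by (simp add: L_def powr_CARD)
      then show ?thesis using y c by (simp add: powr_powr)
    qed
    finally have e1: "(?N * (L - 1) / \<mu>) powr (1 / ?N) = (?N / \<mu>) powr (1 / ?N) * (y / c)" .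
    have "(1 - \<beta> / ?N) * \<mu> * A * (?N * (L - 1) / \<mu>) powr (1 / ?N) = c * (y / c)"
      unfolding e1 by (simp only: c_def mult.assoc)
    then have e: "(1 - \<beta> / ?N) * \<mu> * A * (?N * (L - 1) / \<mu>) powr (1 / ?N) = y"
      using c by simp
    have "(?N - \<beta>) * (L - 1) = (1 - \<beta> / ?N) * \<mu> * (?N * (L - 1) / \<mu>)"
      using \<mu> N by (simp add: field_simps)
    then have "(?N - \<beta>) * (L - 1) + y = (1 - \<beta> / ?N) * \<mu> * (?N * (L - 1) / \<mu> + A * (?N *
      (L - 1) / \<mu>) powr (1 / ?N))"
      using e by (simp add: distrib_left mult.assoc)
    also have "\<dots> \<le> (1 - \<beta> / ?N) * \<mu> * (V powr ?q + A * V powr (1 / (?N - 1)))"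
      using b \<mu> A Vq V1 by (intro mult_left_mono add_mono) auto
    also have "\<dots> \<le> (1 - \<beta> / ?N) * \<mu> * (A + V) powr ?q" using b \<mu> AV by (intro
      mult_left_mono) auto
    finally show ?thesis .
  qed
  have "real n \<le> K * exp y"
  proof -
    have "real n \<le> K * y" using K by (simp add: y_def field_simps)
    also have "y \<le> exp y" using exp_ge_add_one_self[of y] by linarith
    then have "K * y \<le> K * exp y" using K by (intro mult_left_mono) auto
    finally show ?thesis .
  qed
  also have "K * exp y = exp ((?N - \<beta>) * (L - 1) + y) * \<kappa> * r powr (?N - \<beta>)"
  proof -
    have "r powr (?N - \<beta>) = R powr (?N - \<beta>) * exp (- L * (?N - \<beta>))"
      unfolding r_def using R by (simp add: powr_mult exp_powr_real)
    moreover have "exp ((?N - \<beta>) * (L - 1) + y) * exp (- L * (?N - \<beta>)) = exp (- (?N - \<beta>)) * exp y"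
      by (simp add: exp_add[symmetric] algebra_simps)
    ultimately show ?thesis unfolding K_def by (simp add: mult_ac)
  qed
  also have "\<dots> \<le> exp ((1 - \<beta> / ?N) * \<mu> * (A + V) powr ?q) * \<kappa> * r powr (?N - \<beta>)"
    using exp_ge \<kappa> by (intro mult_right_mono) auto
  also have "(1 - \<beta> / ?N) * \<mu> * (A + V) powr ?q = lambda_N F * (1 - \<beta> / ?N) * (1 - \<theta>)
    powr (- 1 / (?N - 1)) * (A + V) powr ?q"
    by (simp add: \<mu>_def mult_ac)
  finally have fin: "real n \<le> exp (lambda_N F * (1 - \<beta> / ?N) * (1 - \<theta>) powr (- 1 / (?N - 1))
    * (A + V) powr ?q) * unit_vol P * r powr (?N - \<beta>)"
    unfolding \<kappa>_def .
  show ?thesis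
    by (rule exI[of _ r], rule exI[of _ "\<lambda>x. V * w x"], rule exI[of _ V])
      (use r w V0 en fin energy_scale[OF \<Omega> w(1)] in auto)
qed

text \<open>The truncated kernel is integrable, so the potential estimate bounds the L^N norm of
  \<open>\<phi>\<close> by that of \<open>F (gradient \<phi>)\<close>. Dual functionals are bounded
  by the full Sobolev norm, which is thus controlled by the energy alone.\<close>

lemma poincare_test:
  assumes \<Omega>: "open \<Omega>" "bounded (\<Omega> :: (real^'n) set)"
  shows "\<exists>C>0. \<forall>\<phi>\<in>test_functions \<Omega>. W1p_norm \<Omega> (real CARD('n)) \<phi>
    \<le> C * aniso_energy F \<Omega> \<phi> powr (1 / real CARD('n))"
proof -
  let ?N = "real CARD('n)"
  have [measurable]: "\<Omega> \<in> sets borel" using \<Omega> by simp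
  obtain R where R: "R > 0" "\<forall>x\<in>\<Omega>. \<forall>y\<in>\<Omega>. P (x - y) \<le> R" using
    bounded_polar_diam[OF \<Omega>(2)] by auto
  obtain c0 where c0: "c0 > 0" "\<And>x. c0 * norm x \<le> F x" using norm_like_lower[OF F_norm_like] by blast
  let ?k = "\<lambda>z. P z powr - (?N - 1) * indicator {z. P z \<le> R} z"
  have "(\<integral>\<^sup>+z. ennreal (P z powr - (?N - 1)) * indicator {z. P z \<le> R} z \<partial>lborel)
    < \<infinity>"
    using R by (intro nn_integral_kernel_finite[OF polar_norm_like]) auto
  also have "(\<integral>\<^sup>+z. ennreal (P z powr - (?N - 1)) * indicator {z. P z \<le> R} z
    \<partial>lborel) = (\<integral>\<^sup>+z. ennreal (?k z) \<partial>lborel)"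
    by (intro nn_integral_cong) (auto simp: indicator_def)
  finally obtain M0 where M0: "(\<integral>\<^sup>+z. ennreal (?k z) \<partial>lborel) = ennreal M0" "0 \<le> M0"
    by (cases "\<integral>\<^sup>+z. ennreal (?k z) \<partial>lborel") auto
  define M where "M = M0 + 1"
  have M: "(\<integral>\<^sup>+z. ennreal (?k z) \<partial>lborel) \<le> ennreal M" "0 < M" using M0 by (auto
    simp: M_def ennreal_leI)
  define K where "K = ?N * unit_vol P"
  have K: "0 < K" using unit_vol_pos[OF polar_norm_like] by (simp add: K_def)
  define D where "D = M ^ CARD('n) / K ^ CARD('n) + 1 / c0 ^ CARD('n)"
  have D: "0 < D" unfolding D_def using M K c0 by (intro add_pos_pos) auto
  have "W1p_norm \<Omega> ?N \<phi> \<le> D powr (1 / ?N) * aniso_energy F \<Omega> \<phi> powr (1 / ?N)" if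
    t: "\<phi> \<in> test_functions \<Omega>" for \<phi>
  proof -
    let ?e = "aniso_energy F \<Omega> \<phi>"
    note r = sobolev_rep_test[OF \<Omega>(1) t]
    have [measurable]: "gradient \<phi> \<in> borel_measurable borel" "\<phi> \<in> borel_measurable borel"
      using r by (auto simp: sobolev_rep_def)
    have z: "\<phi> x = 0" "gradient \<phi> x = 0" if "x \<notin> \<Omega>" for x using r that by (auto simp:
      sobolev_rep_def)
    have e0: "0 \<le> ?e" unfolding energy_test(1)[OF \<Omega>(1) t] using F_nonneg by simp
    let ?f = "\<lambda>y. F (gradient \<phi> y)"
    have pt: "ennreal (K ^ CARD('n) * \<bar>\<phi> x\<bar> ^ CARD('n)) \<le> ennreal (M ^ (CARD('n) - 1)) *
      ((\<integral>\<^sup>+y. ennreal (?f y ^ CARD('n)) * ennreal (?k (x - y)) \<partial>lborel) * indicator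
      \<Omega> x)" for x
    proof (cases "x \<in> \<Omega>")
      case True
      have "ennreal (K * \<bar>\<phi> x\<bar>) \<le> (\<integral>\<^sup>+y. ennreal (?f y * P (x - y) powr -
        (?N - 1)) \<partial>lborel)"
        unfolding K_def by (rule potential_test[OF t])
      also have "\<dots> = (\<integral>\<^sup>+y. ennreal (?f y * ?k (x - y)) \<partial>lborel)"
      proof (rule nn_integral_cong)
        fix y
        show "ennreal (?f y * P (x - y) powr - (?N - 1)) = ennreal (?f y * ?k (x - y))"
          using R(2) True z(2)[of y] by (cases "y \<in> \<Omega>") (auto simp: norm_like_0[OF F_norm_like])
      qed
      finally have "ennreal (K * \<bar>\<phi> x\<bar>) ^ CARD('n) \<le> (\<integral>\<^sup>+y. ennreal (?f y
        * ?k (x - y)) \<partial>lborel) ^ CARD('n)"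
        by (rule power_mono) simp
      also have "\<dots> \<le> ennreal (M ^ (CARD('n) - 1)) * (\<integral>\<^sup>+y. ennreal (?f y ^
        CARD('n)) * ennreal (?k (x - y)) \<partial>lborel)"
        using F_nonneg M by (intro riesz_power_bound) auto
      finally show ?thesis using True K by (simp add: ennreal_power power_mult_distrib)
    qed (simp add: z zero_power)
    have "(\<integral>\<^sup>+x. ennreal (K ^ CARD('n) * \<bar>\<phi> x\<bar> ^ CARD('n)) \<partial>lborel)
      \<le> (\<integral>\<^sup>+x. ennreal (M ^ (CARD('n) - 1)) * ((\<integral>\<^sup>+y. ennreal (?f y ^
      CARD('n)) * ennreal (?k (x - y)) \<partial>lborel) * indicator \<Omega> x) \<partial>lborel)"
      by (rule nn_integral_mono[OF pt])
    also have "\<dots> = ennreal (M ^ (CARD('n) - 1)) * (\<integral>\<^sup>+x. (\<integral>\<^sup>+y. ennreal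
      (?f y ^ CARD('n)) * ennreal (?k (x - y)) \<partial>lborel) * indicator \<Omega> x \<partial>lborel)"
      by (rule nn_integral_cmult) measurable
    also have "\<dots> \<le> ennreal (M ^ (CARD('n) - 1)) * (ennreal M * ennreal ?e)"
    proof (rule mult_left_mono)
      have "(\<integral>\<^sup>+x. (\<integral>\<^sup>+y. ennreal (?f y ^ CARD('n)) * ennreal (?k (x - y))
        \<partial>lborel) * indicator \<Omega> x \<partial>lborel)
        \<le> (\<integral>\<^sup>+z. ennreal (?k z) * indicator {z. P z \<le> R} z \<partial>lborel) *
          (\<integral>\<^sup>+y. ennreal (?f y ^ CARD('n)) \<partial>lborel)"
        using z R by (intro convolution_bound) (auto simp: zero_power norm_like_0[OF F_norm_like])
      also have "(\<integral>\<^sup>+y. ennreal (?f y ^ CARD('n)) \<partial>lborel) = ennreal ?e" by (rule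
        energy_test(2)[OF \<Omega>(1) t])
      also have "(\<integral>\<^sup>+z. ennreal (?k z) * indicator {z. P z \<le> R} z \<partial>lborel) *
        ennreal ?e \<le> ennreal M * ennreal ?e"
      proof (rule mult_right_mono)
        have "(\<integral>\<^sup>+z. ennreal (?k z) * indicator {z. P z \<le> R} z \<partial>lborel) \<le>
          (\<integral>\<^sup>+z. ennreal (?k z) \<partial>lborel)"
          by (intro nn_integral_mono) (auto simp: indicator_def)
        then show "(\<integral>\<^sup>+z. ennreal (?k z) * indicator {z. P z \<le> R} z \<partial>lborel)
          \<le> ennreal M" using M(1) by (rule order_trans)
      qed simp
      finally show "(\<integral>\<^sup>+x. (\<integral>\<^sup>+y. ennreal (?f y ^ CARD('n)) * ennreal (?k (x
        - y)) \<partial>lborel) * indicator \<Omega> x \<partial>lborel) \<le> ennreal M * ennreal ?e" .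
    qed simp
    also have "\<dots> = ennreal (M ^ CARD('n) * ?e)"
    proof -
      have "M ^ CARD('n) = M ^ (CARD('n) - 1) * M" by (rule power_minus_mult[symmetric]) simp
      then show ?thesis using M e0 by (simp add: ennreal_mult[symmetric] mult.assoc)
    qed
    also have "(\<integral>\<^sup>+x. ennreal (K ^ CARD('n) * \<bar>\<phi> x\<bar> ^ CARD('n))
      \<partial>lborel) = ennreal (K ^ CARD('n) * (LINT x|lborel. \<bar>\<phi> x\<bar> ^ CARD('n)))"
      using r K by (subst nn_integral_eq_integral) (auto simp: sobolev_rep_def)
    finally have "K ^ CARD('n) * (LINT x|lborel. \<bar>\<phi> x\<bar> ^ CARD('n)) \<le> M ^ CARD('n) * ?e"
      using M e0 by (subst (asm) ennreal_le_iff) auto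
    then have u: "(LINT x|lborel. \<bar>\<phi> x\<bar> ^ CARD('n)) \<le> M ^ CARD('n) / K ^ CARD('n) * ?e"
      using K by (simp add: field_simps)
    have "c0 ^ CARD('n) * (LINT x|lborel. norm (gradient \<phi> x) ^ CARD('n)) = (LINT x|lborel. c0 ^
      CARD('n) * norm (gradient \<phi> x) ^ CARD('n))"
      by simp
    also have "\<dots> \<le> ?e"
      unfolding energy_test(1)[OF \<Omega>(1) t]
    proof (rule integral_mono)
      show "integrable lborel (\<lambda>x. c0 ^ CARD('n) * norm (gradient \<phi> x) ^ CARD('n))" using r by
        (auto simp: sobolev_rep_def)
      show "integrable lborel (\<lambda>x. ?f x ^ CARD('n))" by (rule energy_test(3)[OF \<Omega>(1) t])
      show "c0 ^ CARD('n) * norm (gradient \<phi> x) ^ CARD('n) \<le> ?f x ^ CARD('n)" for x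
        using c0 by (auto simp: power_mult_distrib[symmetric] intro!: power_mono)
    qed
    finally have g: "(LINT x|lborel. norm (gradient \<phi> x) ^ CARD('n)) \<le> 1 / c0 ^ CARD('n) * ?e"
      using c0 by (simp add: field_simps)
    have "W1p_norm \<Omega> ?N \<phi> \<le> (D * ?e) powr (1 / ?N)"
      unfolding W1p_norm_rep[OF \<Omega>(1) r] using u g by (intro powr_mono2) (auto simp: D_def distrib_right)
    also have "\<dots> = D powr (1 / ?N) * ?e powr (1 / ?N)" using D e0 by (simp add: powr_mult)
    finally show ?thesis .
  qed
  then show ?thesis using D by (intro exI[of _ "D powr (1 / ?N)"]) auto
qed

text \<open>Weak convergence to 0 is checked without reflexivity: if \<open>l (v n)\<close> stayed away from 0 along a
  subsequence, signed sums of \<open>m\<close> terms would have norm \<open>O(m\<^bsup>1/N\<^esup>)\<close>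
    but \<open>l\<close> would grow like \<open>m\<close>.\<close>

lemma disjoint_gradients_weakly_null:
  assumes \<Omega>: "open \<Omega>" "bounded (\<Omega> :: (real^'n) set)" and t: "\<And>n::nat. v n \<in>
    test_functions \<Omega>"
    and en: "\<And>n. aniso_energy F \<Omega> (v n) \<le> 1"
    and d: "\<And>m n x. m \<noteq> n \<Longrightarrow> gradient (v m) x = 0 \<or> gradient (v n) x = 0"
    and l: "l \<in> W01p_dual \<Omega> (real CARD('n))"
  shows "(\<lambda>n. l (v n)) \<longlonglongrightarrow> 0"
proof (rule ccontr)
  let ?N = "real CARD('n)"
  assume "\<not> (\<lambda>n. l (v n)) \<longlonglongrightarrow> 0"
  then obtain e where e: "0 < e" "\<not> (\<forall>\<^sub>F n in sequentially. dist (l (v n)) 0 < e)"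
    by (auto simp: tendsto_iff)
  define S where "S = {n. e \<le> \<bar>l (v n)\<bar>}"
  have inf: "infinite S"
    unfolding S_def infinite_nat_iff_unbounded_le using e(2) by (auto simp: eventually_sequentially not_less)
  have ladd: "l (\<lambda>x. u x + w x) = l u + l w" if "u \<in> W01p \<Omega> ?N" "w \<in> W01p \<Omega> ?N" for u w
    using l that by (auto simp: W01p_dual_def)
  have lscale: "l (\<lambda>x. c * u x) = c * l u" if "u \<in> W01p \<Omega> ?N" for c u
    using l that by (auto simp: W01p_dual_def)
  from l have "\<exists>B. \<forall>u\<in>W01p \<Omega> ?N. \<bar>l u\<bar> \<le> B * W1p_norm \<Omega> ?N u"
    by (auto simp: W01p_dual_def)
  then obtain B where B: "\<forall>u\<in>W01p \<Omega> ?N. \<bar>l u\<bar> \<le> B * W1p_norm \<Omega> ?N u" by blast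
  obtain C where C: "0 < C" "\<forall>\<phi>\<in>test_functions \<Omega>. W1p_norm \<Omega> ?N \<phi> \<le> C
    * aniso_energy F \<Omega> \<phi> powr (1 / ?N)"
    using poincare_test[OF \<Omega>] by blast
  \<comment> \<open>The last clause, disjointness from all terms outside \<open>T\<close>, is
    carried along because it keeps the energy additive in the induction step.\<close>
  have sums: "\<exists>f. f \<in> test_functions \<Omega> \<and> aniso_energy F \<Omega> f \<le> real (card
    T) \<and> l f = (\<Sum>n\<in>T. \<bar>l (v n)\<bar>) \<and>
    (\<forall>m. m \<notin> T \<longrightarrow> (\<forall>x. gradient f x = 0 \<or> gradient (v m) x = 0))"
      if "finite T" for T
    using that
  proof (induction T rule: finite_induct)
    case empty
    have "l (\<lambda>x. 0) = 0" using lscale[OF test_in_W01p[OF \<Omega>(1) zero_test], of 0] by simp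
    moreover have "aniso_energy F \<Omega> (\<lambda>x. 0) = 0"
      using energy_scale(3)[OF \<Omega>(1) zero_test, of 0] by (simp add: zero_power)
    ultimately show ?case using zero_test by (intro exI[of _ "\<lambda>x. 0"]) (simp add: gradient_zero)
  next
    case (insert k T)
    then obtain f where f: "f \<in> test_functions \<Omega>" "aniso_energy F \<Omega> f \<le> real (card T)"
      "l f = (\<Sum>n\<in>T. \<bar>l (v n)\<bar>)"
      "\<forall>m. m \<notin> T \<longrightarrow> (\<forall>x. gradient f x = 0 \<or> gradient (v m) x = 0)" by blast
    \<comment> \<open>The sign aligns the contributions, so that \<open>l\<close> adds up absolute
      values.\<close>
    let ?c = "sgn (l (v k))"
    let ?f = "\<lambda>x. f x + ?c * v k x"
    have ft: "?f \<in> test_functions \<Omega>" by (rule test_function_scale_add[OF f(1) t])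
    have "aniso_energy F \<Omega> ?f = aniso_energy F \<Omega> f + \<bar>?c\<bar> ^ CARD('n) * aniso_energy F
      \<Omega> (v k)"
      using f(4) insert.hyps by (intro energy_disjoint[OF \<Omega>(1) f(1) t]) auto
    also have "\<dots> \<le> real (card T) + 1 * 1"
    proof (intro add_mono mult_mono f(2) en)
      show "\<bar>?c\<bar> ^ CARD('n) \<le> 1" by (intro power_le_one) (auto simp: sgn_if)
      show "0 \<le> aniso_energy F \<Omega> (v k)" unfolding energy_test(1)[OF \<Omega>(1) t] using F_nonneg by simp
    qed auto
    finally have "aniso_energy F \<Omega> ?f \<le> real (card (insert k T))" using insert.hyps by simp
    moreover have "l ?f = (\<Sum>n\<in>insert k T. \<bar>l (v n)\<bar>)"
    proof -
      have "l ?f = l f + ?c * l (v k)"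
        using ladd[OF test_in_W01p[OF \<Omega>(1) f(1)] test_in_W01p[OF \<Omega>(1) energy_scale(1)[OF
          \<Omega>(1) t[of k], of ?c]]]
          lscale[OF test_in_W01p[OF \<Omega>(1) t[of k]], of ?c] by simp
      then show ?thesis using insert.hyps f(3) by (simp add: abs_sgn mult.commute)
    qed
    moreover have "\<forall>m. m \<notin> insert k T \<longrightarrow> (\<forall>x. gradient ?f x = 0 \<or>
      gradient (v m) x = 0)"
    proof (intro allI impI)
      fix m x assume m: "m \<notin> insert k T"
      then have "gradient f x = 0 \<or> gradient (v m) x = 0" "gradient (v k) x = 0 \<or> gradient (v m) x = 0"
        using f(4) d[of k m x] by auto
      then show "gradient ?f x = 0 \<or> gradient (v m) x = 0"
        unfolding test_function_scale_add(2)[OF f(1) t] by auto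
    qed
    ultimately show ?case using ft by blast
  qed
  define K where "K = \<bar>B\<bar> * C"
  \<comment> \<open>Any exponent below 1 gives a contradiction; \<open>1 / 2\<close> dominates
    \<open>1 / N\<close> for all \<open>N \<ge> 2\<close> and suits square values of
    \<open>m\<close>.\<close>
  have bound: "real m * e \<le> K * real m powr (1 / 2)" if m: "1 \<le> m" for m :: nat
  proof -
    obtain T where T: "T \<subseteq> S" "finite T" "card T = m"
      using infinite_arbitrarily_large[OF inf] by blast
    obtain f where f: "f \<in> test_functions \<Omega>" "aniso_energy F \<Omega> f \<le> real (card T)" "l f
      = (\<Sum>n\<in>T. \<bar>l (v n)\<bar>)"
      using sums[OF T(2)] by blast
    have e0: "0 \<le> aniso_energy F \<Omega> f" unfolding energy_test(1)[OF \<Omega>(1) f(1)] using F_nonneg by simp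
    have "real m * e = (\<Sum>n\<in>T. e)" using T by simp
    also have "\<dots> \<le> l f" unfolding f(3) using T(1) by (intro sum_mono) (auto simp: S_def)
    also have "\<dots> \<le> B * W1p_norm \<Omega> ?N f"
      using B test_in_W01p[OF \<Omega>(1) f(1)] by (meson abs_le_D1)
    also have "\<dots> \<le> \<bar>B\<bar> * (C * aniso_energy F \<Omega> f powr (1 / ?N))"
      using C(2) f(1) by (intro mult_mono) (auto simp: W1p_norm_def)
    also have "\<dots> \<le> \<bar>B\<bar> * (C * real m powr (1 / 2))"
    proof -
      have "aniso_energy F \<Omega> f powr (1 / ?N) \<le> real m powr (1 / ?N)"
        using f(2) T(3) e0 by (intro powr_mono2) auto
      also have "\<dots> \<le> real m powr (1 / 2)" using m N2 by (intro powr_mono) (auto simp: field_simps)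
      finally show ?thesis using C(1) by (intro mult_left_mono) auto
    qed
    finally show ?thesis by (simp add: K_def)
  qed
  \<comment> \<open>With \<open>m\<close> the square of \<open>j\<close> the bound reads
    \<open>j * e \<le> K\<close>, which fails for this \<open>j\<close>.\<close>
  obtain j :: nat where j: "K / e < real j" using reals_Archimedean2 by blast
  have K0: "0 \<le> K" using C(1) by (simp add: K_def)
  then have j1: "1 \<le> j" using j e(1) by (cases j) (auto simp: divide_less_0_iff not_less[symmetric])
  have "real (j\<^sup>2) * e \<le> K * real (j\<^sup>2) powr (1 / 2)" using j1 by (intro bound) simp
  also have "real (j\<^sup>2) powr (1 / 2) = real j" by (simp add: powr_half_sqrt)
  finally have "real j * e \<le> K" using j1 by (simp add: power2_eq_square)
  then show False using j e(1) by (simp add: divide_less_eq)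
qed

text \<open>The bumps concentrate at \<open>x0\<close>. If \<open>x0 = 0\<close>, the weight
  supplies the factor \<open>r powr - \<beta>\<close> that matches \<open>1 - \<beta> / N\<close>;
  at another point \<open>\<beta> = 0\<close> makes both trivial. One sequence serves every
  \<open>p\<close> from the critical value on, since the integral grows with
  \<open>p\<close>.\<close>

lemma sharp_sequence:
  assumes \<Omega>: "open \<Omega>" "bounded (\<Omega> :: (real^'n) set)" and x0: "x0 \<in> \<Omega>" "x0 = 0
    \<or> \<beta> = 0"
    and \<theta>: "0 < \<theta>" "\<theta> < 1" and \<beta>: "0 \<le> \<beta>" "\<beta> < real CARD('n)"
  shows "\<exists>us u. admissible_sequence F \<Omega> us u \<and> aniso_energy F \<Omega> u = \<theta> \<and>
    (\<forall>p::real. p_crit F \<Omega> u \<le> ereal p \<longrightarrow> (SUP n. singular_TM_integral F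
      \<Omega> \<beta> p (us n)) = \<infinity>)"
proof -
  let ?N = "real CARD('n)"
  have N: "1 < ?N" using N2 by simp
  have [measurable]: "\<Omega> \<in> sets borel" using \<Omega> by simp
  obtain c0 where c0: "c0 > 0" "\<And>x. c0 * norm x \<le> P x" using norm_like_lower[OF polar_norm_like] by blast
  obtain \<delta> where \<delta>: "0 < \<delta>" "ball x0 \<delta> \<subseteq> \<Omega>" using \<Omega>(1)
    x0(1) by (meson openE)
  define R1 where "R1 = c0 * \<delta> / 2"
  have R1: "0 < R1" using c0 \<delta> by (simp add: R1_def)
  have sub: "{x. P (x - x0) \<le> R1} \<subseteq> \<Omega>"
  proof
    fix x assume "x \<in> {x. P (x - x0) \<le> R1}"
    then have "c0 * norm (x - x0) \<le> c0 * (\<delta> / 2)" using c0(2)[of "x - x0"] by (simp add: R1_def)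
    then have "norm (x - x0) \<le> \<delta> / 2" using c0(1) by simp
    then have "x \<in> ball x0 \<delta>" using \<delta>(1) by (simp add: dist_norm norm_minus_commute)
    then show "x \<in> \<Omega>" using \<delta>(2) by blast
  qed
  \<comment> \<open>On this inner ball \<open>u\<close> will be constant, so bumps whose gradients
    live there have gradients disjoint from that of \<open>u\<close>.\<close>
  define R0 where "R0 = R1 / 2"
  have R0: "0 < R0" "R0 < R1" using R1 by (auto simp: R0_def)
  obtain w0 where w0: "w0 \<in> test_functions \<Omega>" "\<forall>x. P (x - x0) \<le> R0 \<longrightarrow> w0 x = 1"
    "\<forall>x. P (x - x0) \<le> R0 \<or> R1 \<le> P (x - x0) \<longrightarrow> gradient w0 x = 0" "0 <
      aniso_energy F \<Omega> w0"
    using moser_test[OF \<Omega>(1) sub R0 order_refl zero_less_one] by blast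
  define A where "A = (\<theta> / aniso_energy F \<Omega> w0) powr (1 / ?N)"
  have A: "0 < A" using \<theta> w0(4) by (simp add: A_def)
  define u where "u x = A * w0 x" for x
  have ut: "u \<in> test_functions \<Omega>" unfolding u_def by (rule energy_scale(1)[OF \<Omega>(1) w0(1)])
  have ue: "aniso_energy F \<Omega> u = \<theta>"
    unfolding u_def energy_scale(3)[OF \<Omega>(1) w0(1)] using A \<theta> w0(4) by (simp add: A_def power_root)
  have uA: "u x = A" if "P (x - x0) \<le> R0" for x using w0(2) that by (simp add: u_def)
  have ug: "gradient u x = 0" if "P (x - x0) \<le> R0" for x
    unfolding u_def energy_scale(2)[OF \<Omega>(1) w0(1)] using w0(3) that by simp
  let ?pc = "(1 - \<theta>) powr (- 1 / (?N - 1))"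
  have sub0: "{x. P (x - x0) \<le> R0} \<subseteq> \<Omega>" using sub R0 by auto
  \<comment> \<open>The outcome of one concentration step as a predicate, so that radius, bump and
    height are chosen together and the radius can drive a recursion.\<close>
  define Q where "Q n R r v V \<longleftrightarrow> 0 < r \<and> r < R \<and> v \<in> test_functions \<Omega>
    \<and> (\<forall>x. P (x - x0) \<le> r \<longrightarrow> v x = V) \<and> 0 \<le> V \<and>
    (\<forall>x. P (x - x0) \<le> r \<or> R \<le> P (x - x0) \<longrightarrow> gradient v x = 0) \<and>
      aniso_energy F \<Omega> v = 1 - \<theta> \<and>
    real n \<le> exp (lambda_N F * (1 - \<beta> / ?N) * ?pc * (A + V) powr (?N / (?N - 1))) * unit_vol P * r
      powr (?N - \<beta>)"
    for n :: nat and R r :: real and v :: "real^'n \<Rightarrow> real" and V :: real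
  have step: "\<exists>z. Q n R (fst z) (fst (snd z)) (snd (snd z))" if "0 < R" "R \<le> R0" for n R
    using concentrating_step[OF \<Omega>(1) sub0 that A \<theta> \<beta>, of n] unfolding Q_def by (elim exE)
      (rule exI[of _ "(_, _, _)"], simp)
  define Z where "Z n R = (SOME z. Q n R (fst z) (fst (snd z)) (snd (snd z)))" for n R
  have Z: "Q n R (fst (Z n R)) (fst (snd (Z n R))) (snd (snd (Z n R)))" if "0 < R" "R \<le> R0" for n R
    unfolding Z_def by (rule someI_ex[OF step[OF that]])
  \<comment> \<open>The inner radius of each bump is the outer radius of the next one, which makes
    the annuli carrying the gradients disjoint.\<close>
  define Rs where "Rs = rec_nat R0 (\<lambda>n R. fst (Z n R))"
  have Rs_Suc: "Rs (Suc n) = fst (Z n (Rs n))" and Rs_0: "Rs 0 = R0" for n by (simp_all add: Rs_def)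
  have Rs: "0 < Rs n \<and> Rs n \<le> R0" for n
  proof (induction n)
    case 0 then show ?case using R0 by (simp add: Rs_0)
  next
    case (Suc n)
    then have "Q n (Rs n) (Rs (Suc n)) (fst (snd (Z n (Rs n)))) (snd (snd (Z n (Rs n))))" using Z[of "Rs n"
      n] by (simp add: Rs_Suc)
    then have "0 < Rs (Suc n)" "Rs (Suc n) < Rs n" unfolding Q_def by blast+
    then show ?case using Suc by linarith
  qed
  define v where "v n = fst (snd (Z n (Rs n)))" for n
  define V where "V n = snd (snd (Z n (Rs n)))" for n
  have Qn: "Q n (Rs n) (Rs (Suc n)) (v n) (V n)" for n
    using Z[of "Rs n" n] Rs[of n] by (simp add: Rs_Suc v_def V_def)
  have vt: "v n \<in> test_functions \<Omega>" and ve: "aniso_energy F \<Omega> (v n) = 1 - \<theta>" and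
    rdec: "Rs (Suc n) < Rs n"
    and vV: "P (x - x0) \<le> Rs (Suc n) \<Longrightarrow> v n x = V n" and V0: "0 \<le> V n"
    and vg: "P (x - x0) \<le> Rs (Suc n) \<or> Rs n \<le> P (x - x0) \<Longrightarrow> gradient (v n) x = 0"
    and big: "real n \<le> exp (lambda_N F * (1 - \<beta> / ?N) * ?pc * (A + V n) powr (?N / (?N - 1))) *
      unit_vol P * Rs (Suc n) powr (?N - \<beta>)"
    for n x using Qn[of n] unfolding Q_def by blast+
  have mono: "Rs m \<le> Rs n" if "n \<le> m" for n m
    using lift_Suc_antimono_le[of Rs n m] rdec that by (auto intro: less_imp_le)
  have disj: "gradient (v m) x = 0 \<or> gradient (v n) x = 0" if "m \<noteq> n" for m n x
  proof -
    have *: "gradient (v m) x = 0 \<or> gradient (v n) x = 0" if "m < n" for m n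
    proof -
      have "Rs n \<le> Rs (Suc m)" using that by (intro mono) simp
      then show ?thesis using vg[of x m] vg[of x n] by linarith
    qed
    show ?thesis using *[of m n] *[of n m] that by (cases "m < n") auto
  qed
  define us where "us n x = u x + 1 * v n x" for n x
  have ust: "us n \<in> test_functions \<Omega>" for n unfolding us_def by (rule test_function_scale_add[OF ut vt])
  have use: "aniso_energy F \<Omega> (us n) = 1" for n
  proof -
    have "gradient u x = 0 \<or> gradient (v n) x = 0" for x
      using ug[of x] vg[of x n] Rs[of n] by linarith
    then show ?thesis unfolding us_def using energy_disjoint[OF \<Omega>(1) ut vt, of n 1] by (simp add: ue ve)
  qed
  have wk: "weakly_converges_W01p \<Omega> ?N us u"
    unfolding weakly_converges_W01p_def
  proof (intro conjI allI ballI)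
    show "us n \<in> W01p \<Omega> ?N" for n by (rule test_in_W01p[OF \<Omega>(1) ust])
    show "u \<in> W01p \<Omega> ?N" by (rule test_in_W01p[OF \<Omega>(1) ut])
    fix l assume l: "l \<in> W01p_dual \<Omega> ?N"
    have "(\<lambda>n. l (v n)) \<longlonglongrightarrow> 0"
      using disj \<theta> ve by (intro disjoint_gradients_weakly_null[OF \<Omega> vt _ _ l]) auto
    then have "(\<lambda>n. l u + l (v n)) \<longlonglongrightarrow> l u + 0" by (intro tendsto_intros)
    moreover have "l (us n) = l u + l (v n)" for n
    proof -
      have "\<forall>u\<in>W01p \<Omega> ?N. \<forall>v\<in>W01p \<Omega> ?N. l (\<lambda>x. u x + v x) = l u
        + l v" using l by (simp add: W01p_dual_def)
      moreover have "us n = (\<lambda>x. u x + v n x)" by (simp add: us_def fun_eq_iff)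
      ultimately show ?thesis using test_in_W01p[OF \<Omega>(1) ut] test_in_W01p[OF \<Omega>(1) vt[of n]] by simp
    qed
    ultimately show "(\<lambda>n. l (us n)) \<longlonglongrightarrow> l u" by simp
  qed
  have nz: "\<not> (AE x in lebesgue_on \<Omega>. u x = 0)"
  proof
    assume "AE x in lebesgue_on \<Omega>. u x = 0"
    then have "AE x in lborel. x \<in> \<Omega> \<longrightarrow> u x = 0"
      using \<Omega>(1) by (simp add: AE_restrict_space_iff AE_completion_iff)
    then have "AE x in lborel. x \<notin> {x. P (x - x0) \<le> R0}"
      by eventually_elim (use uA A sub0 in auto)
    then have "emeasure lborel {x. P (x - x0) \<le> R0} = 0"
      by (subst (asm) AE_iff_null_sets[symmetric]) auto
    then show False
      using R0 unit_vol_pos[OF polar_norm_like] by (simp add: emeasure_polar_ball_at)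
  qed
  have adm: "admissible_sequence F \<Omega> us u"
    unfolding admissible_sequence_def using use wk nz by simp
  have pc: "p_crit F \<Omega> u = ereal ?pc" using \<theta> by (simp add: p_crit_def ue)
  have "(SUP n. singular_TM_integral F \<Omega> \<beta> p (us n)) = \<infinity>" if p: "p_crit F \<Omega> u
    \<le> ereal p" for p
  proof -
    have p: "?pc \<le> p" using p by (simp add: pc)
    have "ennreal (real n) \<le> singular_TM_integral F \<Omega> \<beta> p (us n)" for n
    proof -
      let ?r = "Rs (Suc n)"
      have r: "0 < ?r" "?r \<le> R0" using Rs by auto
      let ?E = "exp (lambda_N F * (1 - \<beta> / ?N) * ?pc * (A + V n) powr (?N / (?N - 1)))"
      have lam: "0 \<le> lambda_N F * (1 - \<beta> / ?N)"
        unfolding lambda_eq using N \<beta> by (intro mult_nonneg_nonneg) auto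
      have "ennreal (real n) \<le> ennreal (?E * unit_vol P * ?r powr (?N - \<beta>))" by (intro ennreal_leI big)
      also have "\<dots> = ennreal (?E * ?r powr - \<beta>) * emeasure lborel {x. P (x - x0) \<le> ?r}"
      proof -
        have "?r powr (?N - \<beta>) = ?r ^ CARD('n) * ?r powr - \<beta>"
          using r by (simp add: powr_diff powr_minus powr_realpow divide_inverse)
        then show ?thesis
          using r unit_vol_pos[OF polar_norm_like] by (simp add: emeasure_polar_ball_at
            ennreal_mult[symmetric] mult_ac)
      qed
      also have "\<dots> = (\<integral>\<^sup>+x. ennreal (?E * ?r powr - \<beta>) * indicator {x. P (x - x0)
        \<le> ?r} x \<partial>lborel)"
        by (rule nn_integral_cmult_indicator[symmetric]) measurable
      also have "\<dots> \<le> (\<integral>\<^sup>+x. ennreal (exp (lambda_N F * (1 - \<beta> / ?N) * p *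
        \<bar>us n x\<bar> powr (?N / (?N - 1))) / P x powr \<beta>) * indicator \<Omega> x \<partial>lborel)"
      proof (rule nn_integral_mono_AE)
        show "AE x in lborel. ennreal (?E * ?r powr - \<beta>) * indicator {x. P (x - x0) \<le> ?r} x \<le>
          ennreal (exp (lambda_N F * (1 - \<beta> / ?N) * p * \<bar>us n x\<bar> powr (?N / (?N - 1))) / P x
          powr \<beta>) * indicator \<Omega> x"
          using AE_lborel_singleton[of 0]
        proof eventually_elim
          case (elim x)
          show ?case
          proof (cases "P (x - x0) \<le> ?r")
            case True
            then have x: "x \<in> \<Omega>" using sub0 r by auto
            have Px: "0 < P x" using elim by (rule norm_like_pos[OF polar_norm_like])
            have "us n x = A + V n" using uA[of x] vV[OF True] True r by (simp add: us_def)
            then have usx: "\<bar>us n x\<bar> = A + V n" using A V0[of n] by simp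
            \<comment> \<open>For \<open>x0 = 0\<close> the ball of concentration is
              \<open>P x \<le> r\<close>; for \<open>\<beta> = 0\<close> both powers are 1.\<close>
            have "?r powr - \<beta> \<le> P x powr - \<beta>"
              using x0(2)
            proof
              assume "x0 = 0"
              then show ?thesis using True Px \<beta> by (intro powr_mono2') auto
            next
              assume "\<beta> = 0" then show ?thesis using Px r by simp
            qed
            moreover have "?E \<le> exp (lambda_N F * (1 - \<beta> / ?N) * p * \<bar>us n x\<bar> powr (?N /
              (?N - 1)))"
              unfolding usx using p lam by (intro exp_le_cancel_iff[THEN iffD2] mult_right_mono mult_left_mono) auto
            ultimately have "?E * ?r powr - \<beta> \<le> exp (lambda_N F * (1 - \<beta> / ?N) * p * \<bar>us
              n x\<bar> powr (?N / (?N - 1))) * P x powr - \<beta>"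
              by (intro mult_mono) auto
            also have "\<dots> = exp (lambda_N F * (1 - \<beta> / ?N) * p * \<bar>us n x\<bar> powr (?N / (?N
              - 1))) / P x powr \<beta>"
              by (simp add: powr_minus divide_inverse)
            finally show ?thesis using True x by (simp add: ennreal_leI)
          qed simp
        qed
      qed
      also have "\<dots> = singular_TM_integral F \<Omega> \<beta> p (us n)"
        unfolding singular_TM_integral_def Let_def nn_integral_lebesgue_on_open[OF \<Omega>(1)] ..
      finally show ?thesis .
    qed
    then have "(SUP n. of_nat n :: ennreal) \<le> (SUP n. singular_TM_integral F \<Omega> \<beta> p (us n))"
      by (intro SUP_mono) (auto simp: ennreal_of_nat_eq_real_of_nat)
    then show ?thesis by (simp add: ennreal_SUP_of_nat_eq_top top_unique)
  qed
  then show ?thesis using adm ue by blast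
qed

end

theorem theorem1p2:
  fixes F :: "real^'n \<Rightarrow> real" and \<Omega> :: "(real^'n) set" and \<beta> :: real
  assumes "CARD('n) \<ge> 2"
    and "anisotropic_norm F"
    and "smooth_bounded_domain \<Omega>"
    and "0 \<le> \<beta>" and "\<beta> < real CARD('n)"
  shows "(\<forall>us u. \<forall>p::real. admissible_sequence F \<Omega> us u \<and> 0 < p \<and> ereal p <
    p_crit F \<Omega> u \<longrightarrow>
            (SUP n. singular_TM_integral F \<Omega> \<beta> p (us n)) < \<infinity>) \<and>
         (0 \<in> \<Omega> \<or> \<beta> = 0 \<longrightarrow>
            (\<forall>\<theta>. 0 < \<theta> \<and> \<theta> < 1 \<longrightarrow>
              (\<exists>us u. admissible_sequence F \<Omega> us u \<and> aniso_energy F \<Omega> u = \<theta> \<and>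
                 (\<forall>p::real. p_crit F \<Omega> u \<le> ereal p \<longrightarrow>
                    (SUP n. singular_TM_integral F \<Omega> \<beta> p (us n)) = \<infinity>))))"
proof (rule conjI)
  interpret anisotropic_ge2 F using assms(1,2) by unfold_locales
  have \<Omega>: "open \<Omega>" "bounded \<Omega>" "\<Omega> \<noteq> {}" using assms(3) by (auto simp:
    smooth_bounded_domain_def)
  show "\<forall>us u. \<forall>p::real. admissible_sequence F \<Omega> us u \<and> 0 < p \<and> ereal p <
    p_crit F \<Omega> u \<longrightarrow>
            (SUP n. singular_TM_integral F \<Omega> \<beta> p (us n)) < \<infinity>"
    using TM_sup_finite[OF \<Omega>(1,2) assms(4,5)] by blast
  show "0 \<in> \<Omega> \<or> \<beta> = 0 \<longrightarrow> (\<forall>\<theta>. 0 < \<theta> \<and> \<theta>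
    < 1 \<longrightarrow>
              (\<exists>us u. admissible_sequence F \<Omega> us u \<and> aniso_energy F \<Omega> u = \<theta> \<and>
                 (\<forall>p::real. p_crit F \<Omega> u \<le> ereal p \<longrightarrow>
                    (SUP n. singular_TM_integral F \<Omega> \<beta> p (us n)) = \<infinity>)))"
  proof (intro impI allI)
    fix \<theta> :: real assume "0 \<in> \<Omega> \<or> \<beta> = 0" and \<theta>: "0 < \<theta> \<and> \<theta> < 1"
    \<comment> \<open>When \<open>\<beta> = 0\<close> there is no weight to align with, and any
      point of the nonempty domain serves as centre.\<close>
    then obtain x0 where "x0 \<in> \<Omega>" "x0 = 0 \<or> \<beta> = 0" using \<Omega>(3) by blast
    then show "\<exists>us u. admissible_sequence F \<Omega> us u \<and> aniso_energy F \<Omega> u = \<theta> \<and>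
                 (\<forall>p::real. p_crit F \<Omega> u \<le> ereal p \<longrightarrow>
                    (SUP n. singular_TM_integral F \<Omega> \<beta> p (us n)) = \<infinity>)"
      using \<theta> assms(4,5) by (intro sharp_sequence[OF \<Omega>(1,2)]) auto
  qed
qed

end
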